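(* Let $R$ be an algebra over $\mathbb{C}$, $\mathcal{B}$ a right $\times_R$-Hopf algebra, $T$ a right $\mathcal{B}$-comodule algebra, $S=T^{\mathcal{B}}$ its subalgebra of coinvariants, $\mathcal{K}$ a left $\times_S$-Hopf algebra, and suppose that $T$ is a left $\mathcal{K}$-module algebra which is a $\mathcal{K}$-equivariant $\mathcal{B}$-Galois extension of $S$. Let $M$ be a right-left stable anti Yetter-Drinfeld (SAYD) module over $\mathcal{K}$, and let $\widetilde M:=M\otimes_{\mathcal{K}}T$ be the left-right SAYD module over $\mathcal{B}$ with action $b\triangleright(m\otimes_{\mathcal{K}}t)=m_{\langle 0\rangle}\otimes_{\mathcal{K}}b_{\langle +\rangle}\big(m_{\langle -1\rangle}\triangleright(t\,b_{\langle -\rangle})\big)$ and coaction $m\otimes_{\mathcal{K}}t\mapsto m\otimes_{\mathcal{K}}t_{\langle 0\rangle}\otimes_R t_{\langle 1\rangle}$. Then the maps $$\omega_n: M\otimes_{\mathcal{K}}T^{\otimes_S(n+1)}\to \mathcal{B}^{\otimes_R n}\otimes_{R^{op}}\widetilde M,$$ $$\omega_n(m\otimes_{\mathcal{K}}t_0\otimes_S\cdots\otimes_S t_n)= t_{1\langle 1\rangle}t_{2\langle 1\rangle}\cdots t_{n\langle 1\rangle}\otimes_R t_{2\langle 2\rangle}\cdots t_{n\langle 2\rangle}\otimes_R\cdots\otimes_R t_{n\langle n\rangle}\otimes_{R^{op}}\big(m\otimes_{\mathcal{K}}t_0t_{1\langle 0\rangle}\cdots t_{n\langle 0\rangle}\big),\qquad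 n\ge 0,$$ define an isomorphism of cyclic modules between $\,_{\mathcal{K}}C_*(T,M)$ and $\widetilde C_{\mathcal{B},*}(\mathcal{B},\widetilde M)$ (both defined in the context).
   Context: All algebras are unital associative over $\mathbb{C}$. Sweedler notation is used for coproducts ($\Delta(k)=k^{(1)}\otimes k^{(2)}$) and coactions ($m\mapsto m_{\langle -1\rangle}\otimes m_{\langle 0\rangle}$ or $m\mapsto m_{\langle 0\rangle}\otimes m_{\langle 1\rangle}$); iterated coactions are written $t_{\langle 0\rangle}\otimes t_{\langle 1\rangle}\otimes\cdots\otimes t_{\langle n\rangle}$ and $m_{\langle -n\rangle}\otimes\cdots\otimes m_{\langle -1\rangle}\otimes m_{\langle 0\rangle}$. **Left bialgebroids and left $\times_S$-Hopf algebras.** Let $S$ be an algebra. A left $S$-bialgebroid is an algebra $\mathcal{K}$ with algebra maps $\mathfrak{s}:S\to\mathcal{K}$, $\mathfrak{t}:S^{op}\to\mathcal{K}$ with commuting ranges, which is an $S$-coring $(\Delta,\varepsilon)$ for the bimodule structure $r_1kr_2=\mathfrak{s}(r_1)\mathfrak{t}(r_2)k$, such that $k^{(1)}\mathfrak{t}(r)\otimes_S k^{(2)}=k^{(1)}\otimes_S k^{(2)}\mathfrak{s}(r)$; $\Delta(1)=1\otimes_S1$, $\Delta(kk')=k^{(1)}k'^{(1)}\otimes_S k^{(2)}k'^{(2)}$; $\varepsilon(1)=1$, $\varepsilon(kk')=\varepsilon(k\,\mathfrak{s}(\varepsilon(k')))$. It is a left $\times_S$-Hopf algebra if $\nu:\mathcal{K}\otimes_{S^{op}}\mathcal{K}\to\mathcal{K}\otimes_S\mathcal{K}$,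 $k\otimes k'\mapsto k^{(1)}\otimes_S k^{(2)}k'$ is bijective (domain: $k\mathfrak{t}(r)\otimes k'=k\otimes\mathfrak{t}(r)k'$). Write $k^-\otimes_{S^{op}}k^+:=\nu^{-1}(k\otimes_S1)$. **Right bialgebroids and right $\times_R$-Hopf algebras.** A right $R$-bialgebroid is an algebra $\mathcal{B}$ with an algebra map $\mathfrak{s}:R\to\mathcal{B}$ and an anti-algebra map $\mathfrak{t}:R\to\mathcal{B}$ with commuting ranges, which is an $R$-coring for the bimodule structure $r b r'=b\,\mathfrak{s}(r')\mathfrak{t}(r)$, such that $b^{(1)}\otimes_R\mathfrak{t}(r)b^{(2)}=\mathfrak{s}(r)b^{(1)}\otimes_Rb^{(2)}$; $\Delta(1)=1\otimes_R1$, $\Delta(bb')=b^{(1)}b'^{(1)}\otimes_Rb^{(2)}b'^{(2)}$; $\varepsilon(1)=1$, $\varepsilon(bb')=\varepsilon(\mathfrak{s}(\varepsilon(b))b')$. It is a right $\times_R$-Hopf algebra if $\nu:\mathcal{B}\otimes_{R^{op}}\mathcal{B}\to\mathcal{B}\otimes_R\mathcal{B}$, $b\otimes b'\mapsto bb'^{(1)}\otimes_Rb'^{(2)}$ is bijective (domain: $b\mathfrak{t}(r)\otimes b'=b\otimes\mathfrak{t}(r)b'$). Write $b^-\otimes_{R^{op}}b^+:=\nu^{-1}(1\otimes_Rb)$. **Comodules.** A left $\mathcal{K}$-comodule is a left $S$-module $M$ with a left $S$-linear coassociative counital coaction $M\to\mathcal{K}\otimes_SM$; it has a canonical right $S$-action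 $mr=\varepsilon(m_{\langle -1\rangle}\mathfrak{s}(r))m_{\langle 0\rangle}$. A right $\mathcal{B}$-comodule is a right $R$-module $M$ with a right $R$-linear coassociative counital coaction $M\to M\otimes_R\mathcal{B}$; it has a canonical left $R$-action $rm=m_{\langle 0\rangle}\varepsilon(\mathfrak{s}(r)m_{\langle 1\rangle})$. **SAYD modules.** A right-left SAYD module over $\mathcal{K}$ is a right $\mathcal{K}$-module and left $\mathcal{K}$-comodule $M$ such that (i) $mr=m\triangleleft\mathfrak{s}(r)$ and $rm=m\triangleleft\mathfrak{t}(r)$, where the left sides are the comodule $S$-actions; (ii) $(m\triangleleft k)_{\langle -1\rangle}\otimes_S(m\triangleleft k)_{\langle 0\rangle}={k^{(2)}}^+m_{\langle -1\rangle}k^{(1)}\otimes_Sm_{\langle 0\rangle}\triangleleft{k^{(2)}}^-$; (iii) $m_{\langle 0\rangle}\triangleleft m_{\langle -1\rangle}=m$. A left-right SAYD module over $\mathcal{B}$ is a left $\mathcal{B}$-module and right $\mathcal{B}$-comodule $M$ such that (i) $mr=\mathfrak{t}(r)\triangleright m$ and $rm=\mathfrak{s}(r)\triangleright m$, where the left sides are the comodule $R$-actions; (ii) $(b\triangleright m)_{\langle 0\rangle}\otimes_R(b\triangleright m)_{\langle 1\rangle}={b^{(1)}}^+\triangleright m_{\langle 0\rangle}\otimes_Rb^{(2)}m_{\langle 1\rangle}{b^{(1)}}^-$; (iii) $m_{\langle 1\rangle}\triangleright m_{\langle 0\rangle}=m$. **Module algebras.** A left $\mathcal{K}$-module algebra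 is an algebra $T$ that is a left $\mathcal{K}$-module with $k\triangleright1=\mathfrak{s}(\varepsilon(k))\triangleright1$, $k\triangleright(tt')=(k^{(1)}\triangleright t)(k^{(2)}\triangleright t')$, $(\mathfrak{t}(r)\triangleright t)t'=t(\mathfrak{s}(r)\triangleright t')$. It is an $S$-bimodule by $rt=\mathfrak{s}(r)\triangleright t$, $tr=\mathfrak{t}(r)\triangleright t$, and $T^{\otimes_S(n+1)}$ is a left $\mathcal{K}$-module by the diagonal action. **Comodule algebras.** A right $\mathcal{B}$-comodule algebra is an algebra $T$ that is an $R$-bimodule and a right $\mathcal{B}$-comodule with $(tr)t'=t(rt')$, $1\mapsto1\otimes_R1$, and $(tt')_{\langle 0\rangle}\otimes_R(tt')_{\langle 1\rangle}=t_{\langle 0\rangle}t'_{\langle 0\rangle}\otimes_Rt_{\langle 1\rangle}t'_{\langle 1\rangle}$. Its coinvariants are $T^{\mathcal{B}}=\{s\in T: s_{\langle 0\rangle}\otimes_Rs_{\langle 1\rangle}=s\otimes_R1\}$. **Equivariant Galois extension.** Let $T$ be a right $\mathcal{B}$-comodule algebra, $S=T^{\mathcal{B}}$, $\mathcal{K}$ a left $\times_S$-Hopf algebra, and $T$ a left $\mathcal{K}$-module algebra. $T$ is a $\mathcal{K}$-equivariant $\mathcal{B}$-Galois extension of $S$ if $can:T\otimes_ST\to T\otimes_R\mathcal{B}$, $t'\otimes_St\mapsto t't_{\langle 0\rangle}\otimes_Rt_{\langle 1\rangle}$ is bijective and the right coaction of $\mathcal{B}$ on $T$ is $\mathcal{K}$-equivariant,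 i.e. $(k\triangleright t)_{\langle 0\rangle}\otimes_R(k\triangleright t)_{\langle 1\rangle}=k\triangleright t_{\langle 0\rangle}\otimes_Rt_{\langle 1\rangle}$ for all $k\in\mathcal{K},t\in T$. Write $b_{\langle -\rangle}\otimes_Sb_{\langle +\rangle}:=can^{-1}(1\otimes_Rb)$. **Cyclic modules.** A cyclic module is a simplicial module $(C_n,\delta_i,\sigma_i)$ with maps $\tau=\tau_n:C_n\to C_n$ satisfying $\delta_i\tau=\tau\delta_{i-1}$ and $\sigma_i\tau=\tau\sigma_{i-1}$ ($1\le i\le n$), $\delta_0\tau=\delta_n$, $\sigma_0\tau=\tau^2\sigma_n$, $\tau^{n+1}=\mathrm{Id}$. An isomorphism of cyclic modules is a family of linear bijections commuting with all $\delta_i,\sigma_i,\tau$. **The cyclic module $\,_{\mathcal{K}}C_*(T,M)$:** $\,_{\mathcal{K}}C_n(T,M)=M\otimes_{\mathcal{K}}T^{\otimes_S(n+1)}$ with $\delta_i(m\otimes t_0\otimes\cdots\otimes t_n)=m\otimes t_0\otimes\cdots\otimes t_it_{i+1}\otimes\cdots\otimes t_n$ ($0\le i\le n-1$); $\delta_n(m\otimes t_0\otimes\cdots\otimes t_n)=m_{\langle 0\rangle}\otimes t_n(m_{\langle -n\rangle}\triangleright t_0)\otimes m_{\langle -n+1\rangle}\triangleright t_1\otimes\cdots\otimes m_{\langle -1\rangle}\triangleright t_{n-1}$; $\sigma_i(m\otimes t_0\otimes\cdots\otimes t_n)=m\otimes t_0\otimes\cdots\otimes t_i\otimes1\otimes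 t_{i+1}\otimes\cdots\otimes t_n$ ($0\le i\le n$); $\tau_n(m\otimes t_0\otimes\cdots\otimes t_n)=m_{\langle 0\rangle}\otimes t_n\otimes m_{\langle -n\rangle}\triangleright t_0\otimes\cdots\otimes m_{\langle -1\rangle}\triangleright t_{n-1}$. **The cyclic module $\widetilde C_{\mathcal{B},*}(\mathcal{B},N)$** for a left-right SAYD module $N$ over $\mathcal{B}$: $\widetilde C_{\mathcal{B},n}(\mathcal{B},N)=\mathcal{B}^{\otimes_Rn}\otimes_{R^{op}}N$, where $\mathcal{B}^{\otimes_Rn}$ is a right $\mathcal{B}$-module by the diagonal action $\triangleleft$, $R^{op}$ acts on it on the right through $\mathfrak{t}$ (so $(b_1\otimes\cdots\otimes b_n)\cdot r=b_1\mathfrak{t}(r)\otimes b_2\otimes\cdots\otimes b_n$) and on $N$ by $\mathfrak{t}(r)\triangleright$; for $n=0$, $\mathcal{B}^{\otimes_R0}=R$ with $r\triangleleft b=\varepsilon(\mathfrak{s}(r)b)$, so $\widetilde C_{\mathcal{B},0}(\mathcal{B},N)\cong N$ via $r\otimes x\mapsto\mathfrak{t}(r)\triangleright x$, and $\tau_0=\mathrm{Id}$. For $x\in N$: $\delta_i(b_1\otimes\cdots\otimes b_n\otimes x)=b_1\otimes\cdots\otimes\varepsilon(b_{i+1})\otimes\cdots\otimes b_n\otimes x$ ($0\le i\le n-1$); $\delta_n(b_1\otimes\cdots\otimes b_n\otimes x)=(b_1\otimes\cdots\otimes b_{n-1})\triangleleft b_n^-\otimes b_n^+\triangleright x$; $\sigma_i(b_1\otimes\cdots\otimes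 b_n\otimes x)=b_1\otimes\cdots\otimes\Delta(b_{i+1})\otimes\cdots\otimes b_n\otimes x$ ($0\le i\le n-1$); $\sigma_n(b_1\otimes\cdots\otimes b_n\otimes x)=b_1\otimes\cdots\otimes b_n\otimes1\otimes x$; $\tau_n(b_1\otimes\cdots\otimes b_n\otimes x)=(x_{\langle 1\rangle}\otimes b_1\otimes\cdots\otimes b_{n-1})\triangleleft b_n^-\otimes b_n^+\triangleright x_{\langle 0\rangle}$. *)

theory Defs
  imports Complex_Main "HOL-Library.Poly_Mapping"
begin

section \<open>Complex vector spaces and algebras\<close>

class complex_vector = ab_group_add +
  fixes scaleC :: "complex \<Rightarrow> 'a \<Rightarrow> 'a"  (infixr "*\<^sub>C" 75)
  assumes scaleC_add_right: "c *\<^sub>C (x + y) = c *\<^sub>C x + c *\<^sub>C y"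
    and scaleC_add_left: "(c + d) *\<^sub>C x = c *\<^sub>C x + d *\<^sub>C x"
    and scaleC_scaleC: "c *\<^sub>C (d *\<^sub>C x) = (c * d) *\<^sub>C x"
    and scaleC_one: "1 *\<^sub>C x = x"

global_interpretation complex_vector: vector_space "scaleC :: complex \<Rightarrow> 'v \<Rightarrow> 'v::complex_vector"
  by unfold_locales (simp_all add: scaleC_add_right scaleC_add_left scaleC_scaleC scaleC_one)

text \<open>Unital associative algebras. The class \<open>ring_1\<close> is avoided since it excludes the zero algebra.\<close>

class complex_algebra = complex_vector + ring + monoid_mult +
  assumes mult_scaleC_left: "(c *\<^sub>C x) * y = c *\<^sub>C (x * y)"
    and mult_scaleC_right: "x * (c *\<^sub>C y) = c *\<^sub>C (x * y)"

instantiation poly_mapping :: (type, complex_vector) complex_vector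
begin

definition scaleC_poly_mapping :: "complex \<Rightarrow> ('a \<Rightarrow>\<^sub>0 'b) \<Rightarrow> 'a \<Rightarrow>\<^sub>0 'b"
  where "scaleC_poly_mapping c X = Poly_Mapping.map (scaleC c) X"

instance
proof
  have *: "Poly_Mapping.lookup (c *\<^sub>C X) a = c *\<^sub>C Poly_Mapping.lookup X a"
    for c and X :: "'a \<Rightarrow>\<^sub>0 'b" and a
    by (simp add: scaleC_poly_mapping_def map.rep_eq when_def)
  fix c d :: complex and X Y :: "'a \<Rightarrow>\<^sub>0 'b"
  show "c *\<^sub>C (X + Y) = c *\<^sub>C X + c *\<^sub>C Y"
    by (rule poly_mapping_eqI) (simp add: * lookup_add scaleC_add_right)
  show "(c + d) *\<^sub>C X = c *\<^sub>C X + d *\<^sub>C X"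
    by (rule poly_mapping_eqI) (simp add: * lookup_add scaleC_add_left)
  show "c *\<^sub>C (d *\<^sub>C X) = (c * d) *\<^sub>C X"
    by (rule poly_mapping_eqI) (simp add: * scaleC_scaleC)
  show "1 *\<^sub>C X = X"
    by (rule poly_mapping_eqI) (simp add: * scaleC_one)
qed

end

instantiation complex :: complex_algebra
begin

definition scaleC_complex :: "complex \<Rightarrow> complex \<Rightarrow> complex"
  where "scaleC_complex c x = c * x"

instance
  by standard (simp_all add: scaleC_complex_def algebra_simps)

end

definition subalgebra :: "'a::complex_algebra set \<Rightarrow> bool"
  where "subalgebra A \<longleftrightarrow> complex_vector.subspace A \<and> 1 \<in> A \<and> (\<forall>x\<in>A. \<forall>y\<in>A. x * y \<in> A)"


section \<open>Quotient spaces\<close>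

text \<open>
  Every vector space that is not a type is presented as a quotient \<open>'v / Z\<close> of a type by a
  subspace \<open>Z\<close>. A linear map between such quotients is given by a function on representatives
  that is linear modulo the target subspace and maps the source subspace into the target subspace.
\<close>

abbreviation eq_mod :: "'v::complex_vector \<Rightarrow> 'v set \<Rightarrow> 'v \<Rightarrow> bool"  ("(_ \<simeq>\<^bsub>_\<^esub> _)" [51, 0, 51] 50)
  where "x \<simeq>\<^bsub>Z\<^esub> y \<equiv> x - y \<in> Z"

definition qlinear :: "'v::complex_vector set \<Rightarrow> 'w::complex_vector set \<Rightarrow> ('v \<Rightarrow> 'w) \<Rightarrow> bool"
  where "qlinear Z Z' f \<longleftrightarrow>
    (\<forall>x y. f (x + y) \<simeq>\<^bsub>Z'\<^esub> f x + f y) \<and> (\<forall>c x. f (c *\<^sub>C x) \<simeq>\<^bsub>Z'\<^esub> c *\<^sub>C f x) \<and> (\<forall>x\<in>Z. f x \<in> Z')"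

definition quot :: "'v::complex_vector set \<Rightarrow> 'v set set"
  where "quot Z = UNIV // {(x, y). x \<simeq>\<^bsub>Z\<^esub> y}"

definition quot_map :: "'w::complex_vector set \<Rightarrow> ('v \<Rightarrow> 'w) \<Rightarrow> 'v set \<Rightarrow> 'w set"
  where "quot_map Z' f X = (\<Union>x\<in>X. {y. y \<simeq>\<^bsub>Z'\<^esub> f x})"

definition qbij :: "'v::complex_vector set \<Rightarrow> 'w::complex_vector set \<Rightarrow> ('v \<Rightarrow> 'w) \<Rightarrow> bool"
  where "qbij Z Z' f \<longleftrightarrow> bij_betw (quot_map Z' f) (quot Z) (quot Z')"


section \<open>Formal sums and tensor products\<close>

type_synonym 'a free = "'a \<Rightarrow>\<^sub>0 complex"

abbreviation gen :: "'a \<Rightarrow> 'a free"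
  where "gen a \<equiv> Poly_Mapping.single a 1"

abbreviation tens :: "'x \<Rightarrow> 'y \<Rightarrow> ('x \<times> 'y) free"  (infixr "\<otimes>" 70)
  where "x \<otimes> y \<equiv> gen (x, y)"

text \<open>
  \<open>lsum X f\<close> is the linear extension of \<open>f\<close> evaluated at the formal sum \<open>X\<close>. This is how Sweedler
  notation is read: if \<open>D k\<close> is a formal sum representing the coproduct of \<open>k\<close>, then
  \<open>lsum (D k) (\<lambda>(k1, k2). f k1 k2)\<close> is what is usually written \<open>f k\<^sup>(\<^sup>1\<^sup>) k\<^sup>(\<^sup>2\<^sup>)\<close>.
\<close>

definition lsum :: "'a free \<Rightarrow> ('a \<Rightarrow> 'v::complex_vector) \<Rightarrow> 'v"
  where "lsum X f = (\<Sum>a\<in>Poly_Mapping.keys X. Poly_Mapping.lookup X a *\<^sub>C f a)"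

text \<open>
  For \<open>X = 'x / Zx\<close> with a right action \<open>ra\<close> and \<open>Y = 'y / Zy\<close> with a left action \<open>la\<close> of the
  algebra \<open>A\<close>, the tensor product of \<open>X\<close> and \<open>Y\<close> over \<open>A\<close> is the free vector space on
  \<open>'x \<times> 'y\<close> modulo \<open>tensor_null A ra la Zx Zy\<close>.
\<close>

definition tensor_null ::
    "'a set \<Rightarrow> ('x::complex_vector \<Rightarrow> 'a \<Rightarrow> 'x) \<Rightarrow> ('a \<Rightarrow> 'y::complex_vector \<Rightarrow> 'y) \<Rightarrow>
     'x set \<Rightarrow> 'y set \<Rightarrow> ('x \<times> 'y) free set"
  where "tensor_null A ra la Zx Zy = complex_vector.span
    ({(x + x') \<otimes> y - x \<otimes> y - x' \<otimes> y | x x' y. True} \<union>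
     {x \<otimes> (y + y') - x \<otimes> y - x \<otimes> y' | x y y'. True} \<union>
     {(c *\<^sub>C x) \<otimes> y - c *\<^sub>C (x \<otimes> y) | c x y. True} \<union>
     {x \<otimes> (c *\<^sub>C y) - c *\<^sub>C (x \<otimes> y) | c x y. True} \<union>
     {x \<otimes> y | x y. x \<in> Zx \<or> y \<in> Zy} \<union>
     {ra x a \<otimes> y - x \<otimes> la a y | x a y. a \<in> A})"

text \<open>
  The \<open>n\<close>-fold tensor power (\<open>n \<ge> 1\<close>) of an \<open>A\<close>-bimodule \<open>'x\<close> is the free vector space on lists
  modulo \<open>tpow_null A ra la n\<close>. The generators are all lists; those of length other than \<open>n\<close> are
  set to zero, so that the space is again a quotient of a whole type.
\<close>

definition tpow_null ::
    "'a set \<Rightarrow> ('x::complex_vector \<Rightarrow> 'a \<Rightarrow> 'x) \<Rightarrow> ('a \<Rightarrow> 'x \<Rightarrow> 'x) \<Rightarrow> nat \<Rightarrow> 'x list free set"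
  where "tpow_null A ra la n = complex_vector.span
    ({gen xs | xs. length xs \<noteq> n} \<union>
     {gen (us @ (x + x') # vs) - gen (us @ x # vs) - gen (us @ x' # vs) | us x x' vs. True} \<union>
     {gen (us @ (c *\<^sub>C x) # vs) - c *\<^sub>C gen (us @ x # vs) | us c x vs. True} \<union>
     {gen (us @ ra x a # y # vs) - gen (us @ x # la a y # vs) | us x a y vs. a \<in> A})"


section \<open>Modules\<close>

text \<open>Modules over a subalgebra \<open>A\<close> on the space \<open>'v / Z\<close>.\<close>

definition left_module_on ::
    "'a::complex_algebra set \<Rightarrow> 'v::complex_vector set \<Rightarrow> ('a \<Rightarrow> 'v \<Rightarrow> 'v) \<Rightarrow> bool"
  where "left_module_on A Z act \<longleftrightarrow>
    complex_vector.subspace Z \<and>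
    (\<forall>a\<in>A. qlinear Z Z (act a)) \<and>
    (\<forall>a\<in>A. \<forall>b\<in>A. \<forall>v. act (a + b) v \<simeq>\<^bsub>Z\<^esub> act a v + act b v) \<and>
    (\<forall>c. \<forall>a\<in>A. \<forall>v. act (c *\<^sub>C a) v \<simeq>\<^bsub>Z\<^esub> c *\<^sub>C act a v) \<and>
    (\<forall>v. act 1 v \<simeq>\<^bsub>Z\<^esub> v) \<and>
    (\<forall>a\<in>A. \<forall>b\<in>A. \<forall>v. act (a * b) v \<simeq>\<^bsub>Z\<^esub> act a (act b v))"

definition right_module_on ::
    "'a::complex_algebra set \<Rightarrow> 'v::complex_vector set \<Rightarrow> ('v \<Rightarrow> 'a \<Rightarrow> 'v) \<Rightarrow> bool"
  where "right_module_on A Z act \<longleftrightarrow>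
    complex_vector.subspace Z \<and>
    (\<forall>a\<in>A. qlinear Z Z (\<lambda>v. act v a)) \<and>
    (\<forall>a\<in>A. \<forall>b\<in>A. \<forall>v. act v (a + b) \<simeq>\<^bsub>Z\<^esub> act v a + act v b) \<and>
    (\<forall>c. \<forall>a\<in>A. \<forall>v. act v (c *\<^sub>C a) \<simeq>\<^bsub>Z\<^esub> c *\<^sub>C act v a) \<and>
    (\<forall>v. act v 1 \<simeq>\<^bsub>Z\<^esub> v) \<and>
    (\<forall>a\<in>A. \<forall>b\<in>A. \<forall>v. act v (a * b) \<simeq>\<^bsub>Z\<^esub> act (act v a) b)"


section \<open>Bialgebroids and Hopf algebras over a base algebra\<close>

text \<open>
  The base algebra is a subalgebra of a type, since coinvariants form only a subset of the
  comodule algebra. The values of \<open>comul\<close>, and of all coactions below, are formal sums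
  representing elements of a tensor product; the axioms are stated modulo its null space.
\<close>

record ('s, 'k) bialgebroid =
  base :: "'s set"
  src :: "'s \<Rightarrow> 'k"
  tgt :: "'s \<Rightarrow> 'k"
  comul :: "'k \<Rightarrow> ('k \<times> 'k) free"
  counit :: "'k \<Rightarrow> 's"

text \<open>Iterated coproduct: \<open>n + 1\<close> tensor factors.\<close>

primrec comul_iter :: "('s, 'k) bialgebroid \<Rightarrow> nat \<Rightarrow> 'k \<Rightarrow> 'k list free"
  where
    "comul_iter K 0 k = gen [k]"
  | "comul_iter K (Suc n) k =
      lsum (comul K k) (\<lambda>(k1, k2). lsum (comul_iter K n k2) (\<lambda>ks. gen (k1 # ks)))"

definition alg_map_on :: "'s::complex_algebra set \<Rightarrow> ('s \<Rightarrow> 'k::complex_algebra) \<Rightarrow> bool"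
  where "alg_map_on S f \<longleftrightarrow>
    f 1 = 1 \<and> (\<forall>c. \<forall>r\<in>S. f (c *\<^sub>C r) = c *\<^sub>C f r) \<and>
    (\<forall>r\<in>S. \<forall>r'\<in>S. f (r + r') = f r + f r' \<and> f (r * r') = f r * f r')"

definition anti_alg_map_on :: "'s::complex_algebra set \<Rightarrow> ('s \<Rightarrow> 'k::complex_algebra) \<Rightarrow> bool"
  where "anti_alg_map_on S f \<longleftrightarrow>
    f 1 = 1 \<and> (\<forall>c. \<forall>r\<in>S. f (c *\<^sub>C r) = c *\<^sub>C f r) \<and>
    (\<forall>r\<in>S. \<forall>r'\<in>S. f (r + r') = f r + f r' \<and> f (r * r') = f r' * f r)"

subsection \<open>The left case\<close>

text \<open>
  \<open>lcotensor_null K la Z\<close> presents the tensor product over the base of a left bialgebroid, as right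
  module via \<open>k \<cdot> r = tgt r * k\<close>, with a left module \<open>'v / Z\<close>.
\<close>

definition lcotensor_null ::
    "('s, 'k::complex_algebra) bialgebroid \<Rightarrow> ('s \<Rightarrow> 'v::complex_vector \<Rightarrow> 'v) \<Rightarrow> 'v set \<Rightarrow>
     ('k \<times> 'v) free set"
  where "lcotensor_null K la Z = tensor_null (base K) (\<lambda>k r. tgt K r * k) la {0} Z"

abbreviation lbb_null :: "('s, 'k::complex_algebra) bialgebroid \<Rightarrow> ('k \<times> 'k) free set"
  where "lbb_null K \<equiv> lcotensor_null K (\<lambda>r k. src K r * k) {0}"

definition src_left ::
    "('s, 'k::complex_algebra) bialgebroid \<Rightarrow> 's \<Rightarrow> ('k \<times> 'v) free \<Rightarrow> ('k \<times> 'v) free"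
  where "src_left K r X = lsum X (\<lambda>(k, v). (src K r * k) \<otimes> v)"

definition left_bialgebroid ::
    "('s::complex_algebra, 'k::complex_algebra) bialgebroid \<Rightarrow> bool"
  where "left_bialgebroid K \<longleftrightarrow>
    subalgebra (base K) \<and>
    alg_map_on (base K) (src K) \<and> anti_alg_map_on (base K) (tgt K) \<and>
    (\<forall>r\<in>base K. \<forall>r'\<in>base K. src K r * tgt K r' = tgt K r' * src K r) \<and>
    qlinear {0} (lbb_null K) (comul K) \<and>
    (\<forall>r\<in>base K. \<forall>r'\<in>base K. \<forall>k. comul K (src K r * tgt K r' * k) \<simeq>\<^bsub>lbb_null K\<^esub>
       lsum (comul K k) (\<lambda>(k1, k2). (src K r * k1) \<otimes> (tgt K r' * k2))) \<and>
    qlinear {0} {0} (counit K) \<and> (\<forall>k. counit K k \<in> base K) \<and>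
    (\<forall>r\<in>base K. \<forall>r'\<in>base K. \<forall>k. counit K (src K r * tgt K r' * k) = r * counit K k * r') \<and>
    (\<forall>k. lsum (comul K k) (\<lambda>(k1, k2). lsum (comul K k1) (\<lambda>(k11, k12). k11 \<otimes> (k12 \<otimes> k2)))
       \<simeq>\<^bsub>lcotensor_null K (src_left K) (lbb_null K)\<^esub> lsum (comul K k) (\<lambda>(k1, k2). k1 \<otimes> comul K k2)) \<and>
    (\<forall>k. lsum (comul K k) (\<lambda>(k1, k2). src K (counit K k1) * k2) = k) \<and>
    (\<forall>k. lsum (comul K k) (\<lambda>(k1, k2). tgt K (counit K k2) * k1) = k) \<and>
    (\<forall>k. \<forall>r\<in>base K. lsum (comul K k) (\<lambda>(k1, k2). (k1 * tgt K r) \<otimes> k2)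
       \<simeq>\<^bsub>lbb_null K\<^esub> lsum (comul K k) (\<lambda>(k1, k2). k1 \<otimes> (k2 * src K r))) \<and>
    comul K 1 \<simeq>\<^bsub>lbb_null K\<^esub> 1 \<otimes> 1 \<and>
    (\<forall>k k'. comul K (k * k') \<simeq>\<^bsub>lbb_null K\<^esub>
       lsum (comul K k) (\<lambda>(k1, k2). lsum (comul K k') (\<lambda>(k1', k2'). (k1 * k1') \<otimes> (k2 * k2')))) \<and>
    counit K 1 = 1 \<and>
    (\<forall>k k'. counit K (k * k') = counit K (k * src K (counit K k')))"

text \<open>Both \<open>left_hopf\<close> and \<open>right_hopf\<close> have the Galois map defined on the tensor product over the
  opposite base, with \<open>(k * tgt r) \<otimes> k' = k \<otimes> (tgt r * k')\<close>.\<close>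

definition op_null :: "('s, 'k::complex_algebra) bialgebroid \<Rightarrow> ('k \<times> 'k) free set"
  where "op_null K = tensor_null (base K) (\<lambda>k r. k * tgt K r) (\<lambda>r k. tgt K r * k) {0} {0}"

definition nu_left :: "('s, 'k::complex_algebra) bialgebroid \<Rightarrow> ('k \<times> 'k) free \<Rightarrow> ('k \<times> 'k) free"
  where "nu_left K X = lsum X (\<lambda>(k, k'). lsum (comul K k) (\<lambda>(k1, k2). k1 \<otimes> (k2 * k')))"

definition left_hopf :: "('s::complex_algebra, 'k::complex_algebra) bialgebroid \<Rightarrow> bool"
  where "left_hopf K \<longleftrightarrow> left_bialgebroid K \<and> qbij (op_null K) (lbb_null K) (nu_left K)"

text \<open>A representative of \<open>k\<^sup>- \<otimes> k\<^sup>+\<close>.\<close>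

definition transl_left :: "('s, 'k::complex_algebra) bialgebroid \<Rightarrow> 'k \<Rightarrow> ('k \<times> 'k) free"
  where "transl_left K k = (SOME X. nu_left K X \<simeq>\<^bsub>lbb_null K\<^esub> k \<otimes> 1)"

subsection \<open>The right case\<close>

text \<open>
  \<open>rcotensor_null B ra Z\<close> presents the tensor product over the base of a right module \<open>'v / Z\<close> with
  a right bialgebroid, as left module via \<open>r \<cdot> b = b * tgt r\<close>.
\<close>

definition rcotensor_null ::
    "('r, 'b::complex_algebra) bialgebroid \<Rightarrow> ('v::complex_vector \<Rightarrow> 'r \<Rightarrow> 'v) \<Rightarrow> 'v set \<Rightarrow>
     ('v \<times> 'b) free set"
  where "rcotensor_null B ra Z = tensor_null (base B) ra (\<lambda>r b. b * tgt B r) Z {0}"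

abbreviation rbb_null :: "('r, 'b::complex_algebra) bialgebroid \<Rightarrow> ('b \<times> 'b) free set"
  where "rbb_null B \<equiv> rcotensor_null B (\<lambda>b r. b * src B r) {0}"

definition src_right ::
    "('r, 'b::complex_algebra) bialgebroid \<Rightarrow> ('v \<times> 'b) free \<Rightarrow> 'r \<Rightarrow> ('v \<times> 'b) free"
  where "src_right B X r = lsum X (\<lambda>(v, b). v \<otimes> (b * src B r))"

text \<open>The base of a right bialgebroid is always taken to be a whole type.\<close>

definition right_bialgebroid ::
    "('r::complex_algebra, 'b::complex_algebra) bialgebroid \<Rightarrow> bool"
  where "right_bialgebroid B \<longleftrightarrow>
    base B = UNIV \<and>
    alg_map_on UNIV (src B) \<and> anti_alg_map_on UNIV (tgt B) \<and>
    (\<forall>r r'. src B r * tgt B r' = tgt B r' * src B r) \<and>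
    qlinear {0} (rbb_null B) (comul B) \<and>
    (\<forall>r r' b. comul B (b * src B r' * tgt B r) \<simeq>\<^bsub>rbb_null B\<^esub>
       lsum (comul B b) (\<lambda>(b1, b2). (b1 * tgt B r) \<otimes> (b2 * src B r'))) \<and>
    qlinear {0} {0} (counit B) \<and>
    (\<forall>r r' b. counit B (b * src B r' * tgt B r) = r * counit B b * r') \<and>
    (\<forall>b. lsum (comul B b) (\<lambda>(b1, b2). comul B b1 \<otimes> b2)
       \<simeq>\<^bsub>rcotensor_null B (src_right B) (rbb_null B)\<^esub>
       lsum (comul B b) (\<lambda>(b1, b2). lsum (comul B b2) (\<lambda>(b21, b22). (b1 \<otimes> b21) \<otimes> b22))) \<and>
    (\<forall>b. lsum (comul B b) (\<lambda>(b1, b2). b2 * tgt B (counit B b1)) = b) \<and>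
    (\<forall>b. lsum (comul B b) (\<lambda>(b1, b2). b1 * src B (counit B b2)) = b) \<and>
    (\<forall>b r. lsum (comul B b) (\<lambda>(b1, b2). b1 \<otimes> (tgt B r * b2))
       \<simeq>\<^bsub>rbb_null B\<^esub> lsum (comul B b) (\<lambda>(b1, b2). (src B r * b1) \<otimes> b2)) \<and>
    comul B 1 \<simeq>\<^bsub>rbb_null B\<^esub> 1 \<otimes> 1 \<and>
    (\<forall>b b'. comul B (b * b') \<simeq>\<^bsub>rbb_null B\<^esub>
       lsum (comul B b) (\<lambda>(b1, b2). lsum (comul B b') (\<lambda>(b1', b2'). (b1 * b1') \<otimes> (b2 * b2')))) \<and>
    counit B 1 = 1 \<and>
    (\<forall>b b'. counit B (b * b') = counit B (src B (counit B b) * b'))"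

definition nu_right :: "('r, 'b::complex_algebra) bialgebroid \<Rightarrow> ('b \<times> 'b) free \<Rightarrow> ('b \<times> 'b) free"
  where "nu_right B X = lsum X (\<lambda>(b, b'). lsum (comul B b') (\<lambda>(b1', b2'). (b * b1') \<otimes> b2'))"

definition right_hopf :: "('r::complex_algebra, 'b::complex_algebra) bialgebroid \<Rightarrow> bool"
  where "right_hopf B \<longleftrightarrow> right_bialgebroid B \<and> qbij (op_null B) (rbb_null B) (nu_right B)"

text \<open>A representative of \<open>b\<^sup>- \<otimes> b\<^sup>+\<close>.\<close>

definition transl_right :: "('r, 'b::complex_algebra) bialgebroid \<Rightarrow> 'b \<Rightarrow> ('b \<times> 'b) free"
  where "transl_right B b = (SOME X. nu_right B X \<simeq>\<^bsub>rbb_null B\<^esub> 1 \<otimes> b)"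


section \<open>Comodules\<close>

definition left_comodule ::
    "('s::complex_algebra, 'k::complex_algebra) bialgebroid \<Rightarrow> ('s \<Rightarrow> 'm \<Rightarrow> 'm) \<Rightarrow>
     ('m::complex_vector \<Rightarrow> ('k \<times> 'm) free) \<Rightarrow> bool"
  where "left_comodule K lact coact \<longleftrightarrow>
    left_module_on (base K) {0} lact \<and>
    qlinear {0} (lcotensor_null K lact {0}) coact \<and>
    (\<forall>r\<in>base K. \<forall>m. coact (lact r m) \<simeq>\<^bsub>lcotensor_null K lact {0}\<^esub> src_left K r (coact m)) \<and>
    (\<forall>m. lsum (coact m) (\<lambda>(k, m0). lsum (comul K k) (\<lambda>(k1, k2). k1 \<otimes> (k2 \<otimes> m0)))
       \<simeq>\<^bsub>lcotensor_null K (src_left K) (lcotensor_null K lact {0})\<^esub>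
       lsum (coact m) (\<lambda>(k, m0). k \<otimes> coact m0)) \<and>
    (\<forall>m. lsum (coact m) (\<lambda>(k, m0). lact (counit K k) m0) = m)"

definition canonical_ract ::
    "('s, 'k::complex_algebra) bialgebroid \<Rightarrow> ('s \<Rightarrow> 'm \<Rightarrow> 'm) \<Rightarrow>
     ('m::complex_vector \<Rightarrow> ('k \<times> 'm) free) \<Rightarrow> 'm \<Rightarrow> 's \<Rightarrow> 'm"
  where "canonical_ract K lact coact m r = lsum (coact m) (\<lambda>(k, m0). lact (counit K (k * src K r)) m0)"

text \<open>Right comodules with underlying space \<open>'v / Z\<close>.\<close>

definition right_comodule ::
    "('r::complex_algebra, 'b::complex_algebra) bialgebroid \<Rightarrow> 'v::complex_vector set \<Rightarrow>
     ('v \<Rightarrow> 'r \<Rightarrow> 'v) \<Rightarrow> ('v \<Rightarrow> ('v \<times> 'b) free) \<Rightarrow> bool"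
  where "right_comodule B Z ract coact \<longleftrightarrow>
    right_module_on (base B) Z ract \<and>
    qlinear Z (rcotensor_null B ract Z) coact \<and>
    (\<forall>r\<in>base B. \<forall>v. coact (ract v r) \<simeq>\<^bsub>rcotensor_null B ract Z\<^esub> src_right B (coact v) r) \<and>
    (\<forall>v. lsum (coact v) (\<lambda>(v0, b). coact v0 \<otimes> b)
       \<simeq>\<^bsub>rcotensor_null B (src_right B) (rcotensor_null B ract Z)\<^esub>
       lsum (coact v) (\<lambda>(v0, b). lsum (comul B b) (\<lambda>(b1, b2). (v0 \<otimes> b1) \<otimes> b2))) \<and>
    (\<forall>v. lsum (coact v) (\<lambda>(v0, b). ract v0 (counit B b)) \<simeq>\<^bsub>Z\<^esub> v)"

definition canonical_lact ::
    "('r, 'b::complex_algebra) bialgebroid \<Rightarrow> ('v \<Rightarrow> 'r \<Rightarrow> 'v) \<Rightarrow>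
     ('v::complex_vector \<Rightarrow> ('v \<times> 'b) free) \<Rightarrow> 'r \<Rightarrow> 'v \<Rightarrow> 'v"
  where "canonical_lact B ract coact r v = lsum (coact v) (\<lambda>(v0, b). ract v0 (counit B (src B r * b)))"

text \<open>\<open>m \<mapsto> m\<^sub>\<langle>\<^sub>-\<^sub>n\<^sub>\<rangle> \<otimes> \<dots> \<otimes> m\<^sub>\<langle>\<^sub>-\<^sub>1\<^sub>\<rangle> \<otimes> m\<^sub>\<langle>\<^sub>0\<^sub>\<rangle>\<close> and
  \<open>t \<mapsto> t\<^sub>\<langle>\<^sub>0\<^sub>\<rangle> \<otimes> t\<^sub>\<langle>\<^sub>1\<^sub>\<rangle> \<otimes> \<dots> \<otimes> t\<^sub>\<langle>\<^sub>n\<^sub>\<rangle>\<close>, the coacting factors collected in a list.\<close>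

primrec lcoact_iter :: "('m \<Rightarrow> ('k \<times> 'm) free) \<Rightarrow> nat \<Rightarrow> 'm \<Rightarrow> ('k list \<times> 'm) free"
  where
    "lcoact_iter coact 0 m = [] \<otimes> m"
  | "lcoact_iter coact (Suc n) m =
      lsum (coact m) (\<lambda>(k, m'). lsum (lcoact_iter coact n m') (\<lambda>(ks, m0). (k # ks) \<otimes> m0))"

primrec rcoact_iter :: "('t \<Rightarrow> ('t \<times> 'b) free) \<Rightarrow> nat \<Rightarrow> 't \<Rightarrow> ('t \<times> 'b list) free"
  where
    "rcoact_iter coact 0 t = t \<otimes> []"
  | "rcoact_iter coact (Suc n) t =
      lsum (coact t) (\<lambda>(t', b). lsum (rcoact_iter coact n t') (\<lambda>(t0, bs). t0 \<otimes> (bs @ [b])))"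


section \<open>Stable anti Yetter-Drinfeld modules\<close>

definition right_left_SAYD ::
    "('s::complex_algebra, 'k::complex_algebra) bialgebroid \<Rightarrow> ('m \<Rightarrow> 'k \<Rightarrow> 'm) \<Rightarrow>
     ('s \<Rightarrow> 'm \<Rightarrow> 'm) \<Rightarrow> ('m::complex_vector \<Rightarrow> ('k \<times> 'm) free) \<Rightarrow> bool"
  where "right_left_SAYD K act lact coact \<longleftrightarrow>
    right_module_on UNIV {0} act \<and>
    left_comodule K lact coact \<and>
    (\<forall>m. \<forall>r\<in>base K. canonical_ract K lact coact m r = act m (src K r)) \<and>
    (\<forall>m. \<forall>r\<in>base K. lact r m = act m (tgt K r)) \<and>
    (\<forall>m k. coact (act m k) \<simeq>\<^bsub>lcotensor_null K lact {0}\<^esub>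
       lsum (comul K k) (\<lambda>(k1, k2). lsum (transl_left K k2) (\<lambda>(k2m, k2p).
         lsum (coact m) (\<lambda>(a, m0). (k2p * a * k1) \<otimes> act m0 k2m)))) \<and>
    (\<forall>m. lsum (coact m) (\<lambda>(a, m0). act m0 a) = m)"

definition left_right_SAYD ::
    "('r::complex_algebra, 'b::complex_algebra) bialgebroid \<Rightarrow> 'v::complex_vector set \<Rightarrow>
     ('b \<Rightarrow> 'v \<Rightarrow> 'v) \<Rightarrow> ('v \<Rightarrow> 'r \<Rightarrow> 'v) \<Rightarrow> ('v \<Rightarrow> ('v \<times> 'b) free) \<Rightarrow> bool"
  where "left_right_SAYD B Z act ract coact \<longleftrightarrow>
    left_module_on UNIV Z act \<and>
    right_comodule B Z ract coact \<and>
    (\<forall>v. \<forall>r\<in>base B. ract v r \<simeq>\<^bsub>Z\<^esub> act (tgt B r) v) \<and>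
    (\<forall>v. \<forall>r\<in>base B. canonical_lact B ract coact r v \<simeq>\<^bsub>Z\<^esub> act (src B r) v) \<and>
    (\<forall>b v. coact (act b v) \<simeq>\<^bsub>rcotensor_null B ract Z\<^esub>
       lsum (comul B b) (\<lambda>(b1, b2). lsum (transl_right B b1) (\<lambda>(b1m, b1p).
         lsum (coact v) (\<lambda>(v0, a). act b1p v0 \<otimes> (b2 * a * b1m))))) \<and>
    (\<forall>v. lsum (coact v) (\<lambda>(v0, a). act a v0) \<simeq>\<^bsub>Z\<^esub> v)"


section \<open>Module algebras, comodule algebras and Galois extensions\<close>

definition left_module_algebra ::
    "('s::complex_algebra, 'k::complex_algebra) bialgebroid \<Rightarrow> ('k \<Rightarrow> 't::complex_algebra \<Rightarrow> 't) \<Rightarrow> bool"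
  where "left_module_algebra K act \<longleftrightarrow>
    left_module_on UNIV {0} act \<and>
    (\<forall>k. act k 1 = act (src K (counit K k)) 1) \<and>
    (\<forall>k t t'. act k (t * t') = lsum (comul K k) (\<lambda>(k1, k2). act k1 t * act k2 t')) \<and>
    (\<forall>r\<in>base K. \<forall>t t'. act (tgt K r) t * t' = t * act (src K r) t')"

text \<open>The left action of the base on a comodule algebra is the canonical one of the comodule.\<close>

definition right_comodule_algebra ::
    "('r::complex_algebra, 'b::complex_algebra) bialgebroid \<Rightarrow> ('t \<Rightarrow> 'r \<Rightarrow> 't) \<Rightarrow>
     ('t::complex_algebra \<Rightarrow> ('t \<times> 'b) free) \<Rightarrow> bool"
  where "right_comodule_algebra B ract coact \<longleftrightarrow>
    right_comodule B {0} ract coact \<and>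
    (\<forall>r\<in>base B. \<forall>t t'. ract t r * t' = t * canonical_lact B ract coact r t') \<and>
    coact 1 \<simeq>\<^bsub>rcotensor_null B ract {0}\<^esub> 1 \<otimes> 1 \<and>
    (\<forall>t t'. coact (t * t') \<simeq>\<^bsub>rcotensor_null B ract {0}\<^esub>
       lsum (coact t) (\<lambda>(t0, b). lsum (coact t') (\<lambda>(t0', b'). (t0 * t0') \<otimes> (b * b'))))"

definition coinvariants ::
    "('r, 'b::complex_algebra) bialgebroid \<Rightarrow> ('t \<Rightarrow> 'r \<Rightarrow> 't) \<Rightarrow>
     ('t::complex_algebra \<Rightarrow> ('t \<times> 'b) free) \<Rightarrow> 't set"
  where "coinvariants B ract coact = {t. coact t \<simeq>\<^bsub>rcotensor_null B ract {0}\<^esub> t \<otimes> 1}"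

text \<open>The null space of the \<open>n\<close>-fold tensor power of a module algebra over the base of \<open>K\<close>.\<close>

definition modalg_tpow_null ::
    "('s, 'k) bialgebroid \<Rightarrow> ('k \<Rightarrow> 't::complex_vector \<Rightarrow> 't) \<Rightarrow> nat \<Rightarrow> 't list free set"
  where "modalg_tpow_null K act n = tpow_null (base K) (\<lambda>t r. act (tgt K r) t) (\<lambda>r. act (src K r)) n"

definition diag_left ::
    "('s, 'k) bialgebroid \<Rightarrow> ('k \<Rightarrow> 't \<Rightarrow> 't) \<Rightarrow> 'k \<Rightarrow> 't list free \<Rightarrow> 't list free"
  where "diag_left K act k X =
    lsum X (\<lambda>ts. lsum (comul_iter K (length ts - 1) k) (\<lambda>ks. gen (map2 act ks ts)))"

text \<open>
  The domain of the canonical map is the tensor square over the base for the bimodule structure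
  that the \<open>K\<close>-action induces. When \<open>src r \<triangleright> t = r * t\<close> for coinvariant \<open>r\<close>, this
  is the structure given by multiplication in the algebra.
\<close>

definition can_dom_null ::
    "('s, 'k) bialgebroid \<Rightarrow> ('k \<Rightarrow> 't::complex_vector \<Rightarrow> 't) \<Rightarrow> ('t \<times> 't) free set"
  where "can_dom_null K act =
    tensor_null (base K) (\<lambda>t r. act (tgt K r) t) (\<lambda>r. act (src K r)) {0} {0}"

definition can :: "('t::complex_algebra \<Rightarrow> ('t \<times> 'b) free) \<Rightarrow> ('t \<times> 't) free \<Rightarrow> ('t \<times> 'b) free"
  where "can coact X = lsum X (\<lambda>(t', t). lsum (coact t) (\<lambda>(t0, b). (t' * t0) \<otimes> b))"

text \<open>
  In the equivariance condition the left factor is acted upon for every representative of the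
  coaction: part of the condition is that \<open>k \<triangleright> t\<^sub>\<langle>\<^sub>0\<^sub>\<rangle> \<otimes> t\<^sub>\<langle>\<^sub>1\<^sub>\<rangle>\<close> is a well defined element of the
  tensor product.
\<close>

definition equivariant_galois ::
    "('r, 'b::complex_algebra) bialgebroid \<Rightarrow> ('s, 'k) bialgebroid \<Rightarrow> ('t \<Rightarrow> 'r \<Rightarrow> 't) \<Rightarrow>
     ('t::complex_algebra \<Rightarrow> ('t \<times> 'b) free) \<Rightarrow> ('k \<Rightarrow> 't \<Rightarrow> 't) \<Rightarrow> bool"
  where "equivariant_galois B K ract coact act \<longleftrightarrow>
    qbij (can_dom_null K act) (rcotensor_null B ract {0}) (can coact) \<and>
    (\<forall>k t X. X \<simeq>\<^bsub>rcotensor_null B ract {0}\<^esub> coact t \<longrightarrow>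
       coact (act k t) \<simeq>\<^bsub>rcotensor_null B ract {0}\<^esub> lsum X (\<lambda>(t0, b). act k t0 \<otimes> b))"

text \<open>A representative of \<open>b\<^sub>\<langle>\<^sub>-\<^sub>\<rangle> \<otimes> b\<^sub>\<langle>\<^sub>+\<^sub>\<rangle>\<close>.\<close>

definition transl_can ::
    "('r, 'b::complex_algebra) bialgebroid \<Rightarrow> ('t \<Rightarrow> 'r \<Rightarrow> 't) \<Rightarrow>
     ('t::complex_algebra \<Rightarrow> ('t \<times> 'b) free) \<Rightarrow> 'b \<Rightarrow> ('t \<times> 't) free"
  where "transl_can B ract coact b = (SOME X. can coact X \<simeq>\<^bsub>rcotensor_null B ract {0}\<^esub> 1 \<otimes> b)"


section \<open>The module \<open>M \<otimes> T\<close> over \<open>K\<close>\<close>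

definition MT_null ::
    "('m::complex_vector \<Rightarrow> 'k \<Rightarrow> 'm) \<Rightarrow> ('k \<Rightarrow> 't::complex_vector \<Rightarrow> 't) \<Rightarrow> ('m \<times> 't) free set"
  where "MT_null actM actT = tensor_null UNIV actM actT {0} {0}"

definition MT_act ::
    "('r, 'b::complex_algebra) bialgebroid \<Rightarrow> ('t \<Rightarrow> 'r \<Rightarrow> 't) \<Rightarrow>
     ('t::complex_algebra \<Rightarrow> ('t \<times> 'b) free) \<Rightarrow> ('k \<Rightarrow> 't \<Rightarrow> 't) \<Rightarrow> ('m \<Rightarrow> ('k \<times> 'm) free) \<Rightarrow>
     'b \<Rightarrow> ('m \<times> 't) free \<Rightarrow> ('m \<times> 't) free"
  where "MT_act B ractT coactT actT coactM b x =
    lsum x (\<lambda>(m, t). lsum (transl_can B ractT coactT b) (\<lambda>(bm, bp).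
      lsum (coactM m) (\<lambda>(k, m0). m0 \<otimes> (bp * actT k (t * bm)))))"

definition MT_ract :: "('t \<Rightarrow> 'r \<Rightarrow> 't) \<Rightarrow> ('m \<times> 't) free \<Rightarrow> 'r \<Rightarrow> ('m \<times> 't) free"
  where "MT_ract ractT x r = lsum x (\<lambda>(m, t). m \<otimes> ractT t r)"

definition MT_coact ::
    "('t \<Rightarrow> ('t \<times> 'b) free) \<Rightarrow> ('m \<times> 't) free \<Rightarrow> (('m \<times> 't) free \<times> 'b) free"
  where "MT_coact coactT x = lsum x (\<lambda>(m, t). lsum (coactT t) (\<lambda>(t0, b). (m \<otimes> t0) \<otimes> b))"


section \<open>Cyclic modules\<close>

text \<open>The module in degree \<open>n\<close> is \<open>'v / null n\<close>; \<open>face C n i\<close> and \<open>degen C n i\<close> start in degree \<open>n\<close>.\<close>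

record 'v cyclic_data =
  null :: "nat \<Rightarrow> 'v set"
  face :: "nat \<Rightarrow> nat \<Rightarrow> 'v \<Rightarrow> 'v"
  degen :: "nat \<Rightarrow> nat \<Rightarrow> 'v \<Rightarrow> 'v"
  cyc :: "nat \<Rightarrow> 'v \<Rightarrow> 'v"

definition cyclic_module :: "'v::complex_vector cyclic_data \<Rightarrow> bool"
  where "cyclic_module C \<longleftrightarrow>
    (\<forall>n. complex_vector.subspace (null C n)) \<and>
    (\<forall>n\<ge>1. \<forall>i\<le>n. qlinear (null C n) (null C (n - 1)) (face C n i)) \<and>
    (\<forall>n. \<forall>i\<le>n. qlinear (null C n) (null C (n + 1)) (degen C n i)) \<and>
    (\<forall>n. qlinear (null C n) (null C n) (cyc C n)) \<and>
    (\<forall>n\<ge>2. \<forall>i j x. i < j \<and> j \<le> n \<longrightarrow>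
      face C (n - 1) i (face C n j x) \<simeq>\<^bsub>null C (n - 2)\<^esub> face C (n - 1) (j - 1) (face C n i x)) \<and>
    (\<forall>n i j x. i \<le> j \<and> j \<le> n \<longrightarrow>
      degen C (n + 1) i (degen C n j x) \<simeq>\<^bsub>null C (n + 2)\<^esub> degen C (n + 1) (j + 1) (degen C n i x)) \<and>
    (\<forall>n i j x. i < j \<and> j \<le> n \<longrightarrow>
      face C (n + 1) i (degen C n j x) \<simeq>\<^bsub>null C n\<^esub> degen C (n - 1) (j - 1) (face C n i x)) \<and>
    (\<forall>n i j x. (i = j \<or> i = j + 1) \<and> j \<le> n \<longrightarrow>
      face C (n + 1) i (degen C n j x) \<simeq>\<^bsub>null C n\<^esub> x) \<and>
    (\<forall>n i j x. j + 1 < i \<and> i \<le> n + 1 \<longrightarrow>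
      face C (n + 1) i (degen C n j x) \<simeq>\<^bsub>null C n\<^esub> degen C (n - 1) j (face C n (i - 1) x)) \<and>
    (\<forall>n i x. 1 \<le> i \<and> i \<le> n \<longrightarrow>
      face C n i (cyc C n x) \<simeq>\<^bsub>null C (n - 1)\<^esub> cyc C (n - 1) (face C n (i - 1) x)) \<and>
    (\<forall>n i x. 1 \<le> i \<and> i \<le> n \<longrightarrow>
      degen C n i (cyc C n x) \<simeq>\<^bsub>null C (n + 1)\<^esub> cyc C (n + 1) (degen C n (i - 1) x)) \<and>
    (\<forall>n\<ge>1. \<forall>x. face C n 0 (cyc C n x) \<simeq>\<^bsub>null C (n - 1)\<^esub> face C n n x) \<and>
    (\<forall>n x. degen C n 0 (cyc C n x) \<simeq>\<^bsub>null C (n + 1)\<^esub> cyc C (n + 1) (cyc C (n + 1) (degen C n n x))) \<and>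
    (\<forall>n x. (cyc C n ^^ (n + 1)) x \<simeq>\<^bsub>null C n\<^esub> x)"

definition cyclic_iso ::
    "'v::complex_vector cyclic_data \<Rightarrow> 'w::complex_vector cyclic_data \<Rightarrow> (nat \<Rightarrow> 'v \<Rightarrow> 'w) \<Rightarrow> bool"
  where "cyclic_iso C D f \<longleftrightarrow>
    cyclic_module C \<and> cyclic_module D \<and>
    (\<forall>n. qlinear (null C n) (null D n) (f n) \<and> qbij (null C n) (null D n) (f n)) \<and>
    (\<forall>n\<ge>1. \<forall>i\<le>n. \<forall>x. f (n - 1) (face C n i x) \<simeq>\<^bsub>null D (n - 1)\<^esub> face D n i (f n x)) \<and>
    (\<forall>n. \<forall>i\<le>n. \<forall>x. f (n + 1) (degen C n i x) \<simeq>\<^bsub>null D (n + 1)\<^esub> degen D n i (f n x)) \<and>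
    (\<forall>n x. f n (cyc C n x) \<simeq>\<^bsub>null D n\<^esub> cyc D n (f n x))"


section \<open>The cyclic module of a module algebra\<close>

text \<open>
  Degree \<open>n\<close> is \<open>M \<otimes> X\<close> over \<open>K\<close>, with \<open>X\<close> the \<open>(n + 1)\<close>-fold tensor power of \<open>T\<close> over \<open>S\<close>.
  \<open>on_length\<close> discards the lists of other lengths, which represent zero.
\<close>

definition on_length :: "nat \<Rightarrow> 'a list free \<Rightarrow> ('a list \<Rightarrow> 'v::complex_vector) \<Rightarrow> 'v"
  where "on_length n X f = lsum X (\<lambda>xs. if length xs = n then f xs else 0)"

definition cyclic_T ::
    "('s, 'k) bialgebroid \<Rightarrow> ('m \<Rightarrow> 'k \<Rightarrow> 'm) \<Rightarrow> ('m::complex_vector \<Rightarrow> ('k \<times> 'm) free) \<Rightarrow>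
     ('k \<Rightarrow> 't::complex_algebra \<Rightarrow> 't) \<Rightarrow> ('m \<times> 't list free) free cyclic_data"
  where "cyclic_T K actM coactM actT = \<lparr>
    null = \<lambda>n. tensor_null UNIV actM (diag_left K actT) {0} (modalg_tpow_null K actT (n + 1)),
    face = \<lambda>n i z. lsum z (\<lambda>(m, X). on_length (n + 1) X (\<lambda>ts.
      if i < n then m \<otimes> gen (take i ts @ (ts ! i * ts ! (i + 1)) # drop (i + 2) ts)
      else lsum (lcoact_iter coactM n m) (\<lambda>(ks, m0).
        let us = map2 actT ks (butlast ts) in m0 \<otimes> gen ((last ts * hd us) # tl us)))),
    degen = \<lambda>n i z. lsum z (\<lambda>(m, X). on_length (n + 1) X (\<lambda>ts.
      m \<otimes> gen (take (i + 1) ts @ 1 # drop (i + 1) ts))),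
    cyc = \<lambda>n z. lsum z (\<lambda>(m, X). on_length (n + 1) X (\<lambda>ts.
      lsum (lcoact_iter coactM n m) (\<lambda>(ks, m0). m0 \<otimes> gen (last ts # map2 actT ks (butlast ts)))))\<rparr>"


section \<open>The cyclic module of a right Hopf algebra with coefficients\<close>

text \<open>
  Generators of the tensor powers of \<open>B\<close> over \<open>R\<close>: elements of \<open>R\<close> in degree \<open>0\<close>, and lists of
  length \<open>n\<close> in degree \<open>n \<ge> 1\<close>. \<open>Word []\<close> has no degree and represents zero.
\<close>

datatype ('r, 'b) bword = Scalar 'r | Word "'b list"

fun has_degree :: "nat \<Rightarrow> ('r, 'b) bword \<Rightarrow> bool"
  where
    "has_degree n (Scalar r) \<longleftrightarrow> n = 0"
  | "has_degree n (Word bs) \<longleftrightarrow> n \<ge> 1 \<and> length bs = n"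

definition bpow_null ::
    "('r::complex_algebra, 'b::complex_algebra) bialgebroid \<Rightarrow> nat \<Rightarrow> ('r, 'b) bword free set"
  where "bpow_null B n = complex_vector.span
    ({gen w | w. \<not> has_degree n w} \<union>
     {gen (Scalar (r + r')) - gen (Scalar r) - gen (Scalar r') | r r'. True} \<union>
     {gen (Scalar (c *\<^sub>C r)) - c *\<^sub>C gen (Scalar r) | c r. True} \<union>
     (\<lambda>X. lsum X (\<lambda>bs. gen (Word bs))) `
       tpow_null (base B) (\<lambda>b r. b * src B r) (\<lambda>r b. b * tgt B r) n)"

definition bword_op_act ::
    "('r::complex_algebra, 'b::complex_algebra) bialgebroid \<Rightarrow> ('r, 'b) bword free \<Rightarrow> 'r \<Rightarrow>
     ('r, 'b) bword free"
  where "bword_op_act B X r = lsum X (\<lambda>w. case w of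
      Scalar r' \<Rightarrow> gen (Scalar (r * r'))
    | Word bs \<Rightarrow> (if bs = [] then 0 else gen (Word ((hd bs * tgt B r) # tl bs))))"

definition diag_right ::
    "('r, 'b::complex_algebra) bialgebroid \<Rightarrow> ('r, 'b) bword \<Rightarrow> 'b \<Rightarrow> ('r, 'b) bword free"
  where "diag_right B w b = (case w of
      Scalar r \<Rightarrow> gen (Scalar (counit B (src B r * b)))
    | Word bs \<Rightarrow> lsum (comul_iter B (length bs - 1) b) (\<lambda>cs. gen (Word (map2 (*) bs cs))))"

text \<open>The word of a possibly empty list, the empty tensor product being \<open>1 \<in> R\<close>.\<close>

definition bword :: "'b list \<Rightarrow> ('r::complex_algebra, 'b) bword"
  where "bword bs = (if bs = [] then Scalar 1 else Word bs)"

text \<open>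
  \<open>b\<^sub>1 \<otimes> \<dots> \<otimes> \<epsilon>(b\<^sub>i\<^sub>+\<^sub>1) \<otimes> \<dots> \<otimes> b\<^sub>n\<close>: the scalar is moved into the right neighbour if there is one,
  otherwise into the left neighbour, and is itself the result if \<open>n = 1\<close>.
\<close>

definition counit_at ::
    "('r, 'b::complex_algebra) bialgebroid \<Rightarrow> nat \<Rightarrow> 'b list \<Rightarrow> ('r, 'b) bword"
  where "counit_at B i bs =
    (let r = counit B (bs ! i) in
     if length bs = 1 then Scalar r
     else if i + 1 < length bs then Word (take i bs @ (bs ! (i + 1) * tgt B r) # drop (i + 2) bs)
     else Word (take (i - 1) bs @ [bs ! (i - 1) * src B r]))"

text \<open>In \<open>degen\<close> for degree \<open>0\<close>, the element \<open>r \<otimes> 1\<close> of \<open>R \<otimes> B\<close> over \<open>R\<close> is \<open>tgt r\<close> in \<open>B\<close>.\<close>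

definition cyclic_B ::
    "('r::complex_algebra, 'b::complex_algebra) bialgebroid \<Rightarrow> 'v::complex_vector set \<Rightarrow>
     ('b \<Rightarrow> 'v \<Rightarrow> 'v) \<Rightarrow> ('v \<Rightarrow> ('v \<times> 'b) free) \<Rightarrow> (('r, 'b) bword free \<times> 'v) free cyclic_data"
  where "cyclic_B B Z act coact = \<lparr>
    null = \<lambda>n. tensor_null (base B) (bword_op_act B) (\<lambda>r. act (tgt B r)) (bpow_null B n) Z,
    face = \<lambda>n i z. lsum z (\<lambda>(X, x). lsum X (\<lambda>w. case w of
        Scalar r \<Rightarrow> 0
      | Word bs \<Rightarrow>
          if length bs \<noteq> n \<or> n = 0 then 0
          else if i < n then gen (counit_at B i bs) \<otimes> x
          else lsum (transl_right B (last bs)) (\<lambda>(bm, bp).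
            diag_right B (bword (butlast bs)) bm \<otimes> act bp x))),
    degen = \<lambda>n i z. lsum z (\<lambda>(X, x). lsum X (\<lambda>w. case w of
        Scalar r \<Rightarrow> if n = 0 then gen (Word [tgt B r]) \<otimes> x else 0
      | Word bs \<Rightarrow>
          if length bs \<noteq> n \<or> n = 0 then 0
          else if i < n then
            lsum (comul B (bs ! i)) (\<lambda>(b1, b2). gen (Word (take i bs @ b1 # b2 # drop (i + 1) bs)) \<otimes> x)
          else gen (Word (bs @ [1])) \<otimes> x)),
    cyc = \<lambda>n z. lsum z (\<lambda>(X, x). lsum X (\<lambda>w. case w of
        Scalar r \<Rightarrow> if n = 0 then gen (Scalar r) \<otimes> x else 0
      | Word bs \<Rightarrow>
          if length bs \<noteq> n \<or> n = 0 then 0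
          else lsum (coact x) (\<lambda>(x0, x1). lsum (transl_right B (last bs)) (\<lambda>(bm, bp).
            diag_right B (Word (x1 # butlast bs)) bm \<otimes> act bp x0))))\<rparr>"


section \<open>The comparison map\<close>

text \<open>
  For \<open>ts = [t\<^sub>1, \<dots>, t\<^sub>n]\<close>, \<open>coact_all coact 1 ts\<close> is the formal sum of the lists whose \<open>j\<close>-th
  entry, counted from \<open>1\<close>, is \<open>(t\<^sub>j\<^sub>\<langle>\<^sub>0\<^sub>\<rangle>, [t\<^sub>j\<^sub>\<langle>\<^sub>1\<^sub>\<rangle>, \<dots>, t\<^sub>j\<^sub>\<langle>\<^sub>j\<^sub>\<rangle>])\<close>.
\<close>

primrec coact_all :: "('t \<Rightarrow> ('t \<times> 'b) free) \<Rightarrow> nat \<Rightarrow> 't list \<Rightarrow> ('t \<times> 'b list) list free"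
  where
    "coact_all coact j [] = gen []"
  | "coact_all coact j (t # ts) =
      lsum (rcoact_iter coact j t) (\<lambda>y. lsum (coact_all coact (Suc j) ts) (\<lambda>ys. gen (y # ys)))"

definition omega ::
    "('t::complex_algebra \<Rightarrow> ('t \<times> 'b::complex_algebra) free) \<Rightarrow> nat \<Rightarrow>
     ('m \<times> 't list free) free \<Rightarrow> (('r::complex_algebra, 'b) bword free \<times> ('m \<times> 't) free) free"
  where "omega coactT n z = lsum z (\<lambda>(m, X). on_length (n + 1) X (\<lambda>ts.
    lsum (coact_all coactT 1 (tl ts)) (\<lambda>ys.
      gen (bword (map (\<lambda>i. prod_list (map (\<lambda>y. snd y ! i) (drop i ys))) [0..<n])) \<otimes>
      (m \<otimes> (hd ts * prod_list (map fst ys))))))"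

end

theory Submission
  imports Defs
begin

text \<open>
  Two vectors of a quotient space agree if all linear functionals vanishing on the subspace agree on
  them, and the functionals on a tensor product are the balanced multilinear functions. Every
  identity between formal sums thus becomes an identity between values of such functions, in which
  the representatives chosen for coproducts, coactions and translation maps can be rewritten freely.

  The inverse of \<open>\<omega>\<close> is the iterated inverse of the canonical map: with
  \<open>can\<^sup>-\<^sup>1(1 \<otimes> b) = b\<^sub>- \<otimes> b\<^sub>+\<close> it sends \<open>b\<^sub>1 \<otimes> \<dots> \<otimes> b\<^sub>n \<otimes> (m \<otimes> t)\<close> to
  \<open>m \<otimes> t b\<^sub>1\<^sub>- \<otimes> b\<^sub>1\<^sub>+ b\<^sub>2\<^sub>- \<otimes> \<dots> \<otimes> b\<^sub>n\<^sub>+\<close>. This map is easily compared with the faces, degeneracies and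
  cyclic operators, since on functionals all of them amount to substitutions. The cyclic identities
  are verified for \<open>T\<close> only, where \<open>\<tau>\<^sup>n\<^sup>+\<^sup>1 = 1\<close> holds because rotations by \<open>p\<close> and by \<open>q\<close> factors compose to the
  rotation by \<open>p + q\<close> and stability trivializes the full one, and are transported to \<open>B\<close> along the bijection.
\<close>


section \<open>Linear functionals and formal sums\<close>

text \<open>The map \<omega> occurs in two forms. The recursion \<open>omegaT\<close> splits off the
  first factor, as \<open>theta\<close> does; it is shown to descend to the quotients, and it
  inverts \<theta> on one side. The explicit formula behind \<open>omega\<close> has a recursion in
  the last factor, and with it \<theta> is inverted on the other side. A left and a right inverse of
  \<theta> coincide, so the explicit formula inherits from the recursive one that it is well
  defined.

  The obstacle in comparing the operators is the last face over B, where b^- acts diagonally while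
  b^+ acts through can^{-1}. Two facts remove it: the coaction of b_- is expressed by b^-, and a
  coaction of u followed by the diagonal action of u_1 amounts to multiplying the last factor over T
  by u. Both rest on the cancellation of a coaction against can^{-1}, u v_0 v_{1-} \<otimes> v_{1+}
  = u \<otimes> v.\<close>

definition clin :: "('v::complex_vector \<Rightarrow> 'w::complex_vector) \<Rightarrow> bool"
  where "clin f \<longleftrightarrow> (\<forall>x y. f (x + y) = f x + f y) \<and> (\<forall>c x. f (c *\<^sub>C x) = c *\<^sub>C f x)"

lemma clinI: "(\<And>x y. f (x + y) = f x + f y) \<Longrightarrow> (\<And>c x. f (c *\<^sub>C x) = c *\<^sub>C f x) \<Longrightarrow> clin f"
  by (simp add: clin_def)

lemma clin_add: "clin f \<Longrightarrow> f (x + y) = f x + f y"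
  and clin_scale: "clin f \<Longrightarrow> f (c *\<^sub>C x) = c *\<^sub>C f x"
  by (simp_all add: clin_def)

lemma clin_zero: "clin f \<Longrightarrow> f 0 = 0"
  using clin_add[of f 0 0] by simp

lemma clin_diff: "clin f \<Longrightarrow> f (x - y) = f x - f y"
  using clin_add[of f "x - y" y] by (simp add: algebra_simps)

lemma clin_sum: "clin f \<Longrightarrow> f (sum g A) = (\<Sum>a\<in>A. f (g a))"
  by (induction A rule: infinite_finite_induct) (simp_all add: clin_zero clin_add)

lemma clin_comp: "clin f \<Longrightarrow> clin g \<Longrightarrow> clin (\<lambda>x. f (g x))"
  by (simp add: clin_def)

lemma lookup_scaleC: "Poly_Mapping.lookup (c *\<^sub>C X) a = c *\<^sub>C Poly_Mapping.lookup X a"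
  by (simp add: scaleC_poly_mapping_def map.rep_eq when_def)

lemma clin_vanish_span:
  assumes "clin f" "\<And>x. x \<in> S \<Longrightarrow> f x = 0" "x \<in> complex_vector.span S"
  shows "f x = 0"
  using assms(3)
proof (induction rule: complex_vector.span_induct_alt)
  case base then show ?case by (rule clin_zero[OF assms(1)])
next
  case (step c x y) then show ?case by (simp add: clin_add[OF assms(1)] clin_scale[OF assms(1)] assms(2))
qed

text \<open>A basis of Z together with x is independent, so the values 0 on that basis and 1 at x
  extend to a linear functional.\<close>

lemma separating_functional:
  fixes x :: "'v::complex_vector"
  assumes "complex_vector.subspace Z" "x \<notin> Z"
  obtains \<phi> :: "'v \<Rightarrow> complex" where "clin \<phi>" "\<And>z. z \<in> Z \<Longrightarrow> \<phi> z = 0" "\<phi> x \<noteq> 0"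
proof -
  interpret vp: vector_space_pair "scaleC :: complex \<Rightarrow> 'v \<Rightarrow> 'v" "scaleC :: complex \<Rightarrow> complex \<Rightarrow> complex"
    by unfold_locales
  obtain A where A: "A \<subseteq> Z" "complex_vector.independent A" "Z \<subseteq> complex_vector.span A"
    and "card A = complex_vector.dim Z"
    by (rule complex_vector.basis_exists)
  have sp: "complex_vector.span A = Z"
    using complex_vector.span_minimal[OF A(1) assms(1)] A(3) by (rule subset_antisym)
  then have ind: "complex_vector.independent (insert x A)"
    using A(2) assms(2) by (simp add: complex_vector.independent_insert)
  obtain g where g: "Vector_Spaces.linear scaleC scaleC g" "\<forall>a\<in>insert x A. g a = (if a = x then 1 else 0 :: complex)"
    using vp.linear_independent_extend[OF ind, of "\<lambda>a. if a = x then 1 else 0"] by blast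
  interpret g: Vector_Spaces.linear scaleC scaleC g by (rule g(1))
  have cl: "clin g" by (rule clinI) (simp_all add: g.add g.scale)
  show ?thesis
  proof (rule that[of g])
    show "clin g" by (rule cl)
    show "g z = 0" if "z \<in> Z" for z
      using that unfolding sp[symmetric]
      by (rule clin_vanish_span[OF cl, rotated]) (use g(2) A(1) assms(2) in auto)
    show "g x \<noteq> 0" using g(2) by simp
  qed
qed

lemma mem_subspace_iff:
  fixes x :: "'v::complex_vector"
  assumes "complex_vector.subspace Z"
  shows "x \<in> Z \<longleftrightarrow> (\<forall>\<phi> :: 'v \<Rightarrow> complex. clin \<phi> \<longrightarrow> (\<forall>z\<in>Z. \<phi> z = 0) \<longrightarrow> \<phi> x = 0)"
  by (metis assms separating_functional)

lemma lsum_superset: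
  assumes "finite A" "Poly_Mapping.keys X \<subseteq> A"
  shows "lsum X f = (\<Sum>a\<in>A. Poly_Mapping.lookup X a *\<^sub>C f a)"
  unfolding lsum_def using assms
  by (intro sum.mono_neutral_left) (auto simp: in_keys_iff)

lemma lsum_0 [simp]: "lsum 0 f = 0"
  by (simp add: lsum_def)

lemma lsum_zero [simp]: "lsum X (\<lambda>a. 0) = 0"
  by (simp add: lsum_def)

lemma lsum_gen [simp]: "lsum (gen a) f = f a"
  by (simp add: lsum_def)

lemma clin_lsum: "clin (\<lambda>X. lsum X f)"
proof (rule clinI)
  fix X Y :: "'a free" and c :: complex
  \<comment> \<open>Cancellation may remove keys, so the three sums are compared over one finite set
    that contains all of them.\<close>
  let ?A = "Poly_Mapping.keys X \<union> Poly_Mapping.keys Y"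
  have "Poly_Mapping.keys (X + Y) \<subseteq> ?A" by (rule Poly_Mapping.keys_add)
  then show "lsum (X + Y) f = lsum X f + lsum Y f"
    by (simp add: lsum_superset[of ?A] lookup_add scaleC_add_left sum.distrib)
  have "Poly_Mapping.keys (c *\<^sub>C X) \<subseteq> Poly_Mapping.keys X"
    by (auto simp: in_keys_iff lookup_scaleC)
  then show "lsum (c *\<^sub>C X) f = c *\<^sub>C lsum X f"
    by (simp add: lsum_superset[of "Poly_Mapping.keys X"] lookup_scaleC
        complex_vector.scale_sum_right scaleC_scaleC scaleC_complex_def)
qed

lemmas lsum_add_left [simp] = clin_add[OF clin_lsum]
  and lsum_scale_left [simp] = clin_scale[OF clin_lsum]
  and lsum_diff_left [simp] = clin_diff[OF clin_lsum]

lemma lsum_add [simp]: "lsum X (\<lambda>a. f a + g a) = lsum X f + lsum X g"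
  by (simp add: lsum_def scaleC_add_right sum.distrib)

lemma lsum_scale [simp]: "lsum X (\<lambda>a. c *\<^sub>C f a) = c *\<^sub>C lsum X f"
  by (simp add: lsum_def complex_vector.scale_sum_right scaleC_scaleC mult.commute)

lemma clin_lsum_out: "clin \<phi> \<Longrightarrow> \<phi> (lsum X f) = lsum X (\<lambda>a. \<phi> (f a))"
  by (simp add: lsum_def clin_sum clin_scale)

lemma lsum_lsum [simp]: "lsum (lsum X f) g = lsum X (\<lambda>a. lsum (f a) g)"
  by (rule clin_lsum_out[OF clin_lsum])

lemma lsum_commute: "lsum X (\<lambda>a. lsum Y (f a)) = lsum Y (\<lambda>b. lsum X (\<lambda>a. f a b))"
  unfolding lsum_def
  by (simp add: complex_vector.scale_sum_right scaleC_scaleC mult.commute) (rule sum.swap)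

lemma lsum_cong:
  "(\<And>a. a \<in> Poly_Mapping.keys X \<Longrightarrow> f a = g a) \<Longrightarrow> lsum X f = lsum X g"
  by (simp add: lsum_def)

lemma lsum_gen_id: "lsum X gen = X"
proof (rule poly_mapping_eqI)
  fix a
  have "Poly_Mapping.lookup (\<Sum>b\<in>A. Poly_Mapping.lookup X b *\<^sub>C gen b) a
      = (\<Sum>b\<in>A. Poly_Mapping.lookup X b *\<^sub>C Poly_Mapping.lookup (gen b) a)" for A
    by (induction A rule: infinite_finite_induct) (simp_all add: lookup_add lookup_scaleC)
  then show "Poly_Mapping.lookup (lsum X gen) a = Poly_Mapping.lookup X a"
    unfolding lsum_def
    by (simp add: lookup_single when_def scaleC_complex_def if_distrib sum.delta in_keys_iff
        cong: if_cong)
qed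

lemma clin_free: "clin \<phi> \<Longrightarrow> \<phi> X = lsum X (\<lambda>a. \<phi> (gen a))"
  using clin_lsum_out[of \<phi> X gen] by (simp add: lsum_gen_id)

text \<open>Sweedler sums with a curried summand: \<open>lsum\<close> without the pattern match, so
  that nested sums can be rewritten by higher-order unification.\<close>

definition sw2 :: "('a \<times> 'b) free \<Rightarrow> ('a \<Rightarrow> 'b \<Rightarrow> 'w::complex_vector) \<Rightarrow> 'w"
  where "sw2 X F = lsum X (\<lambda>(a, b). F a b)"

lemma sw2_tens [simp]: "sw2 (a \<otimes> b) F = F a b"
  by (simp add: sw2_def)

lemma sw2_0 [simp]: "sw2 0 F = 0"
  by (simp add: sw2_def)

lemma sw2_zero [simp]: "sw2 X (\<lambda>a b. 0) = 0"
  by (simp add: sw2_def case_prod_unfold)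

lemma sw2_add [simp]: "sw2 X (\<lambda>a b. F a b + G a b) = sw2 X F + sw2 X G"
  by (simp add: sw2_def case_prod_unfold)

lemma sw2_scale [simp]: "sw2 X (\<lambda>a b. c *\<^sub>C F a b) = c *\<^sub>C sw2 X F"
  by (simp add: sw2_def case_prod_unfold)

lemma clin_sw2: "clin (\<lambda>X. sw2 X F)"
  by (simp add: sw2_def[abs_def] clin_lsum)

lemmas sw2_add_left [simp] = clin_add[OF clin_sw2]
  and sw2_scale_left [simp] = clin_scale[OF clin_sw2]
  and sw2_diff_left [simp] = clin_diff[OF clin_sw2]

lemma clin_sw2_out: "clin \<phi> \<Longrightarrow> \<phi> (sw2 X F) = sw2 X (\<lambda>a b. \<phi> (F a b))"
  by (simp add: sw2_def clin_lsum_out case_prod_unfold)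

lemma sw2_lsum [simp]: "sw2 (lsum X f) F = lsum X (\<lambda>a. sw2 (f a) F)"
  by (rule clin_lsum_out[OF clin_sw2])

lemma lsum_sw2 [simp]: "lsum (sw2 X f) F = sw2 X (\<lambda>a b. lsum (f a b) F)"
  by (rule clin_sw2_out[OF clin_lsum])

lemma sw2_sw2 [simp]: "sw2 (sw2 X f) F = sw2 X (\<lambda>a b. sw2 (f a b) F)"
  by (rule clin_sw2_out[OF clin_sw2])

lemma lsum_case: "lsum X (\<lambda>(a, b). F a b) = sw2 X F"
  by (simp add: sw2_def)

lemma sw2_commute: "sw2 X (\<lambda>a b. sw2 Y (F a b)) = sw2 Y (\<lambda>c d. sw2 X (\<lambda>a b. F a b c d))"
  using lsum_commute[of X Y "\<lambda>x y. F (fst x) (snd x) (fst y) (snd y)"]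
  by (simp add: sw2_def case_prod_unfold)

lemma sw2_lsum_commute: "sw2 X (\<lambda>a b. lsum Y (F a b)) = lsum Y (\<lambda>c. sw2 X (\<lambda>a b. F a b c))"
  using lsum_commute[of X Y "\<lambda>x y. F (fst x) (snd x) y"]
  by (simp add: sw2_def case_prod_unfold)

lemma sw2_tens_id: "sw2 X (\<otimes>) = X"
  by (simp add: sw2_def case_prod_unfold lsum_gen_id)

lemma sw2_cong: "(\<And>a b. F a b = G a b) \<Longrightarrow> sw2 X F = sw2 X G"
  by presburger

lemma clin_free2: "clin \<phi> \<Longrightarrow> \<phi> X = sw2 X (\<lambda>a b. \<phi> (a \<otimes> b))"
  using clin_sw2_out[of \<phi> X "(\<otimes>)"] by (simp add: sw2_tens_id)


section \<open>Balanced maps\<close>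

text \<open>For \<open>Zx\<close> and \<open>Zy\<close> equal to \<open>{0}\<close> these are the
  linear maps out of the tensor product. For other quotients the vanishing on \<open>Zx\<close> and
  \<open>Zy\<close> is a separate hypothesis of the lemmas below.\<close>

definition bal ::
    "'a set \<Rightarrow> ('x::complex_vector \<Rightarrow> 'a \<Rightarrow> 'x) \<Rightarrow> ('a \<Rightarrow> 'y::complex_vector \<Rightarrow> 'y) \<Rightarrow>
     ('x \<Rightarrow> 'y \<Rightarrow> 'w::complex_vector) \<Rightarrow> bool"
  where "bal A ra la F \<longleftrightarrow>
    (\<forall>y. clin (\<lambda>x. F x y)) \<and> (\<forall>x. clin (F x)) \<and> (\<forall>x a y. a \<in> A \<longrightarrow> F (ra x a) y = F x (la a y))"

lemma balI:
  assumes "\<And>y. clin (\<lambda>x. F x y)" "\<And>x. clin (F x)" "\<And>x a y. a \<in> A \<Longrightarrow> F (ra x a) y = F x (la a y)"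
  shows "bal A ra la F"
  using assms by (simp add: bal_def)

lemma bal_left: "bal A ra la F \<Longrightarrow> clin (\<lambda>x. F x y)"
  and bal_right: "bal A ra la F \<Longrightarrow> clin (F x)"
  and bal_mid: "bal A ra la F \<Longrightarrow> a \<in> A \<Longrightarrow> F (ra x a) y = F x (la a y)"
  by (simp_all add: bal_def)

lemma subspace_tensor_null: "complex_vector.subspace (tensor_null A ra la Zx Zy)"
  unfolding tensor_null_def by (rule complex_vector.subspace_span)

lemma sw2_tensor_null:
  assumes "bal A ra la F" "\<And>x y. x \<in> Zx \<Longrightarrow> F x y = 0" "\<And>x y. y \<in> Zy \<Longrightarrow> F x y = 0"
    and "X \<in> tensor_null A ra la Zx Zy"
  shows "sw2 X F = 0"
  using assms(4) unfolding tensor_null_def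
proof (rule clin_vanish_span[OF clin_sw2, rotated])
  note b = bal_left[OF assms(1)] bal_right[OF assms(1)]
  show "sw2 x F = 0" if "x \<in> {(x + x') \<otimes> y - x \<otimes> y - x' \<otimes> y | x x' y. True} \<union>
     {x \<otimes> (y + y') - x \<otimes> y - x \<otimes> y' | x y y'. True} \<union>
     {(c *\<^sub>C x) \<otimes> y - c *\<^sub>C (x \<otimes> y) | c x y. True} \<union>
     {x \<otimes> (c *\<^sub>C y) - c *\<^sub>C (x \<otimes> y) | c x y. True} \<union>
     {x \<otimes> y | x y. x \<in> Zx \<or> y \<in> Zy} \<union>
     {ra x a \<otimes> y - x \<otimes> la a y | x a y. a \<in> A}" for x
    using that
    by (elim UnE CollectE exE conjE disjE)
      (simp_all add: assms(2,3) clin_add[OF b(1)] clin_add[OF b(2)] clin_scale[OF b(1)]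
        clin_scale[OF b(2)] bal_mid[OF assms(1)])
qed

lemma tensor_null_gens:
  fixes ra :: "'x::complex_vector \<Rightarrow> 'a \<Rightarrow> 'x" and la :: "'a \<Rightarrow> 'y::complex_vector \<Rightarrow> 'y"
  shows "(x + x') \<otimes> y - x \<otimes> y - x' \<otimes> y \<in> tensor_null A ra la Zx Zy"
    "x \<otimes> (y + y') - x \<otimes> y - x \<otimes> y' \<in> tensor_null A ra la Zx Zy"
    "(c *\<^sub>C x) \<otimes> y - c *\<^sub>C (x \<otimes> y) \<in> tensor_null A ra la Zx Zy"
    "x \<otimes> (c *\<^sub>C y) - c *\<^sub>C (x \<otimes> y) \<in> tensor_null A ra la Zx Zy"
    "x \<in> Zx \<Longrightarrow> x \<otimes> y \<in> tensor_null A ra la Zx Zy"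
    "y \<in> Zy \<Longrightarrow> x \<otimes> y \<in> tensor_null A ra la Zx Zy"
    "a \<in> A \<Longrightarrow> ra x a \<otimes> y - x \<otimes> la a y \<in> tensor_null A ra la Zx Zy"
  unfolding tensor_null_def by (rule complex_vector.span_base; blast)+

lemma bal_of_functional:
  assumes \<phi>: "clin \<phi>" "\<And>z. z \<in> tensor_null A ra la Zx Zy \<Longrightarrow> \<phi> z = 0"
  shows "bal A ra la (\<lambda>x y. \<phi> (x \<otimes> y))"
    "x \<in> Zx \<Longrightarrow> \<phi> (x \<otimes> y) = 0" "y \<in> Zy \<Longrightarrow> \<phi> (x \<otimes> y) = 0"
proof -
  note \<phi>_simps = clin_diff[OF \<phi>(1)] clin_scale[OF \<phi>(1)]
  show "bal A ra la (\<lambda>x y. \<phi> (x \<otimes> y))"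
  proof (intro balI clinI)
    fix x x' y y' c
    show "\<phi> ((x + x') \<otimes> y) = \<phi> (x \<otimes> y) + \<phi> (x' \<otimes> y)"
      using \<phi>(2)[OF tensor_null_gens(1)[of x x' y]] by (simp add: \<phi>_simps diff_eq_eq add.commute)
    show "\<phi> (x \<otimes> (y + y')) = \<phi> (x \<otimes> y) + \<phi> (x \<otimes> y')"
      using \<phi>(2)[OF tensor_null_gens(2)[of x y y']] by (simp add: \<phi>_simps diff_eq_eq add.commute)
    show "\<phi> ((c *\<^sub>C x) \<otimes> y) = c *\<^sub>C \<phi> (x \<otimes> y)"
      using \<phi>(2)[OF tensor_null_gens(3)[of c x y]] by (simp add: \<phi>_simps)
    show "\<phi> (x \<otimes> (c *\<^sub>C y)) = c *\<^sub>C \<phi> (x \<otimes> y)"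
      using \<phi>(2)[OF tensor_null_gens(4)[of x c y]] by (simp add: \<phi>_simps)
    show "\<phi> (ra x a \<otimes> y) = \<phi> (x \<otimes> la a y)" if "a \<in> A" for a
      using \<phi>(2)[OF tensor_null_gens(7)[OF that, of ra x y la]] by (simp add: \<phi>_simps)
  qed
  show "x \<in> Zx \<Longrightarrow> \<phi> (x \<otimes> y) = 0" "y \<in> Zy \<Longrightarrow> \<phi> (x \<otimes> y) = 0"
    by (simp_all add: \<phi>(2) tensor_null_gens(5,6))
qed

text \<open>A subspace is cut out by the functionals vanishing on it, and such a functional
  restricts to a balanced bilinear map on pure tensors. Complex-valued test maps therefore
  suffice.\<close>

lemma tensor_nullI:
  fixes X :: "('x::complex_vector \<times> 'y::complex_vector) free"
  assumes "\<And>F :: 'x \<Rightarrow> 'y \<Rightarrow> complex. bal A ra la F \<Longrightarrow> (\<And>x y. x \<in> Zx \<Longrightarrow> F x y = 0) \<Longrightarrow>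
     (\<And>x y. y \<in> Zy \<Longrightarrow> F x y = 0) \<Longrightarrow> sw2 X F = 0"
  shows "X \<in> tensor_null A ra la Zx Zy"
  unfolding mem_subspace_iff[OF subspace_tensor_null]
proof (intro allI impI)
  fix \<phi> :: "('x \<times> 'y) free \<Rightarrow> complex"
  assume \<phi>: "clin \<phi>" "\<forall>z\<in>tensor_null A ra la Zx Zy. \<phi> z = 0"
  then have "sw2 X (\<lambda>x y. \<phi> (x \<otimes> y)) = 0"
    by (intro assms) (auto intro: bal_of_functional)
  then show "\<phi> X = 0" by (simp add: clin_free2[OF \<phi>(1), of X])
qed

lemma eq_tensorI:
  fixes X Y :: "('x::complex_vector \<times> 'y::complex_vector) free"
  assumes "\<And>F :: 'x \<Rightarrow> 'y \<Rightarrow> complex. bal A ra la F \<Longrightarrow> (\<And>x y. x \<in> Zx \<Longrightarrow> F x y = 0) \<Longrightarrow>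
     (\<And>x y. y \<in> Zy \<Longrightarrow> F x y = 0) \<Longrightarrow> sw2 X F = sw2 Y F"
  shows "X \<simeq>\<^bsub>tensor_null A ra la Zx Zy\<^esub> Y"
  by (rule tensor_nullI) (simp add: assms)

lemma sw2_eq_tensor:
  assumes "X \<simeq>\<^bsub>tensor_null A ra la Zx Zy\<^esub> Y" "bal A ra la F"
    "\<And>x y. x \<in> Zx \<Longrightarrow> F x y = 0" "\<And>x y. y \<in> Zy \<Longrightarrow> F x y = 0"
  shows "sw2 X F = sw2 Y F"
  using sw2_tensor_null[OF assms(2,3,4,1)] by simp

lemma bal_zero: "bal A ra la F \<Longrightarrow> F 0 y = 0" "bal A ra la F \<Longrightarrow> F x 0 = 0"
  using bal_left[THEN clin_zero] bal_right[THEN clin_zero] by blast+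

lemma sw2_eq_tensor0:
  assumes "X \<simeq>\<^bsub>tensor_null A ra la {0} {0}\<^esub> Y" "bal A ra la F"
  shows "sw2 X F = sw2 Y F"
  using assms by (rule sw2_eq_tensor) (auto simp: bal_zero[OF assms(2)])


section \<open>Linearity of expressions built from balanced maps\<close>

lemma clin_id [intro]: "clin (\<lambda>x. x)"
  by (simp add: clin_def)

lemma clin_0 [intro]: "clin (\<lambda>x. 0)"
  by (simp add: clin_def)

lemma clin_mult:
  fixes f :: "'v::complex_vector \<Rightarrow> 'a::complex_algebra"
  shows "clin f \<Longrightarrow> clin (\<lambda>x. f x * a)" "clin f \<Longrightarrow> clin (\<lambda>x. a * f x)"
  by (simp_all add: clin_def distrib_left distrib_right mult_scaleC_left mult_scaleC_right)

lemma clin_sw2_in: "(\<And>a b. clin (\<lambda>y. F a b y)) \<Longrightarrow> clin (\<lambda>y. sw2 X (\<lambda>a b. F a b y))"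
  by (simp add: clin_def)

lemma clin_lsum_in: "(\<And>a. clin (\<lambda>y. F a y)) \<Longrightarrow> clin (\<lambda>y. lsum X (\<lambda>a. F a y))"
  by (simp add: clin_def)

lemmas clin_intros = clin_id clin_mult clin_sw2_in clin_lsum_in

lemma bal_clin1: "bal A ra la F \<Longrightarrow> clin f \<Longrightarrow> clin (\<lambda>x. F (f x) y)"
  by (rule clin_comp[OF bal_left])

lemma bal_clin2: "bal A ra la F \<Longrightarrow> clin f \<Longrightarrow> clin (\<lambda>x. F z (f x))"
  by (rule clin_comp[OF bal_right])

lemmas bal_clin = bal_clin1 bal_clin2

text \<open>A structure map such as a coproduct is additive only modulo the null space of its
  target; evaluating a balanced map at it restores genuine linearity.\<close>

lemma clin_sw2_qlinear:
  assumes "qlinear {0} (tensor_null A ra la Zx Zy) D" "bal A ra la F"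
    "\<And>x y. x \<in> Zx \<Longrightarrow> F x y = 0" "\<And>x y. y \<in> Zy \<Longrightarrow> F x y = 0"
  shows "clin (\<lambda>x. sw2 (D x) F)"
proof (rule clinI)
  fix x y c
  have "D (x + y) \<simeq>\<^bsub>tensor_null A ra la Zx Zy\<^esub> D x + D y"
    "D (c *\<^sub>C x) \<simeq>\<^bsub>tensor_null A ra la Zx Zy\<^esub> c *\<^sub>C D x"
    using assms(1) unfolding qlinear_def by blast+
  from this[THEN sw2_eq_tensor, OF assms(2-4)]
  show "sw2 (D (x + y)) F = sw2 (D x) F + sw2 (D y) F" "sw2 (D (c *\<^sub>C x)) F = c *\<^sub>C sw2 (D x) F"
    by simp_all
qed

lemma clin_sw2_qlinear0:
  assumes "qlinear {0} (tensor_null A ra la {0} {0}) D" "bal A ra la F"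
  shows "clin (\<lambda>x. sw2 (D x) F)"
  using assms by (rule clin_sw2_qlinear) (auto simp: bal_zero[OF assms(2)])


section \<open>Maps between quotient spaces\<close>

lemma eq_mod_refl: "complex_vector.subspace Z \<Longrightarrow> x \<simeq>\<^bsub>Z\<^esub> x"
  by (simp add: complex_vector.subspace_0)

lemma eq_mod_sym: "complex_vector.subspace Z \<Longrightarrow> x \<simeq>\<^bsub>Z\<^esub> y \<Longrightarrow> y \<simeq>\<^bsub>Z\<^esub> x"
  using complex_vector.subspace_neg[of Z "x - y"] by simp

lemma eq_mod_trans: "complex_vector.subspace Z \<Longrightarrow> x \<simeq>\<^bsub>Z\<^esub> y \<Longrightarrow> y \<simeq>\<^bsub>Z\<^esub> z \<Longrightarrow> x \<simeq>\<^bsub>Z\<^esub> z"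
  using complex_vector.subspace_add[of Z "x - y" "y - z"] by simp

lemma qlinearI:
  assumes "clin f" "complex_vector.subspace Z'" "\<And>x. x \<in> Z \<Longrightarrow> f x \<in> Z'"
  shows "qlinear Z Z' f"
  using assms by (simp add: qlinear_def clin_add clin_scale complex_vector.subspace_0)

lemma qlinear_eq:
  assumes "qlinear Z Z' f" "complex_vector.subspace Z'" "x \<simeq>\<^bsub>Z\<^esub> y"
  shows "f x \<simeq>\<^bsub>Z'\<^esub> f y"
proof -
  have "f ((x - y) + y) \<simeq>\<^bsub>Z'\<^esub> f (x - y) + f y" "f (x - y) \<in> Z'"
    using assms(1,3) unfolding qlinear_def by blast+
  from complex_vector.subspace_add[OF assms(2) this] show ?thesis by simp
qed

lemma quot_eq: "quot Z = range (\<lambda>x. {y. x \<simeq>\<^bsub>Z\<^esub> y})"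
  unfolding quot_def quotient_def by auto

lemma class_eq_iff:
  assumes "complex_vector.subspace Z"
  shows "{y. x \<simeq>\<^bsub>Z\<^esub> y} = {y. x' \<simeq>\<^bsub>Z\<^esub> y} \<longleftrightarrow> x \<simeq>\<^bsub>Z\<^esub> x'"
  using eq_mod_refl[OF assms] eq_mod_sym[OF assms] eq_mod_trans[OF assms] by blast

lemma quot_map_class:
  assumes "complex_vector.subspace Z" "complex_vector.subspace Z'"
    and wd: "\<And>x y. x \<simeq>\<^bsub>Z\<^esub> y \<Longrightarrow> f x \<simeq>\<^bsub>Z'\<^esub> f y"
  shows "quot_map Z' f {y. x \<simeq>\<^bsub>Z\<^esub> y} = {y. f x \<simeq>\<^bsub>Z'\<^esub> y}"
  unfolding quot_map_def
  using eq_mod_refl[OF assms(1)] eq_mod_sym[OF assms(2)] eq_mod_trans[OF assms(2)] wd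
  by blast

lemma qbijI:
  assumes Z: "complex_vector.subspace Z" "complex_vector.subspace Z'"
    and f: "\<And>x y. x \<simeq>\<^bsub>Z\<^esub> y \<Longrightarrow> f x \<simeq>\<^bsub>Z'\<^esub> f y" and g: "\<And>x y. x \<simeq>\<^bsub>Z'\<^esub> y \<Longrightarrow> g x \<simeq>\<^bsub>Z\<^esub> g y"
    and gf: "\<And>x. g (f x) \<simeq>\<^bsub>Z\<^esub> x" and fg: "\<And>x. f (g x) \<simeq>\<^bsub>Z'\<^esub> x"
  shows "qbij Z Z' f"
  unfolding qbij_def
proof (rule bij_betwI')
  have cl: "quot_map Z' f {y. x \<simeq>\<^bsub>Z\<^esub> y} = {y. f x \<simeq>\<^bsub>Z'\<^esub> y}" for x
    by (rule quot_map_class[OF Z f])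
  note sym = eq_mod_sym[OF Z(1)] and trans = eq_mod_trans[OF Z(1)]
  show "(quot_map Z' f X = quot_map Z' f Y) = (X = Y)" if "X \<in> quot Z" "Y \<in> quot Z" for X Y
    using that unfolding quot_eq
  proof clarify
    fix x y
    have "f x \<simeq>\<^bsub>Z'\<^esub> f y \<longleftrightarrow> x \<simeq>\<^bsub>Z\<^esub> y"
      using f g gf sym trans by meson
    then show "(quot_map Z' f {ya. x \<simeq>\<^bsub>Z\<^esub> ya} = quot_map Z' f {ya. y \<simeq>\<^bsub>Z\<^esub> ya}) =
       ({ya. x \<simeq>\<^bsub>Z\<^esub> ya} = {ya. y \<simeq>\<^bsub>Z\<^esub> ya})"
      unfolding cl class_eq_iff[OF Z(1)] class_eq_iff[OF Z(2)] .
  qed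
  show "quot_map Z' f X \<in> quot Z'" if "X \<in> quot Z" for X
    using that unfolding quot_eq by (auto simp: cl)
  show "\<exists>X\<in>quot Z. Y = quot_map Z' f X" if Y: "Y \<in> quot Z'" for Y
  proof -
    obtain y where "Y = {z. y \<simeq>\<^bsub>Z'\<^esub> z}" using Y unfolding quot_eq by auto
    then have "Y = quot_map Z' f {z. g y \<simeq>\<^bsub>Z\<^esub> z}"
      using fg[of y] eq_mod_sym[OF Z(2)] by (simp add: cl class_eq_iff[OF Z(2)])
    then show ?thesis unfolding quot_eq by blast
  qed
qed

lemma qbij_D:
  assumes q: "qbij Z Z' f" and Z: "complex_vector.subspace Z" "complex_vector.subspace Z'"
  shows "\<exists>x. f x \<simeq>\<^bsub>Z'\<^esub> y" "f x \<simeq>\<^bsub>Z'\<^esub> f x' \<Longrightarrow> x \<simeq>\<^bsub>Z\<^esub> x'"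
proof -
  \<comment> \<open>Compatibility of \<open>f\<close> with the classes is derived here: bijectivity
    sends a class to some class, and that class contains \<open>f x\<close>.\<close>
  have cl: "quot_map Z' f {y. x \<simeq>\<^bsub>Z\<^esub> y} = {y. f x \<simeq>\<^bsub>Z'\<^esub> y}" for x
  proof -
    let ?X = "{y. x \<simeq>\<^bsub>Z\<^esub> y}"
    have "?X \<in> quot Z" unfolding quot_eq by blast
    then have "quot_map Z' f ?X \<in> quot Z'" using q unfolding qbij_def bij_betw_def by blast
    then obtain w where w: "quot_map Z' f ?X = {y. w \<simeq>\<^bsub>Z'\<^esub> y}" unfolding quot_eq by blast
    have "f x \<in> quot_map Z' f ?X"
      unfolding quot_map_def using eq_mod_refl[OF Z(1)] eq_mod_refl[OF Z(2)] by blast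
    then show ?thesis using w class_eq_iff[OF Z(2)] by auto
  qed
  show "\<exists>x. f x \<simeq>\<^bsub>Z'\<^esub> y"
  proof -
    have "{z. y \<simeq>\<^bsub>Z'\<^esub> z} \<in> quot_map Z' f ` quot Z"
      using q unfolding qbij_def bij_betw_def quot_eq by blast
    then obtain x where "quot_map Z' f {z. x \<simeq>\<^bsub>Z\<^esub> z} = {z. y \<simeq>\<^bsub>Z'\<^esub> z}"
      unfolding quot_eq by blast
    then show ?thesis unfolding cl class_eq_iff[OF Z(2)] by blast
  qed
  show "x \<simeq>\<^bsub>Z\<^esub> x'" if "f x \<simeq>\<^bsub>Z'\<^esub> f x'"
  proof -
    have "quot_map Z' f {z. x \<simeq>\<^bsub>Z\<^esub> z} = quot_map Z' f {z. x' \<simeq>\<^bsub>Z\<^esub> z}"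
      unfolding cl class_eq_iff[OF Z(2)] by (rule that)
    then have "{z. x \<simeq>\<^bsub>Z\<^esub> z} = {z. x' \<simeq>\<^bsub>Z\<^esub> z}"
      using q unfolding qbij_def bij_betw_def inj_on_def quot_eq by blast
    then show ?thesis unfolding class_eq_iff[OF Z(1)] .
  qed
qed


section \<open>Right Hopf algebras and comodule algebras\<close>

locale right_hopf_algebra =
  fixes B :: "('r::complex_algebra, 'b::complex_algebra) bialgebroid"
  assumes right_hopf_B: "right_hopf B"
begin

text \<open>Lemmas on sums over the coproduct of \<open>B\<close> are prefixed by \<open>SB\<close>, those on the translation map of \<open>B\<close>
  by \<open>V\<close>. Likewise \<open>CT\<close>, \<open>CM\<close> refer to the coactions of \<open>T\<close> and \<open>M\<close>, \<open>SW\<close>, \<open>U\<close> to the coproduct and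
  translation map of \<open>K\<close>, and \<open>P\<close> to \<open>transl_can\<close>.\<close>

abbreviation bB :: "('b \<Rightarrow> 'b \<Rightarrow> 'w::complex_vector) \<Rightarrow> bool"
  where "bB \<equiv> bal UNIV (\<lambda>b r. b * src B r) (\<lambda>r b. b * tgt B r)"

abbreviation bOp :: "('b \<Rightarrow> 'b \<Rightarrow> 'w::complex_vector) \<Rightarrow> bool"
  where "bOp \<equiv> bal UNIV (\<lambda>b r. b * tgt B r) (\<lambda>r b. tgt B r * b)"

lemma right_bialgebroid_B: "right_bialgebroid B"
  using right_hopf_B by (simp add: right_hopf_def)

lemma base_B [simp]: "base B = UNIV"
  using right_bialgebroid_B by (simp add: right_bialgebroid_def)

lemma rbb_null_eq: "rbb_null B = tensor_null UNIV (\<lambda>b r. b * src B r) (\<lambda>r b. b * tgt B r) {0} {0}"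
  by (simp add: rcotensor_null_def)

lemmas rb_unfolded = right_bialgebroid_B[unfolded right_bialgebroid_def]

lemma src_B: "src B 1 = 1" "src B (r * r') = src B r * src B r'" "clin (src B)"
  using rb_unfolded by (simp_all add: alg_map_on_def clin_def)

lemma tgt_B: "tgt B 1 = 1" "tgt B (r * r') = tgt B r' * tgt B r" "clin (tgt B)"
  using rb_unfolded by (simp_all add: anti_alg_map_on_def clin_def)

lemma src_tgt_B: "src B r * tgt B r' = tgt B r' * src B r"
  using rb_unfolded by blast

lemma counit_B:
  "clin (counit B)" "counit B (b * src B r' * tgt B r) = r * counit B b * r'" "counit B 1 = 1"
  "counit B (b * b') = counit B (src B (counit B b) * b')"
proof -
  have "qlinear {0} {0} (counit B)" using rb_unfolded by blast
  then show "clin (counit B)" by (simp add: qlinear_def clin_def)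
  show "counit B (b * src B r' * tgt B r) = r * counit B b * r'" "counit B 1 = 1"
    "counit B (b * b') = counit B (src B (counit B b) * b')"
    using rb_unfolded by blast+
qed

lemma counit_src_tgt:
  "counit B (b * src B r) = counit B b * r" "counit B (b * tgt B r) = r * counit B b"
  "counit B (src B r) = r" "counit B (tgt B r) = r"
  using counit_B(2)[of b r 1] counit_B(2)[of b 1 r] counit_B(2)[of 1 r 1] counit_B(2)[of 1 1 r]
  by (simp_all add: src_B tgt_B counit_B(3))

lemma clin_SB: "bB F \<Longrightarrow> clin (\<lambda>b. sw2 (comul B b) F)"
proof -
  have "qlinear {0} (rbb_null B) (comul B)" using rb_unfolded by blast
  then show "bB F \<Longrightarrow> clin (\<lambda>b. sw2 (comul B b) F)" unfolding rbb_null_eq by (rule clin_sw2_qlinear0)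
qed

lemma SB_mod: "X \<simeq>\<^bsub>rbb_null B\<^esub> Y \<Longrightarrow> bB F \<Longrightarrow> sw2 X F = sw2 Y F"
  unfolding rbb_null_eq by (rule sw2_eq_tensor0)

lemma SB_act:
  assumes "bB F"
  shows "sw2 (comul B (b * src B r' * tgt B r)) F = sw2 (comul B b) (\<lambda>b1 b2. F (b1 * tgt B r) (b2 * src B r'))"
proof -
  have "comul B (b * src B r' * tgt B r) \<simeq>\<^bsub>rbb_null B\<^esub>
       lsum (comul B b) (\<lambda>(b1, b2). (b1 * tgt B r) \<otimes> (b2 * src B r'))"
    using rb_unfolded by blast
  from SB_mod[OF this assms] show ?thesis by (simp add: lsum_case)
qed

lemma SB_src: "bB F \<Longrightarrow> sw2 (comul B (b * src B r)) F = sw2 (comul B b) (\<lambda>b1 b2. F b1 (b2 * src B r))"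
  and SB_tgt: "bB F \<Longrightarrow> sw2 (comul B (b * tgt B r)) F = sw2 (comul B b) (\<lambda>b1 b2. F (b1 * tgt B r) b2)"
  using SB_act[of F b r 1] SB_act[of F b 1 r] by (simp_all add: src_B tgt_B)

text \<open>The axiom lives in a tensor product whose left factor is itself given by formal sums. A
  function balanced in each pair of adjacent arguments extends linearly in that factor to the test
  map \<open>?G\<close>.\<close>

lemma SB_coassoc:
  assumes "\<And>y. bB (\<lambda>b1 b2. F b1 b2 y)" "\<And>x. bB (F x)"
  shows "sw2 (comul B b) (\<lambda>b1 b2. sw2 (comul B b1) (\<lambda>b11 b12. F b11 b12 b2)) =
    sw2 (comul B b) (\<lambda>b1 b2. sw2 (comul B b2) (F b1))"
proof -
  let ?G = "\<lambda>X y. sw2 X (\<lambda>b1 b2. F b1 b2 y)"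
  have ax: "lsum (comul B b) (\<lambda>(b1, b2). comul B b1 \<otimes> b2)
       \<simeq>\<^bsub>rcotensor_null B (src_right B) (rbb_null B)\<^esub>
       lsum (comul B b) (\<lambda>(b1, b2). lsum (comul B b2) (\<lambda>(b21, b22). (b1 \<otimes> b21) \<otimes> b22))"
    using rb_unfolded by blast
  have "sw2 (lsum (comul B b) (\<lambda>(b1, b2). comul B b1 \<otimes> b2)) ?G =
    sw2 (lsum (comul B b) (\<lambda>(b1, b2). lsum (comul B b2) (\<lambda>(b21, b22). (b1 \<otimes> b21) \<otimes> b22))) ?G"
  proof (rule sw2_eq_tensor[OF ax[unfolded rcotensor_null_def base_B]])
    show "bal UNIV (src_right B) (\<lambda>r b. b * tgt B r) ?G"
    proof (rule balI)
      show "clin (\<lambda>X. ?G X y)" for y by (rule clin_sw2)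
      show "clin (?G X)" for X
        by (intro clin_intros) (rule bal_right[OF assms(2)])
      show "?G (src_right B X r) y = ?G X (y * tgt B r)" for X r y
        unfolding src_right_def lsum_case
        by (simp add: bal_mid[OF assms(2), symmetric])
    qed
    show "?G x y = 0" if "x \<in> tensor_null UNIV (\<lambda>b r. b * src B r) (\<lambda>r b. b * tgt B r) {0} {0}" for x y
      using that by (rule sw2_tensor_null[rotated -1]) (auto simp: bal_zero[OF assms(1)] assms(1))
    show "?G x y = 0" if "y \<in> {0}" for x y
      using that by (simp add: bal_zero[OF assms(2)])
  qed
  then show ?thesis by (simp add: lsum_case)
qed

lemma SB_counit:
  "sw2 (comul B b) (\<lambda>b1 b2. b2 * tgt B (counit B b1)) = b"
  "sw2 (comul B b) (\<lambda>b1 b2. b1 * src B (counit B b2)) = b"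
  using rb_unfolded by (simp_all add: lsum_case)

lemma SB_takeuchi:
  assumes "bB F"
  shows "sw2 (comul B b) (\<lambda>b1 b2. F b1 (tgt B r * b2)) = sw2 (comul B b) (\<lambda>b1 b2. F (src B r * b1) b2)"
proof -
  have "lsum (comul B b) (\<lambda>(b1, b2). b1 \<otimes> (tgt B r * b2))
       \<simeq>\<^bsub>rbb_null B\<^esub> lsum (comul B b) (\<lambda>(b1, b2). (src B r * b1) \<otimes> b2)"
    using rb_unfolded by blast
  from SB_mod[OF this assms] show ?thesis by (simp add: lsum_case)
qed

lemma sw2_nu_right: "sw2 (nu_right B X) G = sw2 X (\<lambda>p q. sw2 (comul B q) (\<lambda>q1 q2. G (p * q1) q2))"
  unfolding nu_right_def by (simp add: lsum_case)

lemma nu_right_surj: "\<exists>X. nu_right B X \<simeq>\<^bsub>rbb_null B\<^esub> Y"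
  and nu_right_inj: "nu_right B X \<simeq>\<^bsub>rbb_null B\<^esub> nu_right B X' \<Longrightarrow> X \<simeq>\<^bsub>op_null B\<^esub> X'"
  using qbij_D[of "op_null B" "rbb_null B" "nu_right B"] right_hopf_B
  by (simp_all add: right_hopf_def rcotensor_null_def op_null_def subspace_tensor_null)

text \<open>Injectivity of the Galois map \<nu>. Identities for b^- \<otimes> b^+ are proved by
  comparing images under \<nu>.\<close>

lemma nu_right_eqI:
  assumes "bOp F" "\<And>G :: 'b \<Rightarrow> 'b \<Rightarrow> complex. bB G \<Longrightarrow>
      sw2 X (\<lambda>p q. sw2 (comul B q) (\<lambda>q1 q2. G (p * q1) q2)) =
      sw2 Y (\<lambda>p q. sw2 (comul B q) (\<lambda>q1 q2. G (p * q1) q2))"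
  shows "sw2 X F = sw2 Y F"
proof -
  have "nu_right B X \<simeq>\<^bsub>rbb_null B\<^esub> nu_right B Y"
    unfolding rbb_null_eq by (rule eq_tensorI) (simp add: sw2_nu_right assms(2))
  then have "X \<simeq>\<^bsub>op_null B\<^esub> Y" by (rule nu_right_inj)
  then show ?thesis unfolding op_null_def base_B using assms(1) by (rule sw2_eq_tensor0)
qed

text \<open>The defining equation \<nu>(b^- \<otimes> b^+) = 1 \<otimes> b, evaluated at a balanced
  map. The arbitrarily chosen representative \<open>transl_right B b\<close> is accessed through
  this equation.\<close>

lemma V_nu:
  assumes "bB G"
  shows "sw2 (transl_right B b) (\<lambda>p q. sw2 (comul B q) (\<lambda>q1 q2. G (p * q1) q2)) = G 1 b"
proof -
  have "nu_right B (transl_right B b) \<simeq>\<^bsub>rbb_null B\<^esub> 1 \<otimes> b"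
    unfolding transl_right_def by (rule someI_ex[OF nu_right_surj])
  from SB_mod[OF this assms] show ?thesis by (simp add: sw2_nu_right)
qed

lemma bB_lmult:
  assumes G: "bB G"
  shows "bB (\<lambda>x y. G (c * x) y)"
  by (rule balI) (intro bal_clin[OF G] clin_intros bal_right[OF G] | simp add: mult.assoc[symmetric] bal_mid[OF G])+

text \<open>The identity c b^(1) b^(2)- \<otimes> b^(2)+ = c \<otimes> b: both sides have the image
  c b^(1) \<otimes> b^(2) under \<nu>.\<close>

lemma V_SB:
  assumes "bOp F"
  shows "sw2 (comul B b) (\<lambda>b1 b2. sw2 (transl_right B b2) (\<lambda>p q. F (c * b1 * p) q)) = F c b"
proof -
  let ?X = "sw2 (comul B b) (\<lambda>b1 b2. sw2 (transl_right B b2) (\<lambda>p q. (c * b1 * p) \<otimes> q))"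
  have "sw2 ?X F = sw2 (c \<otimes> b) F"
  proof (rule nu_right_eqI[OF assms])
    fix G :: "'b \<Rightarrow> 'b \<Rightarrow> complex" assume G: "bB G"
    have "sw2 (transl_right B b2) (\<lambda>p q. sw2 (comul B q) (\<lambda>q1 q2. G (c * b1 * p * q1) q2)) = G (c * b1) b2" for b1 b2
      using V_nu[OF bB_lmult[OF G, of "c * b1"], of b2] by (simp add: mult.assoc)
    then show "sw2 ?X (\<lambda>p q. sw2 (comul B q) (\<lambda>q1 q2. G (p * q1) q2)) =
        sw2 (c \<otimes> b) (\<lambda>p q. sw2 (comul B q) (\<lambda>q1 q2. G (p * q1) q2))"
      by simp
  qed
  then show ?thesis by simp
qed

text \<open>The representatives for x, y and x + y are chosen independently of each other; they are
  compared through \<nu>.\<close>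

lemma clin_V:
  assumes "bOp F"
  shows "clin (\<lambda>b. sw2 (transl_right B b) F)"
proof (rule clinI)
  fix x y c
  have "sw2 (transl_right B (x + y)) F = sw2 (transl_right B x + transl_right B y) F"
    by (rule nu_right_eqI[OF assms]) (simp add: V_nu clin_add[OF bal_right])
  then show "sw2 (transl_right B (x + y)) F = sw2 (transl_right B x) F + sw2 (transl_right B y) F" by simp
  have "sw2 (transl_right B (c *\<^sub>C x)) F = sw2 (c *\<^sub>C transl_right B x) F"
    by (rule nu_right_eqI[OF assms]) (simp add: V_nu clin_scale[OF bal_right])
  then show "sw2 (transl_right B (c *\<^sub>C x)) F = c *\<^sub>C sw2 (transl_right B x) F" by simp
qed

text \<open>Both sides have the image c t(r) \<otimes> b under \<nu>, since the coproduct of q t(r)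
  carries t(r) on its first factor.\<close>

lemma V_tgt:
  assumes F: "bOp F"
  shows "sw2 (transl_right B b) (\<lambda>p q. F (c * tgt B r * p) q) = sw2 (transl_right B b) (\<lambda>p q. F (c * p) (q * tgt B r))"
proof -
  let ?X = "sw2 (transl_right B b) (\<lambda>p q. (c * tgt B r * p) \<otimes> q)"
  let ?Y = "sw2 (transl_right B b) (\<lambda>p q. (c * p) \<otimes> (q * tgt B r))"
  have "sw2 ?X F = sw2 ?Y F"
  proof (rule nu_right_eqI[OF F])
    fix G :: "'b \<Rightarrow> 'b \<Rightarrow> complex" assume G: "bB G"
    have G': "bB (\<lambda>x y. G (c * x * tgt B r) y)"
    proof (rule balI)
      show "G (c * (x * src B a) * tgt B r) y = G (c * x * tgt B r) (y * tgt B a)" for x a y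
        using bal_mid[OF G, of a "c * x * tgt B r" y] by (simp add: mult.assoc src_tgt_B)
    qed (intro bal_clin[OF G] clin_intros bal_right[OF G])+
    have "sw2 (comul B (q * tgt B r)) (\<lambda>q1 q2. G (c * p * q1) q2) =
        sw2 (comul B q) (\<lambda>q1 q2. G (c * p * (q1 * tgt B r)) q2)" for p q
      by (rule SB_tgt[OF bB_lmult[OF G]])
    then have "sw2 ?Y (\<lambda>p q. sw2 (comul B q) (\<lambda>q1 q2. G (p * q1) q2)) =
        sw2 (transl_right B b) (\<lambda>p q. sw2 (comul B q) (\<lambda>q1 q2. G (c * p * (q1 * tgt B r)) q2))"
      by simp
    also have "\<dots> = G (c * tgt B r) b"
      using V_nu[OF G', of b] by (simp add: mult.assoc)
    finally have "sw2 ?Y (\<lambda>p q. sw2 (comul B q) (\<lambda>q1 q2. G (p * q1) q2)) = G (c * tgt B r) b" .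
    moreover have "sw2 ?X (\<lambda>p q. sw2 (comul B q) (\<lambda>q1 q2. G (p * q1) q2)) = G (c * tgt B r) b"
      using V_nu[OF bB_lmult[OF G, of "c * tgt B r"], of b] by (simp add: mult.assoc)
    ultimately show "sw2 ?X (\<lambda>p q. sw2 (comul B q) (\<lambda>q1 q2. G (p * q1) q2)) =
        sw2 ?Y (\<lambda>p q. sw2 (comul B q) (\<lambda>q1 q2. G (p * q1) q2))" by simp
  qed
  then show ?thesis by simp
qed

text \<open>Over R one has 1 \<otimes> b t(r) = s(r) \<otimes> b, and \<nu> commutes with left
  multiplication on the first factor.\<close>

lemma V_mult_tgt:
  assumes F: "bOp F"
  shows "sw2 (transl_right B (b * tgt B r)) F = sw2 (transl_right B b) (\<lambda>p q. F (src B r * p) q)"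
proof -
  let ?Y = "sw2 (transl_right B b) (\<lambda>p q. (src B r * p) \<otimes> q)"
  have "sw2 (transl_right B (b * tgt B r)) F = sw2 ?Y F"
  proof (rule nu_right_eqI[OF F])
    fix G :: "'b \<Rightarrow> 'b \<Rightarrow> complex" assume G: "bB G"
    have "sw2 ?Y (\<lambda>p q. sw2 (comul B q) (\<lambda>q1 q2. G (p * q1) q2)) = G (src B r) b"
      using V_nu[OF bB_lmult[OF G, of "src B r"], of b] by (simp add: mult.assoc)
    then show "sw2 (transl_right B (b * tgt B r)) (\<lambda>p q. sw2 (comul B q) (\<lambda>q1 q2. G (p * q1) q2)) =
        sw2 ?Y (\<lambda>p q. sw2 (comul B q) (\<lambda>q1 q2. G (p * q1) q2))"
      using bal_mid[OF G, of r 1 b] by (simp add: V_nu[OF G])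
  qed
  then show ?thesis by simp
qed

end

section \<open>Comodule algebras and the Takeuchi property of their coaction\<close>

locale comodule_alg = right_hopf_algebra B
  for B :: "('r::complex_algebra, 'b::complex_algebra) bialgebroid" +
  fixes ractT :: "'t::complex_algebra \<Rightarrow> 'r \<Rightarrow> 't"
    and coactT :: "'t \<Rightarrow> ('t \<times> 'b) free"
  assumes comodule_algebra_T: "right_comodule_algebra B ractT coactT"
begin

text \<open>The \<open>R\<close>-bimodule structure of a comodule algebra is multiplication with the image of \<open>eT\<close>.\<close>

definition eT :: "'r \<Rightarrow> 't"
  where "eT r = ractT 1 r"

lemmas ca_unfolded = comodule_algebra_T[unfolded right_comodule_algebra_def]

lemma comodule_T: "right_comodule B {0} ractT coactT"
  using ca_unfolded by blast

lemmas cT_unfolded = comodule_T[unfolded right_comodule_def right_module_on_def]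

text \<open>Setting t = 1 in (tr)t' = t(rt') identifies the left action, setting t' = 1 then
  identifies the right one.\<close>

lemma ractT_eq: "ractT t r = t * eT r"
  and canonical_lact_T: "canonical_lact B ractT coactT r t = eT r * t"
proof -
  have *: "ractT t r * t' = t * canonical_lact B ractT coactT r t'" for t t' r
    using ca_unfolded by simp
  show "canonical_lact B ractT coactT r t = eT r * t" for r t
    using *[of 1 r t] by (simp add: eT_def)
  then show "ractT t r = t * eT r"
    using *[of t r 1] by simp
qed

lemma ractT_fun: "ractT = (\<lambda>t r. t * eT r)"
  by (intro ext) (rule ractT_eq)

abbreviation bT :: "('t \<Rightarrow> 'b \<Rightarrow> 'w::complex_vector) \<Rightarrow> bool"
  where "bT \<equiv> bal UNIV (\<lambda>t r. t * eT r) (\<lambda>r b. b * tgt B r)"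

lemma rcotensor_T: "rcotensor_null B ractT {0} = tensor_null UNIV (\<lambda>t r. t * eT r) (\<lambda>r b. b * tgt B r) {0} {0}"
  by (simp add: rcotensor_null_def ractT_fun[symmetric])

lemma right_module_T: "right_module_on UNIV {0} ractT"
  using comodule_T by (simp add: right_comodule_def)

lemma eT_1 [simp]: "eT 1 = 1"
  and eT_mult: "eT (r * r') = eT r * eT r'"
  and clin_eT: "clin eT"
proof -
  note m = right_module_T[unfolded right_module_on_def]
  have "ractT 1 1 = 1" using m by simp
  then show "eT 1 = 1" by (simp add: eT_def)
  have "ractT 1 (r * r') = ractT (ractT 1 r) r'" using m by simp
  then show "eT (r * r') = eT r * eT r'" by (simp add: ractT_eq)
  have "ractT 1 (r + r') = ractT 1 r + ractT 1 r'" "ractT 1 (c *\<^sub>C r) = c *\<^sub>C ractT 1 r" for c r r'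
    using m by simp_all
  then show "clin eT" by (simp add: eT_def clin_def)
qed

lemma CT_mod: "X \<simeq>\<^bsub>rcotensor_null B ractT {0}\<^esub> Y \<Longrightarrow> bT G \<Longrightarrow> sw2 X G = sw2 Y G"
  unfolding rcotensor_T by (rule sw2_eq_tensor0)

lemma clin_CT: "bT G \<Longrightarrow> clin (\<lambda>t. sw2 (coactT t) G)"
proof -
  have "qlinear {0} (rcotensor_null B ractT {0}) coactT" using cT_unfolded by blast
  then show "bT G \<Longrightarrow> clin (\<lambda>t. sw2 (coactT t) G)" unfolding rcotensor_T by (rule clin_sw2_qlinear0)
qed

lemma CT_ract:
  assumes "bT G"
  shows "sw2 (coactT (t * eT r)) G = sw2 (coactT t) (\<lambda>x b. G x (b * src B r))"
proof -
  have "coactT (ractT t r) \<simeq>\<^bsub>rcotensor_null B ractT {0}\<^esub> src_right B (coactT t) r"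
    using cT_unfolded by simp
  from CT_mod[OF this assms] show ?thesis by (simp add: src_right_def lsum_case ractT_eq)
qed

lemma CT_one: "bT G \<Longrightarrow> sw2 (coactT 1) G = G 1 1"
  using CT_mod[of "coactT 1" "1 \<otimes> 1" G] ca_unfolded by auto

lemma CT_mult:
  assumes "bT G"
  shows "sw2 (coactT (t * t')) G = sw2 (coactT t) (\<lambda>x b. sw2 (coactT t') (\<lambda>x' b'. G (x * x') (b * b')))"
proof -
  have "coactT (t * t') \<simeq>\<^bsub>rcotensor_null B ractT {0}\<^esub>
       lsum (coactT t) (\<lambda>(t0, b). lsum (coactT t') (\<lambda>(t0', b'). (t0 * t0') \<otimes> (b * b')))"
    using ca_unfolded by blast
  from CT_mod[OF this assms] show ?thesis by (simp add: lsum_case)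
qed

lemma CT_eT:
  assumes G: "bT G"
  shows "sw2 (coactT (eT r)) G = G 1 (src B r)"
proof -
  have "bT (\<lambda>x b. G x (b * src B r))"
  proof (rule balI)
    show "clin (\<lambda>x. G x (y * src B r))" for y by (rule bal_left[OF G])
    show "clin (\<lambda>b. G x (b * src B r))" for x by (intro bal_clin[OF G] clin_intros)
    show "G (x * eT a) (y * src B r) = G x (y * tgt B a * src B r)" for x a y
      by (simp add: bal_mid[OF G] mult.assoc src_tgt_B)
  qed
  from CT_one[OF this] show ?thesis using CT_ract[OF G, of 1 r] by simp
qed

lemma CT_coassoc:
  assumes "\<And>y. bT (\<lambda>x b. F x b y)" "\<And>x. bB (F x)"
  shows "sw2 (coactT t) (\<lambda>x y. sw2 (coactT x) (\<lambda>x0 b. F x0 b y)) =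
    sw2 (coactT t) (\<lambda>x b. sw2 (comul B b) (F x))"
proof -
  let ?G = "\<lambda>X y. sw2 X (\<lambda>b1 b2. F b1 b2 y)"
  have ax: "lsum (coactT t) (\<lambda>(v0, b). coactT v0 \<otimes> b)
       \<simeq>\<^bsub>rcotensor_null B (src_right B) (rcotensor_null B ractT {0})\<^esub>
       lsum (coactT t) (\<lambda>(v0, b). lsum (comul B b) (\<lambda>(b1, b2). (v0 \<otimes> b1) \<otimes> b2))"
    using cT_unfolded by blast
  have "sw2 (lsum (coactT t) (\<lambda>(v0, b). coactT v0 \<otimes> b)) ?G =
    sw2 (lsum (coactT t) (\<lambda>(v0, b). lsum (comul B b) (\<lambda>(b1, b2). (v0 \<otimes> b1) \<otimes> b2))) ?G"
  proof (rule sw2_eq_tensor[OF ax[unfolded rcotensor_null_def[of B "src_right B"] base_B rcotensor_T]])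
    show "bal UNIV (src_right B) (\<lambda>r b. b * tgt B r) ?G"
    proof (rule balI)
      show "clin (\<lambda>X. ?G X y)" for y by (rule clin_sw2)
      show "clin (?G X)" for X
        by (intro clin_intros) (rule bal_right[OF assms(2)])
      show "?G (src_right B X r) y = ?G X (y * tgt B r)" for X r y
        unfolding src_right_def lsum_case
        by (simp add: bal_mid[OF assms(2), symmetric])
    qed
    show "?G x y = 0" if "x \<in> tensor_null UNIV (\<lambda>t r. t * eT r) (\<lambda>r b. b * tgt B r) {0} {0}" for x y
      using that by (rule sw2_tensor_null[rotated -1]) (auto simp: bal_zero[OF assms(1)] assms(1))
    show "?G x y = 0" if "y \<in> {0}" for x y
      using that by (simp add: bal_zero[OF assms(2)])
  qed
  then show ?thesis by (simp add: lsum_case)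
qed

lemma CT_counit: "sw2 (coactT t) (\<lambda>x b. x * eT (counit B b)) = t"
  using cT_unfolded by (simp add: lsum_case ractT_eq)

lemma CT_lact: "sw2 (coactT t) (\<lambda>x b. x * eT (counit B (src B r * b))) = eT r * t"
  using canonical_lact_T[of r t] by (simp add: canonical_lact_def lsum_case ractT_eq)

text \<open>Left multiplication by \<open>eT r\<close> is expressed through coaction and counit by
  \<open>CT_lact\<close>. Coassociativity moves it to the coproduct of B, where the corresponding
  axiom of the bialgebroid turns it into left multiplication by t(r).\<close>

lemma CT_takeuchi:
  assumes G: "bT G"
  shows "sw2 (coactT t) (\<lambda>x b. G (eT r * x) b) = sw2 (coactT t) (\<lambda>x b. G x (tgt B r * b))"
proof -
  have inner: "sw2 (comul B b) (\<lambda>b1 b2. b2 * tgt B (counit B (src B r * b1))) = tgt B r * b" for b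
  proof -
    have "bB (\<lambda>b1 b2. b2 * tgt B (counit B b1))"
      by (rule balI) (intro clin_intros clin_comp[OF tgt_B(3)] counit_B(1) |
          simp add: counit_src_tgt tgt_B mult.assoc)+
    from SB_takeuchi[OF this, of b r, symmetric]
    have "sw2 (comul B b) (\<lambda>b1 b2. b2 * tgt B (counit B (src B r * b1)))
       = sw2 (comul B b) (\<lambda>b1 b2. tgt B r * (b2 * tgt B (counit B b1)))"
      by (simp add: mult.assoc)
    also have "\<dots> = tgt B r * sw2 (comul B b) (\<lambda>b1 b2. b2 * tgt B (counit B b1))"
      by (rule clin_sw2_out[symmetric]) (intro clin_intros)
    finally show ?thesis by (simp add: SB_counit)
  qed
  have "sw2 (coactT t) (\<lambda>x b. G (eT r * x) b) =
      sw2 (coactT t) (\<lambda>x b. sw2 (coactT x) (\<lambda>x0 b'. G (x0 * eT (counit B (src B r * b'))) b))"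
    by (rule sw2_cong, subst CT_lact[symmetric], rule clin_sw2_out[OF bal_left[OF G]])
  also have "\<dots> = sw2 (coactT t) (\<lambda>x b. sw2 (comul B b) (\<lambda>b1 b2. G (x * eT (counit B (src B r * b1))) b2))"
  proof (rule CT_coassoc)
    note i = clin_intros bal_clin[OF G] clin_comp[OF clin_eT] clin_comp[OF counit_B(1)]
    note s = mult.assoc[symmetric] counit_src_tgt eT_mult
    show "bT (\<lambda>x b. G (x * eT (counit B (src B r * b))) y)" for y
      by (rule balI) (intro i | simp add: s)+
    show "bB (\<lambda>b. G (x * eT (counit B (src B r * b))))" for x
      by (rule balI) (intro i bal_right[OF G] | simp add: s bal_mid[OF G])+
  qed
  also have "\<dots> = sw2 (coactT t) (\<lambda>x b. sw2 (comul B b) (\<lambda>b1 b2. G x (b2 * tgt B (counit B (src B r * b1)))))"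
    by (simp add: bal_mid[OF G])
  also have "\<dots> = sw2 (coactT t) (\<lambda>x b. G x (sw2 (comul B b) (\<lambda>b1 b2. b2 * tgt B (counit B (src B r * b1)))))"
    by (simp add: clin_sw2_out[OF bal_right[OF G]])
  finally show ?thesis by (simp add: inner)
qed

lemma bT_lmult:
  assumes G: "bT G"
  shows "bT (\<lambda>x b. G (u * x) b)"
  by (rule balI) (intro bal_clin[OF G] clin_intros bal_right[OF G] | simp add: mult.assoc[symmetric] bal_mid[OF G])+

end


section \<open>Left Hopf algebras and module algebras\<close>

locale left_hopf_algebra =
  fixes K :: "('s::complex_algebra, 'k::complex_algebra) bialgebroid"
  assumes left_hopf_K: "left_hopf K"
begin

abbreviation bK :: "('k \<Rightarrow> 'k \<Rightarrow> 'w::complex_vector) \<Rightarrow> bool"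
  where "bK \<equiv> bal (base K) (\<lambda>k r. tgt K r * k) (\<lambda>r k. src K r * k)"

abbreviation bKop :: "('k \<Rightarrow> 'k \<Rightarrow> 'w::complex_vector) \<Rightarrow> bool"
  where "bKop \<equiv> bal (base K) (\<lambda>k r. k * tgt K r) (\<lambda>r k. tgt K r * k)"

lemma left_bialgebroid_K: "left_bialgebroid K"
  using left_hopf_K by (simp add: left_hopf_def)

lemmas lb_unfolded = left_bialgebroid_K[unfolded left_bialgebroid_def]

lemma lbb_null_eq: "lbb_null K = tensor_null (base K) (\<lambda>k r. tgt K r * k) (\<lambda>r k. src K r * k) {0} {0}"
  by (simp add: lcotensor_null_def)

lemma base_K: "1 \<in> base K" "r \<in> base K \<Longrightarrow> r' \<in> base K \<Longrightarrow> r * r' \<in> base K"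
  "counit K k \<in> base K"
  using lb_unfolded by (simp_all add: subalgebra_def)

lemma src_K: "src K 1 = 1" "r \<in> base K \<Longrightarrow> r' \<in> base K \<Longrightarrow> src K (r * r') = src K r * src K r'"
  using lb_unfolded by (simp_all add: alg_map_on_def)

lemma tgt_K: "tgt K 1 = 1" "r \<in> base K \<Longrightarrow> r' \<in> base K \<Longrightarrow> tgt K (r * r') = tgt K r' * tgt K r"
  using lb_unfolded by (simp_all add: anti_alg_map_on_def)

lemma src_tgt_K: "r \<in> base K \<Longrightarrow> r' \<in> base K \<Longrightarrow> src K r * tgt K r' = tgt K r' * src K r"
  using lb_unfolded by blast

lemma clin_counit_K: "clin (counit K)"
proof -
  have "qlinear {0} {0} (counit K)" using lb_unfolded by blast
  then show ?thesis by (simp add: qlinear_def clin_def)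
qed

lemma clin_src_tgt_counit: "clin (\<lambda>k. src K (counit K k))" "clin (\<lambda>k. tgt K (counit K k))"
proof -
  have "alg_map_on (base K) (src K)" "anti_alg_map_on (base K) (tgt K)" using lb_unfolded by blast+
  then show "clin (\<lambda>k. src K (counit K k))" "clin (\<lambda>k. tgt K (counit K k))"
    by (simp_all add: clin_def alg_map_on_def anti_alg_map_on_def base_K
        clin_add[OF clin_counit_K] clin_scale[OF clin_counit_K])
qed

lemma counit_K: "r \<in> base K \<Longrightarrow> r' \<in> base K \<Longrightarrow> counit K (src K r * tgt K r' * k) = r * counit K k * r'"
  "counit K 1 = 1" "counit K (k * k') = counit K (k * src K (counit K k'))"
  using lb_unfolded by blast+

lemma counit_src_tgt_K:
  "r \<in> base K \<Longrightarrow> counit K (src K r * k) = r * counit K k"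
  "r \<in> base K \<Longrightarrow> counit K (tgt K r * k) = counit K k * r"
  using counit_K(1)[of r 1 k] counit_K(1)[of 1 r k] by (simp_all add: src_K tgt_K base_K)

lemma SW_mod: "X \<simeq>\<^bsub>lbb_null K\<^esub> Y \<Longrightarrow> bK F \<Longrightarrow> sw2 X F = sw2 Y F"
  unfolding lbb_null_eq by (rule sw2_eq_tensor0)

lemma clin_SW: "bK F \<Longrightarrow> clin (\<lambda>k. sw2 (comul K k) F)"
proof -
  have "qlinear {0} (lbb_null K) (comul K)" using lb_unfolded by blast
  then show "bK F \<Longrightarrow> clin (\<lambda>k. sw2 (comul K k) F)" unfolding lbb_null_eq by (rule clin_sw2_qlinear0)
qed

lemma SW_act:
  assumes "bK F" "r \<in> base K" "r' \<in> base K"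
  shows "sw2 (comul K (src K r * tgt K r' * k)) F = sw2 (comul K k) (\<lambda>k1 k2. F (src K r * k1) (tgt K r' * k2))"
proof -
  have "comul K (src K r * tgt K r' * k) \<simeq>\<^bsub>lbb_null K\<^esub>
       lsum (comul K k) (\<lambda>(k1, k2). (src K r * k1) \<otimes> (tgt K r' * k2))"
    using lb_unfolded assms(2,3) by blast
  from SW_mod[OF this assms(1)] show ?thesis by (simp add: lsum_case)
qed

lemma SW_src: "bK F \<Longrightarrow> r \<in> base K \<Longrightarrow> sw2 (comul K (src K r * k)) F = sw2 (comul K k) (\<lambda>k1 k2. F (src K r * k1) k2)"
  and SW_tgt: "bK F \<Longrightarrow> r \<in> base K \<Longrightarrow> sw2 (comul K (tgt K r * k)) F = sw2 (comul K k) (\<lambda>k1 k2. F k1 (tgt K r * k2))"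
  using SW_act[of F r 1 k] SW_act[of F 1 r k] by (simp_all add: src_K tgt_K base_K)

lemma SW_one: "bK F \<Longrightarrow> sw2 (comul K 1) F = F 1 1"
  using SW_mod[of "comul K 1" "1 \<otimes> 1" F] lb_unfolded by auto

lemma SW_src_one:
  assumes F: "bK F" and r: "r \<in> base K"
  shows "sw2 (comul K (src K r)) F = F (src K r) 1"
proof -
  have "bK (\<lambda>k1 k2. F (src K r * k1) k2)"
  proof (rule balI)
    show "F (src K r * (tgt K a * x)) y = F (src K r * x) (src K a * y)" if "a \<in> base K" for x a y
      using bal_mid[OF F that, of "src K r * x" y] by (simp add: mult.assoc[symmetric] src_tgt_K r that)
  qed (intro bal_clin[OF F] clin_intros bal_right[OF F])+
  from SW_one[OF this] show ?thesis using SW_src[OF F r, of 1] by simp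
qed

lemma SW_tgt_one:
  assumes F: "bK F" and r: "r \<in> base K"
  shows "sw2 (comul K (tgt K r)) F = F 1 (tgt K r)"
proof -
  have "bK (\<lambda>k1 k2. F k1 (tgt K r * k2))"
  proof (rule balI)
    show "F (tgt K a * x) (tgt K r * y) = F x (tgt K r * (src K a * y))" if "a \<in> base K" for x a y
      using bal_mid[OF F that, of x "tgt K r * y"] by (simp add: mult.assoc[symmetric] src_tgt_K r that)
  qed (intro bal_clin[OF F] clin_intros bal_left[OF F])+
  from SW_one[OF this] show ?thesis using SW_tgt[OF F r, of 1] by simp
qed

lemma SW_coassoc:
  assumes "\<And>y. bK (\<lambda>k1 k2. F k1 k2 y)" "\<And>x. bK (F x)"
  shows "sw2 (comul K k) (\<lambda>k1 k2. sw2 (comul K k1) (\<lambda>k11 k12. F k11 k12 k2)) =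
    sw2 (comul K k) (\<lambda>k1 k2. sw2 (comul K k2) (F k1))"
proof -
  let ?G = "\<lambda>y X. sw2 X (F y)"
  have ax: "lsum (comul K k) (\<lambda>(k1, k2). lsum (comul K k1) (\<lambda>(k11, k12). k11 \<otimes> (k12 \<otimes> k2)))
       \<simeq>\<^bsub>lcotensor_null K (src_left K) (lbb_null K)\<^esub> lsum (comul K k) (\<lambda>(k1, k2). k1 \<otimes> comul K k2)"
    using lb_unfolded by blast
  have "sw2 (lsum (comul K k) (\<lambda>(k1, k2). lsum (comul K k1) (\<lambda>(k11, k12). k11 \<otimes> (k12 \<otimes> k2)))) ?G =
    sw2 (lsum (comul K k) (\<lambda>(k1, k2). k1 \<otimes> comul K k2)) ?G"
  proof (rule sw2_eq_tensor[OF ax[unfolded lcotensor_null_def]])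
    show "bal (base K) (\<lambda>k r. tgt K r * k) (src_left K) ?G"
    proof (rule balI)
      show "clin (?G y)" for y by (rule clin_sw2)
      show "clin (\<lambda>x. ?G x X)" for X
        by (intro clin_intros) (rule bal_left[OF assms(1)])
      show "?G (tgt K r * y) X = ?G y (src_left K r X)" if "r \<in> base K" for X r y
        unfolding src_left_def lsum_case
        by simp (rule sw2_cong, rule bal_mid[OF assms(1) that])
    qed
    show "?G y x = 0" if "x \<in> tensor_null (base K) (\<lambda>k r. tgt K r * k) (\<lambda>r k. src K r * k) {0} {0}" for x y
      using that by (rule sw2_tensor_null[rotated -1]) (auto simp: bal_zero[OF assms(2)] assms(2))
    have "F 0 = (\<lambda>_ _. 0)"
      by (intro ext) (rule bal_zero(1)[OF assms(1)])
    then show "?G x y = 0" if "x \<in> {0}" for x y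
      using that by simp
  qed
  then show ?thesis by (simp add: lsum_case)
qed

lemma SW_counit:
  "sw2 (comul K k) (\<lambda>k1 k2. src K (counit K k1) * k2) = k"
  "sw2 (comul K k) (\<lambda>k1 k2. tgt K (counit K k2) * k1) = k"
  using lb_unfolded by (simp_all add: lsum_case)

lemma SW_takeuchi:
  assumes "bK F" "r \<in> base K"
  shows "sw2 (comul K k) (\<lambda>k1 k2. F (k1 * tgt K r) k2) = sw2 (comul K k) (\<lambda>k1 k2. F k1 (k2 * src K r))"
proof -
  have "lsum (comul K k) (\<lambda>(k1, k2). (k1 * tgt K r) \<otimes> k2)
       \<simeq>\<^bsub>lbb_null K\<^esub> lsum (comul K k) (\<lambda>(k1, k2). k1 \<otimes> (k2 * src K r))"
    using lb_unfolded assms(2) by blast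
  from SW_mod[OF this assms(1)] show ?thesis by (simp add: lsum_case)
qed

lemma SW_mult:
  assumes "bK F"
  shows "sw2 (comul K (k * k')) F =
    sw2 (comul K k) (\<lambda>k1 k2. sw2 (comul K k') (\<lambda>k1' k2'. F (k1 * k1') (k2 * k2')))"
proof -
  have "comul K (k * k') \<simeq>\<^bsub>lbb_null K\<^esub>
       lsum (comul K k) (\<lambda>(k1, k2). lsum (comul K k') (\<lambda>(k1', k2'). (k1 * k1') \<otimes> (k2 * k2')))"
    using lb_unfolded by blast
  from SW_mod[OF this assms] show ?thesis by (simp add: lsum_case)
qed

text \<open>The defining equation \<nu>(k^- \<otimes> k^+) = k \<otimes> 1. It serves to remove the
  translation map that the anti Yetter-Drinfeld condition introduces.\<close>

lemma U_nu:
  assumes "bK G"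
  shows "sw2 (transl_left K k) (\<lambda>p q. sw2 (comul K p) (\<lambda>p1 p2. G p1 (p2 * q))) = G k 1"
proof -
  have "\<exists>X. nu_left K X \<simeq>\<^bsub>lbb_null K\<^esub> Y" for Y
    using qbij_D(1)[of "op_null K" "lbb_null K" "nu_left K"] left_hopf_K
    by (simp add: left_hopf_def lcotensor_null_def op_null_def subspace_tensor_null)
  then have "nu_left K (transl_left K k) \<simeq>\<^bsub>lbb_null K\<^esub> k \<otimes> 1"
    unfolding transl_left_def by (rule someI_ex)
  from SW_mod[OF this assms] show ?thesis by (simp add: nu_left_def lsum_case)
qed

end

section \<open>Module algebras\<close>

locale module_alg = left_hopf_algebra K
  for K :: "('s::complex_algebra, 'k::complex_algebra) bialgebroid" +
  fixes actT :: "'k \<Rightarrow> 't::complex_algebra \<Rightarrow> 't"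
  assumes module_algebra_T: "left_module_algebra K actT"
begin

abbreviation bS :: "('t \<Rightarrow> 't \<Rightarrow> 'w::complex_vector) \<Rightarrow> bool"
  where "bS \<equiv> bal (base K) (\<lambda>t r. actT (tgt K r) t) (\<lambda>r. actT (src K r))"

lemmas ma_unfolded = module_algebra_T[unfolded left_module_algebra_def left_module_on_def]

lemma clin_actT: "clin (actT k)" "clin (\<lambda>k. actT k t)"
  using ma_unfolded by (simp_all add: clin_def qlinear_def)

lemma actT_1 [simp]: "actT 1 t = t" and actT_comp: "actT (k * k') t = actT k (actT k' t)"
  using ma_unfolded by simp_all

lemma actT_mult: "actT k (t * t') = sw2 (comul K k) (\<lambda>k1 k2. actT k1 t * actT k2 t')"
  using ma_unfolded by (simp add: lsum_case)

lemma actT_one: "actT k 1 = actT (src K (counit K k)) 1"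
  using ma_unfolded by blast

lemma actT_mid: "r \<in> base K \<Longrightarrow> actT (tgt K r) t * t' = t * actT (src K r) t'"
  using ma_unfolded by blast

lemma bK_act: "bK (\<lambda>k1 k2. actT k1 t * actT k2 t')"
  by (rule balI) (intro clin_intros clin_actT | simp add: actT_comp actT_mid)+

text \<open>The coproducts of s(r) and t(r) are s(r) \<otimes> 1 and 1 \<otimes> t(r), so s(r)
  reaches only the left factor of a product and t(r) only the right one.\<close>

lemma actT_src_mult: "r \<in> base K \<Longrightarrow> actT (src K r) (t * t') = actT (src K r) t * t'"
  and actT_tgt_mult: "r \<in> base K \<Longrightarrow> actT (tgt K r) (t * t') = t * actT (tgt K r) t'"
  by (simp_all add: actT_mult SW_src_one[OF bK_act] SW_tgt_one[OF bK_act])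

lemma bS_lmult:
  assumes F: "bS F"
  shows "bS (\<lambda>p q. F (u * p) q)"
  by (rule balI) (intro bal_clin[OF F] clin_intros bal_right[OF F] | simp add: actT_tgt_mult[symmetric] bal_mid[OF F])+

lemma bS_rmult:
  assumes F: "bS F"
  shows "bS (\<lambda>p q. F p (q * u))"
  by (rule balI) (intro bal_clin[OF F] clin_intros bal_left[OF F] | simp add: actT_src_mult[symmetric] bal_mid[OF F])+

end


section \<open>Equivariant Galois extensions\<close>

locale equivariant_galois_ext = comodule_alg B ractT coactT + module_alg K actT
  for B :: "('r::complex_algebra, 'b::complex_algebra) bialgebroid"
    and ractT :: "'t::complex_algebra \<Rightarrow> 'r \<Rightarrow> 't"
    and coactT :: "'t \<Rightarrow> ('t \<times> 'b) free"
    and K :: "('s::complex_algebra, 'k::complex_algebra) bialgebroid"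
    and actT :: "'k \<Rightarrow> 't \<Rightarrow> 't" +
  assumes galois: "equivariant_galois B K ractT coactT actT"
begin

abbreviation tr :: "'b \<Rightarrow> ('t \<times> 't) free"
  where "tr \<equiv> transl_can B ractT coactT"

lemma CT_act:
  assumes G: "bT G"
  shows "sw2 (coactT (actT k t)) G = sw2 (coactT t) (\<lambda>x b. G (actT k x) b)"
proof -
  have "coactT (actT k t) \<simeq>\<^bsub>rcotensor_null B ractT {0}\<^esub> lsum (coactT t) (\<lambda>(t0, b). actT k t0 \<otimes> b)"
    using galois by (simp add: equivariant_galois_def rcotensor_T subspace_tensor_null complex_vector.subspace_0)
  from CT_mod[OF this G] show ?thesis by (simp add: lsum_case)
qed

text \<open>The equivariance condition, being imposed for every representative of the coaction, makes
  \<open>K\<close> act by right \<open>R\<close>-linear maps.\<close>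

lemma actT_eT: "actT k (t * eT r) = actT k t * eT r"
proof -
  let ?Z = "rcotensor_null B ractT {0}"
  \<comment> \<open>A null element. Adding it to \<open>coactT 1\<close> gives another
    representative of the same coaction, and acting by \<open>k\<close> on either must give the same
    class.\<close>
  let ?z = "(t * eT r) \<otimes> 1 - t \<otimes> (1 * tgt B r)"
  have z: "?z \<in> ?Z" unfolding rcotensor_T by (rule tensor_null_gens(7)) simp
  have "coactT (actT k 1) \<simeq>\<^bsub>?Z\<^esub> lsum X (\<lambda>(t0, b). actT k t0 \<otimes> b)" if "X \<simeq>\<^bsub>?Z\<^esub> coactT 1" for X
    using galois that by (simp add: equivariant_galois_def)
  note * = this[THEN CT_mod]
  define G :: "'t \<Rightarrow> 'b \<Rightarrow> 't" where "G = (\<lambda>x b. x * eT (counit B b))"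
  have G: "bT G" unfolding G_def
    by (rule balI) (intro clin_intros clin_comp[OF clin_eT] counit_B(1) | simp add: counit_src_tgt eT_mult mult.assoc)+
  have "sw2 (coactT (actT k 1)) G = sw2 (coactT 1 + ?z) (\<lambda>x b. G (actT k x) b)"
    using *[OF _ G, of "coactT 1 + ?z"] z by (simp add: lsum_case)
  then have "sw2 ?z (\<lambda>x b. G (actT k x) b) = 0"
    by (simp add: CT_act[OF G])
  then have "G (actT k (t * eT r)) 1 = G (actT k t) (tgt B r)"
    by simp
  then show ?thesis by (simp add: G_def counit_B(3) counit_src_tgt(4))
qed

text \<open>By \<open>CT_lact\<close>, left multiplication by \<open>eT r\<close> is built from the
  coaction and right multiplication, and K commutes with both.\<close>

lemma actT_eT_left: "actT k (eT r * t) = eT r * actT k t"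
proof -
  have G: "bT (\<lambda>x b. x * eT (counit B (src B r * b)))"
    by (rule balI) (intro clin_intros clin_comp[OF clin_eT] clin_comp[OF counit_B(1)] |
        simp add: counit_src_tgt eT_mult mult.assoc[symmetric])+
  show ?thesis
    by (subst (1 2) CT_lact[symmetric]) (simp add: CT_act[OF G] clin_sw2_out[OF clin_actT(1)] actT_eT)
qed

lemma sw2_can: "sw2 (can coactT X) G = sw2 X (\<lambda>p q. sw2 (coactT q) (\<lambda>q0 q1. G (p * q0) q1))"
  unfolding can_def by (simp add: lsum_case)

lemma can_bij: "qbij (can_dom_null K actT) (rcotensor_null B ractT {0}) (can coactT)"
  using galois by (simp add: equivariant_galois_def)

lemma can_surj: "\<exists>X. can coactT X \<simeq>\<^bsub>rcotensor_null B ractT {0}\<^esub> Y"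
  and can_inj: "can coactT X \<simeq>\<^bsub>rcotensor_null B ractT {0}\<^esub> can coactT X' \<Longrightarrow> X \<simeq>\<^bsub>can_dom_null K actT\<^esub> X'"
  using qbij_D[OF can_bij] by (simp_all add: can_dom_null_def rcotensor_null_def subspace_tensor_null)

lemma P_can:
  assumes G: "bT G"
  shows "sw2 (tr b) (\<lambda>p q. sw2 (coactT q) (\<lambda>q0 q1. G (p * q0) q1)) = G 1 b"
proof -
  have "can coactT (tr b) \<simeq>\<^bsub>rcotensor_null B ractT {0}\<^esub> 1 \<otimes> b"
    unfolding transl_can_def by (rule someI_ex[OF can_surj])
  from CT_mod[OF this G] show ?thesis by (simp add: sw2_can)
qed

lemma P_can_left:
  assumes G: "bT G"
  shows "sw2 (tr b) (\<lambda>p q. sw2 (coactT q) (\<lambda>q0 q1. G (u * p * q0) q1)) = G u b"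
  using P_can[OF bT_lmult[OF G, of u], of b] by (simp add: mult.assoc)

lemma can_eqI:
  assumes "bS F" "\<And>G :: 't \<Rightarrow> 'b \<Rightarrow> complex. bT G \<Longrightarrow>
      sw2 X (\<lambda>p q. sw2 (coactT q) (\<lambda>q0 q1. G (p * q0) q1)) =
      sw2 Y (\<lambda>p q. sw2 (coactT q) (\<lambda>q0 q1. G (p * q0) q1))"
  shows "sw2 X F = sw2 Y F"
proof -
  have "can coactT X \<simeq>\<^bsub>rcotensor_null B ractT {0}\<^esub> can coactT Y"
    unfolding rcotensor_T by (rule eq_tensorI) (simp add: sw2_can assms(2))
  then have "X \<simeq>\<^bsub>can_dom_null K actT\<^esub> Y" by (rule can_inj)
  then show ?thesis unfolding can_dom_null_def using assms(1) by (rule sw2_eq_tensor0)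
qed

text \<open>By left T-linearity of can the element u b_- \<otimes> b_+ has the image u \<otimes> b,
  and by injectivity no other class has it.\<close>

lemma P_unique:
  assumes "bS F" "\<And>G :: 't \<Rightarrow> 'b \<Rightarrow> complex. bT G \<Longrightarrow>
      sw2 X (\<lambda>p q. sw2 (coactT q) (\<lambda>q0 q1. G (p * q0) q1)) = G u b"
  shows "sw2 X F = sw2 (tr b) (\<lambda>p q. F (u * p) q)"
proof -
  have "sw2 X F = sw2 (sw2 (tr b) (\<lambda>p q. (u * p) \<otimes> q)) F"
    by (rule can_eqI[OF assms(1)]) (simp add: assms(2) P_can_left)
  then show ?thesis by simp
qed

text \<open>Both sides of u v_0 v_{1-} \<otimes> v_{1+} = u \<otimes> v have the image u v_0
  \<otimes> v_1 under can. This is the cancellation of a coaction against can^{-1}.\<close>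

lemma P_CT:
  assumes F: "bS F"
  shows "sw2 (coactT v) (\<lambda>v0 v1. sw2 (tr v1) (\<lambda>p q. F (u * v0 * p) q)) = F u v"
proof -
  have "sw2 (sw2 (coactT v) (\<lambda>v0 v1. sw2 (tr v1) (\<lambda>p q. (u * v0 * p) \<otimes> q))) F = sw2 (u \<otimes> v) F"
    by (rule can_eqI[OF F]) (simp add: P_can_left)
  then show ?thesis by simp
qed

lemma clin_P:
  assumes F: "bS F"
  shows "clin (\<lambda>b. sw2 (tr b) F)"
proof (rule clinI)
  fix x y c
  have "sw2 (tr (x + y)) F = sw2 (tr x + tr y) F"
    by (rule can_eqI[OF F]) (simp add: P_can clin_add[OF bal_right])
  then show "sw2 (tr (x + y)) F = sw2 (tr x) F + sw2 (tr y) F" by simp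
  have "sw2 (tr (c *\<^sub>C x)) F = sw2 (c *\<^sub>C tr x) F"
    by (rule can_eqI[OF F]) (simp add: P_can clin_scale[OF bal_right])
  then show "sw2 (tr (c *\<^sub>C x)) F = c *\<^sub>C sw2 (tr x) F" by simp
qed

text \<open>The element b'_- b_- \<otimes> b_+ b'_+ has the image 1 \<otimes> b b' under can: the
  coaction of b_+ b'_+ splits, the sum over b collapses first and then the one over b'.\<close>

lemma P_mult:
  assumes F: "bS F"
  shows "sw2 (tr (b * b')) F = sw2 (tr b') (\<lambda>p' q'. sw2 (tr b) (\<lambda>p q. F (p' * p) (q * q')))"
proof -
  let ?X = "sw2 (tr b') (\<lambda>p' q'. sw2 (tr b) (\<lambda>p q. (p' * p) \<otimes> (q * q')))"
  have "sw2 ?X F = sw2 (tr (b * b')) (\<lambda>p q. F (1 * p) q)"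
  proof (rule P_unique[OF F])
    fix G :: "'t \<Rightarrow> 'b \<Rightarrow> complex" assume G: "bT G"
    \<comment> \<open>The sum over \<open>b\<close> may collapse only inside an expression balanced
      over R; for the coaction of \<open>q'\<close> this is the Takeuchi property.\<close>
    have bal1: "bT (\<lambda>u c. sw2 (coactT q') (\<lambda>q0 q1. G (u * q0) (c * q1)))" for q'
    proof (rule balI)
      have G': "bT (\<lambda>x b. G (u * x) (c * b))" for u c
        by (rule balI) (intro bal_clin[OF G] clin_intros | simp add: mult.assoc[symmetric] bal_mid[OF G])+
      show "sw2 (coactT q') (\<lambda>q0 q1. G (u * eT r * q0) (c * q1)) =
         sw2 (coactT q') (\<lambda>q0 q1. G (u * q0) (c * tgt B r * q1))" for u r c
        using CT_takeuchi[OF G', of q' u r c] by (simp add: mult.assoc)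
    qed (intro bal_clin[OF G] clin_intros)+
    have bal2: "bT (\<lambda>u c. G u (b * c))"
      by (rule balI) (intro bal_clin[OF G] clin_intros bal_left[OF G] | simp add: mult.assoc[symmetric] bal_mid[OF G])+
    have cm: "sw2 (coactT (q * q')) (\<lambda>q0 q1. G (u * q0) q1) =
        sw2 (coactT q) (\<lambda>q0 q1. sw2 (coactT q') (\<lambda>q0' q1'. G (u * (q0 * q0')) (q1 * q1')))" for u q q'
      by (rule CT_mult[OF bT_lmult[OF G]])
    have "sw2 ?X (\<lambda>p q. sw2 (coactT q) (\<lambda>q0 q1. G (p * q0) q1)) =
      sw2 (tr b') (\<lambda>p' q'. sw2 (tr b) (\<lambda>p q. sw2 (coactT q) (\<lambda>q0 q1. sw2 (coactT q') (\<lambda>q0' q1'. G (p' * p * q0 * q0') (q1 * q1')))))"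
      by (simp add: cm) (simp add: mult.assoc)
    also have "\<dots> = sw2 (tr b') (\<lambda>p' q'. sw2 (coactT q') (\<lambda>q0' q1'. G (p' * q0') (b * q1')))"
      by (rule sw2_cong, rule P_can_left[OF bal1])
    also have "\<dots> = G 1 (b * b')" by (rule P_can[OF bal2])
    finally show "sw2 ?X (\<lambda>p q. sw2 (coactT q) (\<lambda>q0 q1. G (p * q0) q1)) = G 1 (b * b')" .
  qed
  then show ?thesis by simp
qed

lemma P_src': "bS F \<Longrightarrow> sw2 (tr (src B r)) F = F 1 (eT r)"
  and P_tgt': "bS F \<Longrightarrow> sw2 (tr (tgt B r)) F = F (eT r) 1"
proof -
  assume F: "bS F"
  have "sw2 (1 \<otimes> eT r) F = sw2 (tr (src B r)) (\<lambda>p q. F (1 * p) q)"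
    by (rule P_unique[OF F]) (simp add: CT_eT)
  then show "sw2 (tr (src B r)) F = F 1 (eT r)" by simp
  have "sw2 (eT r \<otimes> 1) F = sw2 (tr (tgt B r)) (\<lambda>p q. F (1 * p) q)"
  proof (rule P_unique[OF F])
    fix G :: "'t \<Rightarrow> 'b \<Rightarrow> complex" assume G: "bT G"
    show "sw2 (eT r \<otimes> 1) (\<lambda>p q. sw2 (coactT q) (\<lambda>q0 q1. G (p * q0) q1)) = G 1 (tgt B r)"
      using bal_mid[OF G, of r 1 1] by (simp add: CT_one[OF bT_lmult[OF G]])
  qed
  then show "sw2 (tr (tgt B r)) F = F (eT r) 1" by simp
qed

lemma P_one: "bS F \<Longrightarrow> sw2 (tr 1) F = F 1 1"
  using P_src'[of F 1] by (simp add: src_B)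

text \<open>Under can both sides become u (s(r) \<triangleright> 1) \<otimes> b, because s(r) and
  t(r) act alike on 1. As a consequence b_- \<otimes> b_+ may be inserted between two factors that
  are tensored over S.\<close>

lemma P_src_tgt_act:
  assumes F: "bS F" and r: "r \<in> base K"
  shows "sw2 (tr b) (\<lambda>p q. F (u * actT (src K r) p) q) = sw2 (tr b) (\<lambda>p q. F (u * p) (actT (tgt K r) q))"
proof -
  let ?X = "sw2 (tr b) (\<lambda>p q. (u * actT (src K r) p) \<otimes> q)"
  let ?Y = "sw2 (tr b) (\<lambda>p q. (u * p) \<otimes> actT (tgt K r) q)"
  have "sw2 ?X F = sw2 ?Y F"
  proof (rule can_eqI[OF F])
    fix G :: "'t \<Rightarrow> 'b \<Rightarrow> complex" assume G: "bT G"
    have b: "bT (\<lambda>x b. G (u * actT k x) b)" for k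
      by (rule balI) (intro bal_clin[OF G] clin_intros bal_right[OF G] clin_comp[OF clin_actT(1)] |
          simp add: mult.assoc[symmetric] actT_eT bal_mid[OF G])+
    have c: "sw2 (coactT (actT k q)) (\<lambda>q0 q1. G (v * q0) q1) =
        sw2 (coactT q) (\<lambda>q0 q1. G (v * actT k q0) q1)" for v k q
      by (rule CT_act[OF bT_lmult[OF G]])
    have "sw2 ?Y (\<lambda>p q. sw2 (coactT q) (\<lambda>q0 q1. G (p * q0) q1)) =
        sw2 (tr b) (\<lambda>p q. sw2 (coactT q) (\<lambda>q0 q1. G (u * actT (tgt K r) (p * q0)) q1))"
      by (simp add: c actT_tgt_mult[OF r] mult.assoc[symmetric])
    also have "\<dots> = G (u * actT (tgt K r) 1) b" by (rule P_can[OF b])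
    also have "actT (tgt K r) 1 = actT (src K r) 1" using actT_mid[OF r, of 1 1] by simp
    also have "G (u * actT (src K r) 1) b = sw2 (tr b) (\<lambda>p q. sw2 (coactT q) (\<lambda>q0 q1. G (u * actT (src K r) (p * q0)) q1))"
      by (rule P_can[OF b, symmetric])
    also have "\<dots> = sw2 ?X (\<lambda>p q. sw2 (coactT q) (\<lambda>q0 q1. G (p * q0) q1))"
      by (simp add: actT_src_mult[OF r] mult.assoc)
    finally show "sw2 ?X (\<lambda>p q. sw2 (coactT q) (\<lambda>q0 q1. G (p * q0) q1)) =
        sw2 ?Y (\<lambda>p q. sw2 (coactT q) (\<lambda>q0 q1. G (p * q0) q1))" by simp
  qed
  then show ?thesis by simp
qed

lemma bS_mid_mult:
  assumes F: "bS F"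
  shows "bS (\<lambda>p' q'. sw2 (tr b) (\<lambda>p q. F (p' * p) (q * q')))"
proof (rule balI)
  show "sw2 (tr b) (\<lambda>p q. F (actT (tgt K a) x * p) (q * y)) = sw2 (tr b) (\<lambda>p q. F (x * p) (q * actT (src K a) y))"
    if a: "a \<in> base K" for x a y
    using P_src_tgt_act[OF bS_rmult[OF F, of y] a, of b x] by (simp add: actT_mid[OF a])
qed (intro bal_clin[OF F] clin_intros)+

lemma P_mult_tgt: "bS F \<Longrightarrow> sw2 (tr (b * tgt B r)) F = sw2 (tr b) (\<lambda>p q. F (eT r * p) q)"
  and P_mult_src: "bS F \<Longrightarrow> sw2 (tr (b * src B r)) F = sw2 (tr b) (\<lambda>p q. F p (q * eT r))"
  by (simp_all add: P_mult P_tgt'[OF bS_mid_mult] P_src'[OF bS_mid_mult])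

lemma P_tgt_mult: "bS F \<Longrightarrow> sw2 (tr (tgt B r * b)) F = sw2 (tr b) (\<lambda>p q. F (p * eT r) q)"
  by (simp add: P_mult P_tgt' bS_lmult bS_rmult[of "\<lambda>p q. F (x * p) q" for x])

text \<open>Applying the counit of B after can gives b_- b_+ = \<epsilon>(b) in T.\<close>

lemma P_counit:
  assumes "clin g"
  shows "sw2 (tr b) (\<lambda>p q. g (p * q)) = g (eT (counit B b))"
proof -
  have "bT (\<lambda>x b. x * eT (counit B b))"
    by (rule balI) (intro clin_intros clin_comp[OF clin_eT] counit_B(1) | simp add: counit_src_tgt eT_mult mult.assoc)+
  from P_can[OF this, of b]
  have "sw2 (tr b) (\<lambda>p q. sw2 (coactT q) (\<lambda>q0 q1. p * (q0 * eT (counit B q1)))) = eT (counit B b)"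
    by (simp add: mult.assoc)
  moreover have "sw2 (coactT q) (\<lambda>q0 q1. p * (q0 * eT (counit B q1))) = p * q" for p q
    using clin_sw2_out[OF clin_mult(2)[OF clin_id], of p "coactT q" "\<lambda>q0 q1. q0 * eT (counit B q1)"]
    by (simp add: CT_counit)
  ultimately have "sw2 (tr b) (*) = eT (counit B b)" by simp
  then show ?thesis using clin_sw2_out[OF assms, of "tr b" "(*)"] by simp
qed

text \<open>Equivariance of the coaction makes can linear over K for the diagonal action, hence also
  its inverse.\<close>

lemma P_act:
  assumes F: "bS F"
  shows "sw2 (comul K k) (\<lambda>k1 k2. sw2 (tr b) (\<lambda>p q. F (actT k1 (t * p)) (actT k2 q))) =
    sw2 (tr b) (\<lambda>p q. F (actT k t * p) q)"
proof -
  let ?X = "sw2 (comul K k) (\<lambda>k1 k2. sw2 (tr b) (\<lambda>p q. actT k1 (t * p) \<otimes> actT k2 q))"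
  have "sw2 ?X F = sw2 (tr b) (\<lambda>p q. F (actT k t * p) q)"
  proof (rule P_unique[OF F])
    fix G :: "'t \<Rightarrow> 'b \<Rightarrow> complex" assume G: "bT G"
    have b: "bT (\<lambda>x b. G (actT k x) b)"
      by (rule balI) (intro bal_clin[OF G] clin_intros bal_right[OF G] clin_comp[OF clin_actT(1)] |
          simp add: actT_eT bal_mid[OF G])+
    have c: "sw2 (coactT (actT k2 q)) (\<lambda>q0 q1. G (u * q0) q1) =
        sw2 (coactT q) (\<lambda>q0 q1. G (u * actT k2 q0) q1)" for u k2 q
      by (rule CT_act[OF bT_lmult[OF G]])
    have "sw2 ?X (\<lambda>p q. sw2 (coactT q) (\<lambda>q0 q1. G (p * q0) q1)) =
      sw2 (comul K k) (\<lambda>k1 k2. sw2 (tr b) (\<lambda>p q. sw2 (coactT q) (\<lambda>q0 q1. G (actT k1 (t * p) * actT k2 q0) q1)))"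
      by (simp add: c)
    also have "\<dots> = sw2 (tr b) (\<lambda>p q. sw2 (comul K k) (\<lambda>k1 k2. sw2 (coactT q) (\<lambda>q0 q1. G (actT k1 (t * p) * actT k2 q0) q1)))"
      by (rule sw2_commute)
    also have "\<dots> = sw2 (tr b) (\<lambda>p q. sw2 (coactT q) (\<lambda>q0 q1. sw2 (comul K k) (\<lambda>k1 k2. G (actT k1 (t * p) * actT k2 q0) q1)))"
      by (rule sw2_cong, rule sw2_commute)
    also have "\<dots> = sw2 (tr b) (\<lambda>p q. sw2 (coactT q) (\<lambda>q0 q1. G (actT k (t * p * q0)) q1))"
      unfolding actT_mult[of k "t * p" for p]
      by (intro sw2_cong clin_sw2_out[OF bal_left[OF G], symmetric])
    also have "\<dots> = G (actT k t) b" by (rule P_can_left[OF b])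
    finally show "sw2 ?X (\<lambda>p q. sw2 (coactT q) (\<lambda>q0 q1. G (p * q0) q1)) = G (actT k t) b" .
  qed
  then show ?thesis by simp
qed

text \<open>The identity b_- \<otimes> b_{+<0>} \<otimes> b_{+<1>} = b^(1)_- \<otimes> b^(1)_+
  \<otimes> b^(2). A second can^{-1} is inserted by \<open>P_CT\<close>; coassociativity replaces
  the iterated coaction by the coproduct, and \<open>P_can\<close> removes the outer pair.\<close>

lemma P_coact_right:
  assumes bs: "\<And>b. bS (\<lambda>p q. F p q b)" and bt: "\<And>p. bT (F p)"
  shows "sw2 (tr b) (\<lambda>p q. sw2 (coactT q) (\<lambda>q0 q1. F p q0 q1)) =
    sw2 (comul B b) (\<lambda>b1 b2. sw2 (tr b1) (\<lambda>p q. F p q b2))"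
proof -
  define Q where "Q u c b = sw2 (tr c) (\<lambda>p q. F (u * p) q b)" for u c b
  have bs': "bS (\<lambda>p q. F (u * p) q b)" for u b by (rule bS_lmult[OF bs])
  note lins = clin_P[OF bs'] bal_clin[OF bs'] bal_right[OF bt] bal_clin[OF bs]
  have pm: "sw2 (tr (c * tgt B a)) (\<lambda>p q. F (u * p) q y) = sw2 (tr c) (\<lambda>p q. F (u * (eT a * p)) q y)" for c a u y
    by (rule P_mult_tgt[OF bs'])
  have Q1: "bT (\<lambda>x c. Q (p * x) c y)" for p y
    unfolding Q_def
    by (rule balI) (intro clin_intros lins | simp add: pm | simp add: mult.assoc)+
  have Q2: "bB (Q x)" for x
    unfolding Q_def
    by (rule balI) (intro clin_intros lins | simp add: P_mult_src[OF bs'] bal_mid[OF bt])+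
  have "F p q0 q1 = sw2 (coactT q0) (\<lambda>q00 q01. Q (p * q00) q01 q1)" for p q0 q1
    unfolding Q_def by (rule P_CT[OF bs, symmetric])
  then have "sw2 (tr b) (\<lambda>p q. sw2 (coactT q) (\<lambda>q0 q1. F p q0 q1)) =
    sw2 (tr b) (\<lambda>p q. sw2 (coactT q) (\<lambda>q0 q1. sw2 (coactT q0) (\<lambda>q00 q01. Q (p * q00) q01 q1)))"
    by simp
  also have "\<dots> = sw2 (tr b) (\<lambda>p q. sw2 (coactT q) (\<lambda>q0 c. sw2 (comul B c) (\<lambda>c1 c2. Q (p * q0) c1 c2)))"
    by (rule sw2_cong, rule CT_coassoc[OF Q1 Q2])
  also have "\<dots> = sw2 (comul B b) (\<lambda>b1 b2. Q 1 b1 b2)"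
  proof (rule P_can)
    show "bT (\<lambda>x c. sw2 (comul B c) (Q x))"
    proof (rule balI)
      show "clin (\<lambda>x. sw2 (comul B y) (Q x))" for y
        using bal_left[OF Q1[of 1]] by (intro clin_intros) simp
      show "clin (\<lambda>c. sw2 (comul B c) (Q x))" for x by (rule clin_SB[OF Q2])
      show "sw2 (comul B y) (Q (x * eT a)) = sw2 (comul B (y * tgt B a)) (Q x)" for x a y
        unfolding SB_tgt[OF Q2] using bal_mid[OF Q1[of 1]] by (intro sw2_cong) simp
    qed
  qed
  finally show ?thesis by (simp add: Q_def)
qed

text \<open>The identity b_{-<1>} \<otimes> b_{-<0>} \<otimes> b_+ = b^- \<otimes> (b^+)_- \<otimes>
  (b^+)_+. Inserting can^{-1} and the translation map of B at b_+ puts the coactions of b_- and of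
  b_{+<0>} side by side. They multiply to the coaction of b_- b_{+<0>}, and can reduces this to the
  coaction of 1.\<close>

lemma P_coact_left:
  assumes bs: "\<And>c. bS (F c)" and bt: "\<And>q. bT (\<lambda>p c. F c p q)"
  shows "sw2 (tr b) (\<lambda>p q. sw2 (coactT p) (\<lambda>p0 p1. F p1 p0 q)) =
    sw2 (transl_right B b) (\<lambda>c b'. sw2 (tr b') (F c))"
proof -
  define Q where "Q c u b = sw2 (tr b) (\<lambda>p q. F c (u * p) q)" for c u b
  have bs': "bS (\<lambda>p q. F c (u * p) q)" for u c by (rule bS_lmult[OF bs])
  note lins = clin_P[OF bs'] bal_clin[OF bs'] bal_clin[OF bt] bal_clin[OF bs]
  have fm: "F (c * tgt B r) p = F c (p * eT r)" for c r p
    using bal_mid[OF bt] by (intro ext) simp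
  have Qop: "bOp (\<lambda>c b. Q c u b)" for u
    unfolding Q_def
    by (rule balI) (intro clin_intros lins | simp add: P_tgt_mult[OF bs'] fm mult.assoc)+
  have Qu: "clin (\<lambda>u. Q c u b)" for c b
    unfolding Q_def by (intro clin_intros lins)
  \<comment> \<open>Chosen such that \<open>F c p q\<close> becomes \<open>V\<close> evaluated at
    the twofold coaction of \<open>q\<close>, with \<open>p\<close> and \<open>c\<close> multiplied
    on from the left.\<close>
  define V where "V u c b = sw2 (transl_right B b) (\<lambda>c' b'. Q (c * c') u b')" for u c b
  have Qop': "bOp (\<lambda>c' b. Q (c * c') u b)" for c u
    by (rule balI) (intro clin_intros bal_clin[OF Qop] bal_right[OF Qop] | simp add: mult.assoc[symmetric] bal_mid[OF Qop])+
  have Veq: "V (u * eT r) c y = V u (c * tgt B r) y" for u r c y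
  proof -
    have "V u (c * tgt B r) y = sw2 (transl_right B y) (\<lambda>c' b'. Q (c * c') u (b' * tgt B r))"
      unfolding V_def by (rule V_tgt[OF Qop])
    also have "\<dots> = V (u * eT r) c y"
      unfolding V_def Q_def by (simp add: P_mult_tgt[OF bs'] mult.assoc)
    finally show ?thesis by simp
  qed
  have V1: "bT (\<lambda>x c. V (p * x) (d * c) y)" for p d y
  proof (rule balI)
    show "V (p * (x * eT a)) (d * c) y = V (p * x) (d * (c * tgt B a)) y" for x a c
      using Veq[of "p * x" a "d * c" y] by (simp add: mult.assoc)
  qed (unfold V_def, (intro clin_intros bal_clin[OF Qop] clin_comp[OF Qu])+)
  have V2: "bB (\<lambda>c. V u (d * c))" for u d
  proof (rule balI)
    show "V u (d * (c * src B a)) y = V u (d * c) (y * tgt B a)" for c a y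
      unfolding V_def by (subst V_mult_tgt[OF Qop']) (simp add: mult.assoc)
    show "clin (V u (d * c))" for c
      unfolding V_def by (rule clin_V[OF Qop'])
  qed (unfold V_def, intro clin_intros bal_clin[OF Qop])
  have V1': "bT (\<lambda>x c. V x c y)" for y using V1[of 1 1 y] by simp
  have V2': "bB (V u)" for u using V2[of u 1] by simp
  have "F c p q = sw2 (coactT q) (\<lambda>x y. sw2 (coactT x) (\<lambda>x0 x1. V (p * x0) (c * x1) y))" for c p q
  proof -
    have "F c p q = sw2 (coactT q) (\<lambda>q0 q1. Q c (p * q0) q1)"
      unfolding Q_def by (rule P_CT[OF bs, symmetric])
    also have "\<dots> = sw2 (coactT q) (\<lambda>q0 q1. sw2 (comul B q1) (\<lambda>b1 b2. V (p * q0) (c * b1) b2))"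
      unfolding V_def by (rule sw2_cong, rule V_SB[OF Qop, symmetric])
    also have "\<dots> = sw2 (coactT q) (\<lambda>x y. sw2 (coactT x) (\<lambda>x0 x1. V (p * x0) (c * x1) y))"
      by (rule CT_coassoc[OF V1 V2, symmetric])
    finally show ?thesis .
  qed
  then have "sw2 (tr b) (\<lambda>p q. sw2 (coactT p) (\<lambda>p0 p1. F p1 p0 q)) =
    sw2 (tr b) (\<lambda>p q. sw2 (coactT p) (\<lambda>p0 p1. sw2 (coactT q) (\<lambda>x y. sw2 (coactT x) (\<lambda>x0 x1. V (p0 * x0) (p1 * x1) y))))"
    by simp
  also have "\<dots> = sw2 (tr b) (\<lambda>p q. sw2 (coactT q) (\<lambda>x y. sw2 (coactT (p * x)) (\<lambda>z c. V z c y)))"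
    unfolding CT_mult[OF V1'] by (rule sw2_cong, rule sw2_commute)
  also have "\<dots> = sw2 (coactT 1) (\<lambda>z c. V z c b)"
  proof (rule P_can)
    show "bT (\<lambda>x y. sw2 (coactT x) (\<lambda>z c. V z c y))"
    proof (rule balI)
      show "clin (\<lambda>x. sw2 (coactT x) (\<lambda>z c. V z c y))" for y by (rule clin_CT[OF V1'])
      show "clin (\<lambda>y. sw2 (coactT x) (\<lambda>z c. V z c y))" for x by (intro clin_intros bal_right[OF V2'])
      show "sw2 (coactT (x * eT a)) (\<lambda>z c. V z c y) = sw2 (coactT x) (\<lambda>z c. V z c (y * tgt B a))" for x a y
        by (simp add: CT_ract[OF V1'] bal_mid[OF V2'])
    qed
  qed
  also have "\<dots> = V 1 1 b" by (rule CT_one[OF V1'])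
  finally show ?thesis by (simp add: V_def Q_def)
qed

end


section \<open>Balanced multilinear functions on lists\<close>

text \<open>The linear maps out of the n-th tensor power. Lists of other lengths are left
  unconstrained, so functions that agree at length n are interchangeable, whatever default values
  they take elsewhere.\<close>

definition mbal ::
    "'a set \<Rightarrow> ('x::complex_vector \<Rightarrow> 'a \<Rightarrow> 'x) \<Rightarrow> ('a \<Rightarrow> 'x \<Rightarrow> 'x) \<Rightarrow> nat \<Rightarrow>
     ('x list \<Rightarrow> 'w::complex_vector) \<Rightarrow> bool"
  where "mbal A ra la n G \<longleftrightarrow>
    (\<forall>us vs. Suc (length us + length vs) = n \<longrightarrow> clin (\<lambda>x. G (us @ x # vs))) \<and>
    (\<forall>us x a y vs. a \<in> A \<longrightarrow> Suc (Suc (length us + length vs)) = n \<longrightarrow>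
       G (us @ ra x a # y # vs) = G (us @ x # la a y # vs))"

lemma mbalI:
  assumes "\<And>us vs. Suc (length us + length vs) = n \<Longrightarrow> clin (\<lambda>x. G (us @ x # vs))"
    "\<And>us x a y vs. a \<in> A \<Longrightarrow> Suc (Suc (length us + length vs)) = n \<Longrightarrow>
       G (us @ ra x a # y # vs) = G (us @ x # la a y # vs)"
  shows "mbal A ra la n G"
  using assms by (simp add: mbal_def)

lemma mbal_clin: "mbal A ra la n G \<Longrightarrow> Suc (length us + length vs) = n \<Longrightarrow> clin (\<lambda>x. G (us @ x # vs))"
  and mbal_mid: "mbal A ra la n G \<Longrightarrow> a \<in> A \<Longrightarrow> Suc (Suc (length us + length vs)) = n \<Longrightarrow>
    G (us @ ra x a # y # vs) = G (us @ x # la a y # vs)"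
  by (simp_all add: mbal_def)

lemma mbal_cong: "(\<And>ts. length ts = n \<Longrightarrow> G ts = H ts) \<Longrightarrow> mbal A ra la n G = mbal A ra la n H"
  by (simp add: mbal_def)

lemma mbal_transfer:
  "mbal A ra la n H \<Longrightarrow> (\<And>ts. length ts = n \<Longrightarrow> G ts = H ts) \<Longrightarrow> mbal A ra la n G"
  using mbal_cong[of n G H] by blast

lemma mbal_sw2: "(\<And>a b. mbal A ra la n (F a b)) \<Longrightarrow> mbal A ra la n (\<lambda>ts. sw2 X (\<lambda>a b. F a b ts))"
  by (rule mbalI) (intro clin_sw2_in sw2_cong mbal_clin mbal_mid | assumption)+

lemma mbal_append_left:
  assumes "mbal A ra la (p + length ys) G"
  shows "mbal A ra la p (\<lambda>xs. G (xs @ ys))"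
  using assms by (intro mbalI) (simp_all add: mbal_clin mbal_mid)

lemma mbal_append_right:
  assumes "mbal A ra la (length xs + q) G"
  shows "mbal A ra la q (\<lambda>ys. G (xs @ ys))"
proof (rule mbalI)
  show "clin (\<lambda>x. G (xs @ us @ x # vs))" if "Suc (length us + length vs) = q" for us vs
    using mbal_clin[OF assms, of "xs @ us" vs] that by simp
  show "G (xs @ us @ ra x a # y # vs) = G (xs @ us @ x # la a y # vs)"
    if "a \<in> A" "Suc (Suc (length us + length vs)) = q" for us x a y vs
    using mbal_mid[OF assms that(1), of "xs @ us" vs] that by simp
qed

text \<open>Once both blocks are treated, only the relation across the seam between them
  remains.\<close>

lemma mbal_appendI:
  assumes l: "\<And>ys. length ys = q \<Longrightarrow> mbal A ra la p (\<lambda>xs. G (xs @ ys))"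
    and r: "\<And>xs. length xs = p \<Longrightarrow> mbal A ra la q (\<lambda>ys. G (xs @ ys))"
    and m: "\<And>us x a y vs. a \<in> A \<Longrightarrow> Suc (length us) = p \<Longrightarrow> Suc (length vs) = q \<Longrightarrow>
       G (us @ ra x a # y # vs) = G (us @ x # la a y # vs)"
  shows "mbal A ra la (p + q) G"
proof (rule mbalI)
  have td: "take p us @ drop p us @ zs = us @ zs" for us zs :: "'a list"
    by (simp flip: append_assoc)
  fix us vs :: "'a list" assume len: "Suc (length us + length vs) = p + q"
  show "clin (\<lambda>x. G (us @ x # vs))"
  proof (cases "length us < p")
    case True
    let ?i = "p - Suc (length us)"
    have "clin (\<lambda>x. G ((us @ x # take ?i vs) @ drop ?i vs))"
      by (rule mbal_clin[OF l]) (use len True in auto)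
    then show ?thesis by simp
  next
    case False
    have "clin (\<lambda>x. G (take p us @ (drop p us @ x # vs)))"
      by (rule mbal_clin[OF r]) (use len False in auto)
    then show ?thesis by (simp add: td)
  qed
next
  have td: "take p us @ drop p us @ zs = us @ zs" for us zs :: "'a list"
    by (simp flip: append_assoc)
  fix us vs :: "'a list" and x a y
  assume a: "a \<in> A" and len: "Suc (Suc (length us + length vs)) = p + q"
  consider "Suc (length us) < p" | "Suc (length us) = p" | "length us \<ge> p" by linarith
  then show "G (us @ ra x a # y # vs) = G (us @ x # la a y # vs)"
  proof cases
    case 1
    let ?i = "p - Suc (Suc (length us))"
    have "G ((us @ ra x a # y # take ?i vs) @ drop ?i vs) = G ((us @ x # la a y # take ?i vs) @ drop ?i vs)"
      by (rule mbal_mid[OF l a]) (use len 1 in auto)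
    then show ?thesis by simp
  next
    case 2 then show ?thesis using len by (intro m a) auto
  next
    case 3
    have "G (take p us @ (drop p us @ ra x a # y # vs)) = G (take p us @ (drop p us @ x # la a y # vs))"
      by (rule mbal_mid[OF r a]) (use len 3 in auto)
    then show ?thesis by (simp add: td)
  qed
qed

lemma mbal_1: "mbal A ra la (Suc 0) G \<longleftrightarrow> clin (\<lambda>x. G [x])"
  by (auto simp: mbal_def)

lemma mbal_ConsI:
  assumes "\<And>ys. length ys = n \<Longrightarrow> clin (\<lambda>x. G (x # ys))" "\<And>x. mbal A ra la n (\<lambda>ys. G (x # ys))"
    "\<And>x a y ys. a \<in> A \<Longrightarrow> Suc (length ys) = n \<Longrightarrow> G (ra x a # y # ys) = G (x # la a y # ys)"
  shows "mbal A ra la (Suc n) G"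
proof -
  have "mbal A ra la (Suc 0 + n) G"
  proof (rule mbal_appendI)
    show "mbal A ra la (Suc 0) (\<lambda>xs. G (xs @ ys))" if "length ys = n" for ys
      using assms(1)[OF that] by (simp add: mbal_1)
    show "mbal A ra la n (\<lambda>ys. G (xs @ ys))" if "length xs = Suc 0" for xs
      using that assms(2) by (cases xs) simp_all
    show "G (us @ ra x a # y # vs) = G (us @ x # la a y # vs)"
      if "a \<in> A" "Suc (length us) = Suc 0" "Suc (length vs) = n" for us x a y vs
      using that assms(3) by simp
  qed
  then show ?thesis by simp
qed

lemma mbal_ConsD:
  assumes "mbal A ra la (Suc n) G"
  shows "length ys = n \<Longrightarrow> clin (\<lambda>x. G (x # ys))" "mbal A ra la n (\<lambda>ys. G (x # ys))"
    "a \<in> A \<Longrightarrow> Suc (length ys) = n \<Longrightarrow> G (ra x a # y # ys) = G (x # la a y # ys)"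
  using mbal_clin[OF assms, of "[]"] mbal_append_right[of A ra la "[x]" n G] mbal_mid[OF assms, of _ "[]"] assms
  by simp_all

lemma mbal_snocD:
  assumes "mbal A ra la (Suc n) G"
  shows "length xs = n \<Longrightarrow> clin (\<lambda>x. G (xs @ [x]))" "mbal A ra la n (\<lambda>xs. G (xs @ [x]))"
  using mbal_clin[OF assms, of _ "[]"] mbal_append_left[of A ra la n "[x]" G] assms
  by simp_all

lemma on_length_gen [simp]: "on_length n (gen ts) G = (if length ts = n then G ts else 0)"
  by (simp add: on_length_def)

lemma clin_on_length: "clin (\<lambda>X. on_length n X G)"
  unfolding on_length_def by (rule clin_lsum)

lemma on_length_cong: "(\<And>ts. length ts = n \<Longrightarrow> G ts = H ts) \<Longrightarrow> on_length n X G = on_length n X H"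
  unfolding on_length_def by (rule lsum_cong) simp

lemma on_length_tpow_null:
  assumes G: "mbal A ra la n G" and X: "X \<in> tpow_null A ra la n"
  shows "on_length n X G = 0"
  using X unfolding tpow_null_def
proof (rule clin_vanish_span[OF clin_on_length, rotated])
  fix x
  assume "x \<in> {gen xs | xs. length xs \<noteq> n} \<union>
     {gen (us @ (x + x') # vs) - gen (us @ x # vs) - gen (us @ x' # vs) | us x x' vs. True} \<union>
     {gen (us @ (c *\<^sub>C x) # vs) - c *\<^sub>C gen (us @ x # vs) | us c x vs. True} \<union>
     {gen (us @ ra x a # y # vs) - gen (us @ x # la a y # vs) | us x a y vs. a \<in> A}"
  then show "on_length n x G = 0"
    by (elim UnE CollectE exE conjE)
      (auto simp: clin_diff[OF clin_on_length] clin_scale[OF clin_on_length]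
        clin_add[OF mbal_clin[OF G]] clin_scale[OF mbal_clin[OF G]] mbal_mid[OF G])
qed

lemma tpow_null_gens:
  shows "length xs \<noteq> n \<Longrightarrow> gen xs \<in> tpow_null A ra la n"
    "gen (us @ (x + x') # vs) - gen (us @ x # vs) - gen (us @ x' # vs) \<in> tpow_null A ra la n"
    "gen (us @ (c *\<^sub>C x) # vs) - c *\<^sub>C gen (us @ x # vs) \<in> tpow_null A ra la n"
    "a \<in> A \<Longrightarrow> gen (us @ ra x a # y # vs) - gen (us @ x # la a y # vs) \<in> tpow_null A ra la n"
  unfolding tpow_null_def by (rule complex_vector.span_base; blast)+

lemma mbal_of_functional:
  assumes \<phi>: "clin \<phi>" "\<And>z. z \<in> tpow_null A ra la n \<Longrightarrow> \<phi> z = 0"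
  shows "mbal A ra la n (\<lambda>ts. \<phi> (gen ts))" "\<phi> X = on_length n X (\<lambda>ts. \<phi> (gen ts))"
proof -
  note s = clin_diff[OF \<phi>(1)] clin_scale[OF \<phi>(1)]
  show "mbal A ra la n (\<lambda>ts. \<phi> (gen ts))"
  proof (intro mbalI clinI)
    fix us vs x x' y c
    show "\<phi> (gen (us @ (x + x') # vs)) = \<phi> (gen (us @ x # vs)) + \<phi> (gen (us @ x' # vs))"
      using \<phi>(2)[OF tpow_null_gens(2)[of us x x' vs]] by (simp add: s diff_eq_eq add.commute)
    show "\<phi> (gen (us @ (c *\<^sub>C x) # vs)) = c *\<^sub>C \<phi> (gen (us @ x # vs))"
      using \<phi>(2)[OF tpow_null_gens(3)[of us c x vs]] by (simp add: s)
    show "\<phi> (gen (us @ ra x a # y # vs)) = \<phi> (gen (us @ x # la a y # vs))" if "a \<in> A" for a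
      using \<phi>(2)[OF tpow_null_gens(4)[OF that, of us ra x y vs la]] by (simp add: s)
  qed
  show "\<phi> X = on_length n X (\<lambda>ts. \<phi> (gen ts))"
    unfolding on_length_def clin_free[OF \<phi>(1), of X]
    by (rule lsum_cong) (simp add: \<phi>(2) tpow_null_gens(1))
qed


section \<open>The diagonal action on tensor powers\<close>

context module_alg
begin

abbreviation mS :: "nat \<Rightarrow> ('t list \<Rightarrow> 'w::complex_vector) \<Rightarrow> bool"
  where "mS \<equiv> mbal (base K) (\<lambda>t r. actT (tgt K r) t) (\<lambda>r. actT (src K r))"

text \<open>At the empty list \<open>length ts - 1\<close> truncates to 0 and the single factor of K
  is dropped. Rules that involve \<open>k\<close>, such as linearity in it, therefore assume a
  nonempty list.\<close>

definition diagT :: "'k \<Rightarrow> 't list \<Rightarrow> ('t list \<Rightarrow> 'w::complex_vector) \<Rightarrow> 'w"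
  where "diagT k ts G = lsum (comul_iter K (length ts - 1) k) (\<lambda>ks. G (map2 actT ks ts))"

lemma diagT_single [simp]: "diagT k [x] G = G [actT k x]"
  by (simp add: diagT_def)

lemma diagT_Cons:
  "ys \<noteq> [] \<Longrightarrow> diagT k (x # ys) G = sw2 (comul K k) (\<lambda>k1 k2. diagT k2 ys (\<lambda>zs. G (actT k1 x # zs)))"
  by (cases ys) (simp_all add: diagT_def lsum_case)

lemma diagT_zero [simp]: "diagT k ts (\<lambda>zs. 0) = 0"
  by (simp add: diagT_def)

lemma diagT_cong:
  "(\<And>zs. length zs = length ts \<Longrightarrow> G zs = H zs) \<Longrightarrow> diagT k ts G = diagT k ts H"
proof (induction ts arbitrary: k G H)
  case Nil then show ?case by (simp add: diagT_def)
next
  case (Cons x ts)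
  show ?case
  proof (cases "ts = []")
    case True then show ?thesis using Cons.prems by simp
  next
    case False
    then show ?thesis
      unfolding diagT_Cons[OF False]
      by (intro sw2_cong Cons.IH Cons.prems) simp
  qed
qed

lemma diagT_sw2: "diagT k ts (\<lambda>zs. sw2 X (\<lambda>a b. F a b zs)) = sw2 X (\<lambda>a b. diagT k ts (F a b))"
  unfolding diagT_def by (rule sw2_lsum_commute[symmetric])

lemma diagT_commute: "diagT k ts (\<lambda>zs. diagT k' us (F zs)) = diagT k' us (\<lambda>ws. diagT k ts (\<lambda>zs. F zs ws))"
  unfolding diagT_def by (rule lsum_commute)

lemma diagT_if:
  "diagT k ts F = diagT k ts (\<lambda>zs. if length zs = length ts then F zs else 0)"
  by (rule diagT_cong) simp

lemma clin_diagT_in: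
  assumes "\<And>zs. length zs = length ts \<Longrightarrow> clin (\<lambda>y. F y zs)"
  shows "clin (\<lambda>y. diagT k ts (F y))"
proof -
  have "clin (\<lambda>y. if length zs = length ts then F y zs else 0)" for zs
    by (cases "length zs = length ts") (simp_all add: assms clin_0)
  then have "clin (\<lambda>y. diagT k ts (\<lambda>zs. if length zs = length ts then F y zs else 0))"
    unfolding diagT_def by (intro clin_lsum_in)
  then show ?thesis by (subst diagT_if)
qed

lemma mbal_diagT_in:
  assumes "\<And>zs. length zs = length ts \<Longrightarrow> mbal A ra la n (\<lambda>y. F y zs)"
  shows "mbal A ra la n (\<lambda>y. diagT k ts (F y))"
proof (rule mbalI)
  show "clin (\<lambda>x. diagT k ts (F (us @ x # vs)))" if "Suc (length us + length vs) = n" for us vs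
    by (rule clin_diagT_in, rule mbal_clin[OF assms that])
  show "diagT k ts (F (us @ ra x a # y # vs)) = diagT k ts (F (us @ x # la a y # vs))"
    if "a \<in> A" "Suc (Suc (length us + length vs)) = n" for us x a y vs
    by (rule diagT_cong, rule mbal_mid[OF assms that])
qed

text \<open>One simultaneous induction: linearity and the rule for s(r) on the tail make the
  expression balanced over S at the first split, and only then may the coproduct of K be evaluated
  at it to give the rules for the longer list.\<close>

lemma diagT_aux:
  assumes "mS (length ts) G" "ts \<noteq> []"
  shows "clin (\<lambda>k. diagT k ts G) \<and>
    (\<forall>r\<in>base K. \<forall>k. diagT (src K r * k) ts G = diagT k ts (\<lambda>zs. G (actT (src K r) (hd zs) # tl zs))) \<and>
    (\<forall>r\<in>base K. \<forall>k. diagT (tgt K r * k) ts G = diagT k ts (\<lambda>zs. G (butlast zs @ [actT (tgt K r) (last zs)]))) \<and>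
    (\<forall>x ys. ts = x # ys \<longrightarrow> ys \<noteq> [] \<longrightarrow> bK (\<lambda>k1 k2. diagT k2 ys (\<lambda>zs. G (actT k1 x # zs))))"
  using assms
proof (induction ts arbitrary: G)
  case Nil then show ?case by simp
next
  case (Cons y ts)
  show ?case
  proof (cases "ts = []")
    case True
    then have "clin (\<lambda>x. G [x])" using Cons.prems by (simp add: mbal_1)
    then have "clin (\<lambda>k. G [actT k y])" by (rule clin_comp) (rule clin_actT)
    then show ?thesis using True by (simp add: actT_comp)
  next
    case False
    have mc: "mS (Suc (length ts)) G" using Cons.prems by simp
    have m: "mS (length ts) (\<lambda>zs. G (u # zs))" for u by (rule mbal_ConsD(2)[OF mc])
    note IH = Cons.IH[OF m False]
    have bK: "bK (\<lambda>k1 k2. diagT k2 ts (\<lambda>zs. G (actT k1 y # zs)))"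
    proof (rule balI)
      show "clin (\<lambda>k1. diagT k2 ts (\<lambda>zs. G (actT k1 y # zs)))" for k2
        by (rule clin_diagT_in, rule clin_comp[OF mbal_ConsD(1)[OF mc] clin_actT(2)])
      show "clin (\<lambda>k2. diagT k2 ts (\<lambda>zs. G (actT k1 y # zs)))" for k1
        using IH by blast
      show "diagT k2 ts (\<lambda>zs. G (actT (tgt K a * k1) y # zs)) = diagT (src K a * k2) ts (\<lambda>zs. G (actT k1 y # zs))"
        if a: "a \<in> base K" for k1 a k2
      proof -
        have "diagT (src K a * k2) ts (\<lambda>zs. G (actT k1 y # zs)) =
            diagT k2 ts (\<lambda>zs. G (actT k1 y # actT (src K a) (hd zs) # tl zs))"
          using IH a by blast
        also have "\<dots> = diagT k2 ts (\<lambda>zs. G (actT (tgt K a * k1) y # zs))"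
        proof (rule diagT_cong)
          fix zs :: "'t list" assume "length zs = length ts"
          then obtain z zs' where "zs = z # zs'" "Suc (length zs') = length ts"
            using False by (cases zs) auto
          then show "G (actT k1 y # actT (src K a) (hd zs) # tl zs) = G (actT (tgt K a * k1) y # zs)"
            using mbal_ConsD(3)[OF mc a, of zs' "actT k1 y" z] by (simp add: actT_comp)
        qed
        finally show ?thesis by simp
      qed
    qed
    have 1: "clin (\<lambda>k. diagT k (y # ts) G)"
      unfolding diagT_Cons[OF False] by (rule clin_SW[OF bK])
    have 2: "diagT (src K r * k) (y # ts) G = diagT k (y # ts) (\<lambda>zs. G (actT (src K r) (hd zs) # tl zs))"
      if "r \<in> base K" for r k
      unfolding diagT_Cons[OF False] SW_src[OF bK that] by (simp add: actT_comp)
    have 3: "diagT (tgt K r * k) (y # ts) G = diagT k (y # ts) (\<lambda>zs. G (butlast zs @ [actT (tgt K r) (last zs)]))"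
      if r: "r \<in> base K" for r k
    proof -
      have "diagT (tgt K r * k2) ts (\<lambda>zs. G (actT k1 y # zs)) =
        diagT k2 ts (\<lambda>zs. G (actT k1 y # butlast zs @ [actT (tgt K r) (last zs)]))" for k1 k2
        using IH r by blast
      also have "\<dots> k1 k2 = diagT k2 ts (\<lambda>zs. G (butlast (actT k1 y # zs) @ [actT (tgt K r) (last (actT k1 y # zs))]))" for k1 k2
        by (rule diagT_cong) (use False in auto)
      finally show ?thesis
        unfolding diagT_Cons[OF False] SW_tgt[OF bK r] by simp
    qed
    show ?thesis using 1 2 3 bK by simp
  qed
qed

lemma clin_diagT: "mS (length ts) G \<Longrightarrow> ts \<noteq> [] \<Longrightarrow> clin (\<lambda>k. diagT k ts G)"
  and diagT_src: "mS (length ts) G \<Longrightarrow> ts \<noteq> [] \<Longrightarrow> r \<in> base K \<Longrightarrow>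
    diagT (src K r * k) ts G = diagT k ts (\<lambda>zs. G (actT (src K r) (hd zs) # tl zs))"
  and diagT_tgt: "mS (length ts) G \<Longrightarrow> ts \<noteq> [] \<Longrightarrow> r \<in> base K \<Longrightarrow>
    diagT (tgt K r * k) ts G = diagT k ts (\<lambda>zs. G (butlast zs @ [actT (tgt K r) (last zs)]))"
  and bK_diagT_Cons: "mS (Suc (length ys)) G \<Longrightarrow> ys \<noteq> [] \<Longrightarrow>
    bK (\<lambda>k1 k2. diagT k2 ys (\<lambda>zs. G (actT k1 x # zs)))"
  using diagT_aux[of ts G] diagT_aux[of "x # ys" G] by auto

end


section \<open>Multiplying adjacent entries of a list and inserting units\<close>

fun merge_at :: "nat \<Rightarrow> 'a::times list \<Rightarrow> 'a list"
  where
    "merge_at 0 (a # b # ts) = a * b # ts"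
  | "merge_at (Suc i) (a # ts) = a # merge_at i ts"
  | "merge_at i ts = ts"

fun unit_at :: "nat \<Rightarrow> 'a::one list \<Rightarrow> 'a list"
  where
    "unit_at 0 (a # ts) = a # 1 # ts"
  | "unit_at (Suc i) (a # ts) = a # unit_at i ts"
  | "unit_at i ts = ts"

lemma length_merge_at [simp]: "Suc i < length ts \<Longrightarrow> length (merge_at i ts) = length ts - 1"
  by (induction i ts rule: merge_at.induct) auto

lemma length_unit_at [simp]: "i < length ts \<Longrightarrow> length (unit_at i ts) = Suc (length ts)"
  by (induction i ts rule: unit_at.induct) auto

text \<open>Replaces the \<open>take\<close> and \<open>drop\<close> expression of
  \<open>face\<close> by a recursive one, so that the simplicial identities follow by induction on
  the position.\<close>

lemma merge_at_eq:
  "Suc i < length ts \<Longrightarrow> take i ts @ (ts ! i * ts ! (i + 1)) # drop (i + 2) ts = merge_at i ts"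
  by (induction i ts rule: merge_at.induct) auto

lemma unit_at_eq: "i < length ts \<Longrightarrow> take (i + 1) ts @ 1 # drop (i + 1) ts = unit_at i ts"
  by (induction i ts rule: unit_at.induct) auto

lemma merge_merge:
  "i < j \<Longrightarrow> Suc j < length ts \<Longrightarrow>
    merge_at i (merge_at j ts) = merge_at (j - 1) (merge_at i (ts :: 'a::semigroup_mult list))"
proof (induction i arbitrary: j ts)
  case 0
  then obtain a b c us where ts: "ts = a # b # c # us"
    by (cases ts; cases "tl ts"; cases "tl (tl ts)") auto
  from 0 obtain j' where j: "j = Suc j'" by (cases j) auto
  show ?case unfolding ts j by (cases j') (auto simp: mult.assoc)
next
  case (Suc i)
  obtain a us j' where "ts = a # us" "j = Suc j'" "i < j'" "Suc j' < length us"
    using Suc.prems by (cases ts; cases j) auto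
  then show ?case using Suc.IH[of j' us] by (cases j') auto
qed

lemma unit_unit: "i \<le> j \<Longrightarrow> j < length ts \<Longrightarrow> unit_at i (unit_at j ts) = unit_at (Suc j) (unit_at i ts)"
proof (induction i arbitrary: j ts)
  case 0 then show ?case by (cases ts; cases j) auto
next
  case (Suc i)
  obtain a us j' where "ts = a # us" "j = Suc j'" using Suc.prems by (cases ts; cases j) auto
  then show ?case using Suc by auto
qed

lemma merge_unit_less:
  "i < j \<Longrightarrow> j < length ts \<Longrightarrow> merge_at i (unit_at j ts) = unit_at (j - 1) (merge_at i ts)"
proof (induction i arbitrary: j ts)
  case 0
  then obtain a b us j' where "ts = a # b # us" "j = Suc j'"
    by (cases ts; cases "tl ts"; cases j) auto
  then show ?case by (cases j') auto
next
  case (Suc i)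
  obtain a us j' where "ts = a # us" "j = Suc j'" "i < j'" "j' < length us"
    using Suc.prems by (cases ts; cases j) auto
  then show ?case using Suc.IH[of j' us] by (cases j') auto
qed

lemma merge_unit_same:
  "j < length ts \<Longrightarrow> Suc i < Suc (length ts) \<Longrightarrow> i = j \<or> i = Suc j \<Longrightarrow>
    merge_at i (unit_at j ts) = (ts :: 'a::monoid_mult list)"
proof (induction j arbitrary: i ts)
  case 0 then show ?case by (cases ts; cases "tl ts") auto
next
  case (Suc j)
  obtain a us i' where "ts = a # us" "i = Suc i'" using Suc.prems by (cases ts; cases i) auto
  then show ?case using Suc by auto
qed

lemma merge_unit_greater:
  "Suc j < i \<Longrightarrow> i < length ts \<Longrightarrow> merge_at i (unit_at j ts) = unit_at j (merge_at (i - 1) ts)"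
proof (induction j arbitrary: i ts)
  case 0
  then obtain a us i' where "ts = a # us" "i = Suc (Suc i')"
    by (cases ts; cases i; cases "i - 1") auto
  then show ?case by (cases us) auto
next
  case (Suc j)
  obtain a us i' where *: "ts = a # us" "i = Suc i'" "Suc j < i'" "i' < length us"
    using Suc.prems by (cases ts; cases i) auto
  then show ?case using Suc.IH[of i' us] by (cases i') auto
qed

section \<open>The diagonal action and composition, concatenation, products and units\<close>

context module_alg
begin

lemma diagT_one: "mS (length ts) G \<Longrightarrow> ts \<noteq> [] \<Longrightarrow> diagT 1 ts G = G ts"
proof (induction ts arbitrary: G)
  case Nil then show ?case by simp
next
  case (Cons x ts)
  show ?case
  proof (cases "ts = []")
    case False
    have m: "mS (length ts) (\<lambda>zs. G (x # zs))" using Cons.prems by (simp add: mbal_ConsD(2))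
    show ?thesis
      unfolding diagT_Cons[OF False]
      using Cons.IH[OF m False] Cons.prems SW_one[OF bK_diagT_Cons[OF _ False, of G x]] by simp
  qed simp
qed

lemma diagT_src_one: "mS (Suc (length xs)) G \<Longrightarrow> r \<in> base K \<Longrightarrow> diagT (src K r) (x # xs) G = G (actT (src K r) x # xs)"
proof -
  assume G: "mS (Suc (length xs)) G" and r: "r \<in> base K"
  have m: "mS (Suc (length xs)) (\<lambda>zs. G (actT (src K r) (hd zs) # tl zs))"
  proof (rule mbal_ConsI)
    show "clin (\<lambda>z. G (actT (src K r) (hd (z # ys)) # tl (z # ys)))" if "length ys = length xs" for ys
      using clin_comp[OF mbal_ConsD(1)[OF G that] clin_actT(1)] by simp
    show "mS (length xs) (\<lambda>ys. G (actT (src K r) (hd (z # ys)) # tl (z # ys)))" for z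
      using mbal_ConsD(2)[OF G] by simp
    show "G (actT (src K r) (hd (actT (tgt K a) z # y # ys)) # tl (actT (tgt K a) z # y # ys)) =
        G (actT (src K r) (hd (z # actT (src K a) y # ys)) # tl (z # actT (src K a) y # ys))"
      if "a \<in> base K" "Suc (length ys) = length xs" for a z y ys
      using mbal_ConsD(3)[OF G that, of "actT (src K r) z" y]
      by (simp flip: actT_comp) (simp add: actT_comp src_tgt_K that r)
  qed
  show ?thesis
    using diagT_src[of "x # xs" G r 1] diagT_one[of "x # xs", OF _ list.simps(3), OF m[folded length_Cons[of x]]] G r
    by simp
qed

lemma diagT_comp:
  "mS (length ts) G \<Longrightarrow> ts \<noteq> [] \<Longrightarrow> diagT (k * k') ts G = diagT k' ts (\<lambda>zs. diagT k zs G)"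
proof (induction ts arbitrary: G k k')
  case Nil then show ?case by simp
next
  case (Cons x ts)
  show ?case
  proof (cases "ts = []")
    case True then show ?thesis by (simp add: actT_comp)
  next
    case False
    have G: "mS (Suc (length ts)) G" using Cons.prems by simp
    have m: "mS (length ts) (\<lambda>zs. G (u # zs))" for u by (rule mbal_ConsD(2)[OF G])
    have "diagT (k * k') (x # ts) G = sw2 (comul K k) (\<lambda>k1 k2. sw2 (comul K k')
        (\<lambda>k1' k2'. diagT k2' ts (\<lambda>zs. diagT k2 zs (\<lambda>zs. G (actT k1 (actT k1' x) # zs)))))"
      unfolding diagT_Cons[OF False] SW_mult[OF bK_diagT_Cons[OF G False]] Cons.IH[OF m False] actT_comp ..
    also have "\<dots> = sw2 (comul K k') (\<lambda>k1' k2'. diagT k2' ts (\<lambda>zs. sw2 (comul K k)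
        (\<lambda>k1 k2. diagT k2 zs (\<lambda>zs. G (actT k1 (actT k1' x) # zs)))))"
      by (subst sw2_commute) (simp add: diagT_sw2)
    also have "\<dots> = diagT k' (x # ts) (\<lambda>zs. diagT k zs G)"
      unfolding diagT_Cons[OF False]
    proof (intro sw2_cong diagT_cong)
      fix k1 k2 and zs :: "'t list" assume "length zs = length ts"
      then have "zs \<noteq> []" using False by auto
      then show "sw2 (comul K k) (\<lambda>k1a k2. diagT k2 zs (\<lambda>zs. G (actT k1a (actT k1 x) # zs))) =
          diagT k (actT k1 x # zs) G"
        by (simp add: diagT_Cons)
    qed
    finally show ?thesis .
  qed
qed

text \<open>The relation between the first two factors survives because of k^(1) t(r) \<otimes>
  k^(2) = k^(1) \<otimes> k^(2) s(r) for the coproduct of K.\<close>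

lemma mS_diagT: "mS n G \<Longrightarrow> n \<noteq> 0 \<Longrightarrow> mS n (\<lambda>ts. diagT k ts G)"
proof (induction n arbitrary: G k)
  case 0 then show ?case by simp
next
  case (Suc n)
  note G = Suc.prems(1)
  show ?case
  proof (cases "n = 0")
    case True
    then have "clin (\<lambda>x. G [x])" using G by (simp add: mbal_1)
    then have "clin (\<lambda>x. G [actT k x])" by (rule clin_comp) (rule clin_actT)
    then show ?thesis using True by (simp add: mbal_1)
  next
    case False
    have m: "mS n (\<lambda>zs. G (u # zs))" for u by (rule mbal_ConsD(2)[OF G])
    have md: "mS n (\<lambda>ts. diagT k2 ts (\<lambda>zs. G (u # zs)))" for k2 u
      by (rule Suc.IH[OF m False])
    have D: "diagT k (x # ys) G = sw2 (comul K k) (\<lambda>k1 k2. diagT k2 ys (\<lambda>zs. G (actT k1 x # zs)))"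
      if "length ys = n" for k x ys
      using that False by (intro diagT_Cons) auto
    show ?thesis
    proof (rule mbal_ConsI)
      fix ys :: "'t list" assume len: "length ys = n"
      have "clin (\<lambda>x. sw2 (comul K k) (\<lambda>k1 k2. diagT k2 ys (\<lambda>zs. G (actT k1 x # zs))))"
        by (intro clin_sw2_in clin_diagT_in clin_comp[OF mbal_ConsD(1)[OF G] clin_actT(1)]) (simp add: len)
      then show "clin (\<lambda>x. diagT k (x # ys) G)" by (simp add: D[OF len])
    next
      fix x
      have "mS n (\<lambda>ys. sw2 (comul K k) (\<lambda>k1 k2. diagT k2 ys (\<lambda>zs. G (actT k1 x # zs))))"
        by (intro mbal_sw2 md)
      then show "mS n (\<lambda>ys. diagT k (x # ys) G)" by (rule mbal_transfer) (rule D)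
    next
      fix x y :: 't and a and ys :: "'t list" assume a: "a \<in> base K" and len: "Suc (length ys) = n"
      have m2: "mS (Suc (length ys)) (\<lambda>zs. G (u # zs))" for u using m len by simp
      have bK: "bK (\<lambda>k1 k2. diagT k2 (y # ys) (\<lambda>zs. G (actT k1 x # zs)))"
        by (rule bK_diagT_Cons) (use G len in auto)
      have "diagT k (actT (tgt K a) x # y # ys) G =
          sw2 (comul K k) (\<lambda>k1 k2. diagT (k2 * src K a) (y # ys) (\<lambda>zs. G (actT k1 x # zs)))"
        using SW_takeuchi[OF bK a, of k] by (simp add: D len actT_comp)
      also have "\<dots> = sw2 (comul K k) (\<lambda>k1 k2. diagT k2 (actT (src K a) y # ys) (\<lambda>zs. G (actT k1 x # zs)))"
      proof (rule sw2_cong)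
        fix k1 k2
        have "diagT (k2 * src K a) (y # ys) (\<lambda>zs. G (actT k1 x # zs)) =
            diagT (src K a) (y # ys) (\<lambda>ws. diagT k2 ws (\<lambda>zs. G (actT k1 x # zs)))"
          by (rule diagT_comp) (use m2 in auto)
        also have "\<dots> = diagT k2 (actT (src K a) y # ys) (\<lambda>zs. G (actT k1 x # zs))"
          by (rule diagT_src_one) (use md len a in auto)
        finally show "diagT (k2 * src K a) (y # ys) (\<lambda>zs. G (actT k1 x # zs)) =
            diagT k2 (actT (src K a) y # ys) (\<lambda>zs. G (actT k1 x # zs))" .
      qed
      also have "\<dots> = diagT k (x # actT (src K a) y # ys) G" by (simp add: D len)
      finally show "diagT k (actT (tgt K a) x # y # ys) G = diagT k (x # actT (src K a) y # ys) G" .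
    qed
  qed
qed

lemma diagT_tgt_one:
  assumes G: "mS (Suc (length xs)) G" and r: "r \<in> base K"
  shows "diagT (tgt K r) (xs @ [x]) G = G (xs @ [actT (tgt K r) x])"
  using assms
proof (induction xs arbitrary: G)
  case Nil then show ?case by simp
next
  case (Cons y xs)
  have G: "mS (Suc (length (xs @ [x]))) G" using Cons.prems by simp
  have "diagT (tgt K r) (y # (xs @ [x])) G = diagT (tgt K r) (xs @ [x]) (\<lambda>zs. G (actT 1 y # zs))"
    by (subst diagT_Cons) (simp_all add: SW_tgt_one[OF bK_diagT_Cons[OF G]] r)
  also have "\<dots> = G (y # xs @ [actT (tgt K r) x])"
    using Cons.IH[OF mbal_ConsD(2)] G r by simp
  finally show ?case by simp
qed

lemma diagT_mult_tgt:
  "mS (Suc (length xs)) G \<Longrightarrow> r \<in> base K \<Longrightarrow> diagT (k * tgt K r) (xs @ [x]) G = diagT k (xs @ [actT (tgt K r) x]) G"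
  by (subst diagT_comp) (simp_all add: diagT_tgt_one mS_diagT)

lemma bK_diagT_pair:
  assumes G: "mS (length xs + length ys) G" and xs: "xs \<noteq> []" and ys: "ys \<noteq> []"
  shows "bK (\<lambda>k1 k2. diagT k1 xs (\<lambda>us. diagT k2 ys (\<lambda>vs. G (us @ vs))))"
proof (rule balI)
  have m1: "mS (length xs) (\<lambda>us. diagT k2 ys (\<lambda>vs. G (us @ vs)))" for k2
    by (rule mbal_diagT_in, rule mbal_append_left) (simp add: G)
  have m2: "mS (length ys) (\<lambda>vs. G (us @ vs))" if "length us = length xs" for us
    by (rule mbal_append_right) (simp add: G that)
  show "clin (\<lambda>k1. diagT k1 xs (\<lambda>us. diagT k2 ys (\<lambda>vs. G (us @ vs))))" for k2
    by (rule clin_diagT[OF m1 xs])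
  show "clin (\<lambda>k2. diagT k1 xs (\<lambda>us. diagT k2 ys (\<lambda>vs. G (us @ vs))))" for k1
    by (rule clin_diagT_in, rule clin_diagT[OF m2 ys])
  show "diagT (tgt K a * k1) xs (\<lambda>us. diagT k2 ys (\<lambda>vs. G (us @ vs))) =
      diagT k1 xs (\<lambda>us. diagT (src K a * k2) ys (\<lambda>vs. G (us @ vs)))" if a: "a \<in> base K" for k1 a k2
    unfolding diagT_tgt[OF m1 xs a]
  proof (rule diagT_cong)
    fix us :: "'t list" assume len: "length us = length xs"
    then obtain us' u where us: "us = us' @ [u]" using xs by (cases us rule: rev_cases) auto
    show "diagT k2 ys (\<lambda>vs. G ((butlast us @ [actT (tgt K a) (last us)]) @ vs)) = diagT (src K a * k2) ys (\<lambda>vs. G (us @ vs))"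
      unfolding diagT_src[OF m2[OF len] ys a]
    proof (rule diagT_cong)
      fix vs :: "'t list" assume len': "length vs = length ys"
      then obtain v vs' where vs: "vs = v # vs'" using ys by (cases vs) auto
      show "G ((butlast us @ [actT (tgt K a) (last us)]) @ vs) = G (us @ actT (src K a) (hd vs) # tl vs)"
        using mbal_mid[OF G a, of us' vs' u v] len len' by (simp add: us vs)
    qed
  qed
qed

text \<open>Coassociativity allows the iterated coproduct to be split between any two factors, not
  only after the first.\<close>

lemma diagT_append:
  "mS (length xs + length ys) G \<Longrightarrow> xs \<noteq> [] \<Longrightarrow> ys \<noteq> [] \<Longrightarrow>
    diagT k (xs @ ys) G = sw2 (comul K k) (\<lambda>k1 k2. diagT k1 xs (\<lambda>us. diagT k2 ys (\<lambda>vs. G (us @ vs))))"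
proof (induction xs arbitrary: G k)
  case Nil then show ?case by simp
next
  case (Cons x xs)
  note ys = Cons.prems(3)
  show ?case
  proof (cases "xs = []")
    case True then show ?thesis using ys by (simp add: diagT_Cons)
  next
    case False
    have G: "mS (Suc (length xs + length ys)) G" using Cons.prems by simp
    have m: "mS (length xs + length ys) (\<lambda>zs. G (u # zs))" for u by (rule mbal_ConsD(2)[OF G])
    have "diagT k (x # (xs @ ys)) G = sw2 (comul K k) (\<lambda>k1 k2. sw2 (comul K k2)
        (\<lambda>a b. diagT a xs (\<lambda>us. diagT b ys (\<lambda>vs. G (actT k1 x # us @ vs)))))"
      using False by (subst diagT_Cons) (simp_all add: Cons.IH[OF m False ys])
    also have "\<dots> = sw2 (comul K k) (\<lambda>k1 b. sw2 (comul K k1)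
        (\<lambda>k1 a. diagT a xs (\<lambda>us. diagT b ys (\<lambda>vs. G (actT k1 x # us @ vs)))))"
    proof (rule SW_coassoc[symmetric])
      show "bK (\<lambda>k1 a. diagT a xs (\<lambda>us. diagT b ys (\<lambda>vs. G (actT k1 x # us @ vs))))" for b
      proof -
        have "mS (Suc (length xs)) (\<lambda>us. diagT b ys (\<lambda>vs. G (us @ vs)))"
          by (rule mbal_diagT_in, rule mbal_append_left) (use G in simp)
        from bK_diagT_Cons[OF this False, of x] show ?thesis by simp
      qed
      show "bK (\<lambda>a b. diagT a xs (\<lambda>us. diagT b ys (\<lambda>vs. G (actT k1 x # us @ vs))))" for k1
        using bK_diagT_pair[OF m False ys] by simp
    qed
    also have "\<dots> = sw2 (comul K k) (\<lambda>k1 k2. diagT k1 (x # xs) (\<lambda>us. diagT k2 ys (\<lambda>vs. G (us @ vs))))"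
      unfolding diagT_Cons[OF False] by simp
    finally show ?thesis by simp
  qed
qed

lemma mS_lmult: "mS n G \<Longrightarrow> n \<noteq> 0 \<Longrightarrow> mS n (\<lambda>ts. G (u * hd ts # tl ts))"
proof (cases n)
  case (Suc m)
  assume "mS n G"
  then have G: "mS (Suc m) G" using Suc by simp
  show ?thesis unfolding Suc
    by (rule mbal_ConsI)
      (simp_all add: mbal_ConsD(2)[OF G] clin_comp[OF mbal_ConsD(1)[OF G]] clin_mult clin_id
        mbal_ConsD(3)[OF G] flip: actT_tgt_mult)
qed simp

lemma actT_src_tgt_one: "r \<in> base K \<Longrightarrow> actT (tgt K r) 1 = actT (src K r) 1"
  using actT_mid[of r 1 1] by simp

lemma mS_merge: "mS n G \<Longrightarrow> i < n \<Longrightarrow> mS (Suc n) (\<lambda>ts. G (merge_at i ts))"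
proof (induction i arbitrary: n G)
  case 0
  then obtain m where n: "n = Suc m" by (cases n) auto
  have G: "mS (Suc m) G" using 0 n by simp
  show ?case
  proof (rule mbal_ConsI)
    fix ys :: "'t list" assume "length ys = n"
    then obtain y zs where ys: "ys = y # zs" "length zs = m" using n by (cases ys) auto
    show "clin (\<lambda>x. G (merge_at 0 (x # ys)))"
      using clin_comp[OF mbal_ConsD(1)[OF G ys(2)], of "\<lambda>x. x * y"] by (simp add: ys clin_mult clin_id)
  next
    fix x
    have "mS n (\<lambda>ys. G (x * hd ys # tl ys))" by (rule mS_lmult) (use 0 in auto)
    moreover have "G (merge_at 0 (x # ys)) = G (x * hd ys # tl ys)" if "length ys = n" for ys
      using that n by (cases ys) auto
    ultimately show "mS n (\<lambda>ys. G (merge_at 0 (x # ys)))" by (rule mbal_transfer)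
  next
    fix x y :: 't and a and ys :: "'t list" assume "a \<in> base K" "Suc (length ys) = n"
    then show "G (merge_at 0 (actT (tgt K a) x # y # ys)) = G (merge_at 0 (x # actT (src K a) y # ys))"
      by (simp add: actT_mid)
  qed
next
  case (Suc i)
  then obtain m where n: "n = Suc m" "i < m" by (cases n) auto
  have G: "mS (Suc m) G" using Suc.prems n by simp
  show ?case
  proof (rule mbal_ConsI)
    show "clin (\<lambda>x. G (merge_at (Suc i) (x # ys)))" if "length ys = n" for ys
      using mbal_ConsD(1)[OF G, of "merge_at i ys"] that n by simp
    show "mS n (\<lambda>ys. G (merge_at (Suc i) (x # ys)))" for x
      using Suc.IH[OF mbal_ConsD(2)[OF G, of x] n(2)] n by simp
  next
    fix x y :: 't and a and ys :: "'t list" assume a: "a \<in> base K" and len: "Suc (length ys) = n"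
    show "G (merge_at (Suc i) (actT (tgt K a) x # y # ys)) = G (merge_at (Suc i) (x # actT (src K a) y # ys))"
    proof (cases i)
      case 0
      then obtain z zs where "ys = z # zs" using len n by (cases ys) auto
      then show ?thesis
        using mbal_ConsD(3)[OF G a, of zs x "y * z"] len n 0 by (simp add: actT_src_mult[OF a])
    next
      case (Suc j)
      then show ?thesis
        using mbal_ConsD(3)[OF G a, of "merge_at j ys" x y] len n by simp
    qed
  qed
qed

lemma mS_unit: "mS (Suc n) G \<Longrightarrow> i < n \<Longrightarrow> mS n (\<lambda>ts. G (unit_at i ts))"
proof (induction i arbitrary: n G)
  case 0
  then obtain m where n: "n = Suc m" by (cases n) auto
  have G: "mS (Suc (Suc m)) G" using 0 n by simp
  show ?case unfolding n
  proof (rule mbal_ConsI)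
    show "clin (\<lambda>x. G (unit_at 0 (x # ys)))" if "length ys = m" for ys
      using mbal_ConsD(1)[OF G, of "1 # ys"] that by simp
    show "mS m (\<lambda>ys. G (unit_at 0 (x # ys)))" for x
      using mbal_ConsD(2)[OF mbal_ConsD(2)[OF G]] by simp
  next
    fix x y :: 't and a and ys :: "'t list" assume a: "a \<in> base K" and len: "Suc (length ys) = m"
    \<comment> \<open>The scalar has to cross two seams, one on each side of the inserted unit, and
      in between t(r) \<triangleright> 1 = s(r) \<triangleright> 1.\<close>
    have G': "mS (Suc m) (\<lambda>ys. G (x # ys))" by (rule mbal_ConsD(2)[OF G])
    show "G (unit_at 0 (actT (tgt K a) x # y # ys)) = G (unit_at 0 (x # actT (src K a) y # ys))"
      using mbal_ConsD(3)[OF G a, of "y # ys" x 1] mbal_ConsD(3)[OF G' a, of ys 1 y] len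
      by (simp add: actT_src_tgt_one[OF a])
  qed
next
  case (Suc i)
  then obtain m where n: "n = Suc m" "i < m" by (cases n) auto
  have G: "mS (Suc (Suc m)) G" using Suc.prems n by simp
  show ?case unfolding n
  proof (rule mbal_ConsI)
    show "clin (\<lambda>x. G (unit_at (Suc i) (x # ys)))" if "length ys = m" for ys
      using mbal_ConsD(1)[OF G, of "unit_at i ys"] that n by simp
    show "mS m (\<lambda>ys. G (unit_at (Suc i) (x # ys)))" for x
      using Suc.IH[OF mbal_ConsD(2)[OF G, of x] n(2)] by simp
  next
    fix x y :: 't and a and ys :: "'t list" assume a: "a \<in> base K" and len: "Suc (length ys) = m"
    show "G (unit_at (Suc i) (actT (tgt K a) x # y # ys)) = G (unit_at (Suc i) (x # actT (src K a) y # ys))"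
      using mbal_ConsD(3)[OF G a, of "1 # ys" x y] mbal_ConsD(3)[OF G a, of "unit_at (i - 1) ys" x y] len n
      by (cases i) simp_all
  qed
qed

text \<open>Coassociativity brings the two factors of the coproduct that meet in the merged entry
  next to each other, where the module algebra axiom recombines them.\<close>

lemma diagT_merge:
  "mS n G \<Longrightarrow> length ts = Suc n \<Longrightarrow> i < n \<Longrightarrow> diagT k ts (\<lambda>zs. G (merge_at i zs)) = diagT k (merge_at i ts) G"
proof (induction i arbitrary: n G ts k)
  case 0
  then obtain a b vs where ts: "ts = a # b # vs" by (cases ts; cases "tl ts") auto
  show ?case
  proof (cases "vs = []")
    case True
    then have c: "clin (\<lambda>x. G [x])" using 0 ts by (auto simp: mbal_1)
    show ?thesis by (simp add: ts True diagT_Cons actT_mult clin_sw2_out[OF c])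
  next
    case False
    have G: "mS (Suc (length vs)) G" using 0 ts by simp
    have "diagT k ts (\<lambda>zs. G (merge_at 0 zs)) = sw2 (comul K k) (\<lambda>k1 c. sw2 (comul K c)
        (\<lambda>k2 k3. diagT k3 vs (\<lambda>zs. G (actT k1 a * actT k2 b # zs))))"
      by (simp add: ts diagT_Cons False)
    also have "\<dots> = sw2 (comul K k) (\<lambda>c k3. sw2 (comul K c)
        (\<lambda>k1 k2. diagT k3 vs (\<lambda>zs. G (actT k1 a * actT k2 b # zs))))"
    proof (rule SW_coassoc[symmetric])
      show "bK (\<lambda>k1 k2. diagT k3 vs (\<lambda>zs. G (actT k1 a * actT k2 b # zs)))" for k3
        by (rule balI)
          (intro clin_diagT_in clin_comp[OF mbal_ConsD(1)[OF G]] clin_intros clin_actT |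
            simp add: actT_comp actT_mid)+
      show "bK (\<lambda>k2 k3. diagT k3 vs (\<lambda>zs. G (actT k1 a * actT k2 b # zs)))" for k1
        using bK_diagT_Cons[OF mS_lmult[OF G] False, of "actT k1 a" b] by simp
    qed
    also have "\<dots> = sw2 (comul K k) (\<lambda>c k3. diagT k3 vs (\<lambda>zs. G (actT c (a * b) # zs)))"
    proof (rule sw2_cong)
      fix c k3
      have "clin (\<lambda>x. diagT k3 vs (\<lambda>zs. G (x # zs)))"
        by (rule clin_diagT_in, rule mbal_ConsD(1)[OF G])
      from clin_sw2_out[OF this, of "comul K c" "\<lambda>k1 k2. actT k1 a * actT k2 b"]
      show "sw2 (comul K c) (\<lambda>k1 k2. diagT k3 vs (\<lambda>zs. G (actT k1 a * actT k2 b # zs))) =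
          diagT k3 vs (\<lambda>zs. G (actT c (a * b) # zs))" by (simp add: actT_mult)
    qed
    finally show ?thesis by (simp add: ts diagT_Cons False)
  qed
next
  case (Suc i)
  then obtain a us m where ts: "ts = a # us" and n: "n = Suc m" "i < m" by (cases ts; cases n) auto
  have len: "length us = Suc m" using Suc.prems ts n by simp
  have us: "us \<noteq> []" "merge_at i us \<noteq> []" using len n by (cases us; cases i; cases "tl us"; auto)+
  have G: "mS (Suc m) G" using Suc.prems n by simp
  show ?case
    using Suc.IH[OF mbal_ConsD(2)[OF G] len n(2)] us by (simp add: ts diagT_Cons)
qed

text \<open>The factor k^(1) acts on 1 through its counit, an element of S that passes to the next
  entry, where the counit axiom restores k.\<close>

lemma diagT_unit_head:
  assumes G: "mS (Suc (length vs)) G" and vs: "vs \<noteq> []"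
  shows "diagT k (1 # vs) G = diagT k vs (\<lambda>zs. G (1 # zs))"
proof -
  have m: "mS (length vs) (\<lambda>zs. G (1 # zs))" by (rule mbal_ConsD(2)[OF G])
  have "diagT k2 vs (\<lambda>zs. G (actT k1 1 # zs)) = diagT (src K (counit K k1) * k2) vs (\<lambda>zs. G (1 # zs))" for k1 k2
    unfolding diagT_src[OF m vs base_K(3)]
  proof (rule diagT_cong)
    fix zs :: "'t list" assume "length zs = length vs"
    then obtain z zs' where "zs = z # zs'" "Suc (length zs') = length vs" using vs by (cases zs) auto
    then show "G (actT k1 1 # zs) = G (1 # actT (src K (counit K k1)) (hd zs) # tl zs)"
      using mbal_ConsD(3)[OF G base_K(3), of zs' k1 1 z] actT_one[of k1]
      by (simp add: actT_src_tgt_one base_K)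
  qed
  then show ?thesis
    using clin_sw2_out[OF clin_diagT[OF m vs], of "comul K k" "\<lambda>k1 k2. src K (counit K k1) * k2"]
    by (simp add: diagT_Cons vs SW_counit)
qed

lemma diagT_unit:
  "mS (Suc n) G \<Longrightarrow> length ts = n \<Longrightarrow> i < n \<Longrightarrow> diagT k ts (\<lambda>zs. G (unit_at i zs)) = diagT k (unit_at i ts) G"
proof (induction i arbitrary: n G ts k)
  case 0
  then obtain a vs where ts: "ts = a # vs" by (cases ts) auto
  have G: "mS (Suc (Suc (length vs))) G" using 0 ts by simp
  have G': "mS (Suc (length vs)) (\<lambda>zs. G (x # zs))" for x by (rule mbal_ConsD(2)[OF G])
  show ?case
  proof (cases "vs = []")
    case True
    \<comment> \<open>The inserted unit is the last factor here, so its counit passes to the left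
      neighbour, through t.\<close>
    have c: "clin (\<lambda>k. G [actT k a, 1])"
      using clin_comp[OF mbal_ConsD(1)[OF G, of "[1]"] clin_actT(2)] True by simp
    have "G [actT k1 a, actT k2 1] = G [actT (tgt K (counit K k2) * k1) a, 1]" for k1 k2
      using mbal_ConsD(3)[OF G base_K(3), of "[]" k2 "actT k1 a" 1] actT_one[of k2] True
      by (simp add: actT_comp)
    then show ?thesis
      using clin_sw2_out[OF c, of "comul K k" "\<lambda>k1 k2. tgt K (counit K k2) * k1"]
      by (simp add: ts True diagT_Cons SW_counit)
  next
    case False
    then show ?thesis using diagT_unit_head[OF G' False] by (simp add: ts diagT_Cons)
  qed
next
  case (Suc i)
  then obtain a us m where ts: "ts = a # us" and n: "n = Suc m" "i < m" by (cases ts; cases n) auto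
  have len: "length us = m" using Suc.prems ts n by simp
  have us: "us \<noteq> []" "unit_at i us \<noteq> []" using len n by (cases us; cases i; auto)+
  have G: "mS (Suc (Suc m)) G" using Suc.prems n by simp
  show ?case
    using Suc.IH[OF mbal_ConsD(2)[OF G] len n(2)] us by (simp add: ts diagT_Cons)
qed

end


section \<open>Coefficients and the cyclic module of a module algebra\<close>

locale sayd_coefficients = module_alg K actT
  for K :: "('s::complex_algebra, 'k::complex_algebra) bialgebroid"
    and actT :: "'k \<Rightarrow> 't::complex_algebra \<Rightarrow> 't" +
  fixes actM :: "'m::complex_vector \<Rightarrow> 'k \<Rightarrow> 'm"
    and lactM :: "'s \<Rightarrow> 'm \<Rightarrow> 'm"
    and coactM :: "'m \<Rightarrow> ('k \<times> 'm) free"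
  assumes sayd_M: "right_left_SAYD K actM lactM coactM"
begin

abbreviation bM :: "('k \<Rightarrow> 'm \<Rightarrow> 'w::complex_vector) \<Rightarrow> bool"
  where "bM \<equiv> bal (base K) (\<lambda>k r. tgt K r * k) (\<lambda>r m. actM m (tgt K r))"

lemmas sd_unfolded = sayd_M[unfolded right_left_SAYD_def]

lemma module_M: "clin (\<lambda>m. actM m k)" "clin (actM m)" "actM m 1 = m"
  "actM m (k * k') = actM (actM m k) k'"
  using sd_unfolded by (simp_all add: right_module_on_def clin_def qlinear_def)

lemma lactM_eq: "r \<in> base K \<Longrightarrow> lactM r m = actM m (tgt K r)"
  using sd_unfolded by blast

lemma comodule_M: "left_comodule K lactM coactM"
  using sd_unfolded by blast

lemmas cM_unfolded = comodule_M[unfolded left_comodule_def]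

lemma bM_lact: "bM F \<Longrightarrow> bal (base K) (\<lambda>k r. tgt K r * k) lactM F"
  by (simp add: bal_def lactM_eq)

lemma CM_mod: "X \<simeq>\<^bsub>lcotensor_null K lactM {0}\<^esub> Y \<Longrightarrow> bM F \<Longrightarrow> sw2 X F = sw2 Y F"
  unfolding lcotensor_null_def by (rule sw2_eq_tensor0[OF _ bM_lact])

lemma clin_CM: "bM F \<Longrightarrow> clin (\<lambda>m. sw2 (coactM m) F)"
proof -
  have "qlinear {0} (lcotensor_null K lactM {0}) coactM" using cM_unfolded by blast
  then show "bM F \<Longrightarrow> clin (\<lambda>m. sw2 (coactM m) F)"
    unfolding lcotensor_null_def by (rule clin_sw2_qlinear0[OF _ bM_lact])
qed

lemma CM_coassoc:
  assumes "\<And>m. bK (\<lambda>k1 k2. F k1 k2 m)" "\<And>k. bM (F k)"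
  shows "sw2 (coactM m) (\<lambda>k m0. sw2 (comul K k) (\<lambda>k1 k2. F k1 k2 m0)) =
    sw2 (coactM m) (\<lambda>k m0. sw2 (coactM m0) (F k))"
proof -
  let ?G = "\<lambda>k X. sw2 X (F k)"
  have ax: "lsum (coactM m) (\<lambda>(k, m0). lsum (comul K k) (\<lambda>(k1, k2). k1 \<otimes> (k2 \<otimes> m0)))
       \<simeq>\<^bsub>lcotensor_null K (src_left K) (lcotensor_null K lactM {0})\<^esub>
       lsum (coactM m) (\<lambda>(k, m0). k \<otimes> coactM m0)"
    using cM_unfolded by blast
  have "sw2 (lsum (coactM m) (\<lambda>(k, m0). lsum (comul K k) (\<lambda>(k1, k2). k1 \<otimes> (k2 \<otimes> m0)))) ?G =
    sw2 (lsum (coactM m) (\<lambda>(k, m0). k \<otimes> coactM m0)) ?G"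
  proof (rule sw2_eq_tensor[OF ax[unfolded lcotensor_null_def]])
    show "bal (base K) (\<lambda>k r. tgt K r * k) (src_left K) ?G"
    proof (rule balI)
      show "clin (?G k)" for k by (rule clin_sw2)
      show "clin (\<lambda>k. ?G k X)" for X
        by (intro clin_intros) (rule bal_left[OF assms(1)])
      show "?G (tgt K r * k) X = ?G k (src_left K r X)" if "r \<in> base K" for X r k
        unfolding src_left_def lsum_case
        by simp (rule sw2_cong, rule bal_mid[OF assms(1) that])
    qed
    show "?G y x = 0" if "x \<in> tensor_null (base K) (\<lambda>k r. tgt K r * k) lactM {0} {0}" for x y
      using that by (rule sw2_tensor_null[rotated -1]) (auto simp: bal_zero[OF assms(2)] bM_lact[OF assms(2)])
    have "F 0 = (\<lambda>_ _. 0)"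
      by (intro ext) (rule bal_zero(1)[OF assms(1)])
    then show "?G x y = 0" if "x \<in> {0}" for x y
      using that by simp
  qed
  then show ?thesis by (simp add: lsum_case)
qed

lemma CM_counit: "sw2 (coactM m) (\<lambda>k m0. actM m0 (tgt K (counit K k))) = m"
proof -
  have "lsum (coactM m) (\<lambda>(k, m0). lactM (counit K k) m0) = m" using cM_unfolded by blast
  then show ?thesis by (simp add: lsum_case lactM_eq base_K)
qed

lemma CM_stable: "clin h \<Longrightarrow> sw2 (coactM m) (\<lambda>k m0. h (actM m0 k)) = h m"
  using clin_sw2_out[of h "coactM m" "\<lambda>k m0. actM m0 k"] sd_unfolded by (simp add: lsum_case)

lemma CM_act:
  assumes F: "bM F"
  shows "sw2 (coactM (actM m k)) F = sw2 (comul K k) (\<lambda>k1 k2. sw2 (transl_left K k2)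
      (\<lambda>p q. sw2 (coactM m) (\<lambda>a m0. F (q * a * k1) (actM m0 p))))"
proof -
  have "coactM (actM m k) \<simeq>\<^bsub>lcotensor_null K lactM {0}\<^esub>
       lsum (comul K k) (\<lambda>(k1, k2). lsum (transl_left K k2) (\<lambda>(k2m, k2p).
         lsum (coactM m) (\<lambda>(a, m0). (k2p * a * k1) \<otimes> actM m0 k2m)))"
    using sd_unfolded by blast
  from CM_mod[OF this F] show ?thesis by (simp add: lsum_case)
qed

text \<open>Right multiplication by s(r) on M is the canonical action of the comodule, given by
  coaction and counit. Coassociativity turns it into a counit on the second factor of the coproduct
  of m_{<-1>}, and the Takeuchi property moves r to the right of m_{<-1>}.\<close>

lemma CM_mult_tgt:
  assumes F: "bM F" and r: "r \<in> base K"
  shows "sw2 (coactM m) (\<lambda>k m0. F (k * tgt K r) m0) = sw2 (coactM m) (\<lambda>k m0. F k (actM m0 (src K r)))"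
proof -
  let ?c = "\<lambda>k. tgt K (counit K (k * src K r))"
  have cc: "counit K (src K a * (k * src K r)) = a * counit K (k * src K r)"
    "counit K (tgt K a * (k * src K r)) = counit K (k * src K r) * a" if "a \<in> base K" for a k
    by (simp_all add: counit_src_tgt_K that)
  have clc: "clin (\<lambda>k. ?c k)" by (rule clin_comp[OF clin_src_tgt_counit(2)]) (intro clin_intros)
  have ract: "actM m0 (src K r) = sw2 (coactM m0) (\<lambda>k m00. actM m00 (?c k))" for m0
    using sd_unfolded r by (simp add: canonical_ract_def lsum_case lactM_eq base_K)
  have "sw2 (coactM m) (\<lambda>k m0. F k (actM m0 (src K r))) =
      sw2 (coactM m) (\<lambda>k m0. sw2 (coactM m0) (\<lambda>k' m00. F k (actM m00 (?c k'))))"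
    unfolding ract by (intro sw2_cong clin_sw2_out[OF bal_right[OF F]])
  also have "\<dots> = sw2 (coactM m) (\<lambda>k m0. sw2 (comul K k) (\<lambda>k1 k2. F k1 (actM m0 (?c k2))))"
  proof (rule CM_coassoc[symmetric])
    note i = clin_intros bal_clin[OF F] bal_left[OF F] clin_comp[OF module_M(1)] clin_comp[OF module_M(2)] clc
    show "bK (\<lambda>k1 k2. F k1 (actM m (?c k2)))" for m
      by (rule balI) (intro i | simp add: mult.assoc cc tgt_K base_K bal_mid[OF F] module_M(4))+
    show "bM (\<lambda>k2 m. F k1 (actM m (?c k2)))" for k1
      by (rule balI) (intro i clin_comp[OF module_M(2) clc] | simp add: mult.assoc cc tgt_K base_K module_M(4))+
  qed
  also have "\<dots> = sw2 (coactM m) (\<lambda>k m0. sw2 (comul K k) (\<lambda>k1 k2. F (?c k2 * k1) m0))"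
    by (simp add: bal_mid[OF F] base_K)
  also have "\<dots> = sw2 (coactM m) (\<lambda>k m0. F (k * tgt K r) m0)"
  proof (rule sw2_cong)
    fix k m0
    have b: "bK (\<lambda>k1 k2. tgt K (counit K k2) * k1)"
      by (rule balI) (intro clin_intros clin_src_tgt_counit | simp add: counit_src_tgt_K tgt_K base_K mult.assoc)+
    have "sw2 (comul K k) (\<lambda>k1 k2. F (?c k2 * k1) m0) = F (sw2 (comul K k) (\<lambda>k1 k2. ?c k2 * k1)) m0"
      by (rule clin_sw2_out[OF bal_left[OF F], symmetric])
    also have "sw2 (comul K k) (\<lambda>k1 k2. ?c k2 * k1) = sw2 (comul K k) (\<lambda>k1 k2. tgt K (counit K k2) * k1 * tgt K r)"
      unfolding SW_takeuchi[OF b r, symmetric] by (simp add: mult.assoc)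
    also have "\<dots> = sw2 (comul K k) (\<lambda>k1 k2. tgt K (counit K k2) * k1) * tgt K r"
      by (rule clin_sw2_out[OF clin_mult(1)[OF clin_id], symmetric])
    finally show "sw2 (comul K k) (\<lambda>k1 k2. F (?c k2 * k1) m0) = F (k * tgt K r) m0"
      by (simp add: SW_counit)
  qed
  finally show ?thesis by simp
qed

text \<open>The functionals on \<open>M \<otimes>\<^sub>K T\<^sup>\<otimes>\<^sup>n\<close>, with \<open>n\<close> the number of factors \<open>T\<close>.\<close>

definition functC :: "nat \<Rightarrow> ('m \<Rightarrow> 't list \<Rightarrow> 'w::complex_vector) \<Rightarrow> bool"
  where "functC n h \<longleftrightarrow>
    (\<forall>ts. length ts = n \<longrightarrow> clin (\<lambda>m. h m ts)) \<and> (\<forall>m. mS n (h m)) \<and>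
    (\<forall>m k ts. length ts = n \<longrightarrow> h (actM m k) ts = diagT k ts (h m))"

lemma functC_clin: "functC n h \<Longrightarrow> length ts = n \<Longrightarrow> clin (\<lambda>m. h m ts)"
  and functC_mS: "functC n h \<Longrightarrow> mS n (h m)"
  and functC_act: "functC n h \<Longrightarrow> length ts = n \<Longrightarrow> h (actM m k) ts = diagT k ts (h m)"
  by (simp_all add: functC_def)

text \<open>The pullback of a functional along \<open>m \<otimes> x \<otimes> y \<mapsto> m\<^sub>\<langle>\<^sub>0\<^sub>\<rangle> \<otimes> y \<otimes> m\<^sub>\<langle>\<^sub>-\<^sub>1\<^sub>\<rangle> \<triangleright> x\<close>,
  with \<open>p\<close> the number of factors of \<open>x\<close>.\<close>

definition rot :: "nat \<Rightarrow> ('m \<Rightarrow> 't list \<Rightarrow> 'w::complex_vector) \<Rightarrow> 'm \<Rightarrow> 't list \<Rightarrow> 'w"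
  where "rot p h m ts = sw2 (coactM m) (\<lambda>k m0. diagT k (take p ts) (\<lambda>xs. h m0 (drop p ts @ xs)))"

lemma rot_append [simp]:
  "length xs = p \<Longrightarrow> rot p h m (xs @ ys) = sw2 (coactM m) (\<lambda>k m0. diagT k xs (\<lambda>xs. h m0 (ys @ xs)))"
  by (simp add: rot_def)

lemma rot_cong:
  assumes "\<And>m ts. length ts = n \<Longrightarrow> h m ts = h' m ts" "length ts = n" "p \<le> n"
  shows "rot p h m ts = rot p h' m ts"
  unfolding rot_def by (intro sw2_cong diagT_cong assms(1)) (use assms in simp)

text \<open>In t(r) k the factor t(r) reaches only the last rotated entry. This entry is also the
  last of the whole list, hence the one reached when t(r) acts on M instead.\<close>

lemma bM_rot:
  assumes h: "functC (length xs + length ys) h" and xs: "xs \<noteq> []"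
  shows "bM (\<lambda>k m0. diagT k xs (\<lambda>us. h m0 (ys @ us)))"
proof (rule balI)
  have m: "mS (length xs) (\<lambda>us. h m (ys @ us))" for m
    using functC_mS[OF h] by (intro mbal_append_right) (simp add: add.commute)
  show "clin (\<lambda>k. diagT k xs (\<lambda>us. h m0 (ys @ us)))" for m0
    by (rule clin_diagT[OF m xs])
  show "clin (\<lambda>m0. diagT k xs (\<lambda>us. h m0 (ys @ us)))" for k
    by (rule clin_diagT_in, rule functC_clin[OF h]) simp
  show "diagT (tgt K a * k) xs (\<lambda>us. h m0 (ys @ us)) = diagT k xs (\<lambda>us. h (actM m0 (tgt K a)) (ys @ us))"
    if a: "a \<in> base K" for k a m0
    unfolding diagT_tgt[OF m xs a]
  proof (rule diagT_cong)
    fix us :: "'t list" assume len: "length us = length xs"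
    then obtain us' u where us: "us = us' @ [u]" using xs by (cases us rule: rev_cases) auto
    have l: "Suc (length (ys @ us')) = length xs + length ys" using len us by simp
    have "h (actM m0 (tgt K a)) (ys @ us) = diagT (tgt K a) ((ys @ us') @ [u]) (h m0)"
      using functC_act[OF h, of "ys @ us" m0] len by (simp add: us)
    also have "\<dots> = h m0 ((ys @ us') @ [actT (tgt K a) u])"
      by (rule diagT_tgt_one[OF _ a]) (unfold l, rule functC_mS[OF h])
    finally show "h m0 (ys @ butlast us @ [actT (tgt K a) (last us)]) = h (actM m0 (tgt K a)) (ys @ us)"
      by (simp add: us)
  qed
qed

text \<open>The last rotated and the first unrotated factor become the two ends of the list, so the
  relation between them has no seam after the rotation. \<open>CM_mult_tgt\<close> carries the
  scalar through M instead.\<close>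

lemma mS_rot:
  assumes h: "functC (p + q) h" and p: "p \<noteq> 0" and q: "q \<noteq> 0"
  shows "mS (p + q) (rot p h m)"
proof (rule mbal_appendI)
  show "mS p (\<lambda>xs. rot p h m (xs @ ys))" if "length ys = q" for ys
  proof -
    have "mS p (\<lambda>us. h m (ys @ us))" for m
      using functC_mS[OF h] that by (intro mbal_append_right) (simp add: add.commute)
    then have "mS p (\<lambda>xs. sw2 (coactM m) (\<lambda>k m0. diagT k xs (\<lambda>us. h m0 (ys @ us))))"
      using p by (intro mbal_sw2 mS_diagT)
    then show ?thesis by (rule mbal_transfer) simp
  qed
  show "mS q (\<lambda>ys. rot p h m (xs @ ys))" if len: "length xs = p" for xs
  proof -
    have "mS q (\<lambda>ys. h m (ys @ us))" if "length us = length xs" for m us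
      using functC_mS[OF h] that len by (intro mbal_append_left) (simp add: add.commute)
    then have "mS q (\<lambda>ys. sw2 (coactM m) (\<lambda>k m0. diagT k xs (\<lambda>us. h m0 (ys @ us))))"
      by (intro mbal_sw2 mbal_diagT_in)
    then show ?thesis by (rule mbal_transfer) (simp add: len)
  qed
  fix us vs :: "'t list" and x y a assume a: "a \<in> base K" and len: "Suc (length us) = p" "Suc (length vs) = q"
  have m: "mS (Suc (length us)) (\<lambda>zs. h m0 (y # vs @ zs))" for m0
  proof -
    have "length (y # vs) + Suc (length us) = p + q" using len by simp
    then have "mS (length (y # vs) + Suc (length us)) (h m0)" using functC_mS[OF h] by simp
    from mbal_append_right[OF this] show ?thesis by simp
  qed
  have bm: "bM (\<lambda>k m0. diagT k (us @ [x]) (\<lambda>zs. h m0 ((y # vs) @ zs)))"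
    by (rule bM_rot) (use h len in auto)
  have "rot p h m ((us @ [actT (tgt K a) x]) @ y # vs) =
      sw2 (coactM m) (\<lambda>k m0. diagT (k * tgt K a) (us @ [x]) (\<lambda>zs. h m0 (y # vs @ zs)))"
    using len by (subst rot_append) (simp_all add: diagT_mult_tgt[OF m a])
  also have "\<dots> = sw2 (coactM m) (\<lambda>k m0. diagT k (us @ [x]) (\<lambda>zs. h (actM m0 (src K a)) (y # vs @ zs)))"
    using CM_mult_tgt[OF bm a, of m] by simp
  also have "\<dots> = sw2 (coactM m) (\<lambda>k m0. diagT k (us @ [x]) (\<lambda>zs. h m0 (actT (src K a) y # vs @ zs)))"
  proof (intro sw2_cong diagT_cong)
    fix k m0 and zs :: "'t list" assume "length zs = length (us @ [x])"
    then have l: "length (vs @ zs) = p + q - 1" "Suc (p + q - 1) = p + q" using len by auto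
    show "h (actM m0 (src K a)) (y # vs @ zs) = h m0 (actT (src K a) y # vs @ zs)"
      using functC_act[OF h, of "y # vs @ zs" m0 "src K a"] diagT_src_one[of "vs @ zs" "h m0" a y] functC_mS[OF h, of m0] a l
      by simp
  qed
  also have "\<dots> = rot p h m ((us @ [x]) @ actT (src K a) y # vs)"
    using len by (subst rot_append) simp_all
  finally show "rot p h m (us @ actT (tgt K a) x # y # vs) = rot p h m (us @ x # actT (src K a) y # vs)"
    by simp
qed

text \<open>That the rotation is balanced over \<open>K\<close> is the anti Yetter-Drinfeld condition.\<close>

lemma functC_rot:
  assumes h: "functC (p + q) h" and p: "p \<noteq> 0" and q: "q \<noteq> 0"
  shows "functC (p + q) (rot p h)"
  unfolding functC_def
proof (intro conjI allI impI)
  show "mS (p + q) (rot p h m)" for m by (rule mS_rot[OF assms])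
  fix ts :: "'t list" assume "length ts = p + q"
  then obtain xs ys where ts: "ts = xs @ ys" and len: "length xs = p" "length ys = q"
    by (metis add_diff_cancel_left' append_take_drop_id length_drop length_take min.absorb2 le_add1)
  have ne: "xs \<noteq> []" "ys \<noteq> []" using len p q by auto
  have bm: "bM (\<lambda>k m0. diagT k xs (\<lambda>us. h m0 (ys @ us)))"
    by (rule bM_rot) (use h len ne in auto)
  show "clin (\<lambda>m. rot p h m ts)"
    unfolding ts rot_append[OF len(1)] by (rule clin_CM[OF bm])
  fix m k
  have m: "mS (length xs) (\<lambda>us. h m (ys @ us))" if "length ys = q" for m ys
    using functC_mS[OF h] that len by (intro mbal_append_right) (simp add: add.commute)
  have hyx: "h (actM m0 c) (ys @ us) = sw2 (comul K c) (\<lambda>c1 c2. diagT c1 ys (\<lambda>vs. diagT c2 us (\<lambda>us. h m0 (vs @ us))))"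
    if "length us = p" for m0 c us
  proof -
    have "us \<noteq> []" using that p by auto
    then show ?thesis
      using functC_act[OF h, of "ys @ us" m0 c] that len ne functC_mS[OF h, of m0]
      by (simp add: diagT_append add.commute)
  qed
  define F where "F m0 c1 c2 = diagT c1 ys (\<lambda>vs. diagT c2 xs (\<lambda>us. h m0 (vs @ us)))" for m0 c1 c2
  have bF: "bK (F m0)" for m0
    unfolding F_def by (rule bK_diagT_pair) (use functC_mS[OF h] len ne in \<open>simp_all add: add.commute\<close>)
  have bF': "bK (\<lambda>c1 c2. F m0 c1 (c2 * a * k1))" for m0 a k1
  proof (rule balI)
    show "F m0 (tgt K r * x) (y * a * k1) = F m0 x (src K r * y * a * k1)" if "r \<in> base K" for x r y
      using bal_mid[OF bF that, of m0 x "y * a * k1"] by (simp add: mult.assoc)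
  qed (intro clin_intros bal_clin[OF bF] bal_left[OF bF])+
  \<comment> \<open>The anti Yetter-Drinfeld condition, evaluated at the rotated functional.\<close>
  have "rot p h (actM m k) ts = sw2 (comul K k) (\<lambda>k1 k2. sw2 (transl_left K k2)
      (\<lambda>c d. sw2 (coactM m) (\<lambda>a m0. diagT (d * a * k1) xs (\<lambda>us. h (actM m0 c) (ys @ us)))))"
    unfolding ts rot_append[OF len(1)] by (rule CM_act[OF bm])
  also have "\<dots> = sw2 (comul K k) (\<lambda>k1 k2. sw2 (transl_left K k2)
      (\<lambda>c d. sw2 (coactM m) (\<lambda>a m0. sw2 (comul K c) (\<lambda>c1 c2. F m0 c1 (c2 * d * a * k1)))))"
  proof (intro sw2_cong)
    fix k1 k2 c d a m0
    have "diagT (d * a * k1) xs (\<lambda>us. h (actM m0 c) (ys @ us)) = diagT (d * a * k1) xs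
        (\<lambda>us. sw2 (comul K c) (\<lambda>c1 c2. diagT c1 ys (\<lambda>vs. diagT c2 us (\<lambda>us. h m0 (vs @ us)))))"
      by (rule diagT_cong) (simp add: hyx len)
    also have "\<dots> = sw2 (comul K c) (\<lambda>c1 c2. diagT c1 ys (\<lambda>vs. diagT (d * a * k1) xs (\<lambda>us. diagT c2 us (\<lambda>us. h m0 (vs @ us)))))"
      by (simp add: diagT_sw2 diagT_commute[of _ xs])
    also have "\<dots> = sw2 (comul K c) (\<lambda>c1 c2. F m0 c1 (c2 * (d * a * k1)))"
      unfolding F_def by (intro sw2_cong diagT_cong diagT_comp[symmetric] m) (use len ne in auto)
    finally show "diagT (d * a * k1) xs (\<lambda>us. h (actM m0 c) (ys @ us)) =
        sw2 (comul K c) (\<lambda>c1 c2. F m0 c1 (c2 * d * a * k1))" by (simp add: mult.assoc)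
  qed
  also have "\<dots> = sw2 (comul K k) (\<lambda>k1 k2. sw2 (coactM m) (\<lambda>a m0. sw2 (transl_left K k2)
      (\<lambda>c d. sw2 (comul K c) (\<lambda>c1 c2. F m0 c1 (c2 * d * a * k1)))))"
    by (intro sw2_cong sw2_commute)
  \<comment> \<open>With c \<otimes> d standing for k_2^- \<otimes> k_2^+, the sum c^(1) \<otimes>
    c^(2) d is \<nu> of it and collapses to k_2 \<otimes> 1.\<close>
  also have "\<dots> = sw2 (comul K k) (\<lambda>k1 k2. sw2 (coactM m) (\<lambda>a m0. F m0 k2 (a * k1)))"
    using U_nu[OF bF'] by simp
  also have "\<dots> = sw2 (comul K k) (\<lambda>k1 k2. diagT k1 xs (\<lambda>us. diagT k2 ys (\<lambda>vs. rot p h m (us @ vs))))"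
  proof (rule sw2_cong)
    fix k1 k2
    have "F m0 k2 (a * k1) = diagT k1 xs (\<lambda>us. diagT k2 ys (\<lambda>vs. diagT a us (\<lambda>zs. h m0 (vs @ zs))))" for m0 a
    proof -
      have "F m0 k2 (a * k1) = diagT k2 ys (\<lambda>vs. diagT k1 xs (\<lambda>us. diagT a us (\<lambda>zs. h m0 (vs @ zs))))"
        unfolding F_def by (intro diagT_cong diagT_comp m) (use len ne in auto)
      then show ?thesis by (simp add: diagT_commute[of k2 ys])
    qed
    then have "sw2 (coactM m) (\<lambda>a m0. F m0 k2 (a * k1)) =
        diagT k1 xs (\<lambda>us. diagT k2 ys (\<lambda>vs. sw2 (coactM m) (\<lambda>a m0. diagT a us (\<lambda>zs. h m0 (vs @ zs)))))"
      by (simp add: diagT_sw2)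
    also have "\<dots> = diagT k1 xs (\<lambda>us. diagT k2 ys (\<lambda>vs. rot p h m (us @ vs)))"
      by (intro diagT_cong) (simp add: len)
    finally show "sw2 (coactM m) (\<lambda>a m0. F m0 k2 (a * k1)) =
        diagT k1 xs (\<lambda>us. diagT k2 ys (\<lambda>vs. rot p h m (us @ vs)))" .
  qed
  also have "\<dots> = diagT k ts (rot p h m)"
    unfolding ts by (rule diagT_append[symmetric]) (use mS_rot[OF assms] len ne in auto)
  finally show "rot p h (actM m k) ts = diagT k ts (rot p h m)" .
qed

text \<open>Moving p + p' and then q + p factors is a full turn together with a rotation by p.
  Coassociativity separates the part of the coaction that performs the full turn; it acts diagonally
  on the whole list, hence on M, and stability removes it.\<close>

lemma rot_rot:
  assumes h: "functC (p + p' + q) h" and p: "p \<noteq> 0" and p': "p' \<noteq> 0" and q: "q \<noteq> 0"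
    and ts: "length ts = p + p' + q"
  shows "rot (p + p') (rot (q + p) h) m ts = rot p h m ts"
proof -
  obtain xs xs' ys where t: "ts = xs @ xs' @ ys" and len: "length xs = p" "length xs' = p'" "length ys = q"
  proof
    show "ts = take p ts @ take p' (drop p ts) @ drop (p + p') ts"
      by (metis append_take_drop_id drop_drop add.commute)
  qed (use ts in auto)
  have ne: "xs \<noteq> []" "xs' \<noteq> []" "ys \<noteq> []" using len p p' q by auto
  let ?g = "rot (q + p) h"
  have g: "functC (p + p' + q) ?g"
    using functC_rot[of "q + p" p' h] h p' q by (simp add: ac_simps)
  define F where "F k1 k2 m0 = diagT k1 xs (\<lambda>us. diagT k2 xs' (\<lambda>us'. ?g m0 (ys @ us @ us')))" for k1 k2 m0
  define H where "H k1 k2 k3 m0 = diagT k1 xs (\<lambda>us. diagT k2 xs' (\<lambda>us'. diagT k3 (ys @ us) (\<lambda>zs. h m0 (us' @ zs))))"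
    for k1 k2 k3 m0
  have F_H: "F k1 k2 m0 = sw2 (coactM m0) (\<lambda>k3 m1. H k1 k2 k3 m1)" for k1 k2 m0
  proof -
    have "F k1 k2 m0 = diagT k1 xs (\<lambda>us. diagT k2 xs' (\<lambda>us'. sw2 (coactM m0) (\<lambda>k3 m1. diagT k3 (ys @ us) (\<lambda>zs. h m1 (us' @ zs)))))"
      unfolding F_def
    proof (intro diagT_cong)
      fix us us' :: "'t list" assume "length us = length xs" "length us' = length xs'"
      then show "?g m0 (ys @ us @ us') = sw2 (coactM m0) (\<lambda>k3 m1. diagT k3 (ys @ us) (\<lambda>zs. h m1 (us' @ zs)))"
        using rot_append[of "ys @ us" "q + p" h m0 us'] len by simp
    qed
    then show ?thesis by (simp add: diagT_sw2 H_def)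
  qed
  have mg: "mS (p + p') (\<lambda>zs. ?g m0 (ys @ zs))" for m0
    using functC_mS[OF g] len by (intro mbal_append_right) (simp add: ac_simps)
  have F1: "bK (\<lambda>k1 k2. F k1 k2 m0)" for m0
    unfolding F_def by (rule bK_diagT_pair[of xs xs' "\<lambda>zs. ?g m0 (ys @ zs)"]) (use mg len ne in auto)
  have F2: "bM (F k1)" for k1
  proof -
    have b: "bM (\<lambda>k2 m0. diagT k2 xs' (\<lambda>us'. ?g m0 ((ys @ us) @ us')))" if "length us = length xs" for us
      by (rule bM_rot) (use g len ne that in \<open>simp_all add: ac_simps\<close>)
    show ?thesis unfolding F_def
    proof (rule balI)
      show "clin (\<lambda>k2. diagT k1 xs (\<lambda>us. diagT k2 xs' (\<lambda>us'. ?g m0 (ys @ us @ us'))))" for m0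
        by (rule clin_diagT_in) (use bal_left[OF b] in simp)
      show "clin (\<lambda>m0. diagT k1 xs (\<lambda>us. diagT k2 xs' (\<lambda>us'. ?g m0 (ys @ us @ us'))))" for k2
        by (rule clin_diagT_in) (use bal_right[OF b] in simp)
      show "diagT k1 xs (\<lambda>us. diagT (tgt K a * k2) xs' (\<lambda>us'. ?g m0 (ys @ us @ us'))) =
          diagT k1 xs (\<lambda>us. diagT k2 xs' (\<lambda>us'. ?g (actM m0 (tgt K a)) (ys @ us @ us')))" if "a \<in> base K" for k2 a m0
        by (rule diagT_cong) (use bal_mid[OF b that] in simp)
    qed
  qed
  have hm: "mS (length xs' + (length ys + length us)) (h m0)" if "length us = length xs" for us m0
    using functC_mS[OF h, of m0] that len by (simp add: ac_simps)
  have H1: "bK (\<lambda>k2 k3. H k1 k2 k3 m0)" for k1 m0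
  proof -
    have b: "bK (\<lambda>k2 k3. diagT k2 xs' (\<lambda>us'. diagT k3 (ys @ us) (\<lambda>zs. h m0 (us' @ zs))))" if "length us = length xs" for us
      by (rule bK_diagT_pair) (use hm[OF that] ne in auto)
    show ?thesis unfolding H_def
    proof (rule balI)
      show "clin (\<lambda>k2. diagT k1 xs (\<lambda>us. diagT k2 xs' (\<lambda>us'. diagT k3 (ys @ us) (\<lambda>zs. h m0 (us' @ zs)))))" for k3
        by (rule clin_diagT_in) (rule bal_left[OF b])
      show "clin (\<lambda>k3. diagT k1 xs (\<lambda>us. diagT k2 xs' (\<lambda>us'. diagT k3 (ys @ us) (\<lambda>zs. h m0 (us' @ zs)))))" for k2
        by (rule clin_diagT_in) (rule bal_right[OF b])
      show "diagT k1 xs (\<lambda>us. diagT (tgt K a * k2) xs' (\<lambda>us'. diagT k3 (ys @ us) (\<lambda>zs. h m0 (us' @ zs)))) =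
          diagT k1 xs (\<lambda>us. diagT k2 xs' (\<lambda>us'. diagT (src K a * k3) (ys @ us) (\<lambda>zs. h m0 (us' @ zs))))"
        if "a \<in> base K" for k2 a k3
        by (rule diagT_cong, rule bal_mid[OF b that])
    qed
  qed
  have H2: "bM (H k1 k2)" for k1 k2
  proof -
    have b: "bM (\<lambda>k3 m0. diagT k3 (ys @ us) (\<lambda>zs. h m0 (us' @ zs)))"
      if "length us = length xs" "length us' = length xs'" for us us'
      by (rule bM_rot) (use h len ne that in \<open>simp_all add: ac_simps\<close>)
    show ?thesis unfolding H_def
    proof (rule balI)
      show "clin (\<lambda>k3. diagT k1 xs (\<lambda>us. diagT k2 xs' (\<lambda>us'. diagT k3 (ys @ us) (\<lambda>zs. h m0 (us' @ zs)))))" for m0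
        by (rule clin_diagT_in, rule clin_diagT_in, rule bal_left[OF b])
      show "clin (\<lambda>m0. diagT k1 xs (\<lambda>us. diagT k2 xs' (\<lambda>us'. diagT k3 (ys @ us) (\<lambda>zs. h m0 (us' @ zs)))))" for k3
        by (rule clin_diagT_in, rule clin_diagT_in, rule bal_right[OF b])
      show "diagT k1 xs (\<lambda>us. diagT k2 xs' (\<lambda>us'. diagT (tgt K a * k3) (ys @ us) (\<lambda>zs. h m0 (us' @ zs)))) =
          diagT k1 xs (\<lambda>us. diagT k2 xs' (\<lambda>us'. diagT k3 (ys @ us) (\<lambda>zs. h (actM m0 (tgt K a)) (us' @ zs))))"
        if "a \<in> base K" for k3 a m0
        by (rule diagT_cong, rule diagT_cong, rule bal_mid[OF b that])
    qed
  qed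
  have "rot (p + p') ?g m ts = sw2 (coactM m) (\<lambda>k m0. diagT k (xs @ xs') (\<lambda>zs. ?g m0 (ys @ zs)))"
    using rot_append[of "xs @ xs'" "p + p'" ?g m ys] len t by simp
  also have "\<dots> = sw2 (coactM m) (\<lambda>k m0. sw2 (comul K k) (\<lambda>k1 k2. F k1 k2 m0))"
    unfolding F_def by (rule sw2_cong, rule diagT_append) (use mg len ne in auto)
  also have "\<dots> = sw2 (coactM m) (\<lambda>k1 m0. sw2 (coactM m0) (\<lambda>k2 m1. F k1 k2 m1))"
    by (rule CM_coassoc[OF F1 F2])
  also have "\<dots> = sw2 (coactM m) (\<lambda>k1 m0. sw2 (coactM m0) (\<lambda>k m1. sw2 (comul K k) (\<lambda>k2 k3. H k1 k2 k3 m1)))"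
    unfolding F_H by (rule sw2_cong, rule CM_coassoc[OF H1 H2, symmetric])
  \<comment> \<open>The two parts of \<open>k\<close>, one on \<open>xs'\<close> and one on the
    remaining factors, reassemble to a diagonal action on the whole list, which passes to M.\<close>
  also have "\<dots> = sw2 (coactM m) (\<lambda>k1 m0. sw2 (coactM m0) (\<lambda>k m1. diagT k1 xs (\<lambda>us. h (actM m1 k) (xs' @ ys @ us))))"
  proof (intro sw2_cong)
    fix k1 m0 k m1
    show "sw2 (comul K k) (\<lambda>k2 k3. H k1 k2 k3 m1) = diagT k1 xs (\<lambda>us. h (actM m1 k) (xs' @ ys @ us))"
      unfolding H_def diagT_sw2[symmetric]
    proof (rule diagT_cong)
      fix us :: "'t list" assume l: "length us = length xs"
      show "sw2 (comul K k) (\<lambda>k2 k3. diagT k2 xs' (\<lambda>us'. diagT k3 (ys @ us) (\<lambda>zs. h m1 (us' @ zs)))) = h (actM m1 k) (xs' @ ys @ us)"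
        using functC_act[OF h, of "xs' @ ys @ us" m1 k] diagT_append[of xs' "ys @ us" "h m1" k] hm[OF l] l len ne
        by (simp add: ac_simps)
    qed
  qed
  also have "\<dots> = sw2 (coactM m) (\<lambda>k1 m0. diagT k1 xs (\<lambda>us. h m0 (xs' @ ys @ us)))"
  proof (rule sw2_cong)
    fix k1 m0
    have "clin (\<lambda>m1. diagT k1 xs (\<lambda>us. h m1 (xs' @ ys @ us)))"
      by (rule clin_diagT_in, rule functC_clin[OF h]) (use len in simp)
    from CM_stable[OF this] show "sw2 (coactM m0) (\<lambda>k m1. diagT k1 xs (\<lambda>us. h (actM m1 k) (xs' @ ys @ us))) =
        diagT k1 xs (\<lambda>us. h m0 (xs' @ ys @ us))" .
  qed
  also have "\<dots> = rot p h m ts"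
    using len t by simp
  finally show ?thesis .
qed

text \<open>Exactly one full turn: every factor is moved once, so by coassociativity a single
  coacting element acts diagonally, and stability applies.\<close>

lemma rot_rot_id:
  assumes h: "functC (p + q) h" and p: "p \<noteq> 0" and q: "q \<noteq> 0" and ts: "length ts = p + q"
  shows "rot p (rot q h) m ts = h m ts"
proof -
  obtain xs ys where t: "ts = xs @ ys" and len: "length xs = p" "length ys = q"
    using ts by (metis add_diff_cancel_left' append_take_drop_id length_drop length_take min.absorb2 le_add1)
  have ne: "xs \<noteq> []" "ys \<noteq> []" using len p q by auto
  have hm: "mS (length xs + length ys) (h m0)" for m0 using functC_mS[OF h] len by simp
  define H where "H k1 k2 m0 = diagT k1 xs (\<lambda>us. diagT k2 ys (\<lambda>vs. h m0 (us @ vs)))" for k1 k2 m0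
  have "rot p (rot q h) m ts = sw2 (coactM m) (\<lambda>k m0. diagT k xs (\<lambda>us. rot q h m0 (ys @ us)))"
    using len t by simp
  also have "\<dots> = sw2 (coactM m) (\<lambda>k m0. sw2 (coactM m0) (H k))"
    using len by (simp add: diagT_sw2 H_def[abs_def])
  also have "\<dots> = sw2 (coactM m) (\<lambda>k m0. sw2 (comul K k) (\<lambda>k1 k2. H k1 k2 m0))"
  proof (rule CM_coassoc[symmetric])
    show "bK (\<lambda>k1 k2. H k1 k2 m)" for m
      unfolding H_def by (rule bK_diagT_pair[OF hm ne])
    have b: "bM (\<lambda>k m0. diagT k ys (\<lambda>vs. h m0 (us @ vs)))" if "length us = length xs" for us
      by (rule bM_rot) (use h len ne that in \<open>simp_all add: ac_simps\<close>)
    show "bM (H k)" for k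
      unfolding H_def
      by (rule balI; (rule clin_diagT_in | rule diagT_cong), (rule bal_left[OF b] | rule bal_right[OF b] | rule bal_mid[OF b]))
  qed
  also have "\<dots> = sw2 (coactM m) (\<lambda>k m0. h (actM m0 k) ts)"
    unfolding H_def t
    using functC_act[OF h] len by (intro sw2_cong) (simp add: diagT_append[OF hm ne])
  also have "\<dots> = h m ts" by (rule CM_stable[OF functC_clin[OF h ts]])
  finally show ?thesis .
qed

end


section \<open>Faces, degeneracies and the cyclic operator on functionals\<close>

lemma merge_at_append: "Suc j < length us \<Longrightarrow> merge_at j (us @ vs) = merge_at j us @ vs"
  by (induction j us rule: merge_at.induct) auto

lemma merge_at_append_last: "merge_at (length us) (us @ [a, b]) = us @ [a * b]"
  by (induction us) auto

lemma unit_at_append: "j < length us \<Longrightarrow> unit_at j (us @ vs) = unit_at j us @ vs"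
  by (induction j us rule: unit_at.induct) auto

lemma unit_at_last: "us \<noteq> [] \<Longrightarrow> unit_at (length us - 1) us = us @ [1]"
proof (induction us)
  case (Cons a us) then show ?case by (cases us) auto
qed simp

lemma snoc_decomp: "length ts = Suc n \<Longrightarrow> \<exists>us t. ts = us @ [t] \<and> length us = n"
  by (cases ts rule: rev_cases) auto

context sayd_coefficients
begin

abbreviation C where "C \<equiv> cyclic_T K actM coactM actT"

definition evC :: "nat \<Rightarrow> ('m \<Rightarrow> 't list \<Rightarrow> 'w::complex_vector) \<Rightarrow> ('m \<times> 't list free) free \<Rightarrow> 'w"
  where "evC n h z = sw2 z (\<lambda>m X. on_length n X (h m))"

lemma clin_evC: "clin (evC n h)"
  unfolding evC_def by (rule clin_sw2)

lemma evC_cong: "(\<And>m ts. length ts = n \<Longrightarrow> h m ts = h' m ts) \<Longrightarrow> evC n h z = evC n h' z"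
  unfolding evC_def by (intro sw2_cong on_length_cong) auto

text \<open>Indexed by the number of factors T, which is one more than the degree.\<close>

definition nullC :: "nat \<Rightarrow> ('m \<times> 't list free) free set"
  where "nullC n = tensor_null UNIV actM (diag_left K actT) {0} (modalg_tpow_null K actT n)"

lemma null_C: "null C n = nullC (Suc n)"
  by (simp add: cyclic_T_def nullC_def)

lemma on_length_diag_left: "on_length n (diag_left K actT k X) G = on_length n X (\<lambda>ts. diagT k ts G)"
proof -
  have "on_length n (diag_left K actT k X) G = lsum X (\<lambda>ts. diagT k ts (\<lambda>zs. if length zs = n then G zs else 0))"
    unfolding on_length_def diag_left_def diagT_def by simp
  also have "\<dots> = lsum X (\<lambda>ts. if length ts = n then diagT k ts G else 0)"
  proof (rule lsum_cong)
    fix ts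
    have "diagT k ts (\<lambda>zs. if length zs = n then G zs else 0) = diagT k ts (\<lambda>zs. if length ts = n then G zs else 0)"
      by (rule diagT_cong) simp
    then show "diagT k ts (\<lambda>zs. if length zs = n then G zs else 0) = (if length ts = n then diagT k ts G else 0)"
      by simp
  qed
  finally show ?thesis by (simp add: on_length_def)
qed

lemma clin_on_length_in:
  assumes "\<And>ts. length ts = n \<Longrightarrow> clin (\<lambda>y. F y ts)"
  shows "clin (\<lambda>y. on_length n X (F y))"
  unfolding on_length_def
proof (rule clin_lsum_in)
  show "clin (\<lambda>y. if length ts = n then F y ts else 0)" for ts
    by (cases "length ts = n") (simp_all add: assms clin_0)
qed

lemma evC_null:
  assumes h: "functC n h" and z: "z \<in> nullC n"
  shows "evC n h z = 0"
  unfolding evC_def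
proof (rule sw2_tensor_null[OF _ _ _ z[unfolded nullC_def]])
  have cl: "clin (\<lambda>m. on_length n X (h m))" for X
    by (rule clin_on_length_in) (rule functC_clin[OF h])
  show "bal UNIV actM (diag_left K actT) (\<lambda>m X. on_length n X (h m))"
  proof (rule balI)
    show "on_length n X (h (actM m k)) = on_length n (diag_left K actT k X) (h m)" for m k X
      unfolding on_length_diag_left by (rule on_length_cong) (rule functC_act[OF h])
  qed (rule cl clin_on_length)+
  show "on_length n X (h m) = 0" if "m \<in> {0}" for m X
    using that clin_zero[OF cl[of X]] by simp
  show "on_length n X (h m) = 0" if "X \<in> modalg_tpow_null K actT n" for m X
    using functC_mS[OF h] that unfolding modalg_tpow_null_def by (rule on_length_tpow_null)
qed

lemma nullCI:
  assumes "\<And>h :: 'm \<Rightarrow> 't list \<Rightarrow> complex. functC n h \<Longrightarrow> evC n h z = 0"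
  shows "z \<in> nullC n"
  unfolding nullC_def
proof (rule tensor_nullI)
  fix F :: "'m \<Rightarrow> 't list free \<Rightarrow> complex"
  assume F: "bal UNIV actM (diag_left K actT) F"
    and z: "\<And>m X. X \<in> modalg_tpow_null K actT n \<Longrightarrow> F m X = 0"
  define h where "h m ts = F m (gen ts)" for m ts
  note mf = mbal_of_functional[OF bal_right[OF F] z, unfolded modalg_tpow_null_def]
  have ev: "F m X = on_length n X (h m)" for m X
    unfolding h_def by (rule mf(2))
  have "functC n h"
    unfolding functC_def
  proof (intro conjI allI impI)
    show "clin (\<lambda>m. h m ts)" for ts unfolding h_def by (rule bal_left[OF F])
    show "mS n (h m)" for m unfolding h_def by (rule mf(1))
    show "h (actM m k) ts = diagT k ts (h m)" if "length ts = n" for m k ts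
      using bal_mid[OF F, of k m "gen ts"] that by (simp add: ev on_length_diag_left)
  qed
  from assms[OF this] show "sw2 z F = 0" by (simp add: evC_def ev[abs_def])
qed

lemma eqCI:
  assumes "\<And>h :: 'm \<Rightarrow> 't list \<Rightarrow> complex. functC n h \<Longrightarrow> evC n h x = evC n h y"
  shows "x \<simeq>\<^bsub>nullC n\<^esub> y"
  by (rule nullCI) (simp add: clin_diff[OF clin_evC] assms)

lemma subspace_nullC: "complex_vector.subspace (nullC n)"
  unfolding nullC_def by (rule subspace_tensor_null)

lemma functC_merge:
  assumes h: "functC n h" and i: "i < n"
  shows "functC (Suc n) (\<lambda>m ts. h m (merge_at i ts))"
  unfolding functC_def
proof (intro conjI allI impI)
  show "mS (Suc n) (\<lambda>ts. h m (merge_at i ts))" for m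
    by (rule mS_merge[OF functC_mS[OF h] i])
  fix ts :: "'t list" assume len: "length ts = Suc n"
  then have l: "length (merge_at i ts) = n" using i by simp
  show "clin (\<lambda>m. h m (merge_at i ts))" by (rule functC_clin[OF h l])
  show "h (actM m k) (merge_at i ts) = diagT k ts (\<lambda>ts. h m (merge_at i ts))" for m k
    unfolding functC_act[OF h l] diagT_merge[OF functC_mS[OF h] len i] ..
qed

lemma functC_unit:
  assumes h: "functC (Suc n) h" and i: "i < n"
  shows "functC n (\<lambda>m ts. h m (unit_at i ts))"
  unfolding functC_def
proof (intro conjI allI impI)
  show "mS n (\<lambda>ts. h m (unit_at i ts))" for m
    by (rule mS_unit[OF functC_mS[OF h] i])
  fix ts :: "'t list" assume len: "length ts = n"
  then have l: "length (unit_at i ts) = Suc n" using i by simp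
  show "clin (\<lambda>m. h m (unit_at i ts))" by (rule functC_clin[OF h l])
  show "h (actM m k) (unit_at i ts) = diagT k ts (\<lambda>ts. h m (unit_at i ts))" for m k
    unfolding functC_act[OF h l] diagT_unit[OF functC_mS[OF h] len i] ..
qed

text \<open>By coassociativity, an iterated coaction of M acting factor by factor is a single
  coaction acting diagonally. The prefix \<open>ys\<close> is what the induction has already
  processed.\<close>

lemma lcoact_iter_eq:
  "functC (length ts + length ys) h \<Longrightarrow> ts \<noteq> [] \<Longrightarrow>
    sw2 (lcoact_iter coactM (length ts) m) (\<lambda>ks m0. h m0 (ys @ map2 actT ks ts)) =
    sw2 (coactM m) (\<lambda>k m0. diagT k ts (\<lambda>us. h m0 (ys @ us)))"
proof (induction ts arbitrary: ys m)
  case Nil then show ?case by simp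
next
  case (Cons t ts)
  note h = Cons.prems(1)
  show ?case
  proof (cases "ts = []")
    case True then show ?thesis by (simp add: lsum_case)
  next
    case False
    have h': "functC (length ts + length (ys @ [u])) h" for u using h by simp
    have "sw2 (lcoact_iter coactM (length (t # ts)) m) (\<lambda>ks m0. h m0 (ys @ map2 actT ks (t # ts))) =
        sw2 (coactM m) (\<lambda>k m'. sw2 (lcoact_iter coactM (length ts) m') (\<lambda>ks m0. h m0 ((ys @ [actT k t]) @ map2 actT ks ts)))"
      by (simp add: lsum_case)
    also have "\<dots> = sw2 (coactM m) (\<lambda>k m'. sw2 (coactM m') (\<lambda>k' m0. diagT k' ts (\<lambda>us. h m0 ((ys @ [actT k t]) @ us))))"
      using Cons.IH[OF h' False] by simp
    also have "\<dots> = sw2 (coactM m) (\<lambda>k m0. sw2 (comul K k) (\<lambda>k k'. diagT k' ts (\<lambda>us. h m0 ((ys @ [actT k t]) @ us))))"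
    proof (rule CM_coassoc[symmetric])
      show "bK (\<lambda>k k'. diagT k' ts (\<lambda>us. h m ((ys @ [actT k t]) @ us)))" for m
      proof -
        have "length ys + Suc (length ts) = length (t # ts) + length ys" by simp
        then have "mS (length ys + Suc (length ts)) (h m)" using functC_mS[OF h, of m] by (simp add: add.commute)
        from bK_diagT_Cons[OF mbal_append_right[OF this] False, of t] show ?thesis by simp
      qed
      show "bM (\<lambda>k' m0. diagT k' ts (\<lambda>us. h m0 ((ys @ [actT k t]) @ us)))" for k
        by (rule bM_rot[OF h' False])
    qed
    finally show ?thesis by (simp add: diagT_Cons False)
  qed
qed

text \<open>The transpose of a face, so compositions occur in reversed order. The last face is
  encoded as \<delta>_0 \<tau>: a rotation, then the product of the first two factors.\<close>

definition faceF :: "nat \<Rightarrow> nat \<Rightarrow> ('m \<Rightarrow> 't list \<Rightarrow> 'w::complex_vector) \<Rightarrow> 'm \<Rightarrow> 't list \<Rightarrow> 'w"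
  where "faceF n i h = (if i < n then \<lambda>m ts. h m (merge_at i ts) else rot n (\<lambda>m ts. h m (merge_at 0 ts)))"

definition degenF :: "nat \<Rightarrow> ('m \<Rightarrow> 't list \<Rightarrow> 'w::complex_vector) \<Rightarrow> 'm \<Rightarrow> 't list \<Rightarrow> 'w"
  where "degenF i h = (\<lambda>m ts. h m (unit_at i ts))"

text \<open>Degree 0 is separate because \<open>rot 0\<close> would coact on M and drop the coacting
  factor, which is not the identity.\<close>

definition cycF :: "nat \<Rightarrow> ('m \<Rightarrow> 't list \<Rightarrow> 'w::complex_vector) \<Rightarrow> 'm \<Rightarrow> 't list \<Rightarrow> 'w"
  where "cycF n h = (if n = 0 then h else rot n h)"

lemma functC_faceF: "functC n h \<Longrightarrow> n \<noteq> 0 \<Longrightarrow> functC (Suc n) (faceF n i h)"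
  using functC_merge[of n h] functC_rot[of n 1 "\<lambda>m ts. h m (merge_at 0 ts)"]
  by (simp add: faceF_def)

lemma functC_degenF: "functC (Suc (Suc n)) h \<Longrightarrow> i \<le> n \<Longrightarrow> functC (Suc n) (degenF i h)"
  unfolding degenF_def by (rule functC_unit) simp_all

lemma functC_cycF: "functC (Suc n) h \<Longrightarrow> functC (Suc n) (cycF n h)"
  using functC_rot[of n 1 h] by (cases "n = 0") (simp_all add: cycF_def)

lemma evC_op:
  assumes "\<And>m ts. length ts = n \<Longrightarrow> evC n' h (\<phi> m ts) = h' m ts"
  shows "evC n' h (lsum z (\<lambda>(m, X). on_length n X (\<phi> m))) = evC n h' z"
proof -
  have "evC n' h (lsum z (\<lambda>(m, X). on_length n X (\<phi> m))) = sw2 z (\<lambda>m X. evC n' h (on_length n X (\<phi> m)))"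
    unfolding lsum_case by (rule clin_sw2_out[OF clin_evC])
  also have "\<dots> = evC n h' z"
    unfolding evC_def[of n]
  proof (rule sw2_cong)
    fix m X
    show "evC n' h (on_length n X (\<phi> m)) = on_length n X (h' m)"
      unfolding on_length_def clin_lsum_out[OF clin_evC]
      by (rule lsum_cong) (simp add: assms clin_zero[OF clin_evC])
  qed
  finally show ?thesis .
qed

lemma evC_tens [simp]: "evC n h (m \<otimes> X) = on_length n X (h m)"
  by (simp add: evC_def)

lemma evC_sw2: "evC n h (sw2 X F) = sw2 X (\<lambda>a b. evC n h (F a b))"
  by (rule clin_sw2_out[OF clin_evC])

lemma lcoact_iter_length:
  "sw2 (lcoact_iter coactM n m) (\<lambda>ks m0. F ks m0) = sw2 (lcoact_iter coactM n m) (\<lambda>ks m0. if length ks = n then F ks m0 else 0)"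
proof (induction n arbitrary: m F)
  case (Suc n)
  show ?case by (simp add: lsum_case) (rule sw2_cong, rule Suc.IH)
qed simp

lemma evC_cyc:
  assumes h: "functC (Suc n) h"
  shows "evC (Suc n) h (cyc C n z) = evC (Suc n) (cycF n h) z"
  unfolding cyclic_T_def cyclic_data.simps Suc_eq_plus1[symmetric]
proof (rule evC_op)
  fix m and ts :: "'t list" assume "length ts = Suc n"
  then obtain us t where ts: "ts = us @ [t]" and len: "length us = n" using snoc_decomp by blast
  show "evC (Suc n) h (lsum (lcoact_iter coactM n m) (\<lambda>(ks, m0). m0 \<otimes> gen (last ts # map2 actT ks (butlast ts)))) = cycF n h m ts"
  proof (cases "n = 0")
    case True then show ?thesis using len ts by (simp add: cycF_def lsum_case)
  next
    case False
    have "evC (Suc n) h (lsum (lcoact_iter coactM n m) (\<lambda>(ks, m0). m0 \<otimes> gen (last ts # map2 actT ks (butlast ts)))) =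
        sw2 (lcoact_iter coactM n m) (\<lambda>ks m0. if length ks = n then h m0 ([t] @ map2 actT ks us) else 0)"
      by (subst lcoact_iter_length, unfold lsum_case, subst lcoact_iter_length)
        (auto simp: evC_sw2 ts len clin_zero[OF clin_evC] intro!: sw2_cong)
    also have "\<dots> = sw2 (coactM m) (\<lambda>k m0. diagT k us (\<lambda>us. h m0 ([t] @ us)))"
      unfolding lcoact_iter_length[symmetric]
      using lcoact_iter_eq[of us "[t]" h m] h len False by auto
    finally show ?thesis using False len ts by (simp add: cycF_def)
  qed
qed

lemma evC_degen:
  assumes "i \<le> n"
  shows "evC (Suc (Suc n)) h (degen C n i z) = evC (Suc n) (degenF i h) z"
  unfolding cyclic_T_def cyclic_data.simps Suc_eq_plus1[symmetric]
proof (rule evC_op)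
  fix m and ts :: "'t list" assume len: "length ts = Suc n"
  then show "evC (Suc (Suc n)) h (m \<otimes> gen (take (Suc i) ts @ 1 # drop (Suc i) ts)) = degenF i h m ts"
    using assms unit_at_eq[of i ts] by (simp add: degenF_def)
qed

lemma evC_face:
  assumes h: "functC n h" and n: "n \<noteq> 0" and i: "i \<le> n"
  shows "evC n h (face C n i z) = evC (Suc n) (faceF n i h) z"
  unfolding cyclic_T_def cyclic_data.simps Suc_eq_plus1[symmetric]
proof (rule evC_op)
  fix m and ts :: "'t list" assume l: "length ts = Suc n"
  then obtain us t where ts: "ts = us @ [t]" and len: "length us = n" using snoc_decomp by blast
  show "evC n h (if i < n then m \<otimes> gen (take i ts @ (ts ! i * ts ! Suc i) # drop (i + 2) ts)
      else lsum (lcoact_iter coactM n m) (\<lambda>(ks, m0).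
        let us = map2 actT ks (butlast ts) in m0 \<otimes> gen ((last ts * hd us) # tl us))) = faceF n i h m ts"
  proof (cases "i < n")
    case True
    then show ?thesis using merge_at_eq[of i ts] l by (simp add: faceF_def)
  next
    case False
    let ?h = "\<lambda>m ts. h m (merge_at 0 ts)"
    have h': "functC (Suc n) ?h" by (rule functC_merge[OF h]) (use n in simp)
    have m: "h m0 ((t * hd vs) # tl vs) = h m0 (merge_at 0 (t # vs))" if "length vs = n" for vs m0
      using that n by (cases vs) auto
    have "evC n h (lsum (lcoact_iter coactM n m) (\<lambda>(ks, m0).
        let us = map2 actT ks (butlast ts) in m0 \<otimes> gen ((last ts * hd us) # tl us))) =
        sw2 (lcoact_iter coactM n m) (\<lambda>ks m0. if length ks = n then ?h m0 ([t] @ map2 actT ks us) else 0)"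
      by (unfold lsum_case, subst lcoact_iter_length)
        (use n in \<open>auto simp: evC_sw2 ts len clin_zero[OF clin_evC] m Let_def intro!: sw2_cong\<close>)
    also have "\<dots> = sw2 (coactM m) (\<lambda>k m0. diagT k us (\<lambda>us. ?h m0 ([t] @ us)))"
      unfolding lcoact_iter_length[symmetric]
      using lcoact_iter_eq[of us "[t]" ?h m] h' len n by auto
    finally show ?thesis using False len ts by (simp add: faceF_def)
  qed
qed

text \<open>The two factors to be multiplied lie inside the rotated block, where the diagonal action
  respects products.\<close>

lemma rot_merge:
  assumes h: "functC n h" and i: "0 < i" "i < n" and ts: "length ts = Suc n"
  shows "rot n (\<lambda>m ts. h m (merge_at i ts)) m ts = rot (n - 1) h m (merge_at (i - 1) ts)"
proof -
  obtain us t where t: "ts = us @ [t]" and len: "length us = n" using snoc_decomp[OF ts] by blast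
  obtain j where j: "i = Suc j" using i by (cases i) auto
  obtain n' where n: "n = Suc n'" using i by (cases n) auto
  have m: "mS n' (\<lambda>xs. h m0 (t # xs))" for m0
    using functC_mS[OF h] unfolding n by (rule mbal_ConsD(2))
  have "merge_at j ts = merge_at j us @ [t]" unfolding t by (rule merge_at_append) (use i j len in simp)
  then have "rot (n - 1) h m (merge_at (i - 1) ts) = sw2 (coactM m) (\<lambda>k m0. diagT k (merge_at j us) (\<lambda>xs. h m0 (t # xs)))"
    using i j len by simp
  also have "\<dots> = sw2 (coactM m) (\<lambda>k m0. diagT k us (\<lambda>xs. h m0 (t # merge_at j xs)))"
    using i by (intro sw2_cong diagT_merge[OF m, symmetric]) (use len j n in auto)
  finally show ?thesis using len by (simp add: t j)
qed

text \<open>The rotation leaves the last two factors untouched and in front, so they may be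
  multiplied before or after it.\<close>

lemma rot_merge_last:
  assumes "n \<noteq> 0" and ts: "length ts = Suc (Suc n)"
  shows "rot n (\<lambda>m ts. h m (merge_at 0 ts)) m ts = rot n h m (merge_at n ts)"
proof -
  obtain us' b where "ts = us' @ [b]" "length us' = Suc n" using snoc_decomp[OF ts] by blast
  moreover obtain us a where "us' = us @ [a]" "length us = n" using snoc_decomp[OF calculation(2)] by blast
  ultimately have t: "ts = us @ [a, b]" and len: "length us = n" by simp_all
  have "merge_at n ts = us @ [a * b]" using merge_at_append_last[of us a b] t len by simp
  then show ?thesis using len by (simp add: t)
qed

lemma rot_unit:
  assumes h: "functC (Suc (Suc n)) h" and i: "0 < i" "i \<le> n" and ts: "length ts = Suc n"
  shows "rot n (\<lambda>m ts. h m (unit_at i ts)) m ts = rot (Suc n) h m (unit_at (i - 1) ts)"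
proof -
  obtain us t where t: "ts = us @ [t]" and len: "length us = n" using snoc_decomp[OF ts] by blast
  obtain j where j: "i = Suc j" using i by (cases i) auto
  have m: "mS (Suc n) (\<lambda>xs. h m0 (t # xs))" for m0
    using functC_mS[OF h] by (rule mbal_ConsD(2))
  have "unit_at j ts = unit_at j us @ [t]" unfolding t by (rule unit_at_append) (use i j len in simp)
  then have "rot (Suc n) h m (unit_at (i - 1) ts) = sw2 (coactM m) (\<lambda>k m0. diagT k (unit_at j us) (\<lambda>xs. h m0 (t # xs)))"
    using i j len by simp
  also have "\<dots> = sw2 (coactM m) (\<lambda>k m0. diagT k us (\<lambda>xs. h m0 (t # unit_at j xs)))"
    using i by (intro sw2_cong diagT_unit[OF m, symmetric]) (use len j in auto)
  finally show ?thesis using len by (simp add: t j)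
qed

text \<open>Each application moves n of the n + 1 factors, a single step in the opposite direction,
  so j of them amount to moving n + 1 - j factors.\<close>

lemma evC_cyc_pow:
  assumes h: "functC (Suc n) h" and n: "n \<noteq> 0" and j: "0 < j" "j \<le> n"
  shows "evC (Suc n) h ((cyc C n ^^ j) z) = evC (Suc n) (rot (Suc n - j) h) z"
  using j h
proof (induction j arbitrary: h)
  case 0 then show ?case by simp
next
  case (Suc j)
  note h = Suc.prems(3)
  show ?case
  proof (cases "j = 0")
    case True then show ?thesis using evC_cyc[OF h] n by (simp add: cycF_def)
  next
    case False
    have h': "functC (Suc n) (rot n h)" using functC_cycF[OF h] n by (simp add: cycF_def)
    have "evC (Suc n) h ((cyc C n ^^ Suc j) z) = evC (Suc n) (rot n h) ((cyc C n ^^ j) z)"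
      using evC_cyc[OF h] n by (simp add: cycF_def)
    also have "\<dots> = evC (Suc n) (rot (Suc n - j) (rot n h)) z"
      by (rule Suc.IH) (use False Suc.prems h' in auto)
    also have "\<dots> = evC (Suc n) (rot (Suc n - Suc j) h) z"
    proof (rule evC_cong)
      fix m and ts :: "'t list" assume "length ts = Suc n"
      then show "rot (Suc n - j) (rot n h) m ts = rot (Suc n - Suc j) h m ts"
        using rot_rot[of "n - j" 1 j h ts m] h False Suc.prems by (simp add: Suc_diff_le)
    qed
    finally show ?thesis .
  qed
qed

section \<open>The cyclic identities over T\<close>

lemma evC_face_face:
  assumes h: "functC (Suc n) h" and ij: "i < j" "j \<le> Suc (Suc n)"
  shows "evC (Suc n) h (face C (Suc n) i (face C (Suc (Suc n)) j z)) =
    evC (Suc n) h (face C (Suc n) (j - 1) (face C (Suc (Suc n)) i z))"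
proof -
  let ?g = "\<lambda>m ts. h m (merge_at 0 ts)"
  have g: "functC (Suc (Suc n)) ?g" by (rule functC_merge[OF h]) simp
  have "evC (Suc n) h (face C (Suc n) i (face C (Suc (Suc n)) j z)) =
      evC (Suc (Suc (Suc n))) (faceF (Suc (Suc n)) j (faceF (Suc n) i h)) z" if "i < j" "i \<le> Suc n" "j \<le> Suc (Suc n)"
    for i j using that by (simp add: evC_face[OF h] evC_face[OF functC_faceF[OF h]])
  then have 1: "evC (Suc n) h (face C (Suc n) i (face C (Suc (Suc n)) j z)) =
      evC (Suc (Suc (Suc n))) (faceF (Suc (Suc n)) j (faceF (Suc n) i h)) z" using ij by simp
  have 2: "evC (Suc n) h (face C (Suc n) (j - 1) (face C (Suc (Suc n)) i z)) =
      evC (Suc (Suc (Suc n))) (faceF (Suc (Suc n)) i (faceF (Suc n) (j - 1) h)) z"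
    using ij by (simp add: evC_face[OF h] evC_face[OF functC_faceF[OF h]])
  show ?thesis unfolding 1 2
  proof (rule evC_cong)
    fix m and ts :: "'t list" assume ts: "length ts = Suc (Suc (Suc n))"
    consider "j < Suc (Suc n)" | "j = Suc (Suc n)" "i < Suc n" | "j = Suc (Suc n)" "i = Suc n"
      using ij by linarith
    then show "faceF (Suc (Suc n)) j (faceF (Suc n) i h) m ts = faceF (Suc (Suc n)) i (faceF (Suc n) (j - 1) h) m ts"
    proof cases
      case 1
      then have "j - 1 < Suc n" "i < Suc n" using ij by auto
      then show ?thesis using 1 ij merge_merge[of i j ts] ts by (simp add: faceF_def)
    next
      case 2
      have "faceF (Suc (Suc n)) j (faceF (Suc n) i h) m ts = rot (Suc (Suc n)) (\<lambda>m ts. h m (merge_at i (merge_at 0 ts))) m ts"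
        using 2 by (simp add: faceF_def)
      also have "\<dots> = rot (Suc (Suc n)) (\<lambda>m ts. ?g m (merge_at (Suc i) ts)) m ts"
        by (rule rot_cong[OF _ ts]) (use 2 in \<open>auto simp: merge_merge[of 0]\<close>)
      also have "\<dots> = rot (Suc n) ?g m (merge_at i ts)"
        using rot_merge[OF g _ _ ts, of "Suc i"] 2 by simp
      finally show ?thesis using 2 by (simp add: faceF_def)
    next
      \<comment> \<open>Two last faces in succession: once the product is moved out, their rotations
        wrap around, and by \<open>rot_rot\<close> a rotation by n + 1 remains.\<close>
      case 3
      have "faceF (Suc (Suc n)) j (faceF (Suc n) i h) m ts =
          rot (Suc (Suc n)) (\<lambda>m ts. rot (Suc n) ?g m (merge_at 0 ts)) m ts"
        using 3 by (simp add: faceF_def)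
      also have "\<dots> = rot (Suc (Suc n)) (rot (Suc (Suc n)) (\<lambda>m ts. ?g m (merge_at 1 ts))) m ts"
        by (rule rot_cong[OF _ ts]) (use rot_merge[OF g, of 1] in auto)
      also have "\<dots> = rot (Suc n) (\<lambda>m ts. ?g m (merge_at 1 ts)) m ts"
        using rot_rot[of "Suc n" 1 1 "\<lambda>m ts. ?g m (merge_at 1 ts)" ts m] functC_merge[OF g, of 1] ts by simp
      also have "\<dots> = rot (Suc n) (\<lambda>m ts. ?g m (merge_at 0 ts)) m ts"
        by (rule rot_cong[OF _ ts]) (auto simp: merge_merge[of 0])
      also have "\<dots> = rot (Suc n) ?g m (merge_at (Suc n) ts)"
        by (rule rot_merge_last) (use ts in auto)
      finally show ?thesis using 3 by (simp add: faceF_def)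
    qed
  qed
qed

lemma evC_degen_degen:
  assumes "i \<le> j" "j \<le> n"
  shows "evC (Suc (Suc (Suc n))) h (degen C (Suc n) i (degen C n j z)) =
    evC (Suc (Suc (Suc n))) h (degen C (Suc n) (Suc j) (degen C n i z))"
proof -
  have "evC (Suc n) (degenF j (degenF i h)) z = evC (Suc n) (degenF i (degenF (Suc j) h)) z"
    by (rule evC_cong) (use assms in \<open>simp add: degenF_def unit_unit\<close>)
  then show ?thesis using assms by (simp add: evC_degen)
qed

lemma evC_face_degen_less:
  assumes h: "functC (Suc n) h" and ij: "i < j" "j \<le> n"
  shows "evC (Suc n) h (face C (Suc n) i (degen C n j z)) = evC (Suc n) h (degen C (n - 1) (j - 1) (face C n i z))"
proof -
  obtain n' where n: "n = Suc n'" using ij by (cases n) auto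
  have h': "functC (Suc (Suc n')) h" using h n by simp
  have "evC (Suc n) (degenF j (faceF (Suc n) i h)) z = evC (Suc n) (faceF n i (degenF (j - 1) h)) z"
    by (rule evC_cong) (use ij in \<open>simp add: degenF_def faceF_def merge_unit_less\<close>)
  then show ?thesis
    using ij evC_face[OF h, of i "degen C n j z"] evC_degen[of j n "faceF (Suc n) i h" z]
      evC_degen[of "j - 1" n' h "face C n i z"] evC_face[OF functC_degenF[OF h', of "j - 1"], of i z]
    by (simp add: n)
qed

lemma evC_face_degen_same:
  assumes h: "functC (Suc n) h" and ij: "i = j \<or> i = Suc j" "j \<le> n"
  shows "evC (Suc n) h (face C (Suc n) i (degen C n j z)) = evC (Suc n) h z"
proof -
  have "evC (Suc n) (degenF j (faceF (Suc n) i h)) z = evC (Suc n) h z"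
  proof (rule evC_cong)
    fix m and ts :: "'t list" assume ts: "length ts = Suc n"
    show "degenF j (faceF (Suc n) i h) m ts = h m ts"
    proof (cases "i < Suc n")
      case True
      then show ?thesis using ij merge_unit_same[of j ts i] ts by (simp add: degenF_def faceF_def)
    next
      \<comment> \<open>The last face places the inserted unit in front and rotates all original
        factors behind it. They all undergo one diagonal action, which stability removes.\<close>
      case False
      then have ij': "i = Suc n" "j = n" using ij by auto
      have "unit_at n ts = ts @ [1]" using unit_at_last[of ts] ts by fastforce
      then have "degenF j (faceF (Suc n) i h) m ts =
          sw2 (coactM m) (\<lambda>k m0. diagT k ts (\<lambda>xs. h m0 (merge_at 0 (1 # xs))))"
        using ij' ts by (simp add: degenF_def faceF_def)
      also have "\<dots> = sw2 (coactM m) (\<lambda>k m0. diagT k ts (h m0))"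
      proof (intro sw2_cong diagT_cong)
        show "h m0 (merge_at 0 (1 # xs)) = h m0 xs" if "length xs = length ts" for m0 xs
          using that ts by (cases xs) auto
      qed
      also have "\<dots> = sw2 (coactM m) (\<lambda>k m0. h (actM m0 k) ts)" by (simp add: functC_act[OF h ts])
      also have "\<dots> = h m ts" by (rule CM_stable[OF functC_clin[OF h ts]])
      finally show ?thesis .
    qed
  qed
  moreover have "i \<le> Suc n" using ij by auto
  ultimately show ?thesis using ij(2) by (simp add: evC_face[OF h] evC_degen)
qed

lemma evC_face_degen_greater:
  assumes h: "functC (Suc n) h" and ij: "Suc j < i" "i \<le> Suc n"
  shows "evC (Suc n) h (face C (Suc n) i (degen C n j z)) = evC (Suc n) h (degen C (n - 1) j (face C n (i - 1) z))"
proof -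
  obtain n' where n: "n = Suc n'" using ij by (cases n) auto
  have h': "functC (Suc (Suc n')) h" using h n by simp
  have "evC (Suc n) (degenF j (faceF (Suc n) i h)) z = evC (Suc n) (faceF n (i - 1) (degenF j h)) z"
  proof (rule evC_cong)
    fix m and ts :: "'t list" assume ts: "length ts = Suc n"
    show "degenF j (faceF (Suc n) i h) m ts = faceF n (i - 1) (degenF j h) m ts"
    proof (cases "i < Suc n")
      case True
      then show ?thesis using ij merge_unit_greater[of j i ts] ts by (auto simp: degenF_def faceF_def)
    next
      case False
      have g: "functC (Suc (Suc n)) (\<lambda>m ts. h m (merge_at 0 ts))" by (rule functC_merge[OF h]) simp
      have "rot n (\<lambda>m ts. h m (unit_at j (merge_at 0 ts))) m ts = rot n (\<lambda>m ts. h m (merge_at 0 (unit_at (Suc j) ts))) m ts"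
        by (rule rot_cong[OF _ ts]) (use ij in \<open>auto simp: merge_unit_less\<close>)
      also have "\<dots> = rot (Suc n) (\<lambda>m ts. h m (merge_at 0 ts)) m (unit_at j ts)"
        using rot_unit[OF g _ _ ts, of "Suc j"] ij by simp
      finally show ?thesis using False ij by (simp add: degenF_def faceF_def)
    qed
  qed
  then show ?thesis
    using ij evC_face[OF h, of i "degen C n j z"] evC_degen[of j n "faceF (Suc n) i h" z]
      evC_degen[of j n' h "face C n (i - 1) z"] evC_face[OF functC_degenF[OF h', of j], of "i - 1" z]
    by (simp add: n)
qed

lemma evC_face_cyc:
  assumes h: "functC (Suc n) h" and i: "0 < i" "i \<le> Suc n"
  shows "evC (Suc n) h (face C (Suc n) i (cyc C (Suc n) z)) = evC (Suc n) h (cyc C n (face C (Suc n) (i - 1) z))"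
proof -
  let ?g = "\<lambda>m ts. h m (merge_at 0 ts)"
  have g: "functC (Suc (Suc n)) ?g" by (rule functC_merge[OF h]) simp
  have "evC (Suc (Suc n)) (cycF (Suc n) (faceF (Suc n) i h)) z = evC (Suc (Suc n)) (faceF (Suc n) (i - 1) (cycF n h)) z"
  proof (rule evC_cong)
    fix m and ts :: "'t list" assume ts: "length ts = Suc (Suc n)"
    show "cycF (Suc n) (faceF (Suc n) i h) m ts = faceF (Suc n) (i - 1) (cycF n h) m ts"
    proof (cases "i < Suc n")
      case True
      then show ?thesis using rot_merge[OF h i(1) _ ts, of m] i by (auto simp: cycF_def faceF_def)
    next
      case False
      then have i': "i = Suc n" using i by simp
      show ?thesis
      proof (cases "n = 0")
        case True
        then show ?thesis using rot_rot_id[of 1 1 ?g ts m] g ts i' by (simp add: cycF_def faceF_def)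
      next
        case F: False
        then show ?thesis
          using rot_rot[of n 1 1 ?g ts m] g ts i' rot_merge_last[OF F ts, of h m] by (simp add: cycF_def faceF_def)
      qed
    qed
  qed
  then show ?thesis
    using i evC_face[OF h, of i "cyc C (Suc n) z"] evC_cyc[OF functC_faceF[OF h], of i z]
      evC_cyc[OF h, of "face C (Suc n) (i - 1) z"] evC_face[OF functC_cycF[OF h], of "i - 1" z]
    by simp
qed

lemma evC_degen_cyc:
  assumes h: "functC (Suc (Suc n)) h" and i: "0 < i" "i \<le> n"
  shows "evC (Suc (Suc n)) h (degen C n i (cyc C n z)) = evC (Suc (Suc n)) h (cyc C (Suc n) (degen C n (i - 1) z))"
proof -
  have "evC (Suc n) (cycF n (degenF i h)) z = evC (Suc n) (degenF (i - 1) (cycF (Suc n) h)) z"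
    by (rule evC_cong) (use i rot_unit[OF h i] in \<open>simp add: cycF_def degenF_def\<close>)
  then show ?thesis
    using i evC_cyc[OF functC_degenF[OF h, of i], of z] by (simp add: evC_degen evC_cyc[OF h])
qed

text \<open>Two rotations by n + 1 among n + 2 factors amount to a rotation by n, which brings the
  last factor and the inserted unit to the front together.\<close>

lemma evC_degen_0_cyc:
  assumes h: "functC (Suc (Suc n)) h"
  shows "evC (Suc (Suc n)) h (degen C n 0 (cyc C n z)) = evC (Suc (Suc n)) h (cyc C (Suc n) (cyc C (Suc n) (degen C n n z)))"
proof -
  have "evC (Suc n) (cycF n (degenF 0 h)) z = evC (Suc n) (degenF n (cycF (Suc n) (cycF (Suc n) h))) z"
  proof (rule evC_cong)
    fix m and ts :: "'t list" assume ts: "length ts = Suc n"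
    obtain us t where t: "ts = us @ [t]" and len: "length us = n" using snoc_decomp[OF ts] by blast
    have u: "unit_at n ts = us @ [t, 1]" using unit_at_last[of ts] ts t len by fastforce
    show "cycF n (degenF 0 h) m ts = degenF n (cycF (Suc n) (cycF (Suc n) h)) m ts"
    proof (cases "n = 0")
      case True
      then show ?thesis using rot_rot_id[of 1 1 h "[t, 1]" m] h u t len by (simp add: cycF_def degenF_def)
    next
      case False
      then have "degenF n (cycF (Suc n) (cycF (Suc n) h)) m ts = rot n h m (us @ [t, 1])"
        using rot_rot[of n 1 1 h "us @ [t, 1]" m] h len u by (simp add: cycF_def degenF_def)
      then show ?thesis using False len by (simp add: cycF_def degenF_def t)
    qed
  qed
  then show ?thesis
    using evC_cyc[OF functC_degenF[OF h, of 0], of z] by (simp add: evC_degen evC_cyc[OF h] evC_cyc[OF functC_cycF[OF h]])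
qed

lemma evC_cyc_period:
  assumes h: "functC (Suc n) h"
  shows "evC (Suc n) h ((cyc C n ^^ Suc n) z) = evC (Suc n) h z"
proof (cases "n = 0")
  case True then show ?thesis using evC_cyc[OF h, of z] by (simp add: cycF_def)
next
  case False
  have h': "functC (Suc n) (rot n h)" using functC_cycF[OF h] False by (simp add: cycF_def)
  have "evC (Suc n) h ((cyc C n ^^ Suc n) z) = evC (Suc n) (rot n h) ((cyc C n ^^ n) z)"
    using evC_cyc[OF h] False by (simp add: cycF_def)
  also have "\<dots> = evC (Suc n) (rot (Suc n - n) (rot n h)) z"
    by (rule evC_cyc_pow[OF h' False]) (use False in auto)
  also have "\<dots> = evC (Suc n) h z"
    by (rule evC_cong) (use rot_rot_id[of 1 n h] h False in simp)
  finally show ?thesis .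
qed

lemma qlinear_nullC:
  assumes "clin f" "\<And>h :: 'm \<Rightarrow> 't list \<Rightarrow> complex. functC b h \<Longrightarrow> functC a (h' h)"
    "\<And>h z. functC b h \<Longrightarrow> evC b h (f z) = evC a (h' h :: 'm \<Rightarrow> 't list \<Rightarrow> complex) z"
  shows "qlinear (nullC a) (nullC b) f"
  using assms(1) subspace_nullC
proof (rule qlinearI)
  show "f z \<in> nullC b" if "z \<in> nullC a" for z
    by (rule nullCI) (simp add: assms evC_null[OF assms(2) that])
qed

lemma clin_C: "clin (face C n i)" "clin (degen C n i)" "clin (cyc C n)"
  by (simp_all add: cyclic_T_def clin_lsum)

theorem cyclic_module_T: "cyclic_module C"
  unfolding cyclic_module_def null_C
proof (intro conjI allI impI)
  fix n i j :: nat and x :: "('m \<times> 't list free) free"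
  show "complex_vector.subspace (nullC (Suc n))" by (rule subspace_nullC)
  show "qlinear (nullC (Suc n)) (nullC (Suc (n - 1))) (face C n i)" if "1 \<le> n" "i \<le> n"
    using that by (cases n) (auto intro!: qlinear_nullC[OF clin_C(1), of _ _ "faceF n i"] functC_faceF evC_face)
  show "qlinear (nullC (Suc n)) (nullC (Suc (n + 1))) (degen C n i)" if "i \<le> n"
    using that by (auto intro!: qlinear_nullC[OF clin_C(2), of _ _ "degenF i"] functC_degenF evC_degen)
  show "qlinear (nullC (Suc n)) (nullC (Suc n)) (cyc C n)"
    by (auto intro!: qlinear_nullC[OF clin_C(3), of _ _ "cycF n"] functC_cycF evC_cyc)
  show "face C (n - 1) i (face C n j x) \<simeq>\<^bsub>nullC (Suc (n - 2))\<^esub> face C (n - 1) (j - 1) (face C n i x)"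
    if "2 \<le> n" "i < j \<and> j \<le> n"
  proof -
    obtain n' where n: "n = Suc (Suc n')" using \<open>2 \<le> n\<close> by (metis Suc_le_D numeral_2_eq_2 Suc_le_mono)
    show ?thesis using that by (intro eqCI) (simp add: n evC_face_face)
  qed
  show "degen C (n + 1) i (degen C n j x) \<simeq>\<^bsub>nullC (Suc (n + 2))\<^esub> degen C (n + 1) (j + 1) (degen C n i x)"
    if "i \<le> j \<and> j \<le> n"
    using that by (intro eqCI) (simp add: evC_degen_degen)
  show "face C (n + 1) i (degen C n j x) \<simeq>\<^bsub>nullC (Suc n)\<^esub> degen C (n - 1) (j - 1) (face C n i x)"
    if "i < j \<and> j \<le> n"
    using that by (intro eqCI) (simp add: evC_face_degen_less)
  show "face C (n + 1) i (degen C n j x) \<simeq>\<^bsub>nullC (Suc n)\<^esub> x" if "(i = j \<or> i = j + 1) \<and> j \<le> n"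
    using that by (intro eqCI) (simp add: evC_face_degen_same)
  show "face C (n + 1) i (degen C n j x) \<simeq>\<^bsub>nullC (Suc n)\<^esub> degen C (n - 1) j (face C n (i - 1) x)"
    if "j + 1 < i \<and> i \<le> n + 1"
    using that by (intro eqCI) (simp add: evC_face_degen_greater)
  show "face C n i (cyc C n x) \<simeq>\<^bsub>nullC (Suc (n - 1))\<^esub> cyc C (n - 1) (face C n (i - 1) x)"
    if c: "1 \<le> i \<and> i \<le> n"
  proof -
    obtain n' where n: "n = Suc n'" using c by (cases n) auto
    show ?thesis using that by (intro eqCI) (simp add: n evC_face_cyc)
  qed
  show "degen C n i (cyc C n x) \<simeq>\<^bsub>nullC (Suc (n + 1))\<^esub> cyc C (n + 1) (degen C n (i - 1) x)"
    if "1 \<le> i \<and> i \<le> n"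
    using that by (intro eqCI) (simp add: evC_degen_cyc)
  show "face C n 0 (cyc C n x) \<simeq>\<^bsub>nullC (Suc (n - 1))\<^esub> face C n n x" if c: "1 \<le> n"
  proof -
    obtain n' where n: "n = Suc n'" using c by (cases n) auto
    show ?thesis
      using that by (intro eqCI) (simp add: n evC_face evC_cyc functC_faceF, simp add: cycF_def faceF_def)
  qed
  show "degen C n 0 (cyc C n x) \<simeq>\<^bsub>nullC (Suc (n + 1))\<^esub> cyc C (n + 1) (cyc C (n + 1) (degen C n n x))"
    by (intro eqCI) (simp add: evC_degen_0_cyc)
  show "(cyc C n ^^ (n + 1)) x \<simeq>\<^bsub>nullC (Suc n)\<^esub> x"
    unfolding Suc_eq_plus1[symmetric] by (intro eqCI evC_cyc_period)
qed

end


section \<open>The diagonal action on tensor powers of a right bialgebroid\<close>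

context right_hopf_algebra
begin

abbreviation mB :: "nat \<Rightarrow> ('b list \<Rightarrow> 'w::complex_vector) \<Rightarrow> bool"
  where "mB \<equiv> mbal UNIV (\<lambda>b r. b * src B r) (\<lambda>r b. b * tgt B r)"

definition diagB :: "'b \<Rightarrow> 'b list \<Rightarrow> ('b list \<Rightarrow> 'w::complex_vector) \<Rightarrow> 'w"
  where "diagB c bs H = lsum (comul_iter B (length bs - 1) c) (\<lambda>cs. H (map2 (*) bs cs))"

lemma diagB_single [simp]: "diagB c [b] H = H [b * c]"
  by (simp add: diagB_def)

lemma diagB_Cons:
  "bs \<noteq> [] \<Longrightarrow> diagB c (b # bs) H = sw2 (comul B c) (\<lambda>c1 c2. diagB c2 bs (\<lambda>zs. H (b * c1 # zs)))"
  by (cases bs) (simp_all add: diagB_def lsum_case)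

lemma diagB_cong:
  "(\<And>zs. length zs = length bs \<Longrightarrow> G zs = H zs) \<Longrightarrow> diagB c bs G = diagB c bs H"
proof (induction bs arbitrary: c G H)
  case Nil then show ?case by (simp add: diagB_def)
next
  case (Cons b bs)
  show ?case
  proof (cases "bs = []")
    case True then show ?thesis using Cons.prems by simp
  next
    case False
    then show ?thesis
      unfolding diagB_Cons[OF False]
      by (intro sw2_cong Cons.IH Cons.prems) simp
  qed
qed

lemma diagB_sw2: "diagB c bs (\<lambda>zs. sw2 X (\<lambda>a b. F a b zs)) = sw2 X (\<lambda>a b. diagB c bs (F a b))"
  unfolding diagB_def by (rule sw2_lsum_commute[symmetric])

lemma clin_diagB_in:
  assumes "\<And>zs. length zs = length bs \<Longrightarrow> clin (\<lambda>y. F y zs)"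
  shows "clin (\<lambda>y. diagB c bs (F y))"
proof -
  have "clin (\<lambda>y. if length zs = length bs then F y zs else 0)" for zs
    by (cases "length zs = length bs") (simp_all add: assms clin_0)
  then have "clin (\<lambda>y. diagB c bs (\<lambda>zs. if length zs = length bs then F y zs else 0))"
    unfolding diagB_def by (intro clin_lsum_in)
  moreover have "diagB c bs (\<lambda>zs. if length zs = length bs then F y zs else 0) = diagB c bs (F y)" for y
    by (rule diagB_cong) simp
  ultimately show ?thesis by simp
qed

text \<open>The same simultaneous induction as for \<open>diagT_aux\<close>, with right
  multiplication in place of the action of K.\<close>

lemma diagB_aux:
  assumes "mB (length bs) H" "bs \<noteq> []"
  shows "clin (\<lambda>c. diagB c bs H) \<and>
    (\<forall>r c. diagB (c * tgt B r) bs H = diagB c bs (\<lambda>zs. H (hd zs * tgt B r # tl zs))) \<and>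
    (\<forall>r c. diagB (c * src B r) bs H = diagB c bs (\<lambda>zs. H (butlast zs @ [last zs * src B r]))) \<and>
    (\<forall>x ys. bs = x # ys \<longrightarrow> ys \<noteq> [] \<longrightarrow> bB (\<lambda>c1 c2. diagB c2 ys (\<lambda>zs. H (x * c1 # zs))))"
  using assms
proof (induction bs arbitrary: H)
  case Nil then show ?case by simp
next
  case (Cons y ts)
  show ?case
  proof (cases "ts = []")
    case True
    then have "clin (\<lambda>x. H [x])" using Cons.prems by (simp add: mbal_1)
    then have "clin (\<lambda>c. H [y * c])" by (rule clin_comp) (intro clin_intros)
    then show ?thesis using True by (simp add: mult.assoc)
  next
    case False
    have mc: "mB (Suc (length ts)) H" using Cons.prems by simp
    have m: "mB (length ts) (\<lambda>zs. H (u # zs))" for u by (rule mbal_ConsD(2)[OF mc])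
    note IH = Cons.IH[OF m False]
    have bB: "bB (\<lambda>c1 c2. diagB c2 ts (\<lambda>zs. H (y * c1 # zs)))"
    proof (rule balI)
      show "clin (\<lambda>c1. diagB c2 ts (\<lambda>zs. H (y * c1 # zs)))" for c2
        by (rule clin_diagB_in, rule clin_comp[OF mbal_ConsD(1)[OF mc]]) (simp_all add: clin_intros)
      show "clin (\<lambda>c2. diagB c2 ts (\<lambda>zs. H (y * c1 # zs)))" for c1
        using IH by blast
      show "diagB c2 ts (\<lambda>zs. H (y * (c1 * src B a) # zs)) = diagB (c2 * tgt B a) ts (\<lambda>zs. H (y * c1 # zs))" for c1 a c2
      proof -
        have "diagB (c2 * tgt B a) ts (\<lambda>zs. H (y * c1 # zs)) =
            diagB c2 ts (\<lambda>zs. H (y * c1 # hd zs * tgt B a # tl zs))"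
          using IH by blast
        also have "\<dots> = diagB c2 ts (\<lambda>zs. H (y * (c1 * src B a) # zs))"
        proof (rule diagB_cong)
          fix zs :: "'b list" assume "length zs = length ts"
          then obtain z zs' where "zs = z # zs'" "Suc (length zs') = length ts"
            using False by (cases zs) auto
          then show "H (y * c1 # hd zs * tgt B a # tl zs) = H (y * (c1 * src B a) # zs)"
            using mbal_ConsD(3)[OF mc UNIV_I, of zs' "y * c1" a z] by (simp add: mult.assoc)
        qed
        finally show ?thesis by simp
      qed
    qed
    have 1: "clin (\<lambda>c. diagB c (y # ts) H)"
      unfolding diagB_Cons[OF False] by (rule clin_SB[OF bB])
    have 2: "diagB (c * tgt B r) (y # ts) H = diagB c (y # ts) (\<lambda>zs. H (hd zs * tgt B r # tl zs))" for r c
      unfolding diagB_Cons[OF False] SB_tgt[OF bB] by (simp add: mult.assoc)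
    have 3: "diagB (c * src B r) (y # ts) H = diagB c (y # ts) (\<lambda>zs. H (butlast zs @ [last zs * src B r]))" for r c
    proof -
      have "diagB (c2 * src B r) ts (\<lambda>zs. H (y * c1 # zs)) =
        diagB c2 ts (\<lambda>zs. H (y * c1 # butlast zs @ [last zs * src B r]))" for c1 c2
        using IH by blast
      also have "\<dots> c1 c2 = diagB c2 ts (\<lambda>zs. H (butlast (y * c1 # zs) @ [last (y * c1 # zs) * src B r]))" for c1 c2
        by (rule diagB_cong) (use False in auto)
      finally show ?thesis
        unfolding diagB_Cons[OF False] SB_src[OF bB] by simp
    qed
    show ?thesis using 1 2 3 bB by simp
  qed
qed

lemma clin_diagB: "mB (length bs) H \<Longrightarrow> bs \<noteq> [] \<Longrightarrow> clin (\<lambda>c. diagB c bs H)"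
  and diagB_tgt: "mB (length bs) H \<Longrightarrow> bs \<noteq> [] \<Longrightarrow>
    diagB (c * tgt B r) bs H = diagB c bs (\<lambda>zs. H (hd zs * tgt B r # tl zs))"
  and diagB_src: "mB (length bs) H \<Longrightarrow> bs \<noteq> [] \<Longrightarrow>
    diagB (c * src B r) bs H = diagB c bs (\<lambda>zs. H (butlast zs @ [last zs * src B r]))"
  and bB_diagB_Cons: "mB (Suc (length ys)) H \<Longrightarrow> ys \<noteq> [] \<Longrightarrow>
    bB (\<lambda>c1 c2. diagB c2 ys (\<lambda>zs. H (x * c1 # zs)))"
  using diagB_aux[of bs H] diagB_aux[of "x # ys" H] by auto

lemma bB_diagB_snoc:
  assumes H: "mB (Suc (length bs)) H" and bs: "bs \<noteq> []"
  shows "bB (\<lambda>c1 c2. diagB c1 bs (\<lambda>zs. H (zs @ [b * c2])))"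
proof (rule balI)
  have m: "mB (length bs) (\<lambda>zs. H (zs @ [x]))" for x by (rule mbal_snocD(2)[OF H])
  show "clin (\<lambda>c1. diagB c1 bs (\<lambda>zs. H (zs @ [b * c2])))" for c2 by (rule clin_diagB[OF m bs])
  show "clin (\<lambda>c2. diagB c1 bs (\<lambda>zs. H (zs @ [b * c2])))" for c1
    by (rule clin_diagB_in, rule clin_comp[OF mbal_snocD(1)[OF H]]) (simp_all add: clin_intros)
  show "diagB (c1 * src B r) bs (\<lambda>zs. H (zs @ [b * c2])) = diagB c1 bs (\<lambda>zs. H (zs @ [b * (c2 * tgt B r)]))" for c1 r c2
    unfolding diagB_src[OF m bs]
  proof (rule diagB_cong)
    fix zs :: "'b list" assume len: "length zs = length bs"
    then obtain zs' z where "zs = zs' @ [z]" using bs by (cases zs rule: rev_cases) auto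
    then show "H ((butlast zs @ [last zs * src B r]) @ [b * c2]) = H (zs @ [b * (c2 * tgt B r)])"
      using mbal_mid[OF H UNIV_I, of zs' "[]" z r "b * c2"] len by (simp add: mult.assoc)
  qed
qed

text \<open>The recursion of \<open>diagB\<close> splits off the first letter, but the iterated
  coaction of T adds its components at the end; coassociativity gives the split that fits
  it.\<close>

lemma diagB_snoc:
  "mB (Suc (length bs)) H \<Longrightarrow> bs \<noteq> [] \<Longrightarrow>
    diagB c (bs @ [b]) H = sw2 (comul B c) (\<lambda>c1 c2. diagB c1 bs (\<lambda>zs. H (zs @ [b * c2])))"
proof (induction bs arbitrary: H c)
  case Nil then show ?case by simp
next
  case (Cons x bs)
  show ?case
  proof (cases "bs = []")
    case True then show ?thesis by (simp add: diagB_Cons)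
  next
    case False
    have H: "mB (Suc (Suc (length bs))) H" using Cons.prems by simp
    have m: "mB (Suc (length bs)) (\<lambda>zs. H (u # zs))" for u by (rule mbal_ConsD(2)[OF H])
    have "diagB c (x # (bs @ [b])) H = sw2 (comul B c) (\<lambda>c1 c2. sw2 (comul B c2)
        (\<lambda>a d. diagB a bs (\<lambda>zs. H (x * c1 # zs @ [b * d]))))"
      using False by (subst diagB_Cons) (simp_all add: Cons.IH[OF m False])
    also have "\<dots> = sw2 (comul B c) (\<lambda>e d. sw2 (comul B e)
        (\<lambda>c1 a. diagB a bs (\<lambda>zs. H (x * c1 # zs @ [b * d]))))"
    proof (rule SB_coassoc[symmetric])
      show "bB (\<lambda>c1 a. diagB a bs (\<lambda>zs. H (x * c1 # zs @ [b * d])))" for d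
        using bB_diagB_Cons[OF mbal_snocD(2)[OF H] False] by simp
      show "bB (\<lambda>a d. diagB a bs (\<lambda>zs. H (x * c1 # zs @ [b * d])))" for c1
        by (rule bB_diagB_snoc[OF m False])
    qed
    finally show ?thesis by (simp add: diagB_Cons False)
  qed
qed

end


section \<open>The inverse of the iterated canonical map\<close>

definition mult_last :: "'a::times list \<Rightarrow> 'a \<Rightarrow> 'a list"
  where "mult_last ts u = butlast ts @ [last ts * u]"

lemma mult_last_simps [simp]:
  "mult_last [t] u = [t * u]" "ts \<noteq> [] \<Longrightarrow> mult_last (t # ts) u = t # mult_last ts u"
  "mult_last (ts @ [t]) u = ts @ [t * u]" "ts \<noteq> [] \<Longrightarrow> length (mult_last ts u) = length ts"
  by (simp_all add: mult_last_def)

lemma mult_last_mult: "ts \<noteq> [] \<Longrightarrow> mult_last (mult_last ts u) v = mult_last ts (u * v :: 'a::semigroup_mult)"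
  by (simp add: mult_last_def mult.assoc)

context equivariant_galois_ext
begin

lemma mS_mult_last:
  assumes G: "mS (Suc n) G"
  shows "mS (Suc n) (\<lambda>ts. G (mult_last ts u))"
proof -
  have "mS (n + Suc 0) (\<lambda>ts. G (mult_last ts u))"
  proof (rule mbal_appendI)
    show "mS n (\<lambda>xs. G (mult_last (xs @ ys) u))" if "length ys = Suc 0" for ys
      using that mbal_snocD(2)[OF G] by (cases ys) auto
    show "mS (Suc 0) (\<lambda>ys. G (mult_last (xs @ ys) u))" if "length xs = n" for xs
      using clin_comp[OF mbal_snocD(1)[OF G that] clin_mult(1)[OF clin_id]] by (simp add: mbal_1)
    show "G (mult_last (us @ actT (tgt K a) x # y # vs) u) = G (mult_last (us @ x # actT (src K a) y # vs) u)"
      if a: "a \<in> base K" and "Suc (length us) = n" "Suc (length vs) = Suc 0" for us x a y vs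
    proof -
      have "mult_last (us @ x # y # vs) u = us @ x # [y * u]" for x y
        using mult_last_simps(3)[of "us @ [x]" y u] that by simp
      then show ?thesis using mbal_mid[OF G a, of us "[]" x "y * u"] that by (simp add: actT_src_mult)
    qed
  qed
  then show ?thesis by simp
qed

text \<open>The argument t is the factor still open on the right: a letter b closes it to t b_- and
  leaves b_+ open for the next letter.\<close>

primrec thetaT :: "'b list \<Rightarrow> 't \<Rightarrow> 't list free"
  where
    "thetaT [] t = gen [t]"
  | "thetaT (b # bs) t = sw2 (tr b) (\<lambda>p q. lsum (thetaT bs q) (\<lambda>ts. gen (t * p # ts)))"

definition theta :: "'t \<Rightarrow> 'b list \<Rightarrow> ('t list \<Rightarrow> 'w::complex_vector) \<Rightarrow> 'w"
  where "theta t bs G = lsum (thetaT bs t) G"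

lemma theta_Nil [simp]: "theta t [] G = G [t]"
  by (simp add: theta_def)

lemma theta_Cons: "theta t (b # bs) G = sw2 (tr b) (\<lambda>p q. theta q bs (\<lambda>ts. G (t * p # ts)))"
  by (simp add: theta_def)

lemma theta_cong:
  "(\<And>ts. length ts = Suc (length bs) \<Longrightarrow> G ts = H ts) \<Longrightarrow> theta t bs G = theta t bs H"
proof (induction bs arbitrary: t G H)
  case (Cons b bs)
  then show ?case unfolding theta_Cons by (intro sw2_cong Cons.IH) simp
qed simp

lemma theta_sw2: "theta t bs (\<lambda>ts. sw2 X (\<lambda>a b. F a b ts)) = sw2 X (\<lambda>a b. theta t bs (F a b))"
  unfolding theta_def by (rule sw2_lsum_commute[symmetric])

lemma clin_theta_in:
  assumes "\<And>ts. length ts = Suc (length bs) \<Longrightarrow> clin (\<lambda>y. F y ts)"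
  shows "clin (\<lambda>y. theta t bs (F y))"
proof -
  have "clin (\<lambda>y. if length ts = Suc (length bs) then F y ts else 0)" for ts
    by (cases "length ts = Suc (length bs)") (simp_all add: assms clin_0)
  then have "clin (\<lambda>y. theta t bs (\<lambda>ts. if length ts = Suc (length bs) then F y ts else 0))"
    unfolding theta_def by (intro clin_lsum_in)
  moreover have "theta t bs (\<lambda>ts. if length ts = Suc (length bs) then F y ts else 0) = theta t bs (F y)" for y
    by (rule theta_cong) simp
  ultimately show ?thesis by simp
qed

lemma theta_mult_left: "theta (u * t) bs G = theta t bs (\<lambda>ts. G (u * hd ts # tl ts))"
  by (cases bs) (simp_all add: theta_Cons mult.assoc)

text \<open>Linearity and equivariance are proved together: \<open>P_act\<close> applies only to
  functions balanced over S, and for the tail this balancedness is linearity together with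
  equivariance under s(r).\<close>

lemma theta_aux:
  "mS (Suc (length bs)) G \<Longrightarrow>
    clin (\<lambda>t. theta t bs G) \<and> (\<forall>k t. theta (actT k t) bs G = theta t bs (\<lambda>ts. diagT k ts G))"
proof (induction bs arbitrary: G)
  case Nil
  then have "clin (\<lambda>x. G [x])" by (simp add: mbal_1)
  then show ?case by simp
next
  case (Cons b bs)
  have G: "mS (Suc (Suc (length bs))) G" using Cons.prems by simp
  have m: "mS (Suc (length bs)) (\<lambda>ts. G (x # ts))" for x by (rule mbal_ConsD(2)[OF G])
  note IH = Cons.IH[OF m]
  have bS: "bS (\<lambda>x y. theta y bs (\<lambda>ts. G (x # ts)))"
  proof (rule balI)
    show "clin (\<lambda>x. theta y bs (\<lambda>ts. G (x # ts)))" for y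
      by (rule clin_theta_in) (rule mbal_ConsD(1)[OF G])
    show "clin (\<lambda>y. theta y bs (\<lambda>ts. G (x # ts)))" for x using IH by blast
    show "theta y bs (\<lambda>ts. G (actT (tgt K a) x # ts)) = theta (actT (src K a) y) bs (\<lambda>ts. G (x # ts))"
      if a: "a \<in> base K" for x a y
    proof -
      have "theta (actT (src K a) y) bs (\<lambda>ts. G (x # ts)) = theta y bs (\<lambda>ts. diagT (src K a) ts (\<lambda>ts. G (x # ts)))"
        using IH by blast
      also have "\<dots> = theta y bs (\<lambda>ts. G (actT (tgt K a) x # ts))"
      proof (rule theta_cong)
        fix ts :: "'t list" assume "length ts = Suc (length bs)"
        then obtain z zs where "ts = z # zs" "length zs = length bs" by (cases ts) auto
        then show "diagT (src K a) ts (\<lambda>ts. G (x # ts)) = G (actT (tgt K a) x # ts)"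
          using diagT_src_one[of zs "\<lambda>ts. G (x # ts)" a z] mbal_ConsD(3)[OF G a, of zs x z] m a by simp
      qed
      finally show ?thesis by simp
    qed
  qed
  have "clin (\<lambda>t. theta t (b # bs) G)"
    unfolding theta_Cons
    by (intro clin_sw2_in clin_theta_in clin_comp[OF mbal_ConsD(1)[OF G]] clin_mult clin_id) simp
  moreover have "theta (actT k t) (b # bs) G = theta t (b # bs) (\<lambda>ts. diagT k ts G)" for k t
  proof -
    have "theta (actT k t) (b # bs) G = sw2 (tr b) (\<lambda>p q. theta q bs (\<lambda>ts. G (actT k t * p # ts)))"
      by (simp add: theta_Cons)
    also have "\<dots> = sw2 (comul K k) (\<lambda>k1 k2. sw2 (tr b) (\<lambda>p q. theta (actT k2 q) bs (\<lambda>ts. G (actT k1 (t * p) # ts))))"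
      by (rule P_act[OF bS, symmetric])
    also have "\<dots> = sw2 (tr b) (\<lambda>p q. sw2 (comul K k) (\<lambda>k1 k2. theta q bs (\<lambda>ts. diagT k2 ts (\<lambda>ts. G (actT k1 (t * p) # ts)))))"
      using IH by (subst sw2_commute) simp
    also have "\<dots> = sw2 (tr b) (\<lambda>p q. theta q bs (\<lambda>ts. diagT k (t * p # ts) G))"
      unfolding theta_sw2[symmetric]
    proof (intro sw2_cong theta_cong)
      fix p q and ts :: "'t list" assume "length ts = Suc (length bs)"
      then have "ts \<noteq> []" by auto
      then show "sw2 (comul K k) (\<lambda>k1 k2. diagT k2 ts (\<lambda>ts. G (actT k1 (t * p) # ts))) = diagT k (t * p # ts) G"
        by (simp add: diagT_Cons)
    qed
    finally show ?thesis by (simp add: theta_Cons)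
  qed
  ultimately show ?case by blast
qed

lemma clin_theta: "mS (Suc (length bs)) G \<Longrightarrow> clin (\<lambda>t. theta t bs G)"
  and theta_act: "mS (Suc (length bs)) G \<Longrightarrow> theta (actT k t) bs G = theta t bs (\<lambda>ts. diagT k ts G)"
  using theta_aux by blast+

lemma bS_theta:
  assumes G: "mS (Suc (Suc (length bs))) G"
  shows "bS (\<lambda>x y. theta y bs (\<lambda>ts. G (x # ts)))"
proof (rule balI)
  have m: "mS (Suc (length bs)) (\<lambda>ts. G (x # ts))" for x by (rule mbal_ConsD(2)[OF G])
  show "clin (\<lambda>x. theta y bs (\<lambda>ts. G (x # ts)))" for y
    by (rule clin_theta_in) (rule mbal_ConsD(1)[OF G])
  show "clin (\<lambda>y. theta y bs (\<lambda>ts. G (x # ts)))" for x by (rule clin_theta[OF m])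
  show "theta y bs (\<lambda>ts. G (actT (tgt K a) x # ts)) = theta (actT (src K a) y) bs (\<lambda>ts. G (x # ts))"
    if a: "a \<in> base K" for x a y
    unfolding theta_act[OF m]
  proof (rule theta_cong)
    fix ts :: "'t list" assume "length ts = Suc (length bs)"
    then obtain z zs where "ts = z # zs" "length zs = length bs" by (cases ts) auto
    then show "G (actT (tgt K a) x # ts) = diagT (src K a) ts (\<lambda>ts. G (x # ts))"
      using diagT_src_one[of zs "\<lambda>ts. G (x # ts)" a z] mbal_ConsD(3)[OF G a, of zs x z] m a by simp
  qed
qed

lemma theta_eT:
  assumes G: "mS (Suc (Suc (length bs))) G"
  shows "theta (t * eT r) (b # bs) G = theta t (b * tgt B r # bs) G"
  unfolding theta_Cons
  using P_mult_tgt[OF bS_lmult[OF bS_theta[OF G], of t], of b r] by (simp add: mult.assoc)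

text \<open>A factor s(r) on the right of a letter b multiplies b_+ by \<open>eT r\<close>, and
  \<open>theta_eT\<close> turns this into a factor t(r) on the next letter.\<close>

lemma mB_theta: "mS (Suc n) G \<Longrightarrow> mB n (\<lambda>bs. theta t bs G)"
proof (induction n arbitrary: t G)
  case 0 then show ?case by (simp add: mbal_def)
next
  case (Suc n)
  note G = Suc.prems
  have m: "mS (Suc n) (\<lambda>ts. G (x # ts))" for x by (rule mbal_ConsD(2)[OF G])
  show ?case
  proof (rule mbal_ConsI)
    show "clin (\<lambda>b. theta t (b # bs) G)" if "length bs = n" for bs
      unfolding theta_Cons using clin_P[OF bS_lmult[OF bS_theta], of bs G t] G that by simp
    show "mB n (\<lambda>bs. theta t (b # bs) G)" for b
      unfolding theta_Cons by (intro mbal_sw2 Suc.IH m)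
    show "theta t (b * src B r # b' # bs) G = theta t (b # b' * tgt B r # bs) G" if "Suc (length bs) = n" for b r b' bs
    proof -
      have b: "bS (\<lambda>p q. theta q (b' # bs) (\<lambda>ts. G (t * p # ts)))"
        by (rule bS_lmult, rule bS_theta) (use G that in simp)
      have "theta t (b * src B r # b' # bs) G = sw2 (tr b) (\<lambda>p q. theta (q * eT r) (b' # bs) (\<lambda>ts. G (t * p # ts)))"
        by (simp only: theta_Cons[of t "b * src B r"] P_mult_src[OF b])
      also have "\<dots> = sw2 (tr b) (\<lambda>p q. theta q (b' * tgt B r # bs) (\<lambda>ts. G (t * p # ts)))"
        by (intro sw2_cong theta_eT) (use m that in simp)
      finally show ?thesis by (simp only: theta_Cons[of t b])
    qed
  qed
qed

lemma theta_snoc: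
  "theta t (bs @ [b]) G = theta t bs (\<lambda>ts. sw2 (tr b) (\<lambda>p q. G (mult_last ts p @ [q])))"
proof (induction bs arbitrary: t G)
  case Nil then show ?case by (simp add: theta_Cons)
next
  case (Cons c bs)
  have "theta t (c # (bs @ [b])) G =
      sw2 (tr c) (\<lambda>p q. theta q bs (\<lambda>ts. sw2 (tr b) (\<lambda>p' q'. G (t * p # mult_last ts p' @ [q']))))"
    unfolding theta_Cons Cons.IH ..
  also have "\<dots> = sw2 (tr c) (\<lambda>p q. theta q bs (\<lambda>ts. sw2 (tr b) (\<lambda>p' q'. G (mult_last (t * p # ts) p' @ [q']))))"
  proof (intro sw2_cong theta_cong)
    fix p q p' q' and ts :: "'t list" assume "length ts = Suc (length bs)"
    then have "ts \<noteq> []" by auto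
    then show "G (t * p # mult_last ts p' @ [q']) = G (mult_last (t * p # ts) p' @ [q'])" by simp
  qed
  finally show ?case by (simp add: theta_Cons)
qed

lemma theta_unit_last: "mS (Suc (Suc (length bs))) G \<Longrightarrow> theta t (bs @ [1]) G = theta t bs (\<lambda>ts. G (ts @ [1]))"
proof (induction bs arbitrary: t G)
  case Nil
  have "bS (\<lambda>x y. G [x, y])" using bS_theta[of "[]" G] Nil by simp
  from P_one[OF bS_lmult[OF this, of t]] show ?case by (simp add: theta_Cons)
next
  case (Cons c bs)
  have m: "mS (Suc (Suc (length bs))) (\<lambda>ts. G (x # ts))" for x
    using mbal_ConsD(2) Cons.prems by simp
  show ?case by (simp add: theta_Cons Cons.IH[OF m])
qed

text \<open>By \<open>P_mult\<close> the first letter, multiplied by a component of u, splits into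
  can^{-1} for that component and for b. The former cancels by \<open>P_CT\<close>, which leaves the
  coaction of u to the right of b_+, where the induction hypothesis applies.\<close>

lemma theta_mult_right:
  "mS (Suc (length bs)) G \<Longrightarrow> bs \<noteq> [] \<Longrightarrow>
    sw2 (coactT u) (\<lambda>u0 u1. diagB u1 bs (\<lambda>bs'. theta (t * u0) bs' G)) = theta t bs (\<lambda>ts. G (mult_last ts u))"
proof (induction bs arbitrary: t G)
  case Nil then show ?case by simp
next
  case (Cons b bs)
  have G: "mS (Suc (Suc (length bs))) G" using Cons.prems by simp
  show ?case
  proof (cases "bs = []")
    case True
    have bs0: "bS (\<lambda>x y. G [x, y])" using bS_theta[of "[]" G] G True by simp
    have "sw2 (coactT u) (\<lambda>u0 u1. diagB u1 (b # bs) (\<lambda>bs'. theta (t * u0) bs' G)) =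
        sw2 (coactT u) (\<lambda>u0 u1. sw2 (tr (b * u1)) (\<lambda>p q. G [t * u0 * p, q]))"
      by (simp add: True theta_Cons)
    also have "\<dots> = sw2 (coactT u) (\<lambda>u0 u1. sw2 (tr u1) (\<lambda>p' q'. sw2 (tr b) (\<lambda>p q. G [t * u0 * (p' * p), q * q'])))"
      by (rule sw2_cong, rule P_mult[OF bS_lmult[OF bs0]])
    also have "\<dots> = sw2 (coactT u) (\<lambda>u0 u1. sw2 (tr u1) (\<lambda>p' q'. sw2 (tr b) (\<lambda>p q. G [t * u0 * p' * p, q * q'])))"
      by (simp add: mult.assoc)
    also have "\<dots> = sw2 (tr b) (\<lambda>p q. G [t * p, q * u])"
      by (rule P_CT[OF bS_mid_mult[OF bs0]])
    finally show ?thesis by (simp add: True theta_Cons)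
  next
    case False
    have m: "mS (Suc (length bs)) (\<lambda>ts. G (x # ts))" for x by (rule mbal_ConsD(2)[OF G])
    define Q where "Q y x z = diagB y bs (\<lambda>bs'. theta z bs' (\<lambda>ts. G (x # ts)))" for y x z
    have mBt: "mB (length bs) (\<lambda>bs'. theta z bs' (\<lambda>ts. G (x # ts)))" for x z
      by (rule mB_theta[OF m])
    have bSt: "bS (\<lambda>x z. theta z bs' (\<lambda>ts. G (x # ts)))" if "length bs' = length bs" for bs'
      by (rule bS_theta) (use G that in simp)
    have bSQ: "bS (Q y)" for y
      unfolding Q_def
    proof (rule balI)
      show "clin (\<lambda>x. diagB y bs (\<lambda>bs'. theta z bs' (\<lambda>ts. G (x # ts))))" for z
        by (rule clin_diagB_in) (rule bal_left[OF bSt])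
      show "clin (\<lambda>z. diagB y bs (\<lambda>bs'. theta z bs' (\<lambda>ts. G (x # ts))))" for x
        by (rule clin_diagB_in) (rule bal_right[OF bSt])
      show "diagB y bs (\<lambda>bs'. theta z bs' (\<lambda>ts. G (actT (tgt K a) x # ts))) =
          diagB y bs (\<lambda>bs'. theta (actT (src K a) z) bs' (\<lambda>ts. G (x # ts)))" if "a \<in> base K" for x a z
        by (rule diagB_cong, rule bal_mid[OF bSt that])
    qed
    have Qtgt: "Q (y * tgt B r) x z = Q y x (z * eT r)" for y r x z
      unfolding Q_def diagB_tgt[OF mBt False]
    proof (rule diagB_cong)
      fix zs :: "'b list" assume "length zs = length bs"
      then obtain c cs where "zs = c # cs" "Suc (length cs) = length bs" using False by (cases zs) auto
      then show "theta z (hd zs * tgt B r # tl zs) (\<lambda>ts. G (x # ts)) = theta (z * eT r) zs (\<lambda>ts. G (x # ts))"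
        using theta_eT[of cs "\<lambda>ts. G (x # ts)" z r c] m by simp
    qed
    define R where "R y x z = sw2 (tr b) (\<lambda>p q. Q y (x * p) (q * z))" for y x z
    have bSR: "bS (R y)" for y
      unfolding R_def by (rule bS_mid_mult[OF bSQ])
    have clR: "clin (\<lambda>y. R y x z)" for x z
      unfolding R_def Q_def by (intro clin_sw2_in clin_diagB[OF mBt False])
    have Rtgt: "R (y * tgt B r) x = (\<lambda>z. R y x (z * eT r))" for y r x
      unfolding R_def Qtgt by (simp add: mult.assoc)
    define F where "F x c y = sw2 (tr c) (\<lambda>p' q'. R y (x * p') q')" for x c y
    have "sw2 (coactT u) (\<lambda>u0 u1. diagB u1 (b # bs) (\<lambda>bs'. theta (t * u0) bs' G)) =
        sw2 (coactT u) (\<lambda>u0 u1. sw2 (comul B u1) (\<lambda>c1 c2. sw2 (tr (b * c1)) (\<lambda>p q. Q c2 (t * u0 * p) q)))"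
      unfolding diagB_Cons[OF False] theta_Cons Q_def diagB_sw2 ..
    also have "\<dots> = sw2 (coactT u) (\<lambda>u0 u1. sw2 (comul B u1) (\<lambda>c1 c2. F (t * u0) c1 c2))"
    proof (intro sw2_cong)
      show "sw2 (tr (b * c1)) (\<lambda>p q. Q c2 (t * u0 * p) q) = F (t * u0) c1 c2" for u0 c1 c2
        unfolding F_def R_def by (subst P_mult[OF bS_lmult[OF bSQ]]) (simp add: mult.assoc)
    qed
    also have "\<dots> = sw2 (coactT u) (\<lambda>x y. sw2 (coactT x) (\<lambda>u0 c1. F (t * u0) c1 y))"
    proof (rule CT_coassoc[symmetric])
      note lins = clin_P[OF bS_lmult[OF bSR]] bal_clin[OF bSR] clR
      have pm: "sw2 (tr (c * tgt B r)) (\<lambda>p' q'. R y (x * p') q') = sw2 (tr c) (\<lambda>p' q'. R y (x * (eT r * p')) q')" for c r x y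
        by (rule P_mult_tgt[OF bS_lmult[OF bSR]])
      have ps: "sw2 (tr (c * src B r)) (\<lambda>p' q'. R y (x * p') q') = sw2 (tr c) (\<lambda>p' q'. R y (x * p') (q' * eT r))" for c r x y
        by (rule P_mult_src[OF bS_lmult[OF bSR]])
      show "bT (\<lambda>u0 c1. F (t * u0) c1 y)" for y
        unfolding F_def
        by (rule balI) (intro clin_intros lins | simp add: pm | simp add: mult.assoc)+
      show "bB (F (t * x))" for x
        unfolding F_def
        by (rule balI) (intro clin_intros lins | simp add: ps Rtgt)+
    qed
    also have "\<dots> = sw2 (coactT u) (\<lambda>x y. R y t x)"
      unfolding F_def by (rule sw2_cong, rule P_CT[OF bSR])
    also have "\<dots> = sw2 (tr b) (\<lambda>p q. sw2 (coactT u) (\<lambda>x y. diagB y bs (\<lambda>bs'. theta (q * x) bs' (\<lambda>ts. G (t * p # ts)))))"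
      unfolding R_def Q_def by (rule sw2_commute)
    also have "\<dots> = sw2 (tr b) (\<lambda>p q. theta q bs (\<lambda>ts. G (t * p # mult_last ts u)))"
      by (rule sw2_cong, rule Cons.IH[OF m False])
    also have "\<dots> = sw2 (tr b) (\<lambda>p q. theta q bs (\<lambda>ts. G (mult_last (t * p # ts) u)))"
    proof (intro sw2_cong theta_cong)
      fix p q and ts :: "'t list" assume "length ts = Suc (length bs)"
      then have "ts \<noteq> []" by auto
      then show "G (t * p # mult_last ts u) = G (mult_last (t * p # ts) u)" by simp
    qed
    finally show ?thesis by (simp add: theta_Cons)
  qed
qed

fun thetaW :: "'t \<Rightarrow> ('r, 'b) bword \<Rightarrow> ('t list \<Rightarrow> 'w::complex_vector) \<Rightarrow> 'w"
  where
    "thetaW t (Scalar r) G = G [t * eT r]"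
  | "thetaW t (Word bs) G = theta t bs G"

lemma counit_at_Cons:
  assumes "2 \<le> length bs" "j < length bs"
  shows "\<exists>xs. counit_at B j bs = Word xs \<and> counit_at B (Suc j) (b # bs) = Word (b # xs)"
proof (cases "j + 1 < length bs")
  case True then show ?thesis using assms by (cases bs) (auto simp: counit_at_def Let_def)
next
  case False
  then obtain j' where "j = Suc j'" using assms by (cases j) auto
  then show ?thesis using assms False by (cases bs) (auto simp: counit_at_def Let_def)
qed

text \<open>Multiplying the two factors that share the letter b brings together b_- b_+ =
  \<epsilon>(b), a scalar that moves to a neighbouring letter as prescribed by
  \<open>counit_at\<close>.\<close>

lemma theta_face:
  "i < length bs \<Longrightarrow> mS (length bs) G \<Longrightarrow>
    theta t bs (\<lambda>ts. G (merge_at i ts)) = thetaW t (counit_at B i bs) G"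
proof (induction i arbitrary: bs t G)
  case 0
  then obtain b bs' where bs: "bs = b # bs'" by (cases bs) auto
  have G: "mS (Suc (length bs')) G" using 0 bs by simp
  have "theta t bs (\<lambda>ts. G (merge_at 0 ts)) = sw2 (tr b) (\<lambda>p q. theta q bs' (\<lambda>ts. G (t * p * hd ts # tl ts)))"
    unfolding bs theta_Cons
  proof (intro sw2_cong theta_cong)
    fix p q and ts :: "'t list" assume "length ts = Suc (length bs')"
    then show "G (merge_at 0 (t * p # ts)) = G (t * p * hd ts # tl ts)" by (cases ts) auto
  qed
  also have "\<dots> = sw2 (tr b) (\<lambda>p q. theta (t * (p * q)) bs' G)"
    by (simp add: theta_mult_left flip: mult.assoc)
  also have "\<dots> = theta (t * eT (counit B b)) bs' G"
    by (rule P_counit, rule clin_comp[OF clin_theta[OF G]]) (intro clin_intros)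
  also have "\<dots> = thetaW t (counit_at B 0 bs) G"
  proof (cases bs')
    case Nil then show ?thesis by (simp add: bs counit_at_def)
  next
    case (Cons b' bs'')
    then show ?thesis using theta_eT[of bs'' G t "counit B b" b'] G by (simp add: bs counit_at_def Let_def)
  qed
  finally show ?case .
next
  case (Suc j)
  then obtain b bs' where bs: "bs = b # bs'" and j: "j < length bs'" by (cases bs) auto
  have G: "mS (Suc (length bs')) G" using Suc.prems bs by simp
  have IH: "theta t bs (\<lambda>ts. G (merge_at (Suc j) ts)) = sw2 (tr b) (\<lambda>p q. thetaW q (counit_at B j bs') (\<lambda>ts. G (t * p # ts)))"
    unfolding bs theta_Cons using Suc.IH[OF j mbal_ConsD(2)[OF G]] by simp
  show ?case
  proof (cases "2 \<le> length bs'")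
    case True
    then show ?thesis
      using counit_at_Cons[OF True j, of b] IH by (auto simp: bs theta_Cons)
  next
    \<comment> \<open>The removed letter is the second of two, so its counit goes to the letter on
      its left, through s.\<close>
    case False
    then obtain b' where b': "bs' = [b']" "j = 0" using j by (cases bs'; cases "tl bs'") auto
    have "bS (\<lambda>x y. G [x, y])" using bS_theta[of "[]" G] G b' by simp
    from P_mult_src[OF bS_lmult[OF this, of t], of b "counit B b'"] show ?thesis
      using IH by (simp add: bs b' counit_at_def Let_def theta_Cons)
  qed
qed

text \<open>By \<open>P_coact_right\<close> the coproduct of b becomes the coaction of b_+. The
  second letter then contributes can^{-1} of the component of this coaction, and \<open>P_CT\<close>
  cancels the two and leaves a unit between b_- and b_+.\<close>

lemma theta_degen:
  "i < length bs \<Longrightarrow> mS (Suc (Suc (length bs))) G \<Longrightarrow>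
    theta t bs (\<lambda>ts. G (unit_at i ts)) =
    sw2 (comul B (bs ! i)) (\<lambda>b1 b2. theta t (take i bs @ b1 # b2 # drop (Suc i) bs) G)"
proof (induction i arbitrary: bs t G)
  case 0
  then obtain b bs' where bs: "bs = b # bs'" by (cases bs) auto
  have G: "mS (Suc (Suc (Suc (length bs')))) G" using 0 bs by simp
  have m: "mS (Suc (Suc (length bs'))) (\<lambda>ts. G (x # ts))" for x by (rule mbal_ConsD(2)[OF G])
  define H where "H x y z = theta z bs' (\<lambda>ts. G (x # y # ts))" for x y z
  have bSH: "bS (H x)" for x unfolding H_def by (rule bS_theta[OF m])
  have bSH': "bS (\<lambda>x y. H x y z)" for z
    unfolding H_def
  proof (rule balI)
    show "clin (\<lambda>x. theta z bs' (\<lambda>ts. G (x # y # ts)))" for y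
      by (rule clin_theta_in, rule mbal_ConsD(1)[OF G]) simp
    show "clin (\<lambda>y. theta z bs' (\<lambda>ts. G (x # y # ts)))" for x
      by (rule clin_theta_in, rule mbal_ConsD(1)[OF m])
    show "theta z bs' (\<lambda>ts. G (actT (tgt K a) x # y # ts)) = theta z bs' (\<lambda>ts. G (x # actT (src K a) y # ts))"
      if "a \<in> base K" for x a y
      by (rule theta_cong, rule mbal_ConsD(3)[OF G that]) simp
  qed
  define F where "F p q c = sw2 (tr c) (\<lambda>p' q'. H (t * p) (q * p') q')" for p q c
  have FS: "bS (\<lambda>p q. F p q c)" for c
    unfolding F_def
  proof (rule balI)
    show "sw2 (tr c) (\<lambda>p' q'. H (t * actT (tgt K a) x) (y * p') q') = sw2 (tr c) (\<lambda>p' q'. H (t * x) (actT (src K a) y * p') q')"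
      if a: "a \<in> base K" for x a y
      using bal_mid[OF bSH' a] by (simp add: actT_tgt_mult[OF a, symmetric] actT_src_mult[OF a, symmetric])
  qed (intro clin_intros bal_clin[OF bSH'])+
  have FT: "bT (F p)" for p
  proof -
    have pm: "sw2 (tr (c * tgt B r)) (\<lambda>p' q'. H (t * p) (q * p') q') = sw2 (tr c) (\<lambda>p' q'. H (t * p) (q * (eT r * p')) q')" for c r q
      by (rule P_mult_tgt[OF bS_lmult[OF bSH]])
    show ?thesis unfolding F_def
      by (rule balI) (intro clin_intros bal_clin[OF bSH] clin_P[OF bS_lmult[OF bSH]] | simp add: pm | simp add: mult.assoc)+
  qed
  have "sw2 (comul B b) (\<lambda>b1 b2. theta t (b1 # b2 # bs') G) = sw2 (comul B b) (\<lambda>b1 b2. sw2 (tr b1) (\<lambda>p q. F p q b2))"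
    by (simp add: theta_Cons F_def H_def)
  also have "\<dots> = sw2 (tr b) (\<lambda>p q. sw2 (coactT q) (\<lambda>q0 q1. F p q0 q1))"
    by (rule P_coact_right[OF FS FT, symmetric])
  also have "\<dots> = sw2 (tr b) (\<lambda>p q. H (t * p) 1 q)"
    unfolding F_def using P_CT[OF bSH, of _ _ 1] by simp
  finally show ?case by (simp add: bs theta_Cons H_def)
next
  case (Suc j)
  then obtain b bs' where bs: "bs = b # bs'" and j: "j < length bs'" by (cases bs) auto
  have G: "mS (Suc (Suc (Suc (length bs')))) G" using Suc.prems bs by simp
  have "theta t bs (\<lambda>ts. G (unit_at (Suc j) ts)) = sw2 (tr b) (\<lambda>p q. sw2 (comul B (bs' ! j))
      (\<lambda>b1 b2. theta q (take j bs' @ b1 # b2 # drop (Suc j) bs') (\<lambda>ts. G (t * p # ts))))"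
    unfolding bs theta_Cons using Suc.IH[OF j mbal_ConsD(2)[OF G]] by simp
  also have "\<dots> = sw2 (comul B (bs' ! j)) (\<lambda>b1 b2. theta t (b # take j bs' @ b1 # b2 # drop (Suc j) bs') G)"
    unfolding theta_Cons[of t b] by (rule sw2_commute)
  finally show ?case by (simp add: bs)
qed

end


section \<open>The iterated canonical map\<close>

context equivariant_galois_ext
begin

text \<open>The functionals on \<open>B\<^sup>\<otimes>\<^sup>n \<otimes> T\<close> over the opposite of \<open>R\<close>.\<close>

definition functB :: "nat \<Rightarrow> ('b list \<Rightarrow> 't \<Rightarrow> 'w::complex_vector) \<Rightarrow> bool"
  where "functB n H \<longleftrightarrow>
    (\<forall>t. mB n (\<lambda>bs. H bs t)) \<and> (\<forall>bs. length bs = n \<longrightarrow> clin (H bs)) \<and>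
    (\<forall>b bs t r. Suc (length bs) = n \<longrightarrow> H (b # bs) (t * eT r) = H (b * tgt B r # bs) t)"

lemma functB_mB: "functB n H \<Longrightarrow> mB n (\<lambda>bs. H bs t)"
  and functB_clin: "functB n H \<Longrightarrow> length bs = n \<Longrightarrow> clin (H bs)"
  and functB_eT: "functB n H \<Longrightarrow> Suc (length bs) = n \<Longrightarrow> H (b # bs) (t * eT r) = H (b * tgt B r # bs) t"
  by (simp_all add: functB_def)

lemma functB_theta: "mS (Suc n) G \<Longrightarrow> functB n (\<lambda>bs t. theta t bs G)"
  unfolding functB_def by (auto simp: mB_theta clin_theta theta_eT)

lemma bT_functB:
  assumes H: "functB (Suc (length bs)) H"
  shows "bT (\<lambda>t b. H (b # bs) t)"
proof (rule balI)
  show "clin (\<lambda>t. H (b # bs) t)" for b using functB_clin[OF H, of "b # bs"] by simp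
  show "clin (\<lambda>b. H (b # bs) t)" for t by (rule mbal_ConsD(1)[OF functB_mB[OF H]]) simp
  show "H (b # bs) (t * eT r) = H (b * tgt B r # bs) t" for t r b by (rule functB_eT[OF H]) simp
qed

lemma functB_coact:
  assumes H: "functB (Suc n) H"
  shows "functB n (\<lambda>bs y. sw2 (coactT y) (\<lambda>y0 y1. H (y1 # bs) (t * y0)))"
proof -
  have bT: "bT (\<lambda>y0 y1. H (y1 # bs) (t * y0))" if "length bs = n" for bs
    by (rule bT_lmult[OF bT_functB]) (use H that in simp)
  show ?thesis
    unfolding functB_def
  proof (intro conjI allI impI)
    show "mB n (\<lambda>bs. sw2 (coactT y) (\<lambda>y0 y1. H (y1 # bs) (t * y0)))" for y
      by (rule mbal_sw2, rule mbal_ConsD(2)[OF functB_mB[OF H]])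
    show "clin (\<lambda>y. sw2 (coactT y) (\<lambda>y0 y1. H (y1 # bs) (t * y0)))" if "length bs = n" for bs
      by (rule clin_CT[OF bT[OF that]])
    show "sw2 (coactT (y * eT r)) (\<lambda>y0 y1. H (y1 # b # bs) (t * y0)) =
        sw2 (coactT y) (\<lambda>y0 y1. H (y1 # b * tgt B r # bs) (t * y0))" if len: "Suc (length bs) = n" for b bs y r
      using CT_ract[OF bT[of "b # bs"], of y r] len mbal_ConsD(3)[OF functB_mB[OF H] UNIV_I len] by simp
  qed
qed

text \<open>The first letter arises by one coaction on the product y accumulated from all later
  factors; in \<open>omega\<close> it is the product of the components of the single factors. The
  value at \<open>[]\<close> is a default.\<close>

fun omegaT :: "'t list \<Rightarrow> ('b list \<times> 't) free"
  where
    "omegaT [] = 0"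
  | "omegaT [t] = [] \<otimes> t"
  | "omegaT (t # u # ts) = sw2 (omegaT (u # ts)) (\<lambda>bs y. sw2 (coactT y) (\<lambda>y0 y1. (y1 # bs) \<otimes> (t * y0)))"

definition om :: "'t list \<Rightarrow> ('b list \<Rightarrow> 't \<Rightarrow> 'w::complex_vector) \<Rightarrow> 'w"
  where "om ts H = sw2 (omegaT ts) H"

lemma om_single [simp]: "om [t] H = H [] t"
  by (simp add: om_def)

lemma om_Cons: "ts \<noteq> [] \<Longrightarrow> om (t # ts) H = om ts (\<lambda>bs y. sw2 (coactT y) (\<lambda>y0 y1. H (y1 # bs) (t * y0)))"
  by (cases ts) (simp_all add: om_def)

lemma om_cong:
  "(\<And>bs y. Suc (length bs) = length ts \<Longrightarrow> H bs y = H' bs y) \<Longrightarrow> om ts H = om ts H'"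
proof (induction ts arbitrary: H H')
  case Nil then show ?case by (simp add: om_def)
next
  case (Cons t ts)
  show ?case
  proof (cases "ts = []")
    case True then show ?thesis using Cons.prems by simp
  next
    case False
    show ?thesis unfolding om_Cons[OF False] by (intro Cons.IH sw2_cong Cons.prems) simp
  qed
qed

lemma om_sw2: "om ts (\<lambda>bs y. sw2 X (\<lambda>a b. F a b bs y)) = sw2 X (\<lambda>a b. om ts (F a b))"
  unfolding om_def by (rule sw2_commute)

lemma clin_om_in:
  assumes "\<And>bs t. Suc (length bs) = length ts \<Longrightarrow> clin (\<lambda>y. F y bs t)"
  shows "clin (\<lambda>y. om ts (F y))"
proof -
  have "clin (\<lambda>y. if Suc (length bs) = length ts then F y bs t else 0)" for bs t
    by (cases "Suc (length bs) = length ts") (simp_all add: assms clin_0)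
  then have "clin (\<lambda>y. om ts (\<lambda>bs t. if Suc (length bs) = length ts then F y bs t else 0))"
    unfolding om_def by (intro clin_sw2_in)
  moreover have "om ts (\<lambda>bs t. if Suc (length bs) = length ts then F y bs t else 0) = om ts (F y)" for y
    by (rule om_cong) simp
  ultimately show ?thesis by simp
qed

text \<open>Coacting on b_+ after multiplying by b_- is can applied to can^{-1}(1 \<otimes> b), so
  the letters are recovered one by one.\<close>

lemma theta_om:
  "functB (length bs) H \<Longrightarrow> theta t bs (\<lambda>ts. om ts H) = H bs t"
proof (induction bs arbitrary: t H)
  case Nil then show ?case by simp
next
  case (Cons b bs)
  have H: "functB (Suc (length bs)) H" using Cons.prems by simp
  have "theta t (b # bs) (\<lambda>ts. om ts H) =
      sw2 (tr b) (\<lambda>p q. theta q bs (\<lambda>ts. om ts (\<lambda>bs y. sw2 (coactT y) (\<lambda>y0 y1. H (y1 # bs) (t * p * y0)))))"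
    unfolding theta_Cons
  proof (intro sw2_cong theta_cong)
    fix p q and ts :: "'t list" assume "length ts = Suc (length bs)"
    then have "ts \<noteq> []" by auto
    then show "om (t * p # ts) H = om ts (\<lambda>bs y. sw2 (coactT y) (\<lambda>y0 y1. H (y1 # bs) (t * p * y0)))"
      by (rule om_Cons)
  qed
  also have "\<dots> = sw2 (tr b) (\<lambda>p q. sw2 (coactT q) (\<lambda>y0 y1. H (y1 # bs) (t * p * y0)))"
    by (rule sw2_cong, rule Cons.IH[OF functB_coact[OF H]])
  also have "\<dots> = H (b # bs) t"
    by (rule P_can_left[OF bT_functB[OF H]])
  finally show ?case .
qed

lemma om_act:
  "functB n H \<Longrightarrow> length ts = Suc n \<Longrightarrow> diagT k ts (\<lambda>zs. om zs H) = om ts (\<lambda>bs y. H bs (actT k y))"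
proof (induction ts arbitrary: n H k)
  case Nil then show ?case by simp
next
  case (Cons t ts)
  show ?case
  proof (cases "ts = []")
    case True then show ?thesis by simp
  next
    case False
    then obtain n' where n: "n = Suc n'" "length ts = Suc n'" using Cons.prems by (cases n) auto
    have H: "functB (Suc n') H" using Cons.prems n by simp
    have bT: "bT (\<lambda>y0 y1. H (y1 # bs) (u * y0))" if "length bs = n'" for bs u
      by (rule bT_lmult[OF bT_functB]) (use H that in simp)
    have "diagT k (t # ts) (\<lambda>zs. om zs H) = sw2 (comul K k) (\<lambda>k1 k2. diagT k2 ts
        (\<lambda>zs. om zs (\<lambda>bs y. sw2 (coactT y) (\<lambda>y0 y1. H (y1 # bs) (actT k1 t * y0)))))"
      unfolding diagT_Cons[OF False]
    proof (intro sw2_cong diagT_cong)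
      fix k1 k2 and zs :: "'t list" assume "length zs = length ts"
      then have "zs \<noteq> []" using False by auto
      then show "om (actT k1 t # zs) H = om zs (\<lambda>bs y. sw2 (coactT y) (\<lambda>y0 y1. H (y1 # bs) (actT k1 t * y0)))"
        by (rule om_Cons)
    qed
    also have "\<dots> = sw2 (comul K k) (\<lambda>k1 k2. om ts (\<lambda>bs y. sw2 (coactT (actT k2 y)) (\<lambda>y0 y1. H (y1 # bs) (actT k1 t * y0))))"
      by (rule sw2_cong, rule Cons.IH[OF functB_coact[OF H] n(2)])
    also have "\<dots> = om ts (\<lambda>bs y. sw2 (coactT y) (\<lambda>y0 y1. H (y1 # bs) (actT k (t * y0))))"
      unfolding om_sw2[symmetric]
    proof (rule om_cong)
      fix bs :: "'b list" and y assume "Suc (length bs) = length ts"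
      then have len: "length bs = n'" using n by simp
      have "sw2 (comul K k) (\<lambda>k1 k2. sw2 (coactT (actT k2 y)) (\<lambda>y0 y1. H (y1 # bs) (actT k1 t * y0))) =
          sw2 (comul K k) (\<lambda>k1 k2. sw2 (coactT y) (\<lambda>y0 y1. H (y1 # bs) (actT k1 t * actT k2 y0)))"
        by (rule sw2_cong, rule CT_act[OF bT[OF len]])
      also have "\<dots> = sw2 (coactT y) (\<lambda>y0 y1. sw2 (comul K k) (\<lambda>k1 k2. H (y1 # bs) (actT k1 t * actT k2 y0)))"
        by (rule sw2_commute)
      also have "\<dots> = sw2 (coactT y) (\<lambda>y0 y1. H (y1 # bs) (actT k (t * y0)))"
        unfolding actT_mult
        by (intro sw2_cong clin_sw2_out[symmetric] functB_clin[OF H]) (simp add: len)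
      finally show "sw2 (comul K k) (\<lambda>k1 k2. sw2 (coactT (actT k2 y)) (\<lambda>y0 y1. H (y1 # bs) (actT k1 t * y0))) =
          sw2 (coactT y) (\<lambda>y0 y1. H (y1 # bs) (actT k (t * y0)))" .
    qed
    finally show ?thesis by (simp add: om_Cons False)
  qed
qed

text \<open>By \<open>om_act\<close>, an element of S acting on the second factor acts on the
  product accumulated from the tail. This product stands directly to the right of the first factor,
  and \<open>actT_mid\<close> applies.\<close>

lemma mS_om: "functB n H \<Longrightarrow> mS (Suc n) (\<lambda>ts. om ts H)"
proof (induction n arbitrary: H)
  case 0
  then show ?case using functB_clin[OF 0, of "[]"] by (simp add: mbal_1)
next
  case (Suc n)
  note H = Suc.prems
  have bT: "bT (\<lambda>y0 y1. H (y1 # bs) (u * y0))" if "length bs = n" for bs u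
    by (rule bT_lmult[OF bT_functB]) (use H that in simp)
  have oC: "om (t # ts) H = om ts (\<lambda>bs y. sw2 (coactT y) (\<lambda>y0 y1. H (y1 # bs) (t * y0)))"
    if "length ts = Suc n" for t ts
    using that by (intro om_Cons) auto
  show ?case
  proof (rule mbal_ConsI)
    show "clin (\<lambda>t. om (t # ts) H)" if "length ts = Suc n" for ts
      unfolding oC[OF that]
      by (intro clin_om_in clin_sw2_in clin_comp[OF functB_clin[OF H]] clin_mult clin_id) (use that in auto)
    show "mS (Suc n) (\<lambda>ts. om (t # ts) H)" for t
      by (rule mbal_transfer[OF Suc.IH[OF functB_coact[OF H]]]) (rule oC)
    show "om (actT (tgt K a) t # u # ts) H = om (t # actT (src K a) u # ts) H"
      if a: "a \<in> base K" and "Suc (length ts) = Suc n" for t a u ts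
    proof -
      have len: "length (u # ts) = Suc n" for u using that by simp
      let ?H = "\<lambda>bs y. sw2 (coactT y) (\<lambda>y0 y1. H (y1 # bs) (t * y0))"
      have "diagT (src K a) (u # ts) (\<lambda>zs. om zs ?H) = om (actT (src K a) u # ts) ?H"
        by (rule diagT_src_one[OF _ a]) (use Suc.IH[OF functB_coact[OF H, of t]] len in simp)
      then have "om (t # actT (src K a) u # ts) H = diagT (src K a) (u # ts) (\<lambda>zs. om zs ?H)"
        using oC[OF len] by simp
      also have "\<dots> = om (u # ts) (\<lambda>bs y. sw2 (coactT (actT (src K a) y)) (\<lambda>y0 y1. H (y1 # bs) (t * y0)))"
        by (rule om_act[OF functB_coact[OF H] len])
      also have "\<dots> = om (u # ts) (\<lambda>bs y. sw2 (coactT y) (\<lambda>y0 y1. H (y1 # bs) (actT (tgt K a) t * y0)))"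
        by (rule om_cong) (use len in \<open>simp add: CT_act[OF bT] actT_mid[OF a]\<close>)
      finally show ?thesis using oC[OF len] by simp
    qed
  qed
qed

lemma rcoact_iter_length:
  "sw2 (rcoact_iter coactT n x) F = sw2 (rcoact_iter coactT n x) (\<lambda>x0 cs. if length cs = n then F x0 cs else 0)"
proof (induction n arbitrary: x F)
  case (Suc n)
  have "sw2 (rcoact_iter coactT n x') (\<lambda>x0 cs. F x0 (cs @ [c])) =
      sw2 (rcoact_iter coactT n x') (\<lambda>x0 cs. if length (cs @ [c]) = Suc n then F x0 (cs @ [c]) else 0)" for x' c
    using Suc.IH[of x' "\<lambda>x0 cs. F x0 (cs @ [c])"] by simp
  then show ?case by (simp add: lsum_case)
qed simp

text \<open>An iterated coaction multiplied onto the letters one by one is a single coaction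
  followed by the diagonal action. The induction runs from the end because the outermost coaction
  supplies the last component.\<close>

lemma rcoact_iter_eq:
  "functB (length bs) F \<Longrightarrow> bs \<noteq> [] \<Longrightarrow>
    sw2 (rcoact_iter coactT (length bs) x) (\<lambda>x0 cs. F (map2 (*) bs cs) x0) =
    sw2 (coactT x) (\<lambda>x0 c. diagB c bs (\<lambda>zs. F zs x0))"
proof (induction bs arbitrary: x F rule: rev_induct)
  case Nil then show ?case by simp
next
  case (snoc b bs)
  show ?case
  proof (cases "bs = []")
    case True then show ?thesis by (simp add: lsum_case)
  next
    case False
    have F: "functB (Suc (length bs)) F" using snoc.prems by simp
    have F': "functB (length bs) (\<lambda>zs x0. F (zs @ [c]) x0)" for c
      unfolding functB_def
    proof (intro conjI allI impI)
      show "mB (length bs) (\<lambda>zs. F (zs @ [c]) t)" for t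
        by (rule mbal_snocD(2)[OF functB_mB[OF F]])
      show "clin (F (zs @ [c]))" if "length zs = length bs" for zs
        by (rule functB_clin[OF F]) (simp add: that)
      show "F ((z # zs) @ [c]) (t * eT r) = F ((z * tgt B r # zs) @ [c]) t" if "Suc (length zs) = length bs" for z zs t r
        using functB_eT[OF F, of "zs @ [c]" z t r] that by simp
    qed
    have "sw2 (rcoact_iter coactT (length (bs @ [b])) x) (\<lambda>x0 cs. F (map2 (*) (bs @ [b]) cs) x0) =
        sw2 (coactT x) (\<lambda>x' c. sw2 (rcoact_iter coactT (length bs) x') (\<lambda>x0 cs. F (map2 (*) (bs @ [b]) (cs @ [c])) x0))"
      by (simp add: lsum_case)
    also have "\<dots> = sw2 (coactT x) (\<lambda>x' c. sw2 (rcoact_iter coactT (length bs) x') (\<lambda>x0 cs. F (map2 (*) bs cs @ [b * c]) x0))"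
    proof (rule sw2_cong)
      fix x' c
      have "(if length cs = length bs then F (map2 (*) (bs @ [b]) (cs @ [c])) x0 else 0) =
          (if length cs = length bs then F (map2 (*) bs cs @ [b * c]) x0 else 0)" for x0 cs
        by simp
      then show "sw2 (rcoact_iter coactT (length bs) x') (\<lambda>x0 cs. F (map2 (*) (bs @ [b]) (cs @ [c])) x0) =
          sw2 (rcoact_iter coactT (length bs) x') (\<lambda>x0 cs. F (map2 (*) bs cs @ [b * c]) x0)"
        by (subst (1 2) rcoact_iter_length) (rule sw2_cong)
    qed
    also have "\<dots> = sw2 (coactT x) (\<lambda>x' c. sw2 (coactT x') (\<lambda>x0 c'. diagB c' bs (\<lambda>zs. F (zs @ [b * c]) x0)))"
      by (rule sw2_cong, rule snoc.IH[OF F' False])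
    also have "\<dots> = sw2 (coactT x) (\<lambda>x0 d. sw2 (comul B d) (\<lambda>c' c. diagB c' bs (\<lambda>zs. F (zs @ [b * c]) x0)))"
    proof (rule CT_coassoc)
      show "bT (\<lambda>x0 c'. diagB c' bs (\<lambda>zs. F (zs @ [b * c]) x0))" for c
      proof (rule balI)
        show "clin (\<lambda>x0. diagB c' bs (\<lambda>zs. F (zs @ [b * c]) x0))" for c'
          by (rule clin_diagB_in, rule functB_clin[OF F']) 
        show "clin (\<lambda>c'. diagB c' bs (\<lambda>zs. F (zs @ [b * c]) x0))" for x0
          by (rule clin_diagB[OF functB_mB[OF F'] False])
        show "diagB c' bs (\<lambda>zs. F (zs @ [b * c]) (x0 * eT r)) = diagB (c' * tgt B r) bs (\<lambda>zs. F (zs @ [b * c]) x0)" for x0 r c'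
          unfolding diagB_tgt[OF functB_mB[OF F'] False]
        proof (rule diagB_cong)
          fix zs :: "'b list" assume "length zs = length bs"
          then obtain z zs' where "zs = z # zs'" "Suc (length zs') = length bs" using False by (cases zs) auto
          then show "F (zs @ [b * c]) (x0 * eT r) = F ((hd zs * tgt B r # tl zs) @ [b * c]) x0"
            using functB_eT[OF F', of zs' z "b * c" x0 r] by simp
        qed
      qed
      show "bB (\<lambda>c' c. diagB c' bs (\<lambda>zs. F (zs @ [b * c]) x0))" for x0
        by (rule bB_diagB_snoc[OF functB_mB[OF F] False])
    qed
    also have "\<dots> = sw2 (coactT x) (\<lambda>x0 c. diagB c (bs @ [b]) (\<lambda>zs. F zs x0))"
      by (rule sw2_cong, rule diagB_snoc[OF functB_mB[OF F] False, symmetric])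
    finally show ?thesis .
  qed
qed

text \<open>The explicit form of the iterated canonical map used in \<open>omega\<close>.\<close>

definition omE :: "'t list \<Rightarrow> ('b list \<Rightarrow> 't \<Rightarrow> 'w::complex_vector) \<Rightarrow> 'w"
  where "omE ts H = lsum (coact_all coactT 1 (tl ts)) (\<lambda>ys.
    H (map (\<lambda>i. prod_list (map (\<lambda>y. snd y ! i) (drop i ys))) [0..<length ts - 1])
      (hd ts * prod_list (map fst ys)))"

lemma omE_single: "omE [t] H = H [] t"
  by (simp add: omE_def)

lemma coact_all_snoc:
  "coact_all coactT j (ts @ [u]) =
    lsum (coact_all coactT j ts) (\<lambda>ys. lsum (rcoact_iter coactT (j + length ts) u) (\<lambda>y. gen (ys @ [y])))"
  by (induction ts arbitrary: j) simp_all

lemma coact_all_length: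
  "lsum (coact_all coactT j ts) F = lsum (coact_all coactT j ts) (\<lambda>ys. if length ys = length ts then F ys else 0)"
proof (induction ts arbitrary: j F)
  case (Cons t ts)
  have "lsum (coact_all coactT j ts) (\<lambda>ys. F (y # ys)) =
      lsum (coact_all coactT j ts) (\<lambda>ys. if length (y # ys) = length (t # ts) then F (y # ys) else 0)" for y j
    using Cons.IH[of j "\<lambda>ys. F (y # ys)"] by simp
  then show ?case by simp
qed simp

text \<open>A further factor multiplies one component of its iterated coaction onto every earlier
  letter and its outermost component becomes the new last letter. The length restrictions make the
  access by index meaningful.\<close>

lemma omE_snoc:
  assumes "ts \<noteq> []"
  shows "omE (ts @ [u]) H = omE ts (\<lambda>bs y. sw2 (coactT u) (\<lambda>x c.
    sw2 (rcoact_iter coactT (length ts - 1) x) (\<lambda>x0 cs. H (map2 (*) bs cs @ [c]) (y * x0))))"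
proof -
  obtain t ts' where ts: "ts = t # ts'" using assms by (cases ts) auto
  let ?n = "length ts'"
  let ?w = "\<lambda>ys. map (\<lambda>i. prod_list (map (\<lambda>y. snd y ! i) (drop i ys)))"
  have w: "?w (ys @ [(x0, cs @ [c])]) [0..<Suc ?n] = map2 (*) (?w ys [0..<?n]) cs @ [c]"
    if "length ys = ?n" "length cs = ?n" for ys x0 cs c
    using that by (intro nth_equalityI) (auto simp: nth_append)
  have "omE (ts @ [u]) H = lsum (coact_all coactT 1 ts') (\<lambda>ys. sw2 (coactT u) (\<lambda>x c.
      sw2 (rcoact_iter coactT ?n x) (\<lambda>x0 cs. H (?w (ys @ [(x0, cs @ [c])]) [0..<Suc ?n]) (t * (prod_list (map fst ys) * x0)))))"
    by (simp add: omE_def ts coact_all_snoc lsum_case[symmetric] case_prod_unfold del: upt_Suc)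
  also have "\<dots> = lsum (coact_all coactT 1 ts') (\<lambda>ys. if length ys = ?n then sw2 (coactT u) (\<lambda>x c.
      sw2 (rcoact_iter coactT ?n x) (\<lambda>x0 cs. H (?w (ys @ [(x0, cs @ [c])]) [0..<Suc ?n]) (t * (prod_list (map fst ys) * x0)))) else 0)"
    by (rule coact_all_length)
  also have "\<dots> = lsum (coact_all coactT 1 ts') (\<lambda>ys. if length ys = ?n then sw2 (coactT u) (\<lambda>x c.
      sw2 (rcoact_iter coactT ?n x) (\<lambda>x0 cs. H (map2 (*) (?w ys [0..<?n]) cs @ [c]) (t * prod_list (map fst ys) * x0))) else 0)"
  proof (rule lsum_cong)
    fix ys
    show "(if length ys = ?n then sw2 (coactT u) (\<lambda>x c.
      sw2 (rcoact_iter coactT ?n x) (\<lambda>x0 cs. H (?w (ys @ [(x0, cs @ [c])]) [0..<Suc ?n]) (t * (prod_list (map fst ys) * x0)))) else 0) =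
      (if length ys = ?n then sw2 (coactT u) (\<lambda>x c.
      sw2 (rcoact_iter coactT ?n x) (\<lambda>x0 cs. H (map2 (*) (?w ys [0..<?n]) cs @ [c]) (t * prod_list (map fst ys) * x0))) else 0)"
    proof (cases "length ys = ?n")
      case True
      have "(if length cs = ?n then H (?w (ys @ [(x0, cs @ [c])]) [0..<Suc ?n]) (t * (prod_list (map fst ys) * x0)) else 0) =
          (if length cs = ?n then H (map2 (*) (?w ys [0..<?n]) cs @ [c]) (t * prod_list (map fst ys) * x0) else 0)" for x0 cs c
        using w[OF True, of cs x0 c] by (simp add: mult.assoc del: upt_Suc)
      then have "sw2 (rcoact_iter coactT ?n x) (\<lambda>x0 cs. H (?w (ys @ [(x0, cs @ [c])]) [0..<Suc ?n]) (t * (prod_list (map fst ys) * x0))) =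
          sw2 (rcoact_iter coactT ?n x) (\<lambda>x0 cs. H (map2 (*) (?w ys [0..<?n]) cs @ [c]) (t * prod_list (map fst ys) * x0))" for x c
        by (subst (1 2) rcoact_iter_length) (rule sw2_cong)
      then show ?thesis unfolding if_P[OF True] by (rule sw2_cong)
    qed simp
  qed
  also have "\<dots> = lsum (coact_all coactT 1 ts') (\<lambda>ys. sw2 (coactT u) (\<lambda>x c.
      sw2 (rcoact_iter coactT ?n x) (\<lambda>x0 cs. H (map2 (*) (?w ys [0..<?n]) cs @ [c]) (t * prod_list (map fst ys) * x0))))"
    by (rule coact_all_length[symmetric])
  finally show ?thesis by (simp add: omE_def ts)
qed

lemma omE_cong:
  "(\<And>bs y. Suc (length bs) = length ts \<Longrightarrow> H bs y = H' bs y) \<Longrightarrow> ts \<noteq> [] \<Longrightarrow> omE ts H = omE ts H'"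
  unfolding omE_def by (rule lsum_cong) simp

text \<open>The explicit iterated canonical map is a right inverse of \<open>theta\<close>; the induction peels off
  the last factor, where the explicit formula has a recursion.\<close>

lemma omE_theta: "mS (length ts) G \<Longrightarrow> ts \<noteq> [] \<Longrightarrow> omE ts (\<lambda>bs y. theta y bs G) = G ts"
proof (induction ts arbitrary: G rule: rev_induct)
  case Nil then show ?case by simp
next
  case (snoc u ts)
  show ?case
  proof (cases "ts = []")
    case True then show ?thesis by (simp add: omE_single)
  next
    case False
    then obtain n where n: "length ts = Suc n" by (cases ts) auto
    have G: "mS (Suc (Suc n)) G" using snoc.prems n by simp
    have bS: "bS (\<lambda>x q. G (mult_last zs x @ [q]))" if len: "length zs = Suc n" for zs
    proof (rule balI)
      obtain ws w where zs: "zs = ws @ [w]" "length ws = n" using snoc_decomp[OF len] by blast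
      show "clin (\<lambda>x. G (mult_last zs x @ [q]))" for q
        using clin_comp[OF mbal_clin[OF G, of ws "[q]"] clin_mult(2)[OF clin_id]] zs by simp
      show "clin (\<lambda>q. G (mult_last zs x @ [q]))" for x
        by (rule mbal_snocD(1)[OF G]) (simp add: zs)
      show "G (mult_last zs (actT (tgt K a) x) @ [q]) = G (mult_last zs x @ [actT (src K a) q])" if a: "a \<in> base K" for x a q
        using mbal_mid[OF G a, of ws "[]" "w * x" q] zs by (simp add: actT_tgt_mult[OF a])
    qed
    define G' where "G' c = (\<lambda>zs. sw2 (tr c) (\<lambda>p q. G (mult_last zs p @ [q])))" for c
    have G': "mS (Suc n) (G' c)" for c
      unfolding G'_def by (intro mbal_sw2 mS_mult_last mbal_snocD(2)[OF G])
    have "omE (ts @ [u]) (\<lambda>bs y. theta y bs G) = omE ts (\<lambda>bs y. sw2 (coactT u) (\<lambda>x c.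
        sw2 (rcoact_iter coactT n x) (\<lambda>x0 cs. theta (y * x0) (map2 (*) bs cs) (G' c))))"
      unfolding omE_snoc[OF False] theta_snoc G'_def by (simp add: n)
    also have "\<dots> = omE ts (\<lambda>bs y. theta y bs (\<lambda>zs. G (zs @ [u])))"
    proof (rule omE_cong[OF _ False])
      fix bs :: "'b list" and y assume "Suc (length bs) = length ts"
      then have len: "length bs = n" using n by simp
      \<comment> \<open>The last letter c carries can^{-1} of a component of u, and \<open>x\<close>
        multiplies the last factor; \<open>P_CT\<close> fuses both into the factor u.\<close>
      have PG: "sw2 (coactT u) (\<lambda>x c. theta y bs (\<lambda>zs. G' c (mult_last zs x))) = theta y bs (\<lambda>zs. G (zs @ [u]))"
      proof -
        have "sw2 (coactT u) (\<lambda>x c. theta y bs (\<lambda>zs. G' c (mult_last zs x))) =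
            theta y bs (\<lambda>zs. sw2 (coactT u) (\<lambda>x c. sw2 (tr c) (\<lambda>p q. G (mult_last (mult_last zs x) p @ [q]))))"
          unfolding G'_def by (rule theta_sw2[symmetric])
        also have "\<dots> = theta y bs (\<lambda>zs. G (zs @ [u]))"
        proof (rule theta_cong)
          fix zs :: "'t list" assume "length zs = Suc (length bs)"
          then have l: "length zs = Suc n" "zs \<noteq> []" using len by auto
          have "mult_last zs 1 = zs" using l by (cases zs rule: rev_cases) simp_all
          then show "sw2 (coactT u) (\<lambda>x c. sw2 (tr c) (\<lambda>p q. G (mult_last (mult_last zs x) p @ [q]))) = G (zs @ [u])"
            using P_CT[OF bS[OF l(1)], of u 1] l by (simp add: mult_last_mult)
        qed
        finally show ?thesis .
      qed
      show "sw2 (coactT u) (\<lambda>x c. sw2 (rcoact_iter coactT n x) (\<lambda>x0 cs. theta (y * x0) (map2 (*) bs cs) (G' c))) =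
          theta y bs (\<lambda>zs. G (zs @ [u]))"
      proof (cases "bs = []")
        case True
        then have "sw2 (coactT u) (\<lambda>x c. sw2 (rcoact_iter coactT n x) (\<lambda>x0 cs. theta (y * x0) (map2 (*) bs cs) (G' c))) =
            sw2 (coactT u) (\<lambda>x c. theta y bs (\<lambda>zs. G' c (mult_last zs x)))"
          using len by simp
        then show ?thesis using PG by simp
      next
        case b: False
        \<comment> \<open>The iterated coaction on the earlier letters becomes a diagonal action,
          which \<open>theta_mult_right\<close> converts into multiplication of the last factor by
          x.\<close>
        have "functB (length bs) (\<lambda>zs x0. theta (y * x0) zs (G' c))" for c
          unfolding functB_def
        proof (intro conjI allI impI)
          show "mB (length bs) (\<lambda>zs. theta (y * t) zs (G' c))" for t
            by (rule mB_theta) (use G' len in simp)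
          show "clin (\<lambda>x0. theta (y * x0) zs (G' c))" if "length zs = length bs" for zs
            by (rule clin_comp[OF clin_theta clin_mult(2)[OF clin_id]]) (use G' len that in simp)
          show "theta (y * (t * eT r)) (z # zs) (G' c) = theta (y * t) (z * tgt B r # zs) (G' c)"
            if "Suc (length zs) = length bs" for z zs t r
            using theta_eT[of zs "G' c" "y * t" r z] G' len that by (simp add: mult.assoc)
        qed
        from rcoact_iter_eq[OF this b]
        have "sw2 (coactT u) (\<lambda>x c. sw2 (rcoact_iter coactT n x) (\<lambda>x0 cs. theta (y * x0) (map2 (*) bs cs) (G' c))) =
            sw2 (coactT u) (\<lambda>x c. sw2 (coactT x) (\<lambda>x0 d. diagB d bs (\<lambda>zs. theta (y * x0) zs (G' c))))"
          by (simp add: len)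
        also have "\<dots> = sw2 (coactT u) (\<lambda>x c. theta y bs (\<lambda>zs. G' c (mult_last zs x)))"
          by (rule sw2_cong, rule theta_mult_right) (use G' len b in auto)
        finally show ?thesis using PG by simp
      qed
    qed
    also have "\<dots> = G (ts @ [u])"
      by (rule snoc.IH[OF _ False]) (use mbal_snocD(2)[OF G] n in simp)
    finally show ?thesis .
  qed
qed

end


section \<open>The coefficients over the right Hopf algebra\<close>

locale galois_sayd =
  equivariant_galois_ext B ractT coactT K actT + sayd_coefficients K actT actM lactM coactM
  for B :: "('r::complex_algebra, 'b::complex_algebra) bialgebroid"
    and ractT :: "'t::complex_algebra \<Rightarrow> 'r \<Rightarrow> 't"
    and coactT :: "'t \<Rightarrow> ('t \<times> 'b) free"
    and K :: "('s::complex_algebra, 'k::complex_algebra) bialgebroid"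
    and actT :: "'k \<Rightarrow> 't \<Rightarrow> 't"
    and actM :: "'m::complex_vector \<Rightarrow> 'k \<Rightarrow> 'm"
    and lactM :: "'s \<Rightarrow> 'm \<Rightarrow> 'm"
    and coactM :: "'m \<Rightarrow> ('k \<times> 'm) free"
begin

abbreviation bMT :: "('m \<Rightarrow> 't \<Rightarrow> 'w::complex_vector) \<Rightarrow> bool"
  where "bMT \<equiv> bal UNIV actM actT"

abbreviation ZM where "ZM \<equiv> MT_null actM actT"
abbreviation aM where "aM \<equiv> MT_act B ractT coactT actT coactM"
abbreviation rM where "rM \<equiv> MT_ract ractT :: ('m \<times> 't) free \<Rightarrow> 'r \<Rightarrow> ('m \<times> 't) free"
abbreviation cM where "cM \<equiv> MT_coact coactT :: ('m \<times> 't) free \<Rightarrow> (('m \<times> 't) free \<times> 'b) free"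

lemma subspace_ZM: "complex_vector.subspace ZM"
  unfolding MT_null_def by (rule subspace_tensor_null)

lemma ZM_sw2: "x \<in> ZM \<Longrightarrow> bMT h \<Longrightarrow> sw2 x h = 0"
  unfolding MT_null_def by (rule sw2_tensor_null) (auto simp: bal_zero)

lemma ZM_eqI: "(\<And>h :: 'm \<Rightarrow> 't \<Rightarrow> complex. bMT h \<Longrightarrow> sw2 x h = sw2 y h) \<Longrightarrow> x \<simeq>\<^bsub>ZM\<^esub> y"
  unfolding MT_null_def by (rule eq_tensorI)

lemma ZM_I: "(\<And>h :: 'm \<Rightarrow> 't \<Rightarrow> complex. bMT h \<Longrightarrow> sw2 x h = 0) \<Longrightarrow> x \<in> ZM"
  unfolding MT_null_def by (rule tensor_nullI)

text \<open>The last face of the cyclic module over T from degree 1 to degree 0, on functionals. Its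
  balancedness is thus inherited from \<open>rot\<close>.\<close>

definition fl :: "('m \<Rightarrow> 't \<Rightarrow> 'w::complex_vector) \<Rightarrow> 'm \<Rightarrow> 't \<Rightarrow> 't \<Rightarrow> 'w"
  where "fl h m u q = sw2 (coactM m) (\<lambda>k m0. h m0 (q * actT k u))"

definition actF :: "'b \<Rightarrow> ('m \<Rightarrow> 't \<Rightarrow> 'w::complex_vector) \<Rightarrow> 'm \<Rightarrow> 't \<Rightarrow> 'w"
  where "actF b h m t = sw2 (tr b) (\<lambda>p q. fl h m (t * p) q)"

lemma sw2_aM: "sw2 (aM b x) h = sw2 x (actF b h)"
  by (simp add: MT_act_def actF_def[abs_def] fl_def[abs_def] lsum_case)

lemma sw2_rM: "sw2 (rM x r) h = sw2 x (\<lambda>m t. h m (t * eT r))"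
  by (simp add: MT_ract_def lsum_case ractT_eq)

lemma clin_aM: "clin (aM b)" and clin_rM: "clin (\<lambda>x. rM x r)" and clin_cM: "clin cM"
  unfolding MT_act_def[abs_def] MT_ract_def[abs_def] MT_coact_def[abs_def] by (rule clin_lsum)+

lemma functC_1: "bMT h \<Longrightarrow> functC (Suc 0) (\<lambda>m ts. h m (hd ts))"
  unfolding functC_def mbal_1
  by (auto simp: bal_left bal_right bal_mid length_Suc_conv)

lemma functC_fl:
  assumes h: "bMT h"
  shows "functC (Suc (Suc 0)) (rot 1 (\<lambda>m ts. h m (hd (merge_at 0 ts))))"
  using functC_rot[of 1 1] functC_merge[OF functC_1[OF h], of 0] by simp

lemma fl_rot: "fl h m u q = rot 1 (\<lambda>m ts. h m (hd (merge_at 0 ts))) m [u, q]"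
  by (simp add: fl_def rot_def)

lemma bS_fl: "bMT h \<Longrightarrow> bS (fl h m)"
  unfolding fl_rot[abs_def] using bS_theta[of "[]"] functC_mS[OF functC_fl] by fastforce

lemma clin_fl: "bMT h \<Longrightarrow> clin (\<lambda>m. fl h m u q)"
  unfolding fl_rot by (rule functC_clin[OF functC_fl]) simp_all

lemma fl_act: "bMT h \<Longrightarrow> fl h (actM m k) u q = sw2 (comul K k) (\<lambda>k1 k2. fl h m (actT k1 u) (actT k2 q))"
  unfolding fl_rot using functC_act[OF functC_fl, of h "[u, q]" m k] by (simp add: diagT_Cons)

text \<open>The action of k on M becomes a diagonal action on the two arguments of
  \<open>fl\<close>, and \<open>P_act\<close> contracts this to the action of k on t.\<close>

lemma bMT_actF:
  assumes h: "bMT h"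
  shows "bMT (actF b h)"
  unfolding actF_def
proof (rule balI)
  show "sw2 (tr b) (\<lambda>p q. fl h (actM m k) (t * p) q) = sw2 (tr b) (\<lambda>p q. fl h m (actT k t * p) q)" for m k t
    unfolding fl_act[OF h] P_act[OF bS_fl[OF h], symmetric] by (rule sw2_commute)
qed (intro clin_intros clin_fl[OF h] bal_clin[OF bS_fl[OF h]])+

lemma clin_actF: "bMT h \<Longrightarrow> clin (\<lambda>b. actF b h m t)"
  unfolding actF_def by (intro clin_P bS_lmult bS_fl)

lemma stable_MT: "bMT h \<Longrightarrow> sw2 (coactM m) (\<lambda>k m0. h m0 (actT k t)) = h m t"
  using CM_stable[OF bal_left, of _ _ _ h m t] by (simp add: bal_mid)

lemma fl_right_one: "bMT h \<Longrightarrow> fl h m u 1 = h m u"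
  by (simp add: fl_def stable_MT)

lemma actF_one: "bMT h \<Longrightarrow> actF 1 h = h"
  unfolding actF_def[abs_def] by (simp add: P_one[OF bS_lmult[OF bS_fl]] fl_right_one)

lemma actF_tgt: "bMT h \<Longrightarrow> actF (tgt B r) h = (\<lambda>m t. h m (t * eT r))"
  unfolding actF_def[abs_def] by (simp add: P_tgt'[OF bS_lmult[OF bS_fl]] fl_right_one)

lemma actF_src: "bMT h \<Longrightarrow> actF (src B r) h = (\<lambda>m t. h m (eT r * t))"
  unfolding actF_def[abs_def] by (simp add: P_src'[OF bS_lmult[OF bS_fl]] fl_def stable_MT flip: actT_eT_left)

text \<open>Written with three factors, the left side is a composite of two last faces over T;
  \<open>rot_rot\<close> merges the two rotations into one.\<close>

lemma fl_fl:
  assumes h: "bMT h"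
  shows "sw2 (coactM m) (\<lambda>k m0. sw2 (comul K k) (\<lambda>k1 k2. fl h m0 (q' * actT k1 u) (actT k2 q))) = fl h m u (q * q')"
proof -
  let ?h1 = "\<lambda>m ts. h m (hd (merge_at 0 ts))"
  let ?h2 = "\<lambda>m ts. ?h1 m (merge_at 1 ts)"
  have h1: "functC (Suc (Suc 0)) ?h1" using functC_merge[OF functC_1[OF h], of 0] by simp
  have h2: "functC (Suc (Suc (Suc 0))) ?h2" using functC_merge[OF h1, of 1] by simp
  have "sw2 (coactM m) (\<lambda>k m0. sw2 (comul K k) (\<lambda>k1 k2. fl h m0 (q' * actT k1 u) (actT k2 q))) =
      rot 2 (\<lambda>m ts. rot 1 ?h1 m (merge_at 0 ts)) m [u, q, q']"
    unfolding fl_rot by (subst (2) rot_def) (simp add: diagT_Cons)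
  also have "\<dots> = rot 2 (rot 2 ?h2) m [u, q, q']"
    by (rule rot_cong[of 3]) (use rot_merge[OF h1, of 1] in \<open>auto simp: numeral_2_eq_2 numeral_3_eq_3\<close>)
  also have "\<dots> = rot 1 ?h2 m [u, q, q']"
    using rot_rot[of 1 1 1 ?h2 "[u, q, q']" m] h2 by (simp add: numeral_2_eq_2)
  also have "\<dots> = fl h m u (q * q')"
    by (simp add: rot_def fl_def mult.assoc)
  finally show ?thesis .
qed

text \<open>After \<open>P_mult\<close>, equivariance of can^{-1} moves b_- inside the inner action
  of K, and \<open>fl_fl\<close> combines the two flips.\<close>

lemma actF_mult:
  assumes h: "bMT h"
  shows "actF (b * b') h = actF b' (actF b h)"
proof (intro ext)
  fix m t
  have "sw2 (tr b) (\<lambda>p q. fl h m (t * (p' * p)) (q * q')) = fl (actF b h) m (t * p') q'" for p' q'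
  proof -
    have "fl (actF b h) m (t * p') q' =
        sw2 (coactM m) (\<lambda>k m0. sw2 (tr b) (\<lambda>p q. fl h m0 (q' * (actT k (t * p') * p)) q))"
      unfolding fl_def[of "actF b h"] actF_def by (simp add: mult.assoc)
    also have "\<dots> = sw2 (coactM m) (\<lambda>k m0. sw2 (comul K k) (\<lambda>k1 k2. sw2 (tr b)
        (\<lambda>p q. fl h m0 (q' * actT k1 (t * p' * p)) (actT k2 q))))"
      by (rule sw2_cong, rule P_act[OF bS_lmult[OF bS_fl[OF h]], symmetric])
    also have "\<dots> = sw2 (coactM m) (\<lambda>k m0. sw2 (tr b) (\<lambda>p q. sw2 (comul K k)
        (\<lambda>k1 k2. fl h m0 (q' * actT k1 (t * p' * p)) (actT k2 q))))"
      by (rule sw2_cong, rule sw2_commute)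
    also have "\<dots> = sw2 (tr b) (\<lambda>p q. sw2 (coactM m) (\<lambda>k m0. sw2 (comul K k)
        (\<lambda>k1 k2. fl h m0 (q' * actT k1 (t * p' * p)) (actT k2 q))))"
      by (rule sw2_commute)
    finally show ?thesis by (simp add: fl_fl[OF h] mult.assoc)
  qed
  then show "actF (b * b') h m t = actF b' (actF b h) m t"
    unfolding actF_def[of "b * b'"] actF_def[of b']
    by (subst P_mult[OF bS_lmult[OF bS_fl[OF h]]]) simp
qed

text \<open>Since can^{-1} cancels the coaction of t, what remains is m_{<0>} \<otimes> t (m_{<-1>}
  \<triangleright> 1). Here m_{<-1>} acts through its counit, and counitality of the coaction of M
  returns m.\<close>

lemma actF_stable:
  assumes h: "bMT h"
  shows "sw2 (coactT t) (\<lambda>t0 a. actF a h m t0) = h m t"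
proof -
  have "sw2 (coactT t) (\<lambda>t0 a. actF a h m t0) = fl h m 1 t"
    unfolding actF_def using P_CT[OF bS_fl[OF h], where u = 1 and v = t] by simp
  also have "\<dots> = sw2 (coactM m) (\<lambda>k m0. h (actM m0 (tgt K (counit K k))) t)"
    unfolding fl_def
  proof (rule sw2_cong)
    fix k m0
    have "t * actT k 1 = actT (tgt K (counit K k)) t"
      using actT_mid[OF base_K(3), of k t 1] actT_one[of k] by simp
    then show "h m0 (t * actT k 1) = h (actM m0 (tgt K (counit K k))) t"
      by (simp add: bal_mid[OF h])
  qed
  also have "\<dots> = h m t"
    using clin_sw2_out[OF bal_left[OF h, where y = t], where X = "coactM m" and F = "\<lambda>k m0. actM m0 (tgt K (counit K k))"]
    by (simp add: CM_counit)
  finally show ?thesis .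
qed

section \<open>Functionals for the coaction on M \<otimes> T\<close>

definition functMB :: "('m \<Rightarrow> 't \<Rightarrow> 'b \<Rightarrow> 'w::complex_vector) \<Rightarrow> bool"
  where "functMB H \<longleftrightarrow> (\<forall>b. bMT (\<lambda>m t. H m t b)) \<and> (\<forall>m. bT (H m))"

lemma functMB_D: "functMB H \<Longrightarrow> bMT (\<lambda>m t. H m t b)" "functMB H \<Longrightarrow> bT (H m)"
  by (simp_all add: functMB_def)

lemma functMB_of_functional:
  assumes \<phi>: "clin \<phi>" "\<And>z. z \<in> rcotensor_null B rM ZM \<Longrightarrow> \<phi> z = 0"
  shows "functMB (\<lambda>m t b. \<phi> ((m \<otimes> t) \<otimes> b))" "\<phi> z = sw2 z (\<lambda>x b. sw2 x (\<lambda>m t. \<phi> ((m \<otimes> t) \<otimes> b)))"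
proof -
  have z: "\<phi> z = 0" if "z \<in> tensor_null UNIV rM (\<lambda>r b. b * tgt B r) ZM {0}" for z
    using \<phi>(2) that by (simp add: rcotensor_null_def)
  have bf: "bal UNIV rM (\<lambda>r b. b * tgt B r) (\<lambda>x b. \<phi> (x \<otimes> b))"
    by (rule bal_of_functional(1)[OF \<phi>(1) z])
  have bf0: "\<phi> (x \<otimes> b) = 0" if "x \<in> ZM" for x b
    by (rule bal_of_functional(2)[OF \<phi>(1) z that])
  have M: "bMT (\<lambda>m t. \<phi> ((m \<otimes> t) \<otimes> b))" for b
    by (rule bal_of_functional(1)[OF bal_left[OF bf]], rule bf0, unfold MT_null_def)
  show "functMB (\<lambda>m t b. \<phi> ((m \<otimes> t) \<otimes> b))"
    unfolding functMB_def
  proof (intro conjI allI M balI)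
    show "clin (\<lambda>t. \<phi> ((m \<otimes> t) \<otimes> b))" for m b by (rule bal_right[OF M])
    show "clin (\<lambda>b. \<phi> ((m \<otimes> t) \<otimes> b))" for m t by (rule bal_right[OF bf])
    show "\<phi> ((m \<otimes> t * eT r) \<otimes> b) = \<phi> ((m \<otimes> t) \<otimes> b * tgt B r)" for m t r b
      using bal_mid[OF bf UNIV_I, where x = "m \<otimes> t" and a = r and y = b] by (simp add: MT_ract_def ractT_eq)
  qed
  show "\<phi> z = sw2 z (\<lambda>x b. sw2 x (\<lambda>m t. \<phi> ((m \<otimes> t) \<otimes> b)))"
    unfolding clin_free2[OF \<phi>(1), of z]
    by (rule sw2_cong, rule clin_free2[OF bal_left[OF bf]])
qed

lemma rcM_I:
  assumes "\<And>H :: 'm \<Rightarrow> 't \<Rightarrow> 'b \<Rightarrow> complex. functMB H \<Longrightarrow> sw2 X (\<lambda>x b. sw2 x (\<lambda>m t. H m t b)) = 0"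
  shows "X \<in> rcotensor_null B rM ZM"
proof -
  have sub: "complex_vector.subspace (rcotensor_null B rM ZM)"
    unfolding rcotensor_null_def by (rule subspace_tensor_null)
  show ?thesis
    unfolding mem_subspace_iff[OF sub]
  proof (intro allI impI)
    fix \<phi> :: "(('m \<times> 't) free \<times> 'b) free \<Rightarrow> complex"
    assume \<phi>: "clin \<phi>" "\<forall>z\<in>rcotensor_null B rM ZM. \<phi> z = 0"
    have "functMB (\<lambda>m t b. \<phi> ((m \<otimes> t) \<otimes> b))"
      by (rule functMB_of_functional(1)[OF \<phi>(1)]) (use \<phi>(2) in blast)
    then have "sw2 X (\<lambda>x b. sw2 x (\<lambda>m t. \<phi> ((m \<otimes> t) \<otimes> b))) = 0" by (rule assms)
    moreover have "\<phi> X = sw2 X (\<lambda>x b. sw2 x (\<lambda>m t. \<phi> ((m \<otimes> t) \<otimes> b)))"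
      by (rule functMB_of_functional(2)[OF \<phi>(1)]) (use \<phi>(2) in blast)
    ultimately show "\<phi> X = 0" by simp
  qed
qed

lemma rcM_eqI:
  assumes "\<And>H :: 'm \<Rightarrow> 't \<Rightarrow> 'b \<Rightarrow> complex. functMB H \<Longrightarrow>
    sw2 X (\<lambda>x b. sw2 x (\<lambda>m t. H m t b)) = sw2 Y (\<lambda>x b. sw2 x (\<lambda>m t. H m t b))"
  shows "X \<simeq>\<^bsub>rcotensor_null B rM ZM\<^esub> Y"
  by (rule rcM_I) (simp add: assms)

lemma sw2_cM: "sw2 (cM x) F = sw2 x (\<lambda>m t. sw2 (coactT t) (\<lambda>t0 b. F (m \<otimes> t0) b))"
  by (simp add: MT_coact_def lsum_case)

lemma bMT_coact:
  assumes H: "functMB H"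
  shows "bMT (\<lambda>m t. sw2 (coactT t) (H m))"
proof (rule balI)
  show "clin (\<lambda>m. sw2 (coactT t) (H m))" for t
    using bal_left[OF functMB_D(1)[OF H]] by (intro clin_intros)
  show "clin (\<lambda>t. sw2 (coactT t) (H m))" for m by (rule clin_CT[OF functMB_D(2)[OF H]])
  show "sw2 (coactT t) (H (actM m k)) = sw2 (coactT (actT k t)) (H m)" for m k t
    unfolding CT_act[OF functMB_D(2)[OF H]]
    using bal_mid[OF functMB_D(1)[OF H]] by (intro sw2_cong) simp
qed

text \<open>The anti Yetter-Drinfeld condition, from \<open>b\<^sub>- \<otimes> \<Delta>(b\<^sub>+) = b\<^sup>(\<^sup>1\<^sup>)\<^sub>- \<otimes> b\<^sup>(\<^sup>1\<^sup>)\<^sub>+ \<otimes> b\<^sup>(\<^sup>2\<^sup>)\<close> for the coaction of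
  \<open>b\<^sub>+\<close> and the formula for the coaction of \<open>b\<^sub>-\<close> through the translation map of \<open>B\<close>.\<close>

lemma actF_coact:
  assumes H: "functMB H"
  shows "actF b (\<lambda>m t. sw2 (coactT t) (H m)) m t =
    sw2 (comul B b) (\<lambda>b1 b2. sw2 (transl_right B b1) (\<lambda>c b'. sw2 (coactT t)
      (\<lambda>t0 a. actF b' (\<lambda>m t. H m t (b2 * a * c)) m t0)))"
proof -
  let ?h = "\<lambda>c m t. H m t c"
  note hM = functMB_D(1)[OF H] and hT = functMB_D(2)[OF H]
  note bSf = bS_fl[OF hM]
  have fl_eT: "fl (?h c) m (u * eT r) q = fl (?h (c * tgt B r)) m u q" for c u r q
    unfolding fl_def by (simp add: actT_eT bal_mid[OF hT] flip: mult.assoc)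
  have clf: "clin (\<lambda>c. fl (?h c) m u q)" for u q
    unfolding fl_def by (intro clin_intros bal_right[OF hT])
  have bTf: "bT (\<lambda>y a. fl (?h (b * a)) m (u * y) q)" for b u q
    by (rule balI) (intro clin_comp[OF clf] bal_clin[OF bSf] clin_intros | simp add: fl_eT mult.assoc[symmetric])+
  have bTf1: "bT (\<lambda>y a. fl (?h (d * a)) m y q)" for d q
    using bTf[of d 1 q] by simp
  \<comment> \<open>The coaction of q (m_{<-1>} \<triangleright> (t p)) splits into those of q and
    of t p; \<open>c\<close> stands for the component that comes from q.\<close>
  define F where "F p q c = sw2 (coactT (t * p)) (\<lambda>y a. fl (?h (c * a)) m y q)" for p q c
  have FS: "bS (\<lambda>p q. F p q c)" for c
  proof (rule balI)
    show "F (actT (tgt K r) p) q c = F p (actT (src K r) q) c" if r: "r \<in> base K" for p r q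
      unfolding F_def by (simp add: actT_tgt_mult[OF r, symmetric] CT_act[OF bTf1] bal_mid[OF bSf r])
  qed (unfold F_def, (intro clin_comp[OF clin_CT[OF bTf1]] clin_intros bal_right[OF bSf])+)
  have FT: "bT (F p)" for p
  proof (rule balI)
    show "F p (q * eT r) c = F p q (c * tgt B r)" for q r c
    proof -
      have "fl (?h c') m y (q * eT r) = fl (?h c') m (eT r * y) q" for c' y
        unfolding fl_def by (simp add: actT_eT_left mult.assoc)
      moreover have "sw2 (coactT (t * p)) (\<lambda>y a. fl (?h (c * a)) m (eT r * y) q) =
          sw2 (coactT (t * p)) (\<lambda>y a. fl (?h (c * (tgt B r * a))) m y q)"
        by (rule CT_takeuchi[OF bTf1])
      ultimately show ?thesis
        unfolding F_def by (simp add: mult.assoc)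
    qed
  qed (unfold F_def, (intro clin_intros clin_comp[OF clf] bal_right[OF bSf])+)
  define F' where "F' b2 c p q = sw2 (coactT t) (\<lambda>t0 a. fl (?h (b2 * a * c)) m (t0 * p) q)" for b2 c p q
  have F'S: "bS (F' b2 c)" for b2 c
  proof (rule balI)
    show "F' b2 c (actT (tgt K r) p) q = F' b2 c p (actT (src K r) q)" if r: "r \<in> base K" for p r q
      unfolding F'_def by (simp add: actT_tgt_mult[OF r, symmetric] bal_mid[OF bSf r])
  qed (unfold F'_def, (intro clin_intros bal_right[OF bSf] bal_clin[OF bSf])+)
  have F'T: "bT (\<lambda>p c. F' b2 c p q)" for b2 q
    unfolding F'_def
    by (rule balI) (intro clin_comp[OF clf] bal_clin[OF bSf] clin_intros | simp add: fl_eT mult.assoc[symmetric])+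
  \<comment> \<open>Multiplicativity separates the coaction of \<open>t\<close> from that of
    \<open>p\<close>, so that \<open>P_coact_left\<close> can be applied to the latter.\<close>
  have F_F': "F p q b2 = sw2 (coactT p) (\<lambda>p0 p1. F' b2 p1 p0 q)" for p q b2
    unfolding F_def F'_def CT_mult[OF bTf1] by (subst sw2_commute) (simp add: mult.assoc)
  have "actF b (\<lambda>m t. sw2 (coactT t) (H m)) m t = sw2 (tr b) (\<lambda>p q. sw2 (coactT q) (\<lambda>q0 q1. F p q0 q1))"
    unfolding actF_def
  proof (rule sw2_cong)
    fix p q
    have "fl (\<lambda>m t. sw2 (coactT t) (H m)) m (t * p) q =
        sw2 (coactM m) (\<lambda>k m0. sw2 (coactT q) (\<lambda>q0 q1. sw2 (coactT (t * p)) (\<lambda>y a. H m0 (q0 * actT k y) (q1 * a))))"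
      unfolding fl_def CT_mult[OF hT]
    proof (intro sw2_cong)
      fix k m0 q0 q1
      have "bT (\<lambda>y a. H m0 (q0 * y) (q1 * a))"
        by (rule balI) (intro bal_clin[OF hT] clin_intros | simp add: bal_mid[OF hT] mult.assoc[symmetric])+
      from CT_act[OF this] show "sw2 (coactT (actT k (t * p))) (\<lambda>y a. H m0 (q0 * y) (q1 * a)) =
          sw2 (coactT (t * p)) (\<lambda>y a. H m0 (q0 * actT k y) (q1 * a))" .
    qed
    also have "\<dots> = sw2 (coactT q) (\<lambda>q0 q1. sw2 (coactT (t * p)) (\<lambda>y a. fl (?h (q1 * a)) m y q0))"
      unfolding fl_def by (subst sw2_commute, rule sw2_cong, rule sw2_commute)
    finally show "fl (\<lambda>m t. sw2 (coactT t) (H m)) m (t * p) q = sw2 (coactT q) (\<lambda>q0 q1. F p q0 q1)"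
      unfolding F_def .
  qed
  also have "\<dots> = sw2 (comul B b) (\<lambda>b1 b2. sw2 (tr b1) (\<lambda>p q. F p q b2))"
    by (rule P_coact_right[OF FS FT])
  also have "\<dots> = sw2 (comul B b) (\<lambda>b1 b2. sw2 (transl_right B b1) (\<lambda>c b'. sw2 (tr b') (F' b2 c)))"
    unfolding F_F' by (rule sw2_cong, rule P_coact_left[OF F'S F'T])
  also have "\<dots> = sw2 (comul B b) (\<lambda>b1 b2. sw2 (transl_right B b1) (\<lambda>c b'. sw2 (coactT t)
      (\<lambda>t0 a. actF b' (?h (b2 * a * c)) m t0)))"
    unfolding F'_def actF_def by (intro sw2_cong sw2_commute)
  finally show ?thesis .
qed

section \<open>The SAYD axioms for M \<otimes> T\<close>

lemma left_module_MT: "left_module_on UNIV ZM aM"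
  unfolding left_module_on_def
proof (intro conjI ballI allI)
  show "complex_vector.subspace ZM" by (rule subspace_ZM)
  fix a b :: 'b and c and v :: "('m \<times> 't) free"
  show "qlinear ZM ZM (aM a)"
    by (rule qlinearI[OF clin_aM subspace_ZM], rule ZM_I) (simp add: sw2_aM ZM_sw2 bMT_actF)
  have add: "actF (a + b) h = (\<lambda>m t. actF a h m t + actF b h m t)" and
    scale: "actF (c *\<^sub>C a) h = (\<lambda>m t. c *\<^sub>C actF a h m t)" if "bMT h" for h :: "'m \<Rightarrow> 't \<Rightarrow> complex"
    by (intro ext, rule clin_add[OF clin_actF[OF that]], intro ext, rule clin_scale[OF clin_actF[OF that]])
  show "aM (a + b) v \<simeq>\<^bsub>ZM\<^esub> aM a v + aM b v" by (rule ZM_eqI) (simp add: sw2_aM add)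
  show "aM (c *\<^sub>C a) v \<simeq>\<^bsub>ZM\<^esub> c *\<^sub>C aM a v" by (rule ZM_eqI) (simp add: sw2_aM scale)
  show "aM 1 v \<simeq>\<^bsub>ZM\<^esub> v" by (rule ZM_eqI) (simp add: sw2_aM actF_one)
  show "aM (a * b) v \<simeq>\<^bsub>ZM\<^esub> aM a (aM b v)" by (rule ZM_eqI) (simp add: sw2_aM actF_mult)
qed

lemma right_comodule_MT: "right_comodule B ZM rM cM"
  unfolding right_comodule_def right_module_on_def base_B
proof (intro conjI ballI allI)
  show "complex_vector.subspace ZM" by (rule subspace_ZM)
  fix r r' :: 'r and c and v :: "('m \<times> 't) free"
  have bMr: "bMT (\<lambda>m t. h m (t * eT r))" if h: "bMT h" for h :: "'m \<Rightarrow> 't \<Rightarrow> complex"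
    by (rule balI) (intro bal_clin[OF h] bal_left[OF h] clin_intros | simp add: bal_mid[OF h] actT_eT)+
  show "qlinear ZM ZM (\<lambda>v. rM v r)"
    by (rule qlinearI[OF clin_rM subspace_ZM], rule ZM_I) (simp add: sw2_rM ZM_sw2 bMr)
  have e: "eT (r + r') = eT r + eT r'" "eT (c *\<^sub>C r) = c *\<^sub>C eT r"
    by (simp_all add: clin_add[OF clin_eT] clin_scale[OF clin_eT])
  show "rM v (r + r') \<simeq>\<^bsub>ZM\<^esub> rM v r + rM v r'"
    by (rule ZM_eqI) (simp add: sw2_rM e distrib_left clin_add[OF bal_right])
  show "rM v (c *\<^sub>C r) \<simeq>\<^bsub>ZM\<^esub> c *\<^sub>C rM v r"
    by (rule ZM_eqI) (simp add: sw2_rM e mult_scaleC_right clin_scale[OF bal_right])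
  show "rM v 1 \<simeq>\<^bsub>ZM\<^esub> v" by (rule ZM_eqI) (simp add: sw2_rM)
  show "rM v (r * r') \<simeq>\<^bsub>ZM\<^esub> rM (rM v r) r'"
    by (rule ZM_eqI) (simp add: sw2_rM eT_mult mult.assoc)
  show "qlinear ZM (rcotensor_null B rM ZM) cM"
  proof (rule qlinearI[OF clin_cM])
    show "complex_vector.subspace (rcotensor_null B rM ZM)"
      unfolding rcotensor_null_def by (rule subspace_tensor_null)
    show "cM x \<in> rcotensor_null B rM ZM" if "x \<in> ZM" for x
      by (rule rcM_I) (simp add: sw2_cM ZM_sw2[OF that bMT_coact])
  qed
  show "cM (rM v r) \<simeq>\<^bsub>rcotensor_null B rM ZM\<^esub> src_right B (cM v) r"
    by (rule rcM_eqI) (simp add: sw2_cM sw2_rM CT_ract[OF functMB_D(2)] src_right_def lsum_case)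
  show "lsum (cM v) (\<lambda>(v0, b). rM v0 (counit B b)) \<simeq>\<^bsub>ZM\<^esub> v"
  proof (rule ZM_eqI)
    fix h :: "'m \<Rightarrow> 't \<Rightarrow> complex" assume h: "bMT h"
    have "sw2 (coactT t) (\<lambda>x b. h m (x * eT (counit B b))) = h m t" for m t
      using clin_sw2_out[OF bal_right[OF h, where x = m], where X = "coactT t" and F = "\<lambda>x b. x * eT (counit B b)"] by (simp add: CT_counit)
    then show "sw2 (lsum (cM v) (\<lambda>(v0, b). rM v0 (counit B b))) h = sw2 v h"
      by (simp add: lsum_case sw2_cM sw2_rM)
  qed
  show "lsum (cM v) (\<lambda>(v0, b). cM v0 \<otimes> b) \<simeq>\<^bsub>rcotensor_null B (src_right B) (rcotensor_null B rM ZM)\<^esub>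
      lsum (cM v) (\<lambda>(v0, b). lsum (comul B b) (\<lambda>(b1, b2). (v0 \<otimes> b1) \<otimes> b2))"
    unfolding rcotensor_null_def[of B "src_right B"]
  proof (rule eq_tensorI)
    fix F :: "(('m \<times> 't) free \<times> 'b) free \<Rightarrow> 'b \<Rightarrow> complex"
    assume F: "bal (base B) (src_right B) (\<lambda>r b. b * tgt B r) F"
      and z: "\<And>x y. x \<in> rcotensor_null B rM ZM \<Longrightarrow> F x y = 0"
    define H where "H m t b1 b2 = F ((m \<otimes> t) \<otimes> b1) b2" for m t b1 b2
    have H1: "bT (\<lambda>t b1. H m t b1 y)" for m y
      unfolding H_def by (rule functMB_D(2)[OF functMB_of_functional(1)[OF bal_left[OF F] z]])
    have H2: "bB (H m t)" for m t
      unfolding H_def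
    proof (rule balI)
      show "clin (\<lambda>b1. F ((m \<otimes> t) \<otimes> b1) y)" for y using bal_right[OF H1] by (simp add: H_def)
      show "clin (F ((m \<otimes> t) \<otimes> b1))" for b1 by (rule bal_right[OF F])
      show "F ((m \<otimes> t) \<otimes> b1 * src B r) b2 = F ((m \<otimes> t) \<otimes> b1) (b2 * tgt B r)" for b1 r b2
        using bal_mid[OF F, of r "(m \<otimes> t) \<otimes> b1" b2] by (simp add: src_right_def)
    qed
    have Fc: "F (cM (m \<otimes> t)) b = sw2 (coactT t) (\<lambda>t0 b1. H m t0 b1 b)" for m t b
      unfolding MT_coact_def H_def by (simp add: lsum_case clin_sw2_out[OF bal_left[OF F]])
    show "sw2 (lsum (cM v) (\<lambda>(v0, b). cM v0 \<otimes> b)) F =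
        sw2 (lsum (cM v) (\<lambda>(v0, b). lsum (comul B b) (\<lambda>(b1, b2). (v0 \<otimes> b1) \<otimes> b2))) F"
      by (simp add: lsum_case sw2_cM Fc CT_coassoc[OF H1 H2]) (simp add: H_def[abs_def])
  qed
qed

theorem left_right_SAYD_MT: "left_right_SAYD B ZM aM rM cM"
  unfolding left_right_SAYD_def
proof (intro conjI ballI allI left_module_MT right_comodule_MT)
  fix b r and v :: "('m \<times> 't) free"
  show "rM v r \<simeq>\<^bsub>ZM\<^esub> aM (tgt B r) v"
    by (rule ZM_eqI) (simp add: sw2_rM sw2_aM actF_tgt)
  show "canonical_lact B rM cM r v \<simeq>\<^bsub>ZM\<^esub> aM (src B r) v"
  proof (rule ZM_eqI)
    fix h :: "'m \<Rightarrow> 't \<Rightarrow> complex" assume h: "bMT h"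
    have "sw2 (coactT t) (\<lambda>x b. h m (x * eT (counit B (src B r * b)))) = h m (eT r * t)" for m t
      using clin_sw2_out[OF bal_right[OF h, where x = m], where X = "coactT t" and F = "\<lambda>x b. x * eT (counit B (src B r * b))"]
      by (simp add: CT_lact)
    then show "sw2 (canonical_lact B rM cM r v) h = sw2 (aM (src B r) v) h"
      by (simp add: canonical_lact_def lsum_case sw2_cM sw2_rM sw2_aM actF_src[OF h])
  qed
  show "cM (aM b v) \<simeq>\<^bsub>rcotensor_null B rM ZM\<^esub>
      lsum (comul B b) (\<lambda>(b1, b2). lsum (transl_right B b1) (\<lambda>(b1m, b1p).
         lsum (cM v) (\<lambda>(v0, a). aM b1p v0 \<otimes> (b2 * a * b1m))))"
  proof (rule rcM_eqI)
    fix H :: "'m \<Rightarrow> 't \<Rightarrow> 'b \<Rightarrow> complex" assume H: "functMB H"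
    have "sw2 (cM (aM b v)) (\<lambda>x b. sw2 x (\<lambda>m t. H m t b)) = sw2 v (\<lambda>m t. sw2 (comul B b) (\<lambda>b1 b2.
        sw2 (transl_right B b1) (\<lambda>c b'. sw2 (coactT t) (\<lambda>t0 a. actF b' (\<lambda>m t. H m t (b2 * a * c)) m t0))))"
      unfolding sw2_cM sw2_aM sw2_tens by (rule sw2_cong, rule actF_coact[OF H])
    also have "\<dots> = sw2 (comul B b) (\<lambda>b1 b2. sw2 (transl_right B b1) (\<lambda>c b'. sw2 v (\<lambda>m t.
        sw2 (coactT t) (\<lambda>t0 a. actF b' (\<lambda>m t. H m t (b2 * a * c)) m t0))))"
      by (subst sw2_commute, rule sw2_cong, rule sw2_commute)
    also have "\<dots> = sw2 (lsum (comul B b) (\<lambda>(b1, b2). lsum (transl_right B b1) (\<lambda>(b1m, b1p).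
         lsum (cM v) (\<lambda>(v0, a). aM b1p v0 \<otimes> (b2 * a * b1m))))) (\<lambda>x b. sw2 x (\<lambda>m t. H m t b))"
      by (simp add: lsum_case sw2_cM sw2_aM)
    finally show "sw2 (cM (aM b v)) (\<lambda>x b. sw2 x (\<lambda>m t. H m t b)) =
        sw2 (lsum (comul B b) (\<lambda>(b1, b2). lsum (transl_right B b1) (\<lambda>(b1m, b1p).
         lsum (cM v) (\<lambda>(v0, a). aM b1p v0 \<otimes> (b2 * a * b1m))))) (\<lambda>x b. sw2 x (\<lambda>m t. H m t b))" .
  qed
  show "lsum (cM v) (\<lambda>(v0, a). aM a v0) \<simeq>\<^bsub>ZM\<^esub> v"
    by (rule ZM_eqI) (simp add: lsum_case sw2_cM sw2_aM actF_stable)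
qed

end


section \<open>Transport of a cyclic structure\<close>

text \<open>That the operators of D pass to the quotients is part of the claim. The relation
  \<open>R n y x\<close> says that g sends y to the class of x; all operators preserve it, and since
  f inverts g, elements of D related to equal classes of C are equal. Every axiom for D is thus read
  off from C.\<close>

lemma cyclic_isoI:
  fixes C :: "'v::complex_vector cyclic_data" and D :: "'w::complex_vector cyclic_data"
  assumes C: "cyclic_module C"
    and subD: "\<And>n. complex_vector.subspace (null D n)"
    and f: "\<And>n. qlinear (null C n) (null D n) (f n)" and g: "\<And>n. qlinear (null D n) (null C n) (g n)"
    and gf: "\<And>n x. g n (f n x) \<simeq>\<^bsub>null C n\<^esub> x" and fg: "\<And>n y. f n (g n y) \<simeq>\<^bsub>null D n\<^esub> y"
    and clin_D: "\<And>n i. clin (face D n i)" "\<And>n i. clin (degen D n i)" "\<And>n. clin (cyc D n)"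
    and face: "\<And>n i y. 1 \<le> n \<Longrightarrow> i \<le> n \<Longrightarrow> g (n - 1) (face D n i y) \<simeq>\<^bsub>null C (n - 1)\<^esub> face C n i (g n y)"
    and degen: "\<And>n i y. i \<le> n \<Longrightarrow> g (n + 1) (degen D n i y) \<simeq>\<^bsub>null C (n + 1)\<^esub> degen C n i (g n y)"
    and cyc: "\<And>n y. g n (cyc D n y) \<simeq>\<^bsub>null C n\<^esub> cyc C n (g n y)"
  shows "cyclic_iso C D f"
proof -
  note C' = C[unfolded cyclic_module_def]
  note c1 = C'[THEN conjunct1] and r1 = C'[THEN conjunct2]
  note c2 = r1[THEN conjunct1] and r2 = r1[THEN conjunct2]
  note c3 = r2[THEN conjunct1] and r3 = r2[THEN conjunct2]
  note c4 = r3[THEN conjunct1] and r4 = r3[THEN conjunct2]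
  note c5 = r4[THEN conjunct1] and r5 = r4[THEN conjunct2]
  note c6 = r5[THEN conjunct1] and r6 = r5[THEN conjunct2]
  note c7 = r6[THEN conjunct1] and r7 = r6[THEN conjunct2]
  note c8 = r7[THEN conjunct1] and r8 = r7[THEN conjunct2]
  note c9 = r8[THEN conjunct1] and r9 = r8[THEN conjunct2]
  note c10 = r9[THEN conjunct1] and r10 = r9[THEN conjunct2]
  note c11 = r10[THEN conjunct1] and r11 = r10[THEN conjunct2]
  note c12 = r11[THEN conjunct1] and r12 = r11[THEN conjunct2]
  note c13 = r12[THEN conjunct1] and r13 = r12[THEN conjunct2]
  have subC: "complex_vector.subspace (null C n)" for n by (rule c1[rule_format])
  note transC = eq_mod_trans[OF subC] and symC = eq_mod_sym[OF subC]
  note transD = eq_mod_trans[OF subD] and symD = eq_mod_sym[OF subD]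
  have qf: "1 \<le> n \<Longrightarrow> i \<le> n \<Longrightarrow> qlinear (null C n) (null C (n - 1)) (face C n i)"
    and qd: "i \<le> n \<Longrightarrow> qlinear (null C n) (null C (n + 1)) (degen C n i)"
    and qc: "qlinear (null C n) (null C n) (cyc C n)" for n i
    by (rule c2[rule_format], assumption+, rule c3[rule_format], assumption, rule c4[rule_format])
  define R where "R n y x \<longleftrightarrow> g n y \<simeq>\<^bsub>null C n\<^esub> x" for n y x
  have R0: "R n y (g n y)" for n y unfolding R_def by (rule eq_mod_refl[OF subC])
  have Rf: "R (n - 1) (face D n i y) (face C n i x)" if "R n y x" "1 \<le> n" "i \<le> n" for n i y x
    using face[OF that(2,3)] qlinear_eq[OF qf[OF that(2,3)] subC that(1)[unfolded R_def]] transC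
    unfolding R_def by blast
  have Rd: "R (n + 1) (degen D n i y) (degen C n i x)" if "R n y x" "i \<le> n" for n i y x
    using degen[OF that(2)] qlinear_eq[OF qd[OF that(2)] subC that(1)[unfolded R_def]] transC
    unfolding R_def by blast
  have Rc: "R n (cyc D n y) (cyc C n x)" if "R n y x" for n y x
    using cyc qlinear_eq[OF qc subC that[unfolded R_def]] transC unfolding R_def by blast
  have Rp: "R n ((cyc D n ^^ j) y) ((cyc C n ^^ j) x)" if "R n y x" for n j y x
    by (induction j) (use that Rc in auto)
  have Req: "y \<simeq>\<^bsub>null D n\<^esub> y'" if "R n y x" "R n y' x'" "x \<simeq>\<^bsub>null C n\<^esub> x'" for n y y' x x'
  proof -
    have "g n y \<simeq>\<^bsub>null C n\<^esub> g n y'" using that transC symC unfolding R_def by meson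
    then have "f n (g n y) \<simeq>\<^bsub>null D n\<^esub> f n (g n y')" by (rule qlinear_eq[OF f subD])
    then show ?thesis using fg transD symD by meson
  qed
  have RZ: "y \<in> null D n" if "R n y x" "x \<in> null C n" for n y x
  proof -
    have "R n 0 0" using g[of n] complex_vector.subspace_0[OF subD] unfolding R_def qlinear_def by simp
    from Req[OF that(1) this] that(2) show ?thesis by simp
  qed
  have gZ: "g n y \<in> null C n" if "y \<in> null D n" for n y using g that unfolding qlinear_def by blast
  have D: "cyclic_module D"
    unfolding cyclic_module_def
  proof (intro conjI allI impI)
    fix n i j x
    show "complex_vector.subspace (null D n)" by (rule subD)
    show "qlinear (null D n) (null D (n - 1)) (face D n i)" if "1 \<le> n" "i \<le> n"
      by (rule qlinearI[OF clin_D(1) subD], rule RZ[OF Rf[OF R0 that]])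
        (use qf[OF that] gZ in \<open>simp add: qlinear_def\<close>)
    show "qlinear (null D n) (null D (n + 1)) (degen D n i)" if "i \<le> n"
      by (rule qlinearI[OF clin_D(2) subD], rule RZ[OF Rd[OF R0 that]])
        (use qd[OF that] gZ in \<open>simp add: qlinear_def\<close>)
    show "qlinear (null D n) (null D n) (cyc D n)"
      by (rule qlinearI[OF clin_D(3) subD], rule RZ[OF Rc[OF R0]])
        (use qc gZ in \<open>simp add: qlinear_def\<close>)
    show "face D (n - 1) i (face D n j x) \<simeq>\<^bsub>null D (n - 2)\<^esub> face D (n - 1) (j - 1) (face D n i x)"
      if n: "2 \<le> n" and ij: "i < j \<and> j \<le> n"
    proof -
      have "R (n - 1 - 1) (face D (n - 1) i (face D n j x)) (face C (n - 1) i (face C n j (g n x)))"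
        by (rule Rf[OF Rf[OF R0]]) (use n ij in auto)
      moreover have "R (n - 1 - 1) (face D (n - 1) (j - 1) (face D n i x)) (face C (n - 1) (j - 1) (face C n i (g n x)))"
        by (rule Rf[OF Rf[OF R0]]) (use n ij in auto)
      moreover have "n - 1 - 1 = n - 2" by simp
      moreover have "face C (n - 1) i (face C n j (g n x)) \<simeq>\<^bsub>null C (n - 2)\<^esub> face C (n - 1) (j - 1) (face C n i (g n x))"
        using c5[rule_format, OF n ij] .
      ultimately show ?thesis using Req by simp
    qed
    show "degen D (n + 1) i (degen D n j x) \<simeq>\<^bsub>null D (n + 2)\<^esub> degen D (n + 1) (j + 1) (degen D n i x)"
      if ij: "i \<le> j \<and> j \<le> n"
    proof -
      have "R (n + 1 + 1) (degen D (n + 1) i (degen D n j x)) (degen C (n + 1) i (degen C n j (g n x)))"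
        by (rule Rd[OF Rd[OF R0]]) (use ij in auto)
      moreover have "R (n + 1 + 1) (degen D (n + 1) (j + 1) (degen D n i x)) (degen C (n + 1) (j + 1) (degen C n i (g n x)))"
        by (rule Rd[OF Rd[OF R0]]) (use ij in auto)
      moreover have "n + 1 + 1 = n + 2" by simp
      moreover have "degen C (n + 1) i (degen C n j (g n x)) \<simeq>\<^bsub>null C (n + 2)\<^esub> degen C (n + 1) (j + 1) (degen C n i (g n x))"
        by (rule c6[rule_format, OF ij])
      ultimately show ?thesis using Req by metis
    qed
    show "face D (n + 1) i (degen D n j x) \<simeq>\<^bsub>null D n\<^esub> degen D (n - 1) (j - 1) (face D n i x)"
      if ij: "i < j \<and> j \<le> n"
    proof -
      have "R (n + 1 - 1) (face D (n + 1) i (degen D n j x)) (face C (n + 1) i (degen C n j (g n x)))"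
        by (rule Rf[OF Rd[OF R0]]) (use ij in auto)
      moreover have "R (n - 1 + 1) (degen D (n - 1) (j - 1) (face D n i x)) (degen C (n - 1) (j - 1) (face C n i (g n x)))"
        by (rule Rd[OF Rf[OF R0]]) (use ij in auto)
      moreover have "n + 1 - 1 = n" "n - 1 + 1 = n" using ij by auto
      moreover have "face C (n + 1) i (degen C n j (g n x)) \<simeq>\<^bsub>null C n\<^esub> degen C (n - 1) (j - 1) (face C n i (g n x))"
        by (rule c7[rule_format, OF ij])
      ultimately show ?thesis using Req by metis
    qed
    show "face D (n + 1) i (degen D n j x) \<simeq>\<^bsub>null D n\<^esub> x" if ij: "(i = j \<or> i = j + 1) \<and> j \<le> n"
    proof -
      have "R (n + 1 - 1) (face D (n + 1) i (degen D n j x)) (face C (n + 1) i (degen C n j (g n x)))"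
        by (rule Rf[OF Rd[OF R0]]) (use ij in auto)
      moreover have "n + 1 - 1 = n" by simp
      moreover have "face C (n + 1) i (degen C n j (g n x)) \<simeq>\<^bsub>null C n\<^esub> g n x"
        by (rule c8[rule_format, OF ij])
      ultimately show ?thesis using Req R0 by metis
    qed
    show "face D (n + 1) i (degen D n j x) \<simeq>\<^bsub>null D n\<^esub> degen D (n - 1) j (face D n (i - 1) x)"
      if ij: "j + 1 < i \<and> i \<le> n + 1"
    proof -
      have "R (n + 1 - 1) (face D (n + 1) i (degen D n j x)) (face C (n + 1) i (degen C n j (g n x)))"
        by (rule Rf[OF Rd[OF R0]]) (use ij in auto)
      moreover have "R (n - 1 + 1) (degen D (n - 1) j (face D n (i - 1) x)) (degen C (n - 1) j (face C n (i - 1) (g n x)))"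
        by (rule Rd[OF Rf[OF R0]]) (use ij in auto)
      moreover have "n + 1 - 1 = n" "n - 1 + 1 = n" using ij by auto
      moreover have "face C (n + 1) i (degen C n j (g n x)) \<simeq>\<^bsub>null C n\<^esub> degen C (n - 1) j (face C n (i - 1) (g n x))"
        by (rule c9[rule_format, OF ij])
      ultimately show ?thesis using Req by metis
    qed
    show "face D n i (cyc D n x) \<simeq>\<^bsub>null D (n - 1)\<^esub> cyc D (n - 1) (face D n (i - 1) x)"
      if ij: "1 \<le> i \<and> i \<le> n"
    proof -
      have "R (n - 1) (face D n i (cyc D n x)) (face C n i (cyc C n (g n x)))"
        by (rule Rf[OF Rc[OF R0]]) (use ij in auto)
      moreover have "R (n - 1) (cyc D (n - 1) (face D n (i - 1) x)) (cyc C (n - 1) (face C n (i - 1) (g n x)))"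
        by (rule Rc[OF Rf[OF R0]]) (use ij in auto)
      moreover have "face C n i (cyc C n (g n x)) \<simeq>\<^bsub>null C (n - 1)\<^esub> cyc C (n - 1) (face C n (i - 1) (g n x))"
        by (rule c10[rule_format, OF ij])
      ultimately show ?thesis by (rule Req)
    qed
    show "degen D n i (cyc D n x) \<simeq>\<^bsub>null D (n + 1)\<^esub> cyc D (n + 1) (degen D n (i - 1) x)"
      if ij: "1 \<le> i \<and> i \<le> n"
    proof -
      have "R (n + 1) (degen D n i (cyc D n x)) (degen C n i (cyc C n (g n x)))"
        by (rule Rd[OF Rc[OF R0]]) (use ij in auto)
      moreover have "R (n + 1) (cyc D (n + 1) (degen D n (i - 1) x)) (cyc C (n + 1) (degen C n (i - 1) (g n x)))"
        by (rule Rc[OF Rd[OF R0]]) (use ij in auto)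
      moreover have "degen C n i (cyc C n (g n x)) \<simeq>\<^bsub>null C (n + 1)\<^esub> cyc C (n + 1) (degen C n (i - 1) (g n x))"
        by (rule c11[rule_format, OF ij])
      ultimately show ?thesis by (rule Req)
    qed
    show "face D n 0 (cyc D n x) \<simeq>\<^bsub>null D (n - 1)\<^esub> face D n n x" if n: "1 \<le> n"
    proof -
      have "face C n 0 (cyc C n (g n x)) \<simeq>\<^bsub>null C (n - 1)\<^esub> face C n n (g n x)"
        by (rule c12[rule_format, OF n])
      with Rf[OF Rc[OF R0] n le0] Rf[OF R0 n order_refl] show ?thesis by (rule Req)
    qed
    show "degen D n 0 (cyc D n x) \<simeq>\<^bsub>null D (n + 1)\<^esub> cyc D (n + 1) (cyc D (n + 1) (degen D n n x))"
    proof -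
      have "degen C n 0 (cyc C n (g n x)) \<simeq>\<^bsub>null C (n + 1)\<^esub> cyc C (n + 1) (cyc C (n + 1) (degen C n n (g n x)))"
        by (rule c13[rule_format])
      with Rd[OF Rc[OF R0] le0] Rc[OF Rc[OF Rd[OF R0 order_refl]]] show ?thesis by (rule Req)
    qed
    show "(cyc D n ^^ (n + 1)) x \<simeq>\<^bsub>null D n\<^esub> x"
    proof -
      have "(cyc C n ^^ (n + 1)) (g n x) \<simeq>\<^bsub>null C n\<^esub> g n x"
        by (rule r13[rule_format])
      with Rp[OF R0] R0 show ?thesis by (rule Req)
    qed
  qed
  have Rg: "R n (f n x) x" for n x unfolding R_def by (rule gf)
  show ?thesis
    unfolding cyclic_iso_def
  proof (intro conjI allI impI C D f)
    fix n i x
    show "qbij (null C n) (null D n) (f n)"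
      by (rule qbijI[OF subC subD qlinear_eq[OF f subD] qlinear_eq[OF g subC] gf fg])
    show "f (n - 1) (face C n i x) \<simeq>\<^bsub>null D (n - 1)\<^esub> face D n i (f n x)" if "1 \<le> n" "i \<le> n"
      by (rule Req[OF Rg Rf[OF Rg that] eq_mod_refl[OF subC]])
    show "f (n + 1) (degen C n i x) \<simeq>\<^bsub>null D (n + 1)\<^esub> degen D n i (f n x)" if "i \<le> n"
      by (rule Req[OF Rg Rd[OF Rg that] eq_mod_refl[OF subC]])
    show "f n (cyc C n x) \<simeq>\<^bsub>null D n\<^esub> cyc D n (f n x)"
      by (rule Req[OF Rg Rc[OF Rg] eq_mod_refl[OF subC]])
  qed
qed


section \<open>The cyclic module of the right Hopf algebra\<close>

context right_hopf_algebra
begin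

lemma bpow_null_vanish:
  assumes X: "X \<in> bpow_null B n"
    and S: "n = 0 \<Longrightarrow> clin (\<lambda>r. g (Scalar r))" and W: "n \<noteq> 0 \<Longrightarrow> mB n (\<lambda>bs. g (Word bs))"
  shows "lsum X (\<lambda>w. if has_degree n w then g w else 0) = 0"
  using X unfolding bpow_null_def
proof (rule clin_vanish_span[OF clin_lsum, rotated])
  fix x :: "('r, 'b) bword free"
  assume "x \<in> {gen w | w. \<not> has_degree n w} \<union>
     {gen (Scalar (r + r')) - gen (Scalar r) - gen (Scalar r') | r r'. True} \<union>
     {gen (Scalar (c *\<^sub>C r)) - c *\<^sub>C gen (Scalar r) | c r. True} \<union>
     (\<lambda>X. lsum X (\<lambda>bs. gen (Word bs))) `
       tpow_null (base B) (\<lambda>b r. b * src B r) (\<lambda>r b. b * tgt B r) n"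
  then consider w where "x = gen w" "\<not> has_degree n w" |
    r r' where "x = gen (Scalar (r + r')) - gen (Scalar r) - gen (Scalar r')" |
    c r where "x = gen (Scalar (c *\<^sub>C r)) - c *\<^sub>C gen (Scalar r)" |
    Y where "x = lsum Y (\<lambda>bs. gen (Word bs))" "Y \<in> tpow_null UNIV (\<lambda>b r. b * src B r) (\<lambda>r b. b * tgt B r) n"
    by auto
  then show "lsum x (\<lambda>w. if has_degree n w then g w else 0) = 0"
  proof cases
    case 2 then show ?thesis by (cases "n = 0") (simp_all add: clin_add[OF S])
  next
    case 3 then show ?thesis by (cases "n = 0") (simp_all add: clin_scale[OF S])
  next
    case 4
    show ?thesis
    proof (cases "n = 0")
      case True then show ?thesis using 4 by simp
    next
      case False
      then have "lsum x (\<lambda>w. if has_degree n w then g w else 0) = on_length n Y (\<lambda>bs. g (Word bs))"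
        using 4 by (simp add: on_length_def cong: if_cong)
      then show ?thesis using on_length_tpow_null[OF W[OF False] 4(2)] by simp
    qed
  qed simp
qed

lemma bpow_functional:
  assumes \<phi>: "clin \<phi>" "\<And>X. X \<in> bpow_null B n \<Longrightarrow> \<phi> X = 0"
  shows "\<not> has_degree n w \<Longrightarrow> \<phi> (gen w) = 0" "clin (\<lambda>r. \<phi> (gen (Scalar r)))" "mB n (\<lambda>bs. \<phi> (gen (Word bs)))"
    "\<phi> X = lsum X (\<lambda>w. if has_degree n w then \<phi> (gen w) else 0)"
proof -
  show 1: "\<phi> (gen w) = 0" if "\<not> has_degree n w" for w
    by (rule \<phi>(2)) (use that in \<open>auto simp: bpow_null_def intro: complex_vector.span_base\<close>)
  show "clin (\<lambda>r. \<phi> (gen (Scalar r)))"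
  proof (rule clinI)
    fix r r' c
    have "gen (Scalar (r + r')) - gen (Scalar r) - gen (Scalar r') \<in> bpow_null B n"
      "gen (Scalar (c *\<^sub>C r)) - c *\<^sub>C gen (Scalar r) \<in> bpow_null B n"
      unfolding bpow_null_def by (rule complex_vector.span_base; blast)+
    from this[THEN \<phi>(2)]
    show "\<phi> (gen (Scalar (r + r'))) = \<phi> (gen (Scalar r)) + \<phi> (gen (Scalar r'))"
      "\<phi> (gen (Scalar (c *\<^sub>C r))) = c *\<^sub>C \<phi> (gen (Scalar r))"
      by (simp_all add: clin_diff[OF \<phi>(1)] clin_scale[OF \<phi>(1)] diff_eq_eq add.commute)
  qed
  have "mB n (\<lambda>bs. \<phi> (lsum (gen bs) (\<lambda>bs. gen (Word bs))))"
  proof (rule mbal_of_functional(1))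
    show "clin (\<lambda>Y. \<phi> (lsum Y (\<lambda>bs. gen (Word bs))))" by (rule clin_comp[OF \<phi>(1) clin_lsum])
    show "\<phi> (lsum Y (\<lambda>bs. gen (Word bs))) = 0" if "Y \<in> tpow_null UNIV (\<lambda>b r. b * src B r) (\<lambda>r b. b * tgt B r) n" for Y
      by (rule \<phi>(2)) (use that in \<open>auto simp: bpow_null_def intro: complex_vector.span_base\<close>)
  qed
  then show "mB n (\<lambda>bs. \<phi> (gen (Word bs)))" by simp
  show "\<phi> X = lsum X (\<lambda>w. if has_degree n w then \<phi> (gen w) else 0)"
    unfolding clin_free[OF \<phi>(1), of X] by (rule lsum_cong) (simp add: 1)
qed

lemma diag_right_Word: "lsum (diag_right B (Word bs) c) F = diagB c bs (\<lambda>zs. F (Word zs))"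
  by (simp add: diag_right_def diagB_def)

lemma diag_right_Scalar: "lsum (diag_right B (Scalar r) c) F = F (Scalar (counit B (src B r * c)))"
  by (simp add: diag_right_def)

end

context galois_sayd
begin

section \<open>Functionals on the cyclic module over B\<close>

abbreviation D where "D \<equiv> cyclic_B B ZM aM cM"

lemma null_D: "null D n = tensor_null UNIV (bword_op_act B) (\<lambda>r. aM (tgt B r)) (bpow_null B n) ZM"
  by (simp add: cyclic_B_def)

lemma subspace_null_D: "complex_vector.subspace (null D n)"
  unfolding null_D by (rule subspace_tensor_null)

definition evD :: "nat \<Rightarrow> (('r, 'b) bword \<Rightarrow> 'm \<Rightarrow> 't \<Rightarrow> 'w::complex_vector) \<Rightarrow> (('r, 'b) bword free \<times> ('m \<times> 't) free) free \<Rightarrow> 'w"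
  where "evD n H z = sw2 z (\<lambda>X x. lsum X (\<lambda>w. if has_degree n w then sw2 x (H w) else 0))"

lemma clin_evD: "clin (evD n H)"
  unfolding evD_def by (rule clin_sw2)

lemma evD_tens: "evD n H (X \<otimes> x) = lsum X (\<lambda>w. if has_degree n w then sw2 x (H w) else 0)"
  by (simp add: evD_def)

lemma evD_cong: "(\<And>w m t. has_degree n w \<Longrightarrow> H w m t = H' w m t) \<Longrightarrow> evD n H z = evD n H' z"
  unfolding evD_def by (intro sw2_cong lsum_cong if_cong refl) auto

text \<open>In degree 0 the words are scalars, which \<open>functB\<close> does not see; there the
  balancing over the opposite of R is stated for \<open>Scalar\<close> directly.\<close>

definition functD :: "nat \<Rightarrow> (('r, 'b) bword \<Rightarrow> 'm \<Rightarrow> 't \<Rightarrow> 'w::complex_vector) \<Rightarrow> bool"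
  where "functD n H \<longleftrightarrow> (\<forall>w. has_degree n w \<longrightarrow> bMT (H w)) \<and>
    (n = 0 \<longrightarrow> (\<forall>m t. clin (\<lambda>r. H (Scalar r) m t)) \<and>
      (\<forall>r r' m t. H (Scalar (r * r')) m t = H (Scalar r') m (t * eT r))) \<and>
    (n \<noteq> 0 \<longrightarrow> (\<forall>m. functB n (\<lambda>bs t. H (Word bs) m t)))"

lemma evD_null:
  assumes H: "functD n H" and z: "z \<in> null D n"
  shows "evD n H z = 0"
  unfolding evD_def
proof (rule sw2_tensor_null[OF _ _ _ z[unfolded null_D]])
  let ?F = "\<lambda>X x. lsum X (\<lambda>w. if has_degree n w then sw2 x (H w) else 0)"
  have HM: "bMT (H w)" if "has_degree n w" for w using H that by (simp add: functD_def)
  show "bal UNIV (bword_op_act B) (\<lambda>r. aM (tgt B r)) ?F"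
  proof (rule balI)
    show "clin (\<lambda>X. ?F X x)" for x by (rule clin_lsum)
    have "clin (\<lambda>x. if has_degree n w then sw2 x (H w) else 0)" for w
      by (cases "has_degree n w") (simp_all add: clin_sw2 clin_0)
    then show "clin (?F X)" for X by (intro clin_lsum_in)
    show "?F (bword_op_act B X r) x = ?F X (aM (tgt B r) x)" for X r x
      unfolding bword_op_act_def lsum_lsum
    proof (rule lsum_cong)
      fix w
      show "lsum (case w of Scalar r' \<Rightarrow> gen (Scalar (r * r')) | Word bs \<Rightarrow> if bs = [] then 0 else gen (Word ((hd bs * tgt B r) # tl bs)))
          (\<lambda>w. if has_degree n w then sw2 x (H w) else 0) = (if has_degree n w then sw2 (aM (tgt B r) x) (H w) else 0)"
      proof (cases "has_degree n w")
        case True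
        have a: "sw2 (aM (tgt B r) x) (H w) = sw2 x (\<lambda>m t. H w m (t * eT r))"
          by (simp add: sw2_aM actF_tgt[OF HM[OF True]])
        show ?thesis
        proof (cases w)
          case (Scalar r')
          have "H (Scalar (r * r')) = (\<lambda>m t. H (Scalar r') m (t * eT r))"
            using True Scalar H by (intro ext) (simp add: functD_def)
          then show ?thesis using True a Scalar by simp
        next
          case (Word bs)
          then obtain b bs' where bs: "bs = b # bs'" "Suc (length bs') = n" using True by (cases bs) auto
          have "H (Word (b # bs')) m (t * eT r) = H (Word (b * tgt B r # bs')) m t" for m t
            using H bs functB_eT[of n "\<lambda>bs t. H (Word bs) m t" bs' b t r] by (auto simp: functD_def)
          then show ?thesis using True a bs Word by simp
        qed
      qed (auto split: bword.splits)
    qed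
  qed
  show "?F X x = 0" if "X \<in> bpow_null B n" for X x
  proof (rule bpow_null_vanish[OF that])
    show "clin (\<lambda>r. sw2 x (H (Scalar r)))" if "n = 0"
      using H that by (intro clin_sw2_in) (simp add: functD_def)
    show "mB n (\<lambda>bs. sw2 x (H (Word bs)))" if "n \<noteq> 0"
      using H that by (intro mbal_sw2) (simp add: functD_def functB_def)
  qed
  show "?F X x = 0" if "x \<in> ZM" for X x
    using ZM_sw2[OF that HM] by (simp cong: if_cong)
qed

lemma nullDI:
  assumes "\<And>H :: ('r, 'b) bword \<Rightarrow> 'm \<Rightarrow> 't \<Rightarrow> complex. functD n H \<Longrightarrow> evD n H z = 0"
  shows "z \<in> null D n"
  unfolding null_D
proof (rule tensor_nullI)
  fix F :: "('r, 'b) bword free \<Rightarrow> ('m \<times> 't) free \<Rightarrow> complex"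
  assume F: "bal UNIV (bword_op_act B) (\<lambda>r. aM (tgt B r)) F"
    and z1: "\<And>X x. X \<in> bpow_null B n \<Longrightarrow> F X x = 0" and z2: "\<And>X x. x \<in> ZM \<Longrightarrow> F X x = 0"
  define H where "H w m t = F (gen w) (m \<otimes> t)" for w m t
  have bp: "\<not> has_degree n w \<Longrightarrow> F (gen w) x = 0" "clin (\<lambda>r. F (gen (Scalar r)) x)" "mB n (\<lambda>bs. F (gen (Word bs)) x)"
    "F X x = lsum X (\<lambda>w. if has_degree n w then F (gen w) x else 0)" for w X x
    using bpow_functional[OF bal_left[OF F, of x] z1] by blast+
  have Fx: "F (gen w) x = sw2 x (H w)" for w x
    unfolding H_def by (rule clin_free2[OF bal_right[OF F]])
  have HM: "bMT (H w)" for w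
    unfolding H_def
    by (rule bal_of_functional(1)[OF bal_right[OF F], where Zx = "{0}" and Zy = "{0}"], rule z2) (simp add: MT_null_def)
  have op: "F (bword_op_act B (gen w) r) (m \<otimes> t) = H w m (t * eT r)" for w r m t
    using bal_mid[OF F, of r "gen w" "m \<otimes> t"] by (simp add: Fx sw2_aM actF_tgt[OF HM])
  have "functD n H"
    unfolding functD_def
  proof (intro conjI allI impI HM)
    show "clin (\<lambda>r. H (Scalar r) m t)" for m t unfolding H_def by (rule bp(2))
    show "H (Scalar (r * r')) m t = H (Scalar r') m (t * eT r)" for r r' m t
      using op[of "Scalar r'" r m t] by (simp add: bword_op_act_def H_def)
    show "functB n (\<lambda>bs t. H (Word bs) m t)" for m
      unfolding functB_def
    proof (intro conjI allI impI)
      show "mB n (\<lambda>bs. H (Word bs) m t)" for t unfolding H_def by (rule bp(3))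
      show "clin (H (Word bs) m)" for bs by (rule bal_right[OF HM])
      show "H (Word (b # bs)) m (t * eT r) = H (Word (b * tgt B r # bs)) m t" for b bs t r
        using op[of "Word (b # bs)" r m t] by (simp add: bword_op_act_def H_def)
    qed
  qed
  then have "evD n H z = 0" by (rule assms)
  moreover have "F = (\<lambda>X x. lsum X (\<lambda>w. if has_degree n w then sw2 x (H w) else 0))"
    unfolding Fx[symmetric] by (intro ext) (rule bp(4))
  ultimately show "sw2 z F = 0" by (simp add: evD_def)
qed

lemma eqDI:
  assumes "\<And>H :: ('r, 'b) bword \<Rightarrow> 'm \<Rightarrow> 't \<Rightarrow> complex. functD n H \<Longrightarrow> evD n H x = evD n H y"
  shows "x \<simeq>\<^bsub>null D n\<^esub> y"
  by (rule nullDI) (simp add: clin_diff[OF clin_evD] assms)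

section \<open>The comparison maps on representatives\<close>

fun thetaWT :: "('r, 'b) bword \<Rightarrow> 't \<Rightarrow> 't list free"
  where
    "thetaWT (Scalar r) t = gen [t * eT r]"
  | "thetaWT (Word bs) t = thetaT bs t"

lemma on_length_thetaWT: "has_degree n w \<Longrightarrow> on_length (Suc n) (thetaWT w t) G = thetaW t w G"
proof (cases w)
  case (Word bs)
  assume "has_degree n w"
  then have "theta t bs (\<lambda>ts. if length ts = Suc n then G ts else 0) = theta t bs G"
    by (intro theta_cong) (simp add: Word)
  then show ?thesis by (simp add: Word on_length_def theta_def)
qed simp

definition thetaD :: "nat \<Rightarrow> (('r, 'b) bword free \<times> ('m \<times> 't) free) free \<Rightarrow> ('m \<times> 't list free) free"
  where "thetaD n z = lsum z (\<lambda>(X, x). lsum X (\<lambda>w. if has_degree n w then sw2 x (\<lambda>m t. m \<otimes> thetaWT w t) else 0))"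

definition thetaF :: "('m \<Rightarrow> 't list \<Rightarrow> 'w::complex_vector) \<Rightarrow> ('r, 'b) bword \<Rightarrow> 'm \<Rightarrow> 't \<Rightarrow> 'w"
  where "thetaF h w m t = thetaW t w (h m)"

lemma evC_thetaD: "evC (Suc n) h (thetaD n z) = evD n (thetaF h) z"
  unfolding thetaD_def evD_def lsum_case evC_sw2
proof (rule sw2_cong)
  fix X :: "('r, 'b) bword free" and x :: "('m \<times> 't) free"
  show "evC (Suc n) h (lsum X (\<lambda>w. if has_degree n w then sw2 x (\<lambda>m t. m \<otimes> thetaWT w t) else 0)) =
      lsum X (\<lambda>w. if has_degree n w then sw2 x (thetaF h w) else 0)"
    unfolding clin_lsum_out[OF clin_evC]
    by (rule lsum_cong) (simp add: evC_sw2 on_length_thetaWT thetaF_def[abs_def] clin_zero[OF clin_evC])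
qed

lemma functD_thetaF:
  assumes h: "functC (Suc n) h"
  shows "functD n (thetaF h)"
  unfolding functD_def
proof (intro conjI allI impI)
  fix w :: "('r, 'b) bword" assume w: "has_degree n w"
  show "bMT (thetaF h w)"
  proof (cases w)
    case (Scalar r)
    then have h: "functC (Suc 0) h" using h w by simp
    show ?thesis unfolding Scalar
    proof (rule balI)
      show "clin (\<lambda>m. thetaF h (Scalar r) m t)" for t
        unfolding thetaF_def by (simp add: functC_clin[OF h])
      have "clin (\<lambda>t. h m [t])" for m using functC_mS[OF h] by (simp add: mbal_1)
      from clin_comp[OF this clin_mult(1)[OF clin_id]] show "clin (thetaF h (Scalar r) m)" for m
        unfolding thetaF_def by simp
      show "thetaF h (Scalar r) (actM m k) t = thetaF h (Scalar r) m (actT k t)" for m k t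
        unfolding thetaF_def by (simp add: functC_act[OF h] actT_eT)
    qed
  next
    case (Word bs)
    then have len: "length bs = n" using w by simp
    have m: "mS (Suc (length bs)) (h m)" for m using functC_mS[OF h] len by simp
    show ?thesis unfolding Word
    proof (rule balI)
      show "clin (\<lambda>m. thetaF h (Word bs) m t)" for t
        unfolding thetaF_def thetaW.simps by (rule clin_theta_in, rule functC_clin[OF h]) (simp add: len)
      show "clin (thetaF h (Word bs) m)" for m
        unfolding thetaF_def thetaW.simps by (rule clin_theta[OF m])
      show "thetaF h (Word bs) (actM m k) t = thetaF h (Word bs) m (actT k t)" for m k t
        unfolding thetaF_def thetaW.simps theta_act[OF m]
        by (rule theta_cong, rule functC_act[OF h]) (simp add: len)
    qed
  qed
next
  fix m t assume n: "n = 0"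
  have c: "clin (\<lambda>t. h m [t])" using functC_mS[OF h] n by (simp add: mbal_1)
  show "clin (\<lambda>r. thetaF h (Scalar r) m t)"
    unfolding thetaF_def thetaW.simps by (rule clin_comp[OF c]) (intro clin_mult clin_eT)
  show "thetaF h (Scalar (r * r')) m t = thetaF h (Scalar r') m (t * eT r)" for r r'
    unfolding thetaF_def by (simp add: eT_mult mult.assoc)
next
  show "functB n (\<lambda>bs t. thetaF h (Word bs) m t)" for m
    unfolding thetaF_def thetaW.simps by (rule functB_theta[OF functC_mS[OF h]])
qed

lemma qlinear_thetaD: "qlinear (null D n) (null C n) (thetaD n)"
proof (rule qlinearI)
  show "clin (thetaD n)" unfolding thetaD_def by (rule clin_lsum)
  show "complex_vector.subspace (null C n)" unfolding null_C by (rule subspace_nullC)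
  show "thetaD n z \<in> null C n" if "z \<in> null D n" for z
    unfolding null_C by (rule nullCI) (simp add: evC_thetaD evD_null[OF functD_thetaF that])
qed

definition omD :: "nat \<Rightarrow> ('m \<times> 't list free) free \<Rightarrow> (('r, 'b) bword free \<times> ('m \<times> 't) free) free"
  where "omD n z = lsum z (\<lambda>(m, X). on_length (Suc n) X (\<lambda>ts.
    sw2 (omegaT ts) (\<lambda>bs y. gen (bword bs) \<otimes> (m \<otimes> y))))"

lemma evC_out:
  assumes "clin \<phi>"
  shows "\<phi> (lsum z (\<lambda>(m, X). on_length n X (\<psi> m))) = evC n (\<lambda>m ts. \<phi> (\<psi> m ts)) z"
  unfolding lsum_case evC_def clin_sw2_out[OF assms] on_length_def clin_lsum_out[OF assms]
  by (intro sw2_cong lsum_cong) (simp add: clin_zero[OF assms])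

lemma has_degree_bword [simp]: "has_degree n (bword bs) \<longleftrightarrow> length bs = n"
  by (cases bs) (auto simp: bword_def)

lemma evD_omD: "evD n H (omD n z) = evC (Suc n) (\<lambda>m ts. om ts (\<lambda>bs t. H (bword bs) m t)) z"
  unfolding omD_def evC_out[OF clin_evD]
proof (rule evC_cong)
  fix m and ts :: "'t list" assume len: "length ts = Suc n"
  have "evD n H (sw2 (omegaT ts) (\<lambda>bs y. gen (bword bs) \<otimes> (m \<otimes> y))) =
      om ts (\<lambda>bs t. if length bs = n then H (bword bs) m t else 0)"
    unfolding clin_sw2_out[OF clin_evD] om_def by (rule sw2_cong) (simp add: evD_tens)
  also have "\<dots> = om ts (\<lambda>bs t. H (bword bs) m t)"
    by (rule om_cong) (simp add: len)
  finally show "evD n H (sw2 (omegaT ts) (\<lambda>bs y. gen (bword bs) \<otimes> (m \<otimes> y))) = om ts (\<lambda>bs t. H (bword bs) m t)" .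
qed

lemma evD_omega: "evD n H (omega coactT n z) = evC (Suc n) (\<lambda>m ts. omE ts (\<lambda>bs t. H (bword bs) m t)) z"
  unfolding omega_def Suc_eq_plus1[symmetric] evC_out[OF clin_evD]
  by (rule evC_cong) (simp add: omE_def clin_lsum_out[OF clin_evD] evD_tens)

lemma functB_functD:
  assumes "functD n H"
  shows "functB n (\<lambda>bs t. H (bword bs) m t)"
proof (cases "n = 0")
  case True
  then have "bMT (H (Scalar 1))" using assms by (simp add: functD_def)
  then show ?thesis using True by (simp add: functB_def mbal_def bword_def bal_right)
next
  case False
  then have H: "functB n (\<lambda>bs t. H (Word bs) m t)" using assms by (simp add: functD_def)
  have w: "bword bs = Word bs" if "length bs = n" for bs :: "'b list"
    using that False by (auto simp: bword_def)
  show ?thesis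
    unfolding functB_def
  proof (intro conjI allI impI)
    show "mB n (\<lambda>bs. H (bword bs) m t)" for t
      by (rule mbal_transfer[OF functB_mB[OF H, of t]]) (simp add: w)
    show "clin (H (bword bs) m)" if "length bs = n" for bs
      using functB_clin[OF H that] by (simp add: w[OF that])
    show "H (bword (b # bs)) m (t * eT r) = H (bword (b * tgt B r # bs)) m t" if "Suc (length bs) = n" for b bs t r
      using functB_eT[OF H that] by (simp add: w that)
  qed
qed

lemma functC_om:
  assumes H: "functD n H"
  shows "functC (Suc n) (\<lambda>m ts. om ts (\<lambda>bs t. H (bword bs) m t))"
  unfolding functC_def
proof (intro conjI allI impI)
  have HM: "bMT (H (bword bs))" if "length bs = n" for bs using H that by (simp add: functD_def)
  show "mS (Suc n) (\<lambda>ts. om ts (\<lambda>bs t. H (bword bs) m t))" for m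
    by (rule mS_om[OF functB_functD[OF H]])
  show "clin (\<lambda>m. om ts (\<lambda>bs t. H (bword bs) m t))" if "length ts = Suc n" for ts
    by (rule clin_om_in, rule bal_left[OF HM]) (use that in simp)
  show "om ts (\<lambda>bs t. H (bword bs) (actM m k) t) = diagT k ts (\<lambda>ts. om ts (\<lambda>bs t. H (bword bs) m t))"
    if "length ts = Suc n" for m k ts
    unfolding om_act[OF functB_functD[OF H] that]
    by (rule om_cong, rule bal_mid[OF HM UNIV_I]) (use that in simp)
qed

lemma omD_null: "z \<in> null C n \<Longrightarrow> omD n z \<in> null D n"
  unfolding null_C by (rule nullDI) (simp add: evD_omD evC_null[OF functC_om])

lemma omD_thetaD: "omD n (thetaD n z) \<simeq>\<^bsub>null D n\<^esub> z"
proof (rule eqDI)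
  fix H :: "('r, 'b) bword \<Rightarrow> 'm \<Rightarrow> 't \<Rightarrow> complex" assume H: "functD n H"
  show "evD n H (omD n (thetaD n z)) = evD n H z"
    unfolding evD_omD evC_thetaD
  proof (rule evD_cong)
    fix w :: "('r, 'b) bword" and m t assume w: "has_degree n w"
    show "thetaF (\<lambda>m ts. om ts (\<lambda>bs t. H (bword bs) m t)) w m t = H w m t"
    proof (cases w)
      case (Scalar r)
      \<comment> \<open>The map \<open>omD\<close> produces the scalar 1 in degree 0, so r has to be
        moved to T across the tensor sign.\<close>
      have "H (Scalar (r * 1)) m t = H (Scalar 1) m (t * eT r)" using H w Scalar by (simp only: functD_def has_degree.simps)
      then show ?thesis by (simp add: Scalar thetaF_def bword_def)
    next
      case (Word bs)
      then have len: "length bs = n" "bs \<noteq> []" using w by auto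
      show ?thesis
        using theta_om[of bs "\<lambda>bs t. H (bword bs) m t" t] functB_functD[OF H, of m] len
        by (simp add: Word thetaF_def) (simp add: bword_def)
    qed
  qed
qed

lemma thetaD_omega: "thetaD n (omega coactT n z) \<simeq>\<^bsub>null C n\<^esub> z"
  unfolding null_C
proof (rule eqCI)
  fix h :: "'m \<Rightarrow> 't list \<Rightarrow> complex" assume h: "functC (Suc n) h"
  show "evC (Suc n) h (thetaD n (omega coactT n z)) = evC (Suc n) h z"
    unfolding evC_thetaD evD_omega
  proof (rule evC_cong)
    fix m and ts :: "'t list" assume ts: "length ts = Suc n"
    have "thetaF h (bword bs) m t = theta t bs (h m)" for bs t
      by (simp add: thetaF_def bword_def)
    then show "omE ts (\<lambda>bs t. thetaF h (bword bs) m t) = h m ts"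
      using omE_theta[of ts "h m"] functC_mS[OF h, of m] ts by (cases ts) auto
  qed
qed

text \<open>Modulo the null spaces \<open>omD\<close> is a left inverse and \<open>omega\<close> a
  right inverse of \<open>thetaD\<close>, so they agree. That \<open>omega\<close> descends to the
  quotients follows from this.\<close>

lemma omega_omD: "omega coactT n z \<simeq>\<^bsub>null D n\<^esub> omD n z"
proof -
  have "clin (omD n)" unfolding omD_def by (rule clin_lsum)
  then have q: "qlinear (null C n) (null D n) (omD n)"
    by (rule qlinearI[OF _ subspace_null_D omD_null])
  have "omD n (thetaD n (omega coactT n z)) \<simeq>\<^bsub>null D n\<^esub> omD n z"
    by (rule qlinear_eq[OF q subspace_null_D thetaD_omega])
  then show ?thesis
    using omD_thetaD eq_mod_sym[OF subspace_null_D] eq_mod_trans[OF subspace_null_D] by blast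
qed

lemma qlinear_omega: "qlinear (null C n) (null D n) (omega coactT n)"
proof (rule qlinearI[OF _ subspace_null_D])
  show "clin (omega coactT n)" unfolding omega_def by (rule clin_lsum)
  show "omega coactT n z \<in> null D n" if "z \<in> null C n" for z
    using omega_omD[of n z] omD_null[OF that] complex_vector.subspace_add[OF subspace_null_D] by fastforce
qed

lemma omega_thetaD: "omega coactT n (thetaD n z) \<simeq>\<^bsub>null D n\<^esub> z"
  using omega_omD omD_thetaD eq_mod_trans[OF subspace_null_D] by blast

end


section \<open>Compatibility with the cyclic structures\<close>

context galois_sayd
begin

lemma bword_ne: "bs \<noteq> [] \<Longrightarrow> bword bs = Word bs"
  by (simp add: bword_def)

lemma lsum_diag_right:
  "lsum (diag_right B (bword bs) c) (\<lambda>w. if has_degree (length bs) w then F w else 0) = lsum (diag_right B (bword bs) c) F"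
proof (cases "bs = []")
  case True then show ?thesis by (simp add: bword_def diag_right_Scalar)
next
  case False
  show ?thesis unfolding bword_ne[OF False] diag_right_Word
    by (rule diagB_cong) (use False in \<open>simp add: Suc_le_eq\<close>)
qed

text \<open>\<theta> after the diagonal action of c. On the empty word c acts on the scalar 1 and
  gives \<epsilon>(c), which lets the empty and the nonempty case obey common rules.\<close>

definition thetaX :: "'t \<Rightarrow> 'b \<Rightarrow> 'b list \<Rightarrow> ('t list \<Rightarrow> 'w::complex_vector) \<Rightarrow> 'w"
  where "thetaX t c bs G = lsum (diag_right B (bword bs) c) (\<lambda>w. thetaW t w G)"

lemma thetaX_Nil [simp]: "thetaX t c [] G = G [t * eT (counit B c)]"
  by (simp add: thetaX_def bword_def diag_right_Scalar src_B)

lemma thetaX_ne: "bs \<noteq> [] \<Longrightarrow> thetaX t c bs G = diagB c bs (\<lambda>zs. theta t zs G)"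
  by (simp add: thetaX_def bword_ne diag_right_Word)

lemma thetaX_cong:
  "(\<And>ts. length ts = Suc (length bs) \<Longrightarrow> G ts = H ts) \<Longrightarrow> thetaX t c bs G = thetaX t c bs H"
  by (cases "bs = []") (auto simp: thetaX_ne intro!: diagB_cong theta_cong)

lemma thetaX_sw2: "thetaX t c bs (\<lambda>ts. sw2 X (\<lambda>a b. F a b ts)) = sw2 X (\<lambda>a b. thetaX t c bs (F a b))"
  by (cases "bs = []") (simp_all add: thetaX_ne theta_sw2 diagB_sw2)

lemma clin_thetaX_in:
  assumes "\<And>ts. length ts = Suc (length bs) \<Longrightarrow> clin (\<lambda>y. F y ts)"
  shows "clin (\<lambda>y. thetaX t c bs (F y))"
proof (cases "bs = []")
  case False
  then show ?thesis unfolding thetaX_ne[OF False]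
    by (intro clin_diagB_in clin_theta_in assms) simp
qed (simp add: assms)

context
  fixes bs :: "'b list" and G :: "'t list \<Rightarrow> 'w::complex_vector"
  assumes G: "mS (Suc (length bs)) G"
begin

lemma thetaX_clin_Nil: "bs = [] \<Longrightarrow> clin (\<lambda>t. G [t])"
  using G by (simp add: mbal_1)

lemma clin_thetaX: "clin (\<lambda>t. thetaX t c bs G)"
proof (cases "bs = []")
  case True
  show ?thesis unfolding True thetaX_Nil
    by (rule clin_comp[OF thetaX_clin_Nil[OF True]]) (intro clin_mult clin_id)
next
  case False
  show ?thesis unfolding thetaX_ne[OF False]
    by (rule clin_diagB_in, rule clin_theta) (use G in simp)
qed

lemma clin_thetaX': "clin (\<lambda>c. thetaX t c bs G)"
proof (cases "bs = []")
  case True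
  show ?thesis unfolding True thetaX_Nil
    by (rule clin_comp[OF thetaX_clin_Nil[OF True]]) (intro clin_mult clin_comp[OF clin_eT] counit_B(1))
next
  case False
  show ?thesis unfolding thetaX_ne[OF False]
    by (rule clin_diagB[OF mB_theta[OF G] False])
qed

lemma thetaX_act: "thetaX (actT k t) c bs G = thetaX t c bs (\<lambda>ts. diagT k ts G)"
proof (cases "bs = []")
  case True then show ?thesis by (simp add: actT_eT)
next
  case False
  show ?thesis unfolding thetaX_ne[OF False]
    by (rule diagB_cong, rule theta_act) (use G in simp)
qed

lemma thetaX_eT: "thetaX (t * eT r) c bs G = thetaX t (c * tgt B r) bs G"
proof (cases "bs = []")
  case True then show ?thesis by (simp add: counit_src_tgt eT_mult mult.assoc)
next
  case False
  show ?thesis unfolding thetaX_ne[OF False] diagB_tgt[OF mB_theta[OF G] False]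
  proof (rule diagB_cong)
    fix zs :: "'b list" assume "length zs = length bs"
    then obtain b cs where "zs = b # cs" "Suc (length cs) = length bs" using False by (cases zs) auto
    then show "theta (t * eT r) zs G = theta t (hd zs * tgt B r # tl zs) G"
      using theta_eT[of cs G t r b] G by simp
  qed
qed

lemma thetaX_mult_right:
  "sw2 (coactT u) (\<lambda>u0 u1. thetaX (t * u0) u1 bs G) = theta t bs (\<lambda>ts. G (mult_last ts u))"
proof (cases "bs = []")
  case True
  have c: "clin (\<lambda>v. G [t * v])" by (rule clin_comp[OF thetaX_clin_Nil[OF True]]) (intro clin_mult clin_id)
  show ?thesis
    using clin_sw2_out[OF c, of "coactT u" "\<lambda>x b. x * eT (counit B b)"]
    by (simp add: True CT_counit mult.assoc)
next
  case False
  show ?thesis unfolding thetaX_ne[OF False] by (rule theta_mult_right[OF G False])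
qed

end

lemma thetaX_mult_left: "thetaX (u * t) c bs G = thetaX t c bs (\<lambda>ts. G (u * hd ts # tl ts))"
  by (cases "bs = []") (simp_all add: thetaX_ne theta_mult_left mult.assoc)

text \<open>By equivariance, t(r) acting on the first argument acts diagonally on the list; this
  affects only its last entry, the neighbour of q.\<close>

lemma bS_thetaX:
  assumes R: "mS (Suc (Suc (length bs))) R"
  shows "bS (\<lambda>p q. thetaX p c bs (\<lambda>ts. R (ts @ [q])))"
proof (rule balI)
  have m: "mS (Suc (length bs)) (\<lambda>ts. R (ts @ [q]))" for q by (rule mbal_snocD(2)[OF R])
  show "clin (\<lambda>p. thetaX p c bs (\<lambda>ts. R (ts @ [q])))" for q by (rule clin_thetaX[OF m])
  show "clin (\<lambda>q. thetaX p c bs (\<lambda>ts. R (ts @ [q])))" for p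
    by (rule clin_thetaX_in, rule mbal_snocD(1)[OF R])
  show "thetaX (actT (tgt K a) p) c bs (\<lambda>ts. R (ts @ [q])) = thetaX p c bs (\<lambda>ts. R (ts @ [actT (src K a) q]))"
    if a: "a \<in> base K" for p a q
    unfolding thetaX_act[OF m]
  proof (rule thetaX_cong)
    fix ts :: "'t list" assume "length ts = Suc (length bs)"
    then obtain us t where ts: "ts = us @ [t]" "length us = length bs" using snoc_decomp by blast
    then have "mS (Suc (length us)) (\<lambda>ts. R (ts @ [q]))" using m by simp
    from diagT_tgt_one[OF this a] show "diagT (tgt K a) ts (\<lambda>ts. R (ts @ [q])) = R (ts @ [actT (src K a) q])"
      using mbal_mid[OF R a, of us "[]" t q] ts by simp
  qed
qed

text \<open>This carries the last face, and with an additional letter from the coaction of \<open>M \<otimes> T\<close> the cyclic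
  operator, from \<open>B\<close> to \<open>T\<close>: by \<open>P_coact_left\<close> the factor \<open>b\<^sup>-\<close> acting diagonally is the coaction of
  \<open>b\<^sub>-\<close>, and \<open>theta_mult_right\<close> turns this into multiplication of the last factor by \<open>b\<^sub>-\<close>.\<close>

lemma theta_last_face:
  assumes h: "functC (Suc (length bs)) h"
  shows "sw2 (transl_right B b) (\<lambda>c b'. sw2 (tr b') (\<lambda>p q.
      sw2 (coactM m) (\<lambda>k m0. thetaX (q * actT k (t * p)) c bs (h m0)))) =
    theta t (bs @ [b]) (rot (Suc (length bs)) (\<lambda>m ts. h m (merge_at 0 ts)) m)"
proof -
  let ?n = "Suc (length bs)"
  let ?R = "rot ?n (\<lambda>m ts. h m (merge_at 0 ts)) m"
  have "functC (Suc ?n) (rot ?n (\<lambda>m ts. h m (merge_at 0 ts)))"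
    using functC_faceF[OF h, of ?n] by (simp add: faceF_def)
  then have R: "mS (Suc ?n) ?R" by (rule functC_mS)
  have m: "mS ?n (\<lambda>ts. ?R (ts @ [q]))" for q by (rule mbal_snocD(2)[OF R])
  define F where "F c p q = thetaX (t * p) c bs (\<lambda>ts. ?R (ts @ [q]))" for c p q
  \<comment> \<open>Equivariance of \<theta> turns the action of k on the argument into a diagonal
    action on the list, so the coaction of M reassembles to a rotation.\<close>
  have "sw2 (coactM m) (\<lambda>k m0. thetaX (q * actT k (t * p)) c bs (h m0)) = F c p q" for c p q
  proof -
    have "thetaX (q * actT k (t * p)) c bs (h m0) =
        thetaX (t * p) c bs (\<lambda>ts. diagT k ts (\<lambda>zs. h m0 (q * hd zs # tl zs)))" for k m0
      unfolding thetaX_mult_left[of q] by (rule thetaX_act, rule mS_lmult[OF functC_mS[OF h]]) simp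
    then have "sw2 (coactM m) (\<lambda>k m0. thetaX (q * actT k (t * p)) c bs (h m0)) =
        thetaX (t * p) c bs (\<lambda>ts. sw2 (coactM m) (\<lambda>k m0. diagT k ts (\<lambda>zs. h m0 (q * hd zs # tl zs))))"
      by (simp add: thetaX_sw2)
    also have "\<dots> = F c p q"
      unfolding F_def
    proof (rule thetaX_cong)
      fix ts :: "'t list" assume len: "length ts = ?n"
      have "diagT k ts (\<lambda>zs. h m0 (q * hd zs # tl zs)) = diagT k ts (\<lambda>zs. h m0 (merge_at 0 ([q] @ zs)))" for k m0
      proof (rule diagT_cong)
        fix zs :: "'t list" assume "length zs = length ts"
        then show "h m0 (q * hd zs # tl zs) = h m0 (merge_at 0 ([q] @ zs))" using len by (cases zs) auto
      qed
      then show "sw2 (coactM m) (\<lambda>k m0. diagT k ts (\<lambda>zs. h m0 (q * hd zs # tl zs))) = ?R (ts @ [q])"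
        by (simp add: rot_append[OF len])
    qed
    finally show ?thesis .
  qed
  then have "sw2 (transl_right B b) (\<lambda>c b'. sw2 (tr b') (\<lambda>p q.
      sw2 (coactM m) (\<lambda>k m0. thetaX (q * actT k (t * p)) c bs (h m0)))) =
      sw2 (transl_right B b) (\<lambda>c b'. sw2 (tr b') (F c))"
    by simp
  also have "\<dots> = sw2 (tr b) (\<lambda>p q. sw2 (coactT p) (\<lambda>p0 p1. F p1 p0 q))"
  proof (rule P_coact_left[symmetric])
    show "bS (F c)" for c unfolding F_def by (rule bS_lmult[OF bS_thetaX[OF R]])
    show "bT (\<lambda>p c. F c p q)" for q
    proof (rule balI)
      show "clin (\<lambda>p. F c p q)" for c
        unfolding F_def by (rule clin_comp[OF clin_thetaX[OF m]]) (intro clin_mult clin_id)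
      show "clin (\<lambda>c. F c p q)" for p unfolding F_def by (rule clin_thetaX'[OF m])
      show "F c (p * eT r) q = F (c * tgt B r) p q" for p r c
        unfolding F_def using thetaX_eT[OF m, of "t * p"] by (simp add: mult.assoc)
    qed
  qed
  also have "\<dots> = sw2 (tr b) (\<lambda>p q. theta t bs (\<lambda>ts. ?R (mult_last ts p @ [q])))"
    unfolding F_def by (rule sw2_cong, rule thetaX_mult_right[OF m])
  also have "\<dots> = theta t (bs @ [b]) ?R"
    by (simp add: theta_snoc theta_sw2)
  finally show ?thesis .
qed

lemma evD_last_face:
  assumes h: "functC (Suc (length bs)) h"
  shows "evD (length bs) (thetaF h) (lsum (transl_right B b) (\<lambda>(bm, bp). diag_right B (bword bs) bm \<otimes> aM bp x)) =
    sw2 x (\<lambda>m t. theta t (bs @ [b]) (rot (Suc (length bs)) (\<lambda>m ts. h m (merge_at 0 ts)) m))"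
proof -
  have "evD (length bs) (thetaF h) (lsum (transl_right B b) (\<lambda>(bm, bp). diag_right B (bword bs) bm \<otimes> aM bp x)) =
      sw2 (transl_right B b) (\<lambda>c b'. lsum (diag_right B (bword bs) c) (\<lambda>w. sw2 x (actF b' (thetaF h w))))"
    unfolding lsum_case clin_sw2_out[OF clin_evD] evD_tens lsum_diag_right sw2_aM ..
  also have "\<dots> = sw2 (transl_right B b) (\<lambda>c b'. sw2 x (\<lambda>m t. sw2 (tr b') (\<lambda>p q.
      sw2 (coactM m) (\<lambda>k m0. thetaX (q * actT k (t * p)) c bs (h m0)))))"
    unfolding actF_def fl_def thetaF_def thetaX_def sw2_lsum_commute[symmetric] ..
  also have "\<dots> = sw2 x (\<lambda>m t. sw2 (transl_right B b) (\<lambda>c b'. sw2 (tr b') (\<lambda>p q.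
      sw2 (coactM m) (\<lambda>k m0. thetaX (q * actT k (t * p)) c bs (h m0)))))"
    by (rule sw2_commute)
  finally show ?thesis unfolding theta_last_face[OF h] .
qed

lemma evD_op:
  assumes "\<And>w x. has_degree n w \<Longrightarrow> evD n' H' (\<phi> w x) = sw2 x (H w)" "\<And>w x. \<not> has_degree n w \<Longrightarrow> \<phi> w x = 0"
  shows "evD n' H' (lsum z (\<lambda>(X, x). lsum X (\<lambda>w. \<phi> w x))) = evD n H z"
  unfolding lsum_case evD_def[of n] clin_sw2_out[OF clin_evD]
proof (rule sw2_cong)
  fix X :: "('r, 'b) bword free" and x :: "('m \<times> 't) free"
  show "evD n' H' (lsum X (\<lambda>w. \<phi> w x)) = lsum X (\<lambda>w. if has_degree n w then sw2 x (H w) else 0)"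
    unfolding clin_lsum_out[OF clin_evD] by (rule lsum_cong) (simp add: assms clin_zero[OF clin_evD])
qed

lemma has_degree_SucE:
  assumes "has_degree (Suc n) w" obtains bs where "w = Word bs" "length bs = Suc n"
  using assms by (cases w) auto

lemma has_degree_counit_at: "length bs = Suc n \<Longrightarrow> i \<le> n \<Longrightarrow> has_degree n (counit_at B i bs)"
  by (auto simp: counit_at_def Let_def)

lemma evD_face:
  assumes h: "functC (Suc n) h" and i: "i \<le> Suc n"
  shows "evD n (thetaF h) (face D (Suc n) i z) = evD (Suc n) (thetaF (faceF (Suc n) i h)) z"
  unfolding cyclic_B_def cyclic_data.simps
proof (rule evD_op)
  fix w :: "('r, 'b) bword" and x :: "('m \<times> 't) free"
  show "(case w of Scalar r \<Rightarrow> 0 | Word bs \<Rightarrow> if length bs \<noteq> Suc n \<or> Suc n = 0 then 0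
      else if i < Suc n then gen (counit_at B i bs) \<otimes> x
      else lsum (transl_right B (last bs)) (\<lambda>(bm, bp). diag_right B (bword (butlast bs)) bm \<otimes> aM bp x)) = 0"
    if "\<not> has_degree (Suc n) w"
    using that by (cases w) (auto simp: Suc_le_eq)
  assume "has_degree (Suc n) w"
  then obtain bs where w: "w = Word bs" and len: "length bs = Suc n" by (rule has_degree_SucE)
  have "evD n (thetaF h) (if i < Suc n then gen (counit_at B i bs) \<otimes> x
      else lsum (transl_right B (last bs)) (\<lambda>(bm, bp). diag_right B (bword (butlast bs)) bm \<otimes> aM bp x)) =
      sw2 x (thetaF (faceF (Suc n) i h) (Word bs))"
  proof (cases "i < Suc n")
    case True
    have "thetaF h (counit_at B i bs) m t = thetaF (faceF (Suc n) i h) (Word bs) m t" for m t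
      using theta_face[of i bs "h m" t] functC_mS[OF h, of m] True len by (simp add: thetaF_def faceF_def)
    then have "thetaF h (counit_at B i bs) = thetaF (faceF (Suc n) i h) (Word bs)" by blast
    then show ?thesis using True len by (simp add: evD_tens has_degree_counit_at)
  next
    case False
    obtain bs' b where bs: "bs = bs' @ [b]" "length bs' = n" using snoc_decomp[OF len] by blast
    have "functC (Suc (length bs')) h" using h bs by simp
    from evD_last_face[OF this] show ?thesis
      using False bs by (simp add: thetaF_def[abs_def] faceF_def)
  qed
  then show "evD n (thetaF h) (case w of Scalar r \<Rightarrow> 0 | Word bs \<Rightarrow> if length bs \<noteq> Suc n \<or> Suc n = 0 then 0
      else if i < Suc n then gen (counit_at B i bs) \<otimes> x
      else lsum (transl_right B (last bs)) (\<lambda>(bm, bp). diag_right B (bword (butlast bs)) bm \<otimes> aM bp x)) =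
      sw2 x (thetaF (faceF (Suc n) i h) w)"
    by (simp add: w len)
qed

lemma evD_degen:
  assumes h: "functC (Suc (Suc n)) h" and i: "i \<le> n"
  shows "evD (Suc n) (thetaF h) (degen D n i z) = evD n (thetaF (degenF i h)) z"
  unfolding cyclic_B_def cyclic_data.simps
proof (rule evD_op)
  fix w :: "('r, 'b) bword" and x :: "('m \<times> 't) free"
  let ?d = "case w of Scalar r \<Rightarrow> if n = 0 then gen (Word [tgt B r]) \<otimes> x else 0 | Word bs \<Rightarrow>
      if length bs \<noteq> n \<or> n = 0 then 0 else if i < n then
        lsum (comul B (bs ! i)) (\<lambda>(b1, b2). gen (Word (take i bs @ b1 # b2 # drop (i + 1) bs)) \<otimes> x)
      else gen (Word (bs @ [1])) \<otimes> x"
  show "?d = 0" if "\<not> has_degree n w" using that by (cases w) (auto simp: Suc_le_eq)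
  assume w: "has_degree n w"
  show "evD (Suc n) (thetaF h) ?d = sw2 x (thetaF (degenF i h) w)"
  proof (cases w)
    \<comment> \<open>The letter t(r) has can^{-1}(1 \<otimes> t(r)) = \<open>eT r\<close> \<otimes>
      1, which is the scalar multiplied onto t with a unit appended.\<close>
    case (Scalar r)
    then have n: "n = 0" using w by simp
    have b: "bS (\<lambda>p q. h m [p, q])" for m
      using bS_theta[of "[]" "h m"] functC_mS[OF h] n by simp
    have "thetaF h (Word [tgt B r]) m t = thetaF (degenF i h) (Scalar r) m t" for m t
      using P_tgt'[OF bS_lmult[OF b[of m], of t], of r] n i by (simp add: thetaF_def degenF_def theta_Cons)
    then have "thetaF h (Word [tgt B r]) = thetaF (degenF i h) (Scalar r)" by blast
    then show ?thesis using n Scalar by (simp add: evD_tens)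
  next
    case (Word bs)
    then have len: "length bs = n" "n \<noteq> 0" using w by auto
    have m: "mS (Suc (Suc (length bs))) (h m)" for m using functC_mS[OF h] len by simp
    show ?thesis
    proof (cases "i < n")
      case True
      have l: "Suc n = length (take i bs @ b1 # b2 # drop (Suc i) bs)" for b1 b2 :: 'b
        using len True by simp
      have "thetaF (degenF i h) (Word bs) m t =
          sw2 (comul B (bs ! i)) (\<lambda>b1 b2. thetaF h (Word (take i bs @ b1 # b2 # drop (Suc i) bs)) m t)" for m t
        using theta_degen[OF _ m[of m], of i t] True len by (simp add: thetaF_def degenF_def)
      then have "sw2 x (thetaF (degenF i h) (Word bs)) =
          sw2 (comul B (bs ! i)) (\<lambda>b1 b2. sw2 x (thetaF h (Word (take i bs @ b1 # b2 # drop (Suc i) bs))))"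
        by (subst sw2_commute) (rule sw2_cong)
      then show ?thesis
        using True len by (simp add: Word lsum_case clin_sw2_out[OF clin_evD] evD_tens)
    next
      case False
      have "thetaF h (Word (bs @ [1])) m t = thetaF (degenF i h) (Word bs) m t" for m t
        unfolding thetaF_def degenF_def thetaW.simps theta_unit_last[OF m]
      proof (rule theta_cong)
        fix ts :: "'t list" assume "length ts = Suc (length bs)"
        then show "h m (ts @ [1]) = h m (unit_at i ts)"
          using unit_at_last[of ts] False i len by (cases "ts = []") auto
      qed
      then have "thetaF h (Word (bs @ [1])) = thetaF (degenF i h) (Word bs)" by blast
      then show ?thesis using False len Word by (simp add: evD_tens)
    qed
  qed
qed

text \<open>Putting a unit in front is the extra degeneracy, and the last face after it is the
  cyclic operator: q is multiplied with the unit, on which K acts by the counit.\<close>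

lemma rot_merge_unit:
  assumes h: "functC (Suc n) h" and n: "n \<noteq> 0" and ts: "length ts = Suc n"
  shows "rot (Suc n) (\<lambda>m ts. h m (merge_at 0 ts)) m (1 # ts) = rot n h m ts"
proof -
  obtain us q where t: "ts = us @ [q]" and len: "length us = n" using snoc_decomp[OF ts] by blast
  have g: "functC (Suc (Suc n)) (\<lambda>m ts. h m (merge_at 0 ts))" by (rule functC_merge[OF h]) simp
  have m: "mS (Suc (length us)) (\<lambda>xs. h m0 (merge_at 0 (q # xs)))" for m0
    using mbal_ConsD(2)[OF functC_mS[OF g]] len by blast
  have "rot (Suc n) (\<lambda>m ts. h m (merge_at 0 ts)) m ((1 # us) @ [q]) =
      sw2 (coactM m) (\<lambda>k m0. diagT k (1 # us) (\<lambda>xs. h m0 (merge_at 0 (q # xs))))"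
    by (subst rot_append) (simp_all add: len)
  also have "\<dots> = sw2 (coactM m) (\<lambda>k m0. diagT k us (\<lambda>xs. h m0 (q # xs)))"
    using len n by (subst diagT_unit_head[OF m]) auto
  finally show ?thesis using len by (simp add: t)
qed

lemma evD_cyc:
  assumes h: "functC (Suc n) h"
  shows "evD n (thetaF h) (cyc D n z) = evD n (thetaF (cycF n h)) z"
  unfolding cyclic_B_def cyclic_data.simps
proof (rule evD_op)
  fix w :: "('r, 'b) bword" and x :: "('m \<times> 't) free"
  let ?c = "case w of Scalar r \<Rightarrow> if n = 0 then gen (Scalar r) \<otimes> x else 0 | Word bs \<Rightarrow>
      if length bs \<noteq> n \<or> n = 0 then 0
      else lsum (cM x) (\<lambda>(x0, x1). lsum (transl_right B (last bs)) (\<lambda>(bm, bp).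
        diag_right B (Word (x1 # butlast bs)) bm \<otimes> aM bp x0))"
  show "?c = 0" if "\<not> has_degree n w" using that by (cases w) (auto simp: Suc_le_eq)
  assume w: "has_degree n w"
  show "evD n (thetaF h) ?c = sw2 x (thetaF (cycF n h) w)"
  proof (cases w)
    case (Scalar r)
    then show ?thesis using w by (simp add: evD_tens cycF_def)
  next
    case (Word bs)
    then have len: "length bs = n" "n \<noteq> 0" using w by auto
    then obtain bs' b where bs: "bs = bs' @ [b]" "n = Suc (length bs')" by (cases bs rule: rev_cases) auto
    let ?R = "rot (Suc n) (\<lambda>m ts. h m (merge_at 0 ts))"
    have "functC (Suc (Suc n)) ?R" using functC_faceF[OF h, of "Suc n"] by (simp add: faceF_def)
    then have R: "mS (Suc (Suc (length bs))) (?R m)" for m using len functC_mS by blast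
    have h': "functC (Suc (length (a # bs'))) h" for a using h bs by simp
    \<comment> \<open>The formula for \<tau> is that of the last face at the word enlarged by the
      letter x_{<1>} in front.\<close>
    have "evD n (thetaF h) ?c = sw2 (cM x) (\<lambda>x0 a. evD (length (a # bs')) (thetaF h)
        (lsum (transl_right B b) (\<lambda>(bm, bp). diag_right B (bword (a # bs')) bm \<otimes> aM bp x0)))"
      using len bs by (simp add: Word lsum_case clin_sw2_out[OF clin_evD] bword_ne)
    also have "\<dots> = sw2 (cM x) (\<lambda>x0 a. sw2 x0 (\<lambda>m t. theta t (a # bs) (?R m)))"
      unfolding evD_last_face[OF h'] by (simp add: bs)
    also have "\<dots> = sw2 x (\<lambda>m t. sw2 (coactT t) (\<lambda>t0 a. theta t0 (a # bs) (?R m)))"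
      by (simp add: sw2_cM)
    also have "\<dots> = sw2 x (thetaF (cycF n h) (Word bs))"
    proof (rule sw2_cong)
      fix m t
      \<comment> \<open>The additional letter comes from the coaction of t, so \<open>P_CT\<close>
        cancels it and leaves a unit in front, with t as the open factor.\<close>
      have "sw2 (coactT t) (\<lambda>t0 a. theta t0 (a # bs) (?R m)) = theta t bs (\<lambda>ts. ?R m (1 # ts))"
        using P_CT[OF bS_theta[OF R], where u = 1 and v = t] by (simp add: theta_Cons)
      also have "\<dots> = theta t bs (rot n h m)"
        by (rule theta_cong, rule rot_merge_unit[OF h len(2)]) (simp add: len)
      finally show "sw2 (coactT t) (\<lambda>t0 a. theta t0 (a # bs) (?R m)) = thetaF (cycF n h) (Word bs) m t"
        using len by (simp add: thetaF_def cycF_def)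
    qed
    finally show ?thesis by (simp add: Word)
  qed
qed

lemma thetaD_face:
  assumes "1 \<le> n" "i \<le> n"
  shows "thetaD (n - 1) (face D n i y) \<simeq>\<^bsub>null C (n - 1)\<^esub> face C n i (thetaD n y)"
proof -
  obtain n' where n: "n = Suc n'" using assms by (cases n) auto
  show ?thesis unfolding null_C
  proof (rule eqCI)
    fix h :: "'m \<Rightarrow> 't list \<Rightarrow> complex" assume "functC (Suc (n - 1)) h"
    then have h: "functC n h" using n by simp
    show "evC (Suc (n - 1)) h (thetaD (n - 1) (face D n i y)) = evC (Suc (n - 1)) h (face C n i (thetaD n y))"
      using evC_face[OF h, of i "thetaD n y"] evD_face[of n' h i y] h assms by (simp add: evC_thetaD n)
  qed
qed

lemma thetaD_degen:
  assumes "i \<le> n"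
  shows "thetaD (n + 1) (degen D n i y) \<simeq>\<^bsub>null C (n + 1)\<^esub> degen C n i (thetaD n y)"
  unfolding null_C
proof (rule eqCI)
  fix h :: "'m \<Rightarrow> 't list \<Rightarrow> complex" assume h: "functC (Suc (n + 1)) h"
  show "evC (Suc (n + 1)) h (thetaD (n + 1) (degen D n i y)) = evC (Suc (n + 1)) h (degen C n i (thetaD n y))"
    using evD_degen[of n h i y] h assms by (simp add: evC_thetaD evC_degen)
qed

lemma thetaD_cyc: "thetaD n (cyc D n y) \<simeq>\<^bsub>null C n\<^esub> cyc C n (thetaD n y)"
  unfolding null_C
proof (rule eqCI)
  fix h :: "'m \<Rightarrow> 't list \<Rightarrow> complex" assume h: "functC (Suc n) h"
  show "evC (Suc n) h (thetaD n (cyc D n y)) = evC (Suc n) h (cyc C n (thetaD n y))"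
    by (simp add: evC_thetaD evC_cyc[OF h] evD_cyc[OF h])
qed

lemma cyclic_iso_omega: "cyclic_iso C D (omega coactT)"
proof (rule cyclic_isoI[OF cyclic_module_T subspace_null_D qlinear_omega qlinear_thetaD thetaD_omega omega_thetaD])
  show "clin (face D n i)" "clin (degen D n i)" "clin (cyc D n)" for n i
    by (simp_all add: cyclic_B_def clin_lsum)
qed (rule thetaD_face thetaD_degen thetaD_cyc; assumption)+

end

theorem theorem3p5:
  fixes B :: "('r::complex_algebra, 'b::complex_algebra) bialgebroid"
    and ractT :: "'t::complex_algebra \<Rightarrow> 'r \<Rightarrow> 't"
    and coactT :: "'t \<Rightarrow> ('t \<times> 'b) free"
    and K :: "('t, 'k::complex_algebra) bialgebroid"
    and actT :: "'k \<Rightarrow> 't \<Rightarrow> 't"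
    and actM :: "'m::complex_vector \<Rightarrow> 'k \<Rightarrow> 'm"
    and lactM :: "'t \<Rightarrow> 'm \<Rightarrow> 'm"
    and coactM :: "'m \<Rightarrow> ('k \<times> 'm) free"
  assumes "right_hopf B"
    and "right_comodule_algebra B ractT coactT"
    and "base K = coinvariants B ractT coactT"
    and "left_hopf K"
    and "left_module_algebra K actT"
    and "equivariant_galois B K ractT coactT actT"
    and "right_left_SAYD K actM lactM coactM"
  shows "left_right_SAYD B (MT_null actM actT) (MT_act B ractT coactT actT coactM)
      (MT_ract ractT) (MT_coact coactT)
    \<and> cyclic_iso (cyclic_T K actM coactM actT)
      (cyclic_B B (MT_null actM actT) (MT_act B ractT coactT actT coactM) (MT_coact coactT))
      (omega coactT)"
proof -
  interpret right_hopf_algebra B using assms by unfold_locales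
  interpret galois_sayd B ractT coactT K actT actM lactM coactM using assms by unfold_locales
  show ?thesis using left_right_SAYD_MT cyclic_iso_omega by blast
qed

end
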